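(* Let $$I=\{T\otimes\partial\Delta^n\hookrightarrow T\otimes\Delta^n \mid T \text{ an orbit in } \mathcal S^D,\ n\ge 0\},\qquad J=\{T\otimes\Lambda^n_k\hookrightarrow T\otimes\Delta^n\mid T\text{ an orbit in }\mathcal S^D,\ n\ge k\ge 0,\ n\geq 1\}.$$ Then each of the classes $I$ and $J$ of maps of $\mathcal S^D$ may be equipped with an instrumentation.
   Context: $\mathcal S$ denotes the category of spaces: either simplicial sets or compactly generated topological spaces, with its standard model structure. $D$ is a small category enriched over $\mathcal S$, and $\mathcal S^D$ is the category of continuous (enriched) functors $D\to\mathcal S$ with natural transformations as morphisms. For $X\in\mathcal S^D$ and a simplicial set $K$, $X\otimes K$ is the objectwise product with $K$ (with $|K|$ in the topological case). An orbit is a diagram $T\in\mathcal S^D$ with $\operatorname{colim}_D T=*$ (a point); orbits may form a proper class. For a category $C$, $\mathrm{Map}\,C$ is the category of maps of $C$ with commutative squares as morphisms. $\mathrm{Pow}\,C$ is the category whose objects are all subsets of $\mathrm{obj}(C)$; a morphism $A\to B$ is a function $F\colon A\to\mathrm{mor}(C)$ with $\mathrm{dom}\,F(a)=a$ and $\mathrm{codom}\,F(a)\in B$ for all $a\in A$; composition is $(F_2\circ F_1)(a)=F_2(\mathrm{codom}\,F_1(a))\circ F_1(a)$, and the identity sends $a$ to $\mathrm{id}_a$. Let $O$ be a class of objects of $C$. A set of arrows $\psi_i\colon o_i\to c$ has the factorization property with respect to $O$ if every $\psi\colon o\to c$ with $o\in O$ factors as $o\to o_i\xrightarrow{\psi_i}c$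 for some $i$. $O$ is locally small if for every object $c$ there is a set of arrows $o_i\to c$, $o_i\in O$, with the factorization property with respect to $O$. A factorization setup for $(C,O)$, $O$ locally small, is a functor $F\colon C\to\mathrm{Pow}(\mathrm{Map}\,C)$ such that for every object $c$ and morphism $f\colon c\to c'$: (1) $F(c)$ is a set of maps of the form $o\to c$, $o\in O$; (2) $F(c)$ has the factorization property with respect to $O$; (3) $F(f)$ assigns to each element $o\to c$ of $F(c)$ a commutative square whose vertical maps are $o\to c$ and some element $o'\to c'$ of $F(c')$, and whose bottom map is $f\colon c\to c'$. For a class $I$ of maps in a category with small colimits, $I$-cell is the class of transfinite compositions of pushouts of elements of $I$. An object $A$ is $\kappa$-small relative to a class $\mathcal D$ of maps if for all $\kappa$-filtered ordinals $\lambda$ and all $\lambda$-sequences $X_0\to X_1\to\cdots\to X_\beta\to\cdots$ (colimit-preserving functors from $\lambda$) with all maps $X_\beta\to X_{\beta+1}$ in $\mathcal D$, the natural map $\operatorname{colim}_{\beta<\lambda}\mathrm{mor}(A,X_\beta)\to\mathrm{mor}(A,\operatorname{colim}_{\beta<\lambda}X_\beta)$ is an isomorphism. A locally small class $I$ of maps of $C$ (i.e. locally small as a class of objects of $\mathrm{Map}\,C$) is instrumented (equipped with an instrumentation) if (1) there is a cardinal $\kappa$ such that every domain of a map in $I$ is $\kappa$-small relative to $I$-cell, and (2) there is a factorization setup for the pair $(\mathrm{Map}\,C,I)$. *)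

theory Defs
  imports "HOL-Homology.Simplices"
begin

section \<open>Sets and classes\<close>

text \<open>
  A type of inaccessible cardinality here plays the role of the class of all sets: a "set" is a
  collection with fewer elements than the universe, a "class" is an arbitrary HOL set.
\<close>

definition inaccessible :: "'u itself \<Rightarrow> bool" where
  "inaccessible U \<longleftrightarrow>
     |UNIV :: nat set| <o |UNIV :: 'u set| \<and>
     regularCard |UNIV :: 'u set| \<and>
     (\<forall>A :: 'u set. |A| <o |UNIV :: 'u set| \<longrightarrow> |Pow A| <o |UNIV :: 'u set| )"

definition small :: "'u itself \<Rightarrow> 'a set \<Rightarrow> bool" where
  "small U A \<longleftrightarrow> |A| <o |UNIV :: 'u set|"

text \<open>
  Points and simplices of spaces are taken from the following type.  It contains the universe and
  has room for binary products, for the simplices of finite simplicial sets, and for the points of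
  their geometric realizations (equivalence classes of triples, see \<open>realization\<close> below).
\<close>

datatype 'u element =
    Atom 'u
  | Pair (pfst: "'u element") (psnd: "'u element")
  | Simplex (un_Simplex: "nat list")
  | Point (un_Point: "(nat \<times> nat list \<times> (nat \<Rightarrow> real)) set")


section \<open>Categories\<close>

datatype ('o, 'f) arrow = Arrow (Dom: 'o) (Fn: 'f) (Cod: 'o)

record ('o, 'f) category =
  Obj :: "'o set"
  Mor :: "('o, 'f) arrow set"
  Ident :: "'o \<Rightarrow> ('o, 'f) arrow"
  Cmp :: "('o, 'f) arrow \<Rightarrow> ('o, 'f) arrow \<Rightarrow> ('o, 'f) arrow"

abbreviation cmp_in ("_ \<cdot>\<^bsub>_\<^esub> _" [71, 0, 70] 70) where
  "g \<cdot>\<^bsub>C\<^esub> f \<equiv> Cmp C g f"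

definition Hom :: "('o, 'f, 'z) category_scheme \<Rightarrow> 'o \<Rightarrow> 'o \<Rightarrow> ('o, 'f) arrow set" where
  "Hom C a b = {f \<in> Mor C. Dom f = a \<and> Cod f = b}"

definition is_functor ::
  "('o, 'f, 'z) category_scheme \<Rightarrow> ('p, 'g, 'y) category_scheme \<Rightarrow>
   ('o \<Rightarrow> 'p) \<Rightarrow> (('o, 'f) arrow \<Rightarrow> ('p, 'g) arrow) \<Rightarrow> bool" where
  "is_functor C E Fo Fm \<longleftrightarrow>
     (\<forall>a \<in> Obj C. Fo a \<in> Obj E \<and> Fm (Ident C a) = Ident E (Fo a)) \<and>
     (\<forall>f \<in> Mor C. Fm f \<in> Hom E (Fo (Dom f)) (Fo (Cod f))) \<and>
     (\<forall>f \<in> Mor C. \<forall>g \<in> Mor C. Cod f = Dom g \<longrightarrow> Fm (g \<cdot>\<^bsub>C\<^esub> f) = Fm g \<cdot>\<^bsub>E\<^esub> Fm f)"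

text \<open>
  In the category of maps, a commutative square from \<open>f\<close> to \<open>g\<close> is
  \<open>Arrow f (t, b) g\<close> with vertical maps \<open>f\<close>, \<open>g\<close>, top map \<open>t\<close> and bottom map \<open>b\<close>.
\<close>

definition MapCat ::
  "('o, 'f, 'z) category_scheme \<Rightarrow>
   (('o, 'f) arrow, ('o, 'f) arrow \<times> ('o, 'f) arrow) category" where
  "MapCat C =
     \<lparr> Obj = Mor C,
       Mor = {Arrow f (t, b) g | f t b g.
                f \<in> Mor C \<and> g \<in> Mor C \<and>
                t \<in> Hom C (Dom f) (Dom g) \<and> b \<in> Hom C (Cod f) (Cod g) \<and>
                g \<cdot>\<^bsub>C\<^esub> t = b \<cdot>\<^bsub>C\<^esub> f},
       Ident = (\<lambda>f. Arrow f (Ident C (Dom f), Ident C (Cod f)) f),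
       Cmp = (\<lambda>Q P. Arrow (Dom P)
                (fst (Fn Q) \<cdot>\<^bsub>C\<^esub> fst (Fn P), snd (Fn Q) \<cdot>\<^bsub>C\<^esub> snd (Fn P)) (Cod Q)) \<rparr>"

definition PowCat ::
  "'u itself \<Rightarrow> ('o, 'f, 'z) category_scheme \<Rightarrow> ('o set, 'o \<Rightarrow> ('o, 'f) arrow) category" where
  "PowCat U C =
     \<lparr> Obj = {A. A \<subseteq> Obj C \<and> small U A},
       Mor = {Arrow A F B | A F B.
                A \<subseteq> Obj C \<and> small U A \<and> B \<subseteq> Obj C \<and> small U B \<and> F \<in> extensional A \<and>
                (\<forall>a \<in> A. F a \<in> Mor C \<and> Dom (F a) = a \<and> Cod (F a) \<in> B)},
       Ident = (\<lambda>A. Arrow A (\<lambda>a\<in>A. Ident C a) A),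
       Cmp = (\<lambda>F2 F1. Arrow (Dom F1)
                (\<lambda>a\<in>Dom F1. Fn F2 (Cod (Fn F1 a)) \<cdot>\<^bsub>C\<^esub> Fn F1 a) (Cod F2)) \<rparr>"


section \<open>Factorization setups\<close>

definition factorization_property ::
  "('o, 'f, 'z) category_scheme \<Rightarrow> 'o set \<Rightarrow> 'o \<Rightarrow> ('o, 'f) arrow set \<Rightarrow> bool" where
  "factorization_property C O' c \<Psi> \<longleftrightarrow>
     (\<forall>o' \<in> O'. \<forall>\<psi> \<in> Hom C o' c. \<exists>\<phi> \<in> \<Psi>. \<exists>h \<in> Hom C o' (Dom \<phi>). \<psi> = \<phi> \<cdot>\<^bsub>C\<^esub> h)"

definition arrows_into ::
  "('o, 'f, 'z) category_scheme \<Rightarrow> 'o set \<Rightarrow> 'o \<Rightarrow> ('o, 'f) arrow set" where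
  "arrows_into C O' c = {\<psi> \<in> Mor C. Dom \<psi> \<in> O' \<and> Cod \<psi> = c}"

definition locally_small ::
  "'u itself \<Rightarrow> ('o, 'f, 'z) category_scheme \<Rightarrow> 'o set \<Rightarrow> bool" where
  "locally_small U C O' \<longleftrightarrow>
     O' \<subseteq> Obj C \<and>
     (\<forall>c \<in> Obj C. \<exists>\<Psi> \<subseteq> arrows_into C O' c. small U \<Psi> \<and> factorization_property C O' c \<Psi>)"

definition factorization_setup ::
  "'u itself \<Rightarrow> ('o, 'f, 'z) category_scheme \<Rightarrow> 'o set \<Rightarrow>
   ('o \<Rightarrow> ('o, 'f) arrow set) \<Rightarrow>
   (('o, 'f) arrow \<Rightarrow>
     (('o, 'f) arrow set,
      ('o, 'f) arrow \<Rightarrow> (('o, 'f) arrow, ('o, 'f) arrow \<times> ('o, 'f) arrow) arrow) arrow) \<Rightarrow>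
   bool" where
  "factorization_setup U C O' Fo Fm \<longleftrightarrow>
     locally_small U C O' \<and>
     is_functor C (PowCat U (MapCat C)) Fo Fm \<and>
     (\<forall>c \<in> Obj C. Fo c \<subseteq> arrows_into C O' c \<and> factorization_property C O' c (Fo c)) \<and>
     (\<forall>f \<in> Mor C. \<forall>\<psi> \<in> Fo (Dom f).
        Dom (Fn (Fm f) \<psi>) = \<psi> \<and> Cod (Fn (Fm f) \<psi>) \<in> Fo (Cod f) \<and> snd (Fn (Fn (Fm f) \<psi>)) = f)"


section \<open>Transfinite sequences and cellular maps\<close>

text \<open>
  An ordinal is given by a (reflexive) well-order \<open>r\<close>; its elements are the members of \<open>Field r\<close>.
  A functor from it is given by objects \<open>X i\<close> and arrows \<open>x i j : X i \<rightarrow> X j\<close> for \<open>(i, j) \<in> r\<close>.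
\<close>

definition ordinal_functor ::
  "('o, 'f, 'z) category_scheme \<Rightarrow> 'i rel \<Rightarrow> ('i \<Rightarrow> 'o) \<Rightarrow> ('i \<Rightarrow> 'i \<Rightarrow> ('o, 'f) arrow) \<Rightarrow> bool" where
  "ordinal_functor C r X x \<longleftrightarrow>
     (\<forall>i \<in> Field r. X i \<in> Obj C \<and> x i i = Ident C (X i)) \<and>
     (\<forall>(i, j) \<in> r. x i j \<in> Hom C (X i) (X j)) \<and>
     (\<forall>i j k. (i, j) \<in> r \<longrightarrow> (j, k) \<in> r \<longrightarrow> x i k = x j k \<cdot>\<^bsub>C\<^esub> x i j)"

definition cocone ::
  "('o, 'f, 'z) category_scheme \<Rightarrow> 'i rel \<Rightarrow> 'i set \<Rightarrow> ('i \<Rightarrow> 'o) \<Rightarrow> ('i \<Rightarrow> 'i \<Rightarrow> ('o, 'f) arrow) \<Rightarrow>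
   'o \<Rightarrow> ('i \<Rightarrow> ('o, 'f) arrow) \<Rightarrow> bool" where
  "cocone C r A X x c q \<longleftrightarrow>
     c \<in> Obj C \<and> (\<forall>i \<in> A. q i \<in> Hom C (X i) c) \<and>
     (\<forall>i \<in> A. \<forall>j \<in> A. (i, j) \<in> r \<longrightarrow> q i = q j \<cdot>\<^bsub>C\<^esub> x i j)"

definition is_colimit ::
  "('o, 'f, 'z) category_scheme \<Rightarrow> 'i rel \<Rightarrow> 'i set \<Rightarrow> ('i \<Rightarrow> 'o) \<Rightarrow> ('i \<Rightarrow> 'i \<Rightarrow> ('o, 'f) arrow) \<Rightarrow>
   'o \<Rightarrow> ('i \<Rightarrow> ('o, 'f) arrow) \<Rightarrow> bool" where
  "is_colimit C r A X x c q \<longleftrightarrow>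
     cocone C r A X x c q \<and>
     (\<forall>c' q'. cocone C r A X x c' q' \<longrightarrow> (\<exists>!u. u \<in> Hom C c c' \<and> (\<forall>i \<in> A. q' i = u \<cdot>\<^bsub>C\<^esub> q i)))"

definition successor_in :: "'i rel \<Rightarrow> 'i \<Rightarrow> 'i \<Rightarrow> bool" where
  "successor_in r i j \<longleftrightarrow>
     (i, j) \<in> r \<and> i \<noteq> j \<and> (\<forall>k. (i, k) \<in> r \<and> k \<noteq> i \<longrightarrow> (j, k) \<in> r)"

definition limit_in :: "'i rel \<Rightarrow> 'i \<Rightarrow> bool" where
  "limit_in r j \<longleftrightarrow> j \<in> Field r \<and> underS r j \<noteq> {} \<and> (\<nexists>i. successor_in r i j)"

definition sequence ::
  "('o, 'f, 'z) category_scheme \<Rightarrow> 'i rel \<Rightarrow> ('i \<Rightarrow> 'o) \<Rightarrow> ('i \<Rightarrow> 'i \<Rightarrow> ('o, 'f) arrow) \<Rightarrow> bool" where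
  "sequence C r X x \<longleftrightarrow>
     ordinal_functor C r X x \<and>
     (\<forall>j. limit_in r j \<longrightarrow> is_colimit C r (underS r j) X x (X j) (\<lambda>i. x i j))"

definition is_pushout ::
  "('o, 'f, 'z) category_scheme \<Rightarrow> ('o, 'f) arrow \<Rightarrow> ('o, 'f) arrow \<Rightarrow> ('o, 'f) arrow \<Rightarrow>
   ('o, 'f) arrow \<Rightarrow> bool" where
  "is_pushout C i f g j \<longleftrightarrow>
     i \<in> Mor C \<and> f \<in> Hom C (Dom i) (Cod f) \<and>
     g \<in> Hom C (Cod i) (Cod j) \<and> j \<in> Hom C (Cod f) (Cod j) \<and> g \<cdot>\<^bsub>C\<^esub> i = j \<cdot>\<^bsub>C\<^esub> f \<and>
     (\<forall>e. \<forall>g' \<in> Hom C (Cod i) e. \<forall>j' \<in> Hom C (Cod f) e. g' \<cdot>\<^bsub>C\<^esub> i = j' \<cdot>\<^bsub>C\<^esub> f \<longrightarrow>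
        (\<exists>!u. u \<in> Hom C (Cod j) e \<and> g' = u \<cdot>\<^bsub>C\<^esub> g \<and> j' = u \<cdot>\<^bsub>C\<^esub> j))"

definition pushouts ::
  "('o, 'f, 'z) category_scheme \<Rightarrow> ('o, 'f) arrow set \<Rightarrow> ('o, 'f) arrow set" where
  "pushouts C I = {j. \<exists>i \<in> I. \<exists>f g. is_pushout C i f g j}"

definition cell ::
  "'u itself \<Rightarrow> ('o, 'f, 'z) category_scheme \<Rightarrow> ('o, 'f) arrow set \<Rightarrow> ('o, 'f) arrow set" where
  "cell U C I =
     {h. \<exists>(r :: 'u rel) X x c q z.
           Well_order r \<and> small U (Field r) \<and>
           sequence C r X x \<and>
           (\<forall>i j. successor_in r i j \<longrightarrow> x i j \<in> pushouts C I) \<and>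
           is_colimit C r (Field r) X x c q \<and>
           z \<in> Field r \<and> (\<forall>i \<in> Field r. (z, i) \<in> r) \<and> h = q z}"

definition filtered_ordinal :: "'k rel \<Rightarrow> 'i rel \<Rightarrow> bool" where
  "filtered_ordinal \<kappa> r \<longleftrightarrow>
     Well_order r \<and> (\<forall>i \<in> Field r. \<exists>j \<in> Field r. j \<noteq> i \<and> (i, j) \<in> r) \<and>
     (\<forall>A \<subseteq> Field r. |A| \<le>o \<kappa> \<longrightarrow> (\<exists>b \<in> Field r. \<forall>a \<in> A. (a, b) \<in> r))"

text \<open>
  The colimit of the sets \<open>Hom C a (X i)\<close>: the disjoint union modulo the relation
  identifying elements that become equal at a later stage.
\<close>

definition hom_union ::
  "('o, 'f, 'z) category_scheme \<Rightarrow> 'i rel \<Rightarrow> ('i \<Rightarrow> 'o) \<Rightarrow> 'o \<Rightarrow> ('i \<times> ('o, 'f) arrow) set" where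
  "hom_union C r X a = (SIGMA i : Field r. Hom C a (X i))"

definition hom_rel ::
  "('o, 'f, 'z) category_scheme \<Rightarrow> 'i rel \<Rightarrow> ('i \<Rightarrow> 'o) \<Rightarrow> ('i \<Rightarrow> 'i \<Rightarrow> ('o, 'f) arrow) \<Rightarrow> 'o \<Rightarrow>
   ('i \<times> ('o, 'f) arrow) rel" where
  "hom_rel C r X x a =
     {((i, g), (j, h)). (i, g) \<in> hom_union C r X a \<and> (j, h) \<in> hom_union C r X a \<and>
        (\<exists>k. (i, k) \<in> r \<and> (j, k) \<in> r \<and> x i k \<cdot>\<^bsub>C\<^esub> g = x j k \<cdot>\<^bsub>C\<^esub> h)}"

definition small_relative ::
  "'u itself \<Rightarrow> ('o, 'f, 'z) category_scheme \<Rightarrow> 'k rel \<Rightarrow> ('o, 'f) arrow set \<Rightarrow> 'o \<Rightarrow> bool" where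
  "small_relative U C \<kappa> \<D> a \<longleftrightarrow>
     (\<forall>(r :: 'u rel) X x c q.
        small U (Field r) \<longrightarrow> filtered_ordinal \<kappa> r \<longrightarrow>
        sequence C r X x \<longrightarrow> (\<forall>i j. successor_in r i j \<longrightarrow> x i j \<in> \<D>) \<longrightarrow>
        is_colimit C r (Field r) X x c q \<longrightarrow>
        bij_betw (\<lambda>K. the_elem ((\<lambda>(i, g). q i \<cdot>\<^bsub>C\<^esub> g) ` K))
          (hom_union C r X a // hom_rel C r X x a) (Hom C a c))"

definition instrumented ::
  "'u itself \<Rightarrow> ('o, 'f, 'z) category_scheme \<Rightarrow> ('o, 'f) arrow set \<Rightarrow> bool" where
  "instrumented U C I \<longleftrightarrow>
     locally_small U (MapCat C) I \<and>
     (\<exists>\<kappa> :: 'u rel. Card_order \<kappa> \<and> \<kappa> <o |UNIV :: 'u set| \<and>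
        (\<forall>i \<in> I. small_relative U C \<kappa> (cell U C I) (Dom i))) \<and>
     (\<exists>Fo Fm. factorization_setup U (MapCat C) I Fo Fm)"


section \<open>Simplicial sets\<close>

text \<open>
  \<open>operators m n\<close> are the monotone maps \<open>[m] \<rightarrow> [n]\<close>, as lists of values.
  \<open>Op X n \<theta>\<close> is the map \<open>X\<^sub>n \<rightarrow> X\<^sub>m\<close> induced by \<open>\<theta> : [m] \<rightarrow> [n]\<close>.
\<close>

definition operators :: "nat \<Rightarrow> nat \<Rightarrow> nat list set" where
  "operators m n = {\<theta>. length \<theta> = Suc m \<and> sorted \<theta> \<and> set \<theta> \<subseteq> {..n}}"

record 'e sset =
  Smp :: "nat \<Rightarrow> 'e set"
  Op :: "nat \<Rightarrow> nat list \<Rightarrow> 'e \<Rightarrow> 'e"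

definition simplicial_set :: "'e sset \<Rightarrow> bool" where
  "simplicial_set X \<longleftrightarrow>
     (\<forall>m n. \<forall>\<theta> \<in> operators m n. \<forall>x \<in> Smp X n. Op X n \<theta> x \<in> Smp X m) \<and>
     (\<forall>n. \<forall>x \<in> Smp X n. Op X n [0..<Suc n] x = x) \<and>
     (\<forall>l m n. \<forall>\<phi> \<in> operators l m. \<forall>\<theta> \<in> operators m n. \<forall>x \<in> Smp X n.
        Op X m \<phi> (Op X n \<theta> x) = Op X n (map ((!) \<theta>) \<phi>) x) \<and>
     (\<forall>n \<theta> x. \<not> ((\<exists>m. \<theta> \<in> operators m n) \<and> x \<in> Smp X n) \<longrightarrow> Op X n \<theta> x = undefined)"

definition sset_maps :: "('e sset, nat \<Rightarrow> 'e \<Rightarrow> 'e) arrow set" where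
  "sset_maps =
     {Arrow X f Y | X f Y.
        simplicial_set X \<and> simplicial_set Y \<and>
        (\<forall>n. f n \<in> extensional (Smp X n) \<and> f n ` Smp X n \<subseteq> Smp Y n) \<and>
        (\<forall>m n. \<forall>\<theta> \<in> operators m n. \<forall>x \<in> Smp X n. f m (Op X n \<theta> x) = Op Y n \<theta> (f n x))}"

text \<open>
  The \<open>m\<close>-simplices of \<open>\<Delta>\<^sup>n\<close> are the monotone maps \<open>[m] \<rightarrow> [n]\<close>; the boundary consists of those
  lying in some face, and the \<open>k\<close>-th horn of those lying in some face other than the \<open>k\<close>-th one.
\<close>

definition subsimplex :: "nat \<Rightarrow> (nat list \<Rightarrow> bool) \<Rightarrow> nat list sset" where
  "subsimplex n P =
     \<lparr> Smp = (\<lambda>m. {\<sigma> \<in> operators m n. P \<sigma>}),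
       Op = (\<lambda>m \<theta> \<sigma>. if (\<exists>l. \<theta> \<in> operators l m) \<and> \<sigma> \<in> operators m n \<and> P \<sigma>
                       then map ((!) \<sigma>) \<theta> else undefined) \<rparr>"

definition Delta :: "nat \<Rightarrow> nat list sset" where
  "Delta n = subsimplex n (\<lambda>_. True)"

definition boundary :: "nat \<Rightarrow> nat list sset" where
  "boundary n = subsimplex n (\<lambda>\<sigma>. \<exists>i \<le> n. i \<notin> set \<sigma>)"

definition horn :: "nat \<Rightarrow> nat \<Rightarrow> nat list sset" where
  "horn n k = subsimplex n (\<lambda>\<sigma>. \<exists>i \<le> n. i \<noteq> k \<and> i \<notin> set \<sigma>)"

definition inclusion :: "'e sset \<Rightarrow> 'e sset \<Rightarrow> ('e sset, nat \<Rightarrow> 'e \<Rightarrow> 'e) arrow" where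
  "inclusion K L = Arrow K (\<lambda>m. \<lambda>\<sigma> \<in> Smp K m. \<sigma>) L"


section \<open>Geometric realization\<close>

definition push :: "nat list \<Rightarrow> (nat \<Rightarrow> real) \<Rightarrow> nat \<Rightarrow> real" where
  "push \<theta> t = (\<lambda>i. \<Sum>j | j < length \<theta> \<and> \<theta> ! j = i. t j)"

definition real_points :: "'e sset \<Rightarrow> (nat \<times> 'e \<times> (nat \<Rightarrow> real)) set" where
  "real_points K = {(n, x, t). x \<in> Smp K n \<and> t \<in> standard_simplex n}"

definition real_glue :: "'e sset \<Rightarrow> (nat \<times> 'e \<times> (nat \<Rightarrow> real)) rel" where
  "real_glue K =
     {((m, Op K n \<theta> x, t), (n, x, push \<theta> t)) | m n \<theta> x t.
        \<theta> \<in> operators m n \<and> x \<in> Smp K n \<and> t \<in> standard_simplex m}"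

definition real_eq :: "'e sset \<Rightarrow> (nat \<times> 'e \<times> (nat \<Rightarrow> real)) rel" where
  "real_eq K = Restr ((real_glue K \<union> (real_glue K)\<inverse>)\<^sup>*) (real_points K)"

definition realization :: "'e sset \<Rightarrow> (nat \<times> 'e \<times> (nat \<Rightarrow> real)) set topology" where
  "realization K = topology (\<lambda>W.
     W \<subseteq> real_points K // real_eq K \<and>
     (\<forall>n. \<forall>x \<in> Smp K n.
        openin (subtopology (powertop_real UNIV) (standard_simplex n))
          {t \<in> standard_simplex n. real_eq K `` {(n, x, t)} \<in> W}))"

definition realization_map ::
  "('e sset, nat \<Rightarrow> 'e \<Rightarrow> 'e) arrow \<Rightarrow>
   (nat \<times> 'e \<times> (nat \<Rightarrow> real)) set \<Rightarrow> (nat \<times> 'e \<times> (nat \<Rightarrow> real)) set" where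
  "realization_map f p = real_eq (Cod f) `` ((\<lambda>(n, x, t). (n, Fn f n x, t)) ` p)"

lemma istopology_finality:
  assumes "\<And>i. i \<in> I \<Longrightarrow> f i ` topspace (K i) \<subseteq> S"
  shows "istopology (\<lambda>W. W \<subseteq> S \<and> (\<forall>i \<in> I. openin (K i) {t \<in> topspace (K i). f i t \<in> W}))"
proof -
  have *: "{t \<in> topspace (K i). f i t \<in> V \<inter> W} =
      {t \<in> topspace (K i). f i t \<in> V} \<inter> {t \<in> topspace (K i). f i t \<in> W}" for i V W
    by auto
  have **: "{t \<in> topspace (K i). f i t \<in> \<Union>\<W>} =
      (\<Union>W \<in> \<W>. {t \<in> topspace (K i). f i t \<in> W})" for i \<W>
    by auto
  show ?thesis
    unfolding istopology_def * ** by blast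
qed

lemma openin_realization:
  "openin (realization K) W \<longleftrightarrow>
     W \<subseteq> real_points K // real_eq K \<and>
     (\<forall>n. \<forall>x \<in> Smp K n.
        openin (subtopology (powertop_real UNIV) (standard_simplex n))
          {t \<in> standard_simplex n. real_eq K `` {(n, x, t)} \<in> W})"
proof -
  have "istopology (\<lambda>W. W \<subseteq> real_points K // real_eq K \<and>
     (\<forall>i \<in> (SIGMA n : UNIV. Smp K n).
        openin (subtopology (powertop_real UNIV) (standard_simplex (fst i)))
          {t \<in> topspace (subtopology (powertop_real UNIV) (standard_simplex (fst i))).
             real_eq K `` {(fst i, snd i, t)} \<in> W}))"
    by (rule istopology_finality)
       (auto simp: real_points_def intro!: quotientI)
  then show ?thesis
    unfolding realization_def by (subst topology_inverse') simp_all
qed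


section \<open>Compactly generated spaces\<close>

text \<open>
  A set is open in the k-ification of \<open>X\<close> iff its preimage under every continuous map from a
  compact Hausdorff space is open.  No separation axiom is imposed on \<open>X\<close>.  (The library's
  \<open>k_space\<close> tests with arbitrary compact subspaces instead; outside Hausdorff spaces that is a
  different notion.)  The test spaces range over all compact Hausdorff spaces in the universe,
  each of which is homeomorphic to one with points in \<open>'u element\<close>.
\<close>

definition k_open :: "'u element topology \<Rightarrow> 'u element set \<Rightarrow> bool" where
  "k_open X W \<longleftrightarrow>
     W \<subseteq> topspace X \<and>
     (\<forall>(K :: 'u element topology) u.
        small TYPE('u) (topspace K) \<and> compact_space K \<and> Hausdorff_space K \<and>
        continuous_map K X u \<longrightarrow> openin K {z \<in> topspace K. u z \<in> W})"

definition kify :: "'u element topology \<Rightarrow> 'u element topology" where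
  "kify X = topology (k_open X)"

definition compactly_generated :: "'u element topology \<Rightarrow> bool" where
  "compactly_generated X \<longleftrightarrow> (\<forall>W. k_open X W \<longrightarrow> openin X W)"

lemma openin_kify: "openin (kify X) W \<longleftrightarrow> k_open X W"
proof -
  have "istopology (\<lambda>W. W \<subseteq> topspace X \<and>
    (\<forall>i \<in> {(K :: 'a element topology, u). small TYPE('a) (topspace K) \<and> compact_space K \<and>
        Hausdorff_space K \<and> continuous_map K X u}.
      openin (fst i) {z \<in> topspace (fst i). snd i z \<in> W}))"
    by (rule istopology_finality) (auto simp: continuous_map_def Pi_iff)
  moreover have "k_open X = (\<lambda>W. W \<subseteq> topspace X \<and>
    (\<forall>i \<in> {(K :: 'a element topology, u). small TYPE('a) (topspace K) \<and> compact_space K \<and>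
        Hausdorff_space K \<and> continuous_map K X u}.
      openin (fst i) {z \<in> topspace (fst i). snd i z \<in> W}))"
    by (auto simp: k_open_def fun_eq_iff)
  ultimately have "istopology (k_open X)" by simp
  then show ?thesis
    unfolding kify_def by (simp add: topology_inverse')
qed


section \<open>The two categories of spaces\<close>

text \<open>
  Besides the category, a structure of spaces records the chosen binary products and terminal
  object, and the functor sending a simplicial set \<open>K\<close> to \<open>K\<close> itself (with simplices renamed) or
  to its realization \<open>|K|\<close>.
\<close>

record ('o, 'f) spaces = "('o, 'f) category" +
  Prod :: "'o \<Rightarrow> 'o \<Rightarrow> 'o"
  Pr1 :: "'o \<Rightarrow> 'o \<Rightarrow> ('o, 'f) arrow"
  Pr2 :: "'o \<Rightarrow> 'o \<Rightarrow> ('o, 'f) arrow"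
  Tuple :: "('o, 'f) arrow \<Rightarrow> ('o, 'f) arrow \<Rightarrow> ('o, 'f) arrow"
  One :: "'o"
  Bang :: "'o \<Rightarrow> ('o, 'f) arrow"
  Rlz :: "nat list sset \<Rightarrow> 'o"
  RlzMap :: "(nat list sset, nat \<Rightarrow> nat list \<Rightarrow> nat list) arrow \<Rightarrow> ('o, 'f) arrow"

definition sset_product :: "'u element sset \<Rightarrow> 'u element sset \<Rightarrow> 'u element sset" where
  "sset_product X Y =
     \<lparr> Smp = (\<lambda>n. {Pair x y | x y. x \<in> Smp X n \<and> y \<in> Smp Y n}),
       Op = (\<lambda>n \<theta> p. if (\<exists>m. \<theta> \<in> operators m n) \<and>
                         (\<exists>x \<in> Smp X n. \<exists>y \<in> Smp Y n. p = Pair x y)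
                       then Pair (Op X n \<theta> (pfst p)) (Op Y n \<theta> (psnd p)) else undefined) \<rparr>"

definition sset_embed :: "nat list sset \<Rightarrow> 'u element sset" where
  "sset_embed K =
     \<lparr> Smp = (\<lambda>n. Simplex ` Smp K n),
       Op = (\<lambda>n \<theta> p. if (\<exists>m. \<theta> \<in> operators m n) \<and> p \<in> Simplex ` Smp K n
                       then Simplex (Op K n \<theta> (un_Simplex p)) else undefined) \<rparr>"

definition SSet :: "('u element sset, nat \<Rightarrow> 'u element \<Rightarrow> 'u element) spaces" where
  "SSet =
     \<lparr> Obj = {X. simplicial_set X \<and> (\<forall>n. small TYPE('u) (Smp X n))},
       Mor = {f \<in> sset_maps. (\<forall>n. small TYPE('u) (Smp (Dom f) n)) \<and>
                             (\<forall>n. small TYPE('u) (Smp (Cod f) n))},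
       Ident = (\<lambda>X. Arrow X (\<lambda>n. \<lambda>x \<in> Smp X n. x) X),
       Cmp = (\<lambda>g f. Arrow (Dom f) (\<lambda>n. \<lambda>x \<in> Smp (Dom f) n. Fn g n (Fn f n x)) (Cod g)),
       Prod = sset_product,
       Pr1 = (\<lambda>X Y. Arrow (sset_product X Y) (\<lambda>n. \<lambda>p \<in> Smp (sset_product X Y) n. pfst p) X),
       Pr2 = (\<lambda>X Y. Arrow (sset_product X Y) (\<lambda>n. \<lambda>p \<in> Smp (sset_product X Y) n. psnd p) Y),
       Tuple = (\<lambda>f g. Arrow (Dom f) (\<lambda>n. \<lambda>x \<in> Smp (Dom f) n. Pair (Fn f n x) (Fn g n x))
                  (sset_product (Cod f) (Cod g))),
       One = sset_embed (Delta 0),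
       Bang = (\<lambda>X. Arrow X (\<lambda>n. \<lambda>x \<in> Smp X n. Simplex (replicate (Suc n) 0))
                  (sset_embed (Delta 0))),
       Rlz = sset_embed,
       RlzMap = (\<lambda>f. Arrow (sset_embed (Dom f))
                  (\<lambda>n. \<lambda>p \<in> Smp (sset_embed (Dom f)) n. Simplex (Fn f n (un_Simplex p)))
                  (sset_embed (Cod f))) \<rparr>"

definition top_product ::
  "'u element topology \<Rightarrow> 'u element topology \<Rightarrow> 'u element topology" where
  "top_product X Y =
     kify (pullback_topology {Pair x y | x y. True} (\<lambda>p. (pfst p, psnd p)) (prod_topology X Y))"

definition top_realization :: "nat list sset \<Rightarrow> 'u element topology" where
  "top_realization K = pullback_topology (range Point) un_Point (realization K)"

definition CGTop :: "('u element topology, 'u element \<Rightarrow> 'u element) spaces" where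
  "CGTop =
     \<lparr> Obj = {X. compactly_generated X \<and> small TYPE('u) (topspace X)},
       Mor = {Arrow X f Y | X f Y.
                compactly_generated X \<and> small TYPE('u) (topspace X) \<and>
                compactly_generated Y \<and> small TYPE('u) (topspace Y) \<and>
                continuous_map X Y f \<and> f \<in> extensional (topspace X)},
       Ident = (\<lambda>X. Arrow X (\<lambda>x \<in> topspace X. x) X),
       Cmp = (\<lambda>g f. Arrow (Dom f) (\<lambda>x \<in> topspace (Dom f). Fn g (Fn f x)) (Cod g)),
       Prod = top_product,
       Pr1 = (\<lambda>X Y. Arrow (top_product X Y) (\<lambda>p \<in> topspace (top_product X Y). pfst p) X),
       Pr2 = (\<lambda>X Y. Arrow (top_product X Y) (\<lambda>p \<in> topspace (top_product X Y). psnd p) Y),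
       Tuple = (\<lambda>f g. Arrow (Dom f) (\<lambda>x \<in> topspace (Dom f). Pair (Fn f x) (Fn g x))
                  (top_product (Cod f) (Cod g))),
       One = discrete_topology {Simplex [0]},
       Bang = (\<lambda>X. Arrow X (\<lambda>x \<in> topspace X. Simplex [0]) (discrete_topology {Simplex [0]})),
       Rlz = top_realization,
       RlzMap = (\<lambda>f. Arrow (top_realization (Dom f))
                  (\<lambda>p \<in> topspace (top_realization (Dom f)).
                     Point (realization_map f (un_Point p)))
                  (top_realization (Cod f))) \<rparr>"


section \<open>Enriched categories and diagrams\<close>

record ('d, 'o, 'f) enriched =
  Ob :: "'d set"
  EHom :: "'d \<Rightarrow> 'd \<Rightarrow> 'o"
  EComp :: "'d \<Rightarrow> 'd \<Rightarrow> 'd \<Rightarrow> ('o, 'f) arrow"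
  EId :: "'d \<Rightarrow> ('o, 'f) arrow"

definition enriched_category ::
  "('o, 'f) spaces \<Rightarrow> ('d, 'o, 'f) enriched \<Rightarrow> bool" where
  "enriched_category S D \<longleftrightarrow>
     (\<forall>a \<in> Ob D. \<forall>b \<in> Ob D. EHom D a b \<in> Obj S) \<and>
     (\<forall>a \<in> Ob D. \<forall>b \<in> Ob D. \<forall>c \<in> Ob D.
        EComp D a b c \<in> Hom S (Prod S (EHom D b c) (EHom D a b)) (EHom D a c)) \<and>
     (\<forall>a \<in> Ob D. EId D a \<in> Hom S (One S) (EHom D a a)) \<and>
     (\<forall>a \<in> Ob D. \<forall>b \<in> Ob D. \<forall>c \<in> Ob D. \<forall>d \<in> Ob D.
        (let P = Prod S (EHom D c d) (EHom D b c);
             h = Pr1 S (EHom D c d) (EHom D b c) \<cdot>\<^bsub>S\<^esub> Pr1 S P (EHom D a b);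
             g = Pr2 S (EHom D c d) (EHom D b c) \<cdot>\<^bsub>S\<^esub> Pr1 S P (EHom D a b);
             f = Pr2 S P (EHom D a b)
         in EComp D a b d \<cdot>\<^bsub>S\<^esub> Tuple S (EComp D b c d \<cdot>\<^bsub>S\<^esub> Tuple S h g) f =
            EComp D a c d \<cdot>\<^bsub>S\<^esub> Tuple S h (EComp D a b c \<cdot>\<^bsub>S\<^esub> Tuple S g f))) \<and>
     (\<forall>a \<in> Ob D. \<forall>b \<in> Ob D.
        EComp D a a b \<cdot>\<^bsub>S\<^esub> Tuple S (Ident S (EHom D a b)) (EId D a \<cdot>\<^bsub>S\<^esub> Bang S (EHom D a b)) =
          Ident S (EHom D a b) \<and>
        EComp D a b b \<cdot>\<^bsub>S\<^esub> Tuple S (EId D b \<cdot>\<^bsub>S\<^esub> Bang S (EHom D a b)) (Ident S (EHom D a b)) =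
          Ident S (EHom D a b))"

text \<open>
  The action of an enriched functor \<open>X\<close> on hom objects, \<open>D(a,b) \<rightarrow> map(X a, X b)\<close>, is given in its
  adjoint form \<open>Act X a b : D(a,b) \<times> X a \<rightarrow> X b\<close>.
\<close>

record ('d, 'o, 'f) diagram =
  At :: "'d \<Rightarrow> 'o"
  Act :: "'d \<Rightarrow> 'd \<Rightarrow> ('o, 'f) arrow"

definition enriched_functor ::
  "('o, 'f) spaces \<Rightarrow> ('d, 'o, 'f) enriched \<Rightarrow> ('d, 'o, 'f) diagram \<Rightarrow> bool" where
  "enriched_functor S D X \<longleftrightarrow>
     At X \<in> extensional (Ob D) \<and> Act X \<in> extensional (Ob D) \<and>
     (\<forall>a \<in> Ob D. Act X a \<in> extensional (Ob D)) \<and>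
     (\<forall>a \<in> Ob D. At X a \<in> Obj S) \<and>
     (\<forall>a \<in> Ob D. \<forall>b \<in> Ob D. Act X a b \<in> Hom S (Prod S (EHom D a b) (At X a)) (At X b)) \<and>
     (\<forall>a \<in> Ob D. \<forall>b \<in> Ob D. \<forall>c \<in> Ob D.
        (let P = Prod S (EHom D b c) (EHom D a b);
             g = Pr1 S (EHom D b c) (EHom D a b) \<cdot>\<^bsub>S\<^esub> Pr1 S P (At X a);
             f = Pr2 S (EHom D b c) (EHom D a b) \<cdot>\<^bsub>S\<^esub> Pr1 S P (At X a);
             x = Pr2 S P (At X a)
         in Act X a c \<cdot>\<^bsub>S\<^esub> Tuple S (EComp D a b c \<cdot>\<^bsub>S\<^esub> Tuple S g f) x =
            Act X b c \<cdot>\<^bsub>S\<^esub> Tuple S g (Act X a b \<cdot>\<^bsub>S\<^esub> Tuple S f x))) \<and>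
     (\<forall>a \<in> Ob D.
        Act X a a \<cdot>\<^bsub>S\<^esub> Tuple S (EId D a \<cdot>\<^bsub>S\<^esub> Bang S (At X a)) (Ident S (At X a)) =
          Ident S (At X a))"

definition natural_transformations ::
  "('o, 'f) spaces \<Rightarrow> ('d, 'o, 'f) enriched \<Rightarrow>
   (('d, 'o, 'f) diagram, 'd \<Rightarrow> ('o, 'f) arrow) arrow set" where
  "natural_transformations S D =
     {Arrow X \<alpha> Y | X \<alpha> Y.
        enriched_functor S D X \<and> enriched_functor S D Y \<and> \<alpha> \<in> extensional (Ob D) \<and>
        (\<forall>a \<in> Ob D. \<alpha> a \<in> Hom S (At X a) (At Y a)) \<and>
        (\<forall>a \<in> Ob D. \<forall>b \<in> Ob D.
           \<alpha> b \<cdot>\<^bsub>S\<^esub> Act X a b =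
           Act Y a b \<cdot>\<^bsub>S\<^esub> Tuple S (Pr1 S (EHom D a b) (At X a))
                                 (\<alpha> a \<cdot>\<^bsub>S\<^esub> Pr2 S (EHom D a b) (At X a)))}"

definition Diagrams ::
  "('o, 'f) spaces \<Rightarrow> ('d, 'o, 'f) enriched \<Rightarrow>
   (('d, 'o, 'f) diagram, 'd \<Rightarrow> ('o, 'f) arrow) category" where
  "Diagrams S D =
     \<lparr> Obj = {X. enriched_functor S D X},
       Mor = natural_transformations S D,
       Ident = (\<lambda>X. Arrow X (\<lambda>a \<in> Ob D. Ident S (At X a)) X),
       Cmp = (\<lambda>\<beta> \<alpha>. Arrow (Dom \<alpha>) (\<lambda>a \<in> Ob D. Fn \<beta> a \<cdot>\<^bsub>S\<^esub> Fn \<alpha> a) (Cod \<beta>)) \<rparr>"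

definition const_diagram ::
  "('o, 'f) spaces \<Rightarrow> ('d, 'o, 'f) enriched \<Rightarrow> 'o \<Rightarrow> ('d, 'o, 'f) diagram" where
  "const_diagram S D Y =
     \<lparr> At = (\<lambda>a \<in> Ob D. Y), Act = (\<lambda>a \<in> Ob D. \<lambda>b \<in> Ob D. Pr2 S (EHom D a b) Y) \<rparr>"

definition const_map ::
  "('o, 'f) spaces \<Rightarrow> ('d, 'o, 'f) enriched \<Rightarrow> ('o, 'f) arrow \<Rightarrow>
   (('d, 'o, 'f) diagram, 'd \<Rightarrow> ('o, 'f) arrow) arrow" where
  "const_map S D u =
     Arrow (const_diagram S D (Dom u)) (\<lambda>a \<in> Ob D. u) (const_diagram S D (Cod u))"

text \<open>
  \<open>colim\<^sub>D\<close> is left adjoint to the constant diagram functor, so \<open>L\<close> is a colimit of \<open>X\<close> iff it carries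
  a universal natural transformation from \<open>X\<close> to a constant diagram.
\<close>

definition is_diagram_colimit ::
  "('o, 'f) spaces \<Rightarrow> ('d, 'o, 'f) enriched \<Rightarrow> ('d, 'o, 'f) diagram \<Rightarrow> 'o \<Rightarrow>
   (('d, 'o, 'f) diagram, 'd \<Rightarrow> ('o, 'f) arrow) arrow \<Rightarrow> bool" where
  "is_diagram_colimit S D X L \<tau> \<longleftrightarrow>
     L \<in> Obj S \<and> \<tau> \<in> Hom (Diagrams S D) X (const_diagram S D L) \<and>
     (\<forall>Y \<in> Obj S. \<forall>\<sigma> \<in> Hom (Diagrams S D) X (const_diagram S D Y).
        \<exists>!u. u \<in> Hom S L Y \<and> \<sigma> = const_map S D u \<cdot>\<^bsub>Diagrams S D\<^esub> \<tau>)"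

definition orbit ::
  "('o, 'f) spaces \<Rightarrow> ('d, 'o, 'f) enriched \<Rightarrow> ('d, 'o, 'f) diagram \<Rightarrow> bool" where
  "orbit S D T \<longleftrightarrow> T \<in> Obj (Diagrams S D) \<and> (\<exists>\<tau>. is_diagram_colimit S D T (One S) \<tau>)"

definition tensor ::
  "('o, 'f) spaces \<Rightarrow> ('d, 'o, 'f) enriched \<Rightarrow> ('d, 'o, 'f) diagram \<Rightarrow> nat list sset \<Rightarrow>
   ('d, 'o, 'f) diagram" where
  "tensor S D X K =
     \<lparr> At = (\<lambda>a \<in> Ob D. Prod S (At X a) (Rlz S K)),
       Act = (\<lambda>a \<in> Ob D. \<lambda>b \<in> Ob D.
         (let XK = Prod S (At X a) (Rlz S K);
              f = Pr1 S (EHom D a b) XK;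
              x = Pr1 S (At X a) (Rlz S K) \<cdot>\<^bsub>S\<^esub> Pr2 S (EHom D a b) XK;
              k = Pr2 S (At X a) (Rlz S K) \<cdot>\<^bsub>S\<^esub> Pr2 S (EHom D a b) XK
          in Tuple S (Act X a b \<cdot>\<^bsub>S\<^esub> Tuple S f x) k)) \<rparr>"

definition tensor_map ::
  "('o, 'f) spaces \<Rightarrow> ('d, 'o, 'f) enriched \<Rightarrow> ('d, 'o, 'f) diagram \<Rightarrow>
   (nat list sset, nat \<Rightarrow> nat list \<Rightarrow> nat list) arrow \<Rightarrow>
   (('d, 'o, 'f) diagram, 'd \<Rightarrow> ('o, 'f) arrow) arrow" where
  "tensor_map S D X i =
     Arrow (tensor S D X (Dom i))
       (\<lambda>a \<in> Ob D. Tuple S (Pr1 S (At X a) (Rlz S (Dom i)))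
                            (RlzMap S i \<cdot>\<^bsub>S\<^esub> Pr2 S (At X a) (Rlz S (Dom i))))
       (tensor S D X (Cod i))"

definition I_maps ::
  "('o, 'f) spaces \<Rightarrow> ('d, 'o, 'f) enriched \<Rightarrow>
   (('d, 'o, 'f) diagram, 'd \<Rightarrow> ('o, 'f) arrow) arrow set" where
  "I_maps S D = {tensor_map S D T (inclusion (boundary n) (Delta n)) | T n. orbit S D T}"

definition J_maps ::
  "('o, 'f) spaces \<Rightarrow> ('d, 'o, 'f) enriched \<Rightarrow>
   (('d, 'o, 'f) diagram, 'd \<Rightarrow> ('o, 'f) arrow) arrow set" where
  "J_maps S D =
     {tensor_map S D T (inclusion (horn n k) (Delta n)) | T n k. orbit S D T \<and> k \<le> n \<and> 1 \<le> n}"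

end

theory Submission
  imports Defs "HOL-Analysis.Abstract_Topological_Spaces"
begin

text \<open>
  Simplicial sets and compactly generated spaces enter the argument only through the properties
  collected in the locale \<open>space_model\<close>: an object has points, morphisms are determined by their
  values on points, there are internal homs and subobjects, and arbitrary sets of points have
  classifying maps.  Everything about diagrams is proved from these.

  \<^emph>\<open>Orbits.\<close>  The category \<open>D\<close> acts on the points of a diagram, and the classes of the equivalence relation
  generated by this action are its components.  A diagram is an orbit if and only if it has exactly one
  component (\<open>connected_orbit\<close>, \<open>orbit_connected\<close>).  Hence the component of a vertex in an arbitrary
  diagram is an orbit (\<open>component_orbit\<close>), and a map from an orbit that hits a component lands in it.

  \<^emph>\<open>Factorization setup.\<close>  By the exponential laws, the squares from \<open>T \<otimes> K \<rightarrow> T \<otimes> L\<close> to \<open>f : X \<rightarrow> Y\<close>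
  are the maps from \<open>T\<close> to a diagram of squares, the part of \<open>X\<^sup>K \<times> Y\<^sup>L\<close> on which the two composites to
  \<open>Y\<^sup>K\<close> agree.  If \<open>T\<close> is an orbit, such a map factors through one component.  The components
  are orbits and form a small set, so the evaluation squares on them have the factorization property
  (\<open>factorization\<close>).  The diagram of squares is functorial in \<open>f\<close> and natural transformations carry
  components into components, which yields the functor to the category of subsets
  (\<open>factorization_setup_from_labels\<close>).

  \<^emph>\<open>Smallness.\<close>  Relative cell complexes are objectwise embeddings whose image is a union of components
  (\<open>cell_good\<close>).  For the generating maps this holds because \<open>D\<close> acts on the factor \<open>T\<close> only.
  Now consider a map from \<open>T \<otimes> K\<close> to the colimit of a sequence of such maps, and fix a vertex \<open>t\<close> of \<open>T\<close>.
  The points of \<open>K\<close> are bounded in number independently of \<open>T\<close>, so if the sequence is sufficiently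
  filtered then the values at the points \<open>(t, k)\<close> all come from one stage.  Every other point of \<open>T \<otimes> K\<close> is
  in the component of such a point, so its value comes from the same stage, and the map factors
  (\<open>tensor_small_relative\<close>).

  \<^emph>\<open>The two models.\<close>  For simplicial sets the internal homs are function complexes.  For spaces they carry the
  k-ification of a compact-open topology, and embeddings are recognized by extending maps to the indiscrete
  and the Sierpinski space.  The remaining input is that \<open>|K| \<rightarrow> |\<Delta>\<^sup>n|\<close> is a closed embedding of compact
  Hausdorff spaces for a subcomplex \<open>K\<close> of \<open>\<Delta>\<^sup>n\<close>; it rests on the fact that a point of \<open>|K|\<close> is
  determined by its barycentric coordinates (\<open>real_eq_iff\<close>).
\<close>


section \<open>Arithmetic of small sets\<close>

lemma small_ordLeq: "|A| \<le>o |B| ==> small U B ==> small U A"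
  unfolding small_def by (rule ordLeq_ordLess_trans)

lemma small_subset: "small U B ==> A \<subseteq> B ==> small U A"
  by (rule small_ordLeq[OF card_of_mono1])

lemma small_image: "small U A ==> small U (f ` A)"
  by (rule small_ordLeq[OF card_of_image])

lemma small_inj_on: "inj_on f A ==> f ` A \<subseteq> B ==> small U B ==> small U A"
  using small_ordLeq card_of_ordLeq by blast

lemma small_embedding:
  assumes "small (U :: 'u itself) A"
  obtains f :: "'a => 'u" where "inj_on f A"
  using assms card_of_ordLeq[of A "UNIV :: 'u set"] ordLess_imp_ordLeq
  unfolding small_def by blast

context
  fixes U :: "'u itself"
  assumes inaccessible: "inaccessible U"
begin

lemma infinite_universe: "infinite (UNIV :: 'u set)"
proof -
  have "|UNIV :: nat set| \<le>o |UNIV :: 'u set|"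
    using inaccessible ordLess_imp_ordLeq unfolding inaccessible_def by blast
  then show ?thesis using infinite_iff_card_of_nat by blast
qed

lemma small_UN: "small U I ==> (\<And>i. i \<in> I ==> small U (A i)) ==> small U (\<Union>i\<in>I. A i)"
  unfolding small_def
  using inaccessible infinite_universe
  by (intro card_of_UNION_ordLess_infinite_Field_regularCard)
     (simp_all add: inaccessible_def cinfinite_def Field_card_of card_of_card_order_on)

lemma small_singleton: "small U {x}"
proof -
  have "|{x}| <o |UNIV :: 'u set|"
    by (rule finite_ordLess_infinite2) (use infinite_universe in auto)
  then show ?thesis by (simp add: small_def)
qed

lemma small_Sigma: "small U I ==> (\<And>i. i \<in> I ==> small U (A i)) ==> small U (Sigma I A)"
  unfolding Sigma_def by (intro small_UN small_singleton)

lemma small_Times: "small U A ==> small U B ==> small U (A \<times> B)"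
  by (rule small_Sigma)

lemma small_Pow:
  assumes "small U A" shows "small U (Pow A)"
proof -
  obtain f :: "_ => 'u" where f: "inj_on f A" using small_embedding[OF assms] .
  have "small U (f ` A)" using assms by (rule small_image)
  then have "small U (Pow (f ` A))"
    using inaccessible unfolding inaccessible_def small_def by blast
  then show ?thesis
    by (rule small_inj_on[rotated 2, of _ _ "image f"])
       (use f in \<open>auto simp: inj_on_def[of "image f"] inj_on_image_eq_iff\<close>)
qed

lemma small_countable: "countable A ==> small U A"
proof -
  assume "countable A"
  then obtain f :: "_ => nat" where "inj_on f A" by (auto simp: countable_def)
  then have "|A| \<le>o |UNIV :: nat set|" using card_of_ordLeq by blast
  moreover have "small U (UNIV :: nat set)"
    using inaccessible unfolding inaccessible_def small_def by blast
  ultimately show "small U A" by (rule small_ordLeq)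
qed

lemma small_PiE:
  assumes "small U A" "small U B"
  shows "small U (A \<rightarrow>\<^sub>E B)"
proof (rule small_inj_on)
  show "inj_on (\<lambda>f. (\<lambda>x. (x, f x)) ` A) (A \<rightarrow>\<^sub>E B)"
  proof (rule inj_onI)
    fix f g assume f: "f \<in> A \<rightarrow>\<^sub>E B" and g: "g \<in> A \<rightarrow>\<^sub>E B"
      and eq: "(\<lambda>x. (x, f x)) ` A = (\<lambda>x. (x, g x)) ` A"
    show "f = g"
      by (rule PiE_ext[OF f g]) (use eq in \<open>auto simp: set_eq_iff image_iff\<close>)
  qed
  show "(\<lambda>f. (\<lambda>x. (x, f x)) ` A) ` (A \<rightarrow>\<^sub>E B) \<subseteq> Pow (A \<times> B)" by (auto simp: PiE_def)
  show "small U (Pow (A \<times> B))" by (intro small_Pow small_Times assms)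
qed

text \<open>A real number is determined by the rationals below it.\<close>

lemma small_reals: "small U (UNIV :: (nat => real) set)"
proof (rule small_inj_on)
  show "inj (\<lambda>f :: nat => real. {(n, q :: rat). of_rat q < f n})"
  proof (rule injI)
    fix f g :: "nat => real"
    assume eq: "{(n, q :: rat). of_rat q < f n} = {(n, q). of_rat q < g n}"
    have *: "f' n \<le> g' n" if "{(n, q :: rat). of_rat q < f' n} = {(n, q). of_rat q < g' n}"
      for n and f' g' :: "nat => real"
    proof (rule ccontr)
      assume "\<not> f' n \<le> g' n"
      then obtain q where "g' n < of_rat q" "of_rat q < f' n" using of_rat_dense[of "g' n" "f' n"] by auto
      with that show False by (auto simp: set_eq_iff not_less dest: spec[of _ n] spec[of _ q])
    qed
    show "f = g" using *[OF eq] *[OF eq[symmetric]] by (auto simp: fun_eq_iff intro: antisym)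
  qed
  show "small U (Pow (UNIV :: (nat \<times> rat) set))" by (intro small_Pow small_countable) simp
qed auto

lemma small_simplex_points: "small U (UNIV :: (nat \<times> nat list \<times> (nat => real)) set)"
proof -
  have "small U ((UNIV :: nat set) \<times> (UNIV :: nat list set) \<times> (UNIV :: (nat => real) set))"
    by (intro small_Times small_reals small_countable) auto
  then show ?thesis by (rule small_subset) auto
qed

end

lemma operator_comp: "\<phi> \<in> operators l m ==> \<theta> \<in> operators m n ==> map ((!) \<theta>) \<phi> \<in> operators l n"
proof -
  assume \<phi>: "\<phi> \<in> operators l m" and \<theta>: "\<theta> \<in> operators m n"
  have lt: "i < length \<theta>" if "i \<in> set \<phi>" for i
    using that \<phi> \<theta> by (auto simp: operators_def)
  have "sorted_wrt (\<lambda>i j. \<theta> ! i \<le> \<theta> ! j) \<phi>"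
    by (rule sorted_wrt_mono_rel[of \<phi> "(\<le>)"])
      (use \<phi> \<theta> lt in \<open>auto simp: operators_def sorted_nth_mono\<close>)
  then have "sorted (map ((!) \<theta>) \<phi>)" by (simp add: sorted_map)
  moreover have "\<theta> ! i \<le> n" if "i \<in> set \<phi>" for i
    using nth_mem[OF lt[OF that]] \<theta> by (auto simp: operators_def)
  ultimately show ?thesis using \<phi> by (auto simp: operators_def)
qed


section \<open>Categories with an instrumentation\<close>

locale abstract_category =
  fixes C :: "('o, 'f, 'z) category_scheme"
  assumes mor_obj: "f \<in> Mor C ==> Dom f \<in> Obj C \<and> Cod f \<in> Obj C"
    and ident_hom: "a \<in> Obj C ==> Ident C a \<in> Hom C a a"
    and cmp_hom: "f \<in> Hom C a b ==> g \<in> Hom C b c ==> g \<cdot>\<^bsub>C\<^esub> f \<in> Hom C a c"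
    and ident_left: "f \<in> Hom C a b ==> Ident C b \<cdot>\<^bsub>C\<^esub> f = f"
    and ident_right: "f \<in> Hom C a b ==> f \<cdot>\<^bsub>C\<^esub> Ident C a = f"
    and cmp_assoc: "f \<in> Hom C a b ==> g \<in> Hom C b c ==> h \<in> Hom C c d ==>
        (h \<cdot>\<^bsub>C\<^esub> g) \<cdot>\<^bsub>C\<^esub> f = h \<cdot>\<^bsub>C\<^esub> (g \<cdot>\<^bsub>C\<^esub> f)"

lemma HomI: "f \<in> Mor C ==> Dom f = a ==> Cod f = b ==> f \<in> Hom C a b"
  by (simp add: Hom_def)

text \<open>
  A factorization setup arises from labelled arrows: the labels of an object are transported along
  morphisms, and the squares over a morphism are chosen functorially in the label.  Since a functor
  to the category of subsets acts on the arrows themselves, an arrow has to determine its label.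
\<close>

lemma factorization_setup_from_labels:
  fixes C :: "('o, 'f, 'z) category_scheme" and U :: "'u itself"
  assumes obj: "P \<subseteq> Obj C"
    and mor: "\<And>g. g \<in> Mor C ==> Dom g \<in> Obj C \<and> Cod g \<in> Obj C"
    and ident: "\<And>c. c \<in> Obj C ==> Ident C c \<in> Hom C c c"
    and cmp: "\<And>f g. f \<in> Mor C ==> g \<in> Mor C ==> Cod f = Dom g ==>
        g \<cdot>\<^bsub>C\<^esub> f \<in> Hom C (Dom f) (Cod g)"
    and arr: "\<And>c l. c \<in> Obj C ==> l \<in> L c ==> \<phi> c l \<in> arrows_into C P c"
    and inj: "\<And>c. c \<in> Obj C ==> inj_on (\<phi> c) (L c)"
    and small: "\<And>c. c \<in> Obj C ==> small U (L c)"
    and fact: "\<And>c. c \<in> Obj C ==> factorization_property C P c (\<phi> c ` L c)"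
    and lm: "\<And>g l. g \<in> Mor C ==> l \<in> L (Dom g) ==> lm g l \<in> L (Cod g)"
    and hm: "\<And>g l. g \<in> Mor C ==> l \<in> L (Dom g) ==>
        hm g l \<in> Hom C (Dom (\<phi> (Dom g) l)) (Dom (\<phi> (Cod g) (lm g l)))"
    and comm: "\<And>g l. g \<in> Mor C ==> l \<in> L (Dom g) ==>
        \<phi> (Cod g) (lm g l) \<cdot>\<^bsub>C\<^esub> hm g l = g \<cdot>\<^bsub>C\<^esub> \<phi> (Dom g) l"
    and lm_id: "\<And>c l. c \<in> Obj C ==> l \<in> L c ==> lm (Ident C c) l = l"
    and hm_id: "\<And>c l. c \<in> Obj C ==> l \<in> L c ==> hm (Ident C c) l = Ident C (Dom (\<phi> c l))"
    and lm_cmp: "\<And>f g l. f \<in> Mor C ==> g \<in> Mor C ==> Cod f = Dom g ==> l \<in> L (Dom f) ==>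
        lm (g \<cdot>\<^bsub>C\<^esub> f) l = lm g (lm f l)"
    and hm_cmp: "\<And>f g l. f \<in> Mor C ==> g \<in> Mor C ==> Cod f = Dom g ==> l \<in> L (Dom f) ==>
        hm (g \<cdot>\<^bsub>C\<^esub> f) l = hm g (lm f l) \<cdot>\<^bsub>C\<^esub> hm f l"
  shows "locally_small U C P \<and> (\<exists>Fo Fm. factorization_setup U C P Fo Fm)"
proof -
  define Fo where "Fo = (\<lambda>c. \<phi> c ` L c)"
  define lab where "lab = (\<lambda>c. inv_into (L c) (\<phi> c))"
  define sq where "sq = (\<lambda>g l. Arrow (\<phi> (Dom g) l) (hm g l, g) (\<phi> (Cod g) (lm g l)))"
  define Fm where "Fm = (\<lambda>g. Arrow (Fo (Dom g))
      (\<lambda>\<psi>\<in>Fo (Dom g). sq g (lab (Dom g) \<psi>)) (Fo (Cod g)))"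
  have lab: "lab c (\<phi> c l) = l" if "c \<in> Obj C" "l \<in> L c" for c l
    using that inj by (simp add: lab_def)
  have Fm_app: "Fn (Fm g) (\<phi> (Dom g) l) = sq g l" if "g \<in> Mor C" "l \<in> L (Dom g)" for g l
    using that mor lab by (auto simp: Fm_def Fo_def)
  have into: "Fo c \<subseteq> arrows_into C P c" if "c \<in> Obj C" for c
    using arr that by (auto simp: Fo_def)
  have Fo_mor: "Fo c \<subseteq> Mor C" if "c \<in> Obj C" for c
    using into[OF that] by (auto simp: arrows_into_def)
  have Fo_small: "small U (Fo c)" if "c \<in> Obj C" for c
    using small[OF that] unfolding Fo_def by (rule small_image)
  have sq_mor: "sq g l \<in> Mor (MapCat C)" if g: "g \<in> Mor C" and l: "l \<in> L (Dom g)" for g l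
    using g l mor[OF g] arr[of "Dom g" l] arr[of "Cod g" "lm g l"] lm[OF g l] hm[OF g l] comm[OF g l]
    by (auto simp: sq_def MapCat_def arrows_into_def HomI)
  have Fm_hom: "Fm g \<in> Hom (PowCat U (MapCat C)) (Fo (Dom g)) (Fo (Cod g))" if g: "g \<in> Mor C" for g
  proof -
    have "Fo (Dom g) \<subseteq> Mor C" "Fo (Cod g) \<subseteq> Mor C" "small U (Fo (Dom g))" "small U (Fo (Cod g))"
      using Fo_mor Fo_small mor[OF g] by auto
    moreover have "Fn (Fm g) \<psi> \<in> Mor (MapCat C) \<and> Dom (Fn (Fm g) \<psi>) = \<psi> \<and> Cod (Fn (Fm g) \<psi>) \<in> Fo (Cod g)"
      if psi: "\<psi> \<in> Fo (Dom g)" for \<psi>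
    proof -
      obtain l where l: "l \<in> L (Dom g)" "\<psi> = \<phi> (Dom g) l" using psi by (auto simp: Fo_def)
      show ?thesis using Fm_app[OF g l(1)] sq_mor[OF g l(1)] lm[OF g l(1)] l
        by (auto simp: sq_def Fo_def)
    qed
    ultimately show ?thesis
      by (auto simp: Hom_def PowCat_def Fm_def MapCat_def)
  qed
  have "is_functor C (PowCat U (MapCat C)) Fo Fm"
    unfolding is_functor_def
  proof (intro conjI ballI impI)
    fix c assume c: "c \<in> Obj C"
    show "Fo c \<in> Obj (PowCat U (MapCat C))"
      using Fo_mor[OF c] Fo_small[OF c] by (simp add: PowCat_def MapCat_def)
    have I: "Ident C c \<in> Mor C" "Dom (Ident C c) = c" "Cod (Ident C c) = c"
      using ident[OF c] by (auto simp: Hom_def)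
    have "sq (Ident C c) (lab c \<psi>) = Ident (MapCat C) \<psi>" if psi: "\<psi> \<in> Fo c" for \<psi>
    proof -
      obtain l where l: "l \<in> L c" "\<psi> = \<phi> c l" using psi by (auto simp: Fo_def)
      show ?thesis using arr[OF c l(1)] lab[OF c l(1)] lm_id[OF c l(1)] hm_id[OF c l(1)] l I
        by (simp add: sq_def MapCat_def arrows_into_def)
    qed
    then show "Fm (Ident C c) = Ident (PowCat U (MapCat C)) (Fo c)"
      unfolding Fm_def I by (simp add: PowCat_def cong: restrict_cong)
  next
    fix g assume "g \<in> Mor C"
    then show "Fm g \<in> Hom (PowCat U (MapCat C)) (Fo (Dom g)) (Fo (Cod g))" by (rule Fm_hom)
  next
    fix f g assume f: "f \<in> Mor C" and g: "g \<in> Mor C" and fg: "Cod f = Dom g"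
    have gf: "g \<cdot>\<^bsub>C\<^esub> f \<in> Mor C" "Dom (g \<cdot>\<^bsub>C\<^esub> f) = Dom f" "Cod (g \<cdot>\<^bsub>C\<^esub> f) = Cod g"
      using cmp[OF f g fg] by (auto simp: Hom_def)
    have "sq (g \<cdot>\<^bsub>C\<^esub> f) (lab (Dom f) \<psi>) =
        Fn (Fm g) (Cod (Fn (Fm f) \<psi>)) \<cdot>\<^bsub>MapCat C\<^esub> Fn (Fm f) \<psi>" if psi: "\<psi> \<in> Fo (Dom f)" for \<psi>
    proof -
      obtain l where l: "l \<in> L (Dom f)" "\<psi> = \<phi> (Dom f) l" using psi by (auto simp: Fo_def)
      have l': "lm f l \<in> L (Dom g)" using lm[OF f l(1)] fg by simp
      have "Cod (Fn (Fm f) \<psi>) = \<phi> (Dom g) (lm f l)"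
        using Fm_app[OF f l(1)] l fg by (simp add: sq_def)
      then show ?thesis
        using Fm_app[OF f l(1)] Fm_app[OF g l'] lab[of "Dom f" l] mor[OF f] l gf
          lm_cmp[OF f g fg l(1)] hm_cmp[OF f g fg l(1)]
        by (simp add: sq_def MapCat_def)
    qed
    then have "Fm (g \<cdot>\<^bsub>C\<^esub> f) = Arrow (Fo (Dom f))
        (\<lambda>\<psi>\<in>Fo (Dom f). Fn (Fm g) (Cod (Fn (Fm f) \<psi>)) \<cdot>\<^bsub>MapCat C\<^esub> Fn (Fm f) \<psi>) (Fo (Cod g))"
      by (subst Fm_def) (simp add: gf cong: restrict_cong)
    moreover have "Dom (Fm f) = Fo (Dom f)" "Cod (Fm g) = Fo (Cod g)" by (simp_all add: Fm_def)
    ultimately show "Fm (g \<cdot>\<^bsub>C\<^esub> f) = Fm g \<cdot>\<^bsub>PowCat U (MapCat C)\<^esub> Fm f"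
      by (simp add: PowCat_def)
  qed
  moreover have "locally_small U C P"
    unfolding locally_small_def
  proof (intro conjI ballI)
    fix c assume "c \<in> Obj C"
    then show "\<exists>\<Psi>\<subseteq>arrows_into C P c. small U \<Psi> \<and> factorization_property C P c \<Psi>"
      using into Fo_small fact by (intro exI[of _ "Fo c"]) (simp add: Fo_def)
  qed (rule obj)
  moreover have "\<forall>f \<in> Mor C. \<forall>\<psi> \<in> Fo (Dom f).
       Dom (Fn (Fm f) \<psi>) = \<psi> \<and> Cod (Fn (Fm f) \<psi>) \<in> Fo (Cod f) \<and> snd (Fn (Fn (Fm f) \<psi>)) = f"
  proof (intro ballI)
    fix f \<psi> assume f: "f \<in> Mor C" and "\<psi> \<in> Fo (Dom f)"
    then obtain l where l: "l \<in> L (Dom f)" "\<psi> = \<phi> (Dom f) l" by (auto simp: Fo_def)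
    show "Dom (Fn (Fm f) \<psi>) = \<psi> \<and> Cod (Fn (Fm f) \<psi>) \<in> Fo (Cod f) \<and> snd (Fn (Fn (Fm f) \<psi>)) = f"
      using Fm_app[OF f l(1)] lm[OF f l(1)] l by (simp add: sq_def Fo_def)
  qed
  ultimately have "factorization_setup U C P Fo Fm"
    unfolding factorization_setup_def using into fact by (auto simp: Fo_def)
  then show ?thesis using \<open>locally_small U C P\<close> by blast
qed

lemma well_order_facts:
  assumes "Well_order r"
  shows "i \<in> Field r ==> (i, i) \<in> r"
    and "(i, j) \<in> r ==> (j, k) \<in> r ==> (i, k) \<in> r"
    and "(i, j) \<in> r ==> (j, i) \<in> r ==> i = j"
    and "i \<in> Field r ==> j \<in> Field r ==> (i, j) \<in> r \<or> (j, i) \<in> r"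
    and "wf (r - Id)"
proof -
  interpret wo_rel r by (rule wo_rel.intro) (rule assms)
  show "i \<in> Field r ==> (i, i) \<in> r" using REFL by (rule refl_onD)
  show "(i, j) \<in> r ==> (j, k) \<in> r ==> (i, k) \<in> r" using TRANS by (rule transD)
  show "(i, j) \<in> r ==> (j, i) \<in> r ==> i = j" using ANTISYM by (rule antisymD)
  show "i \<in> Field r ==> j \<in> Field r ==> (i, j) \<in> r \<or> (j, i) \<in> r" using TOTALS by blast
  show "wf (r - Id)" by (rule WF)
qed

lemma some_eq_imp: "\<exists>w. Q w ==> u = (SOME w. Q w) ==> Q u"
  by (simp add: someI_ex)

text \<open>
  \<open>Z\<close> is injective relative to \<open>j\<close>.  The property passes to pushouts and transfinite compositions, which is
  why embeddings will be expressed through it.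
\<close>

definition extends :: "('o, 'f, 'z) category_scheme => 'o => ('o, 'f) arrow => bool" where
  "extends C Z j \<longleftrightarrow> (\<forall>v \<in> Hom C (Dom j) Z. \<exists>w \<in> Hom C (Cod j) Z. w \<cdot>\<^bsub>C\<^esub> j = v)"

context abstract_category
begin

lemma extends_pushout:
  assumes "is_pushout C i f g j" "extends C Z i"
  shows "extends C Z j"
  unfolding extends_def
proof
  fix v assume v: "v \<in> Hom C (Dom j) Z"
  have P: "i \<in> Mor C" "f \<in> Hom C (Dom i) (Cod f)" "g \<in> Hom C (Cod i) (Cod j)"
    "j \<in> Hom C (Cod f) (Cod j)"
    and univ: "\<And>e g' j'. g' \<in> Hom C (Cod i) e ==> j' \<in> Hom C (Cod f) e ==>
      g' \<cdot>\<^bsub>C\<^esub> i = j' \<cdot>\<^bsub>C\<^esub> f ==> \<exists>!u. u \<in> Hom C (Cod j) e \<and> g' = u \<cdot>\<^bsub>C\<^esub> g \<and> j' = u \<cdot>\<^bsub>C\<^esub> j"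
    using assms(1) unfolding is_pushout_def by blast+
  have v': "v \<in> Hom C (Cod f) Z" using v P(4) by (simp add: Hom_def)
  then have "v \<cdot>\<^bsub>C\<^esub> f \<in> Hom C (Dom i) Z" using P(2) cmp_hom by blast
  then obtain w where "w \<in> Hom C (Cod i) Z" "w \<cdot>\<^bsub>C\<^esub> i = v \<cdot>\<^bsub>C\<^esub> f"
    using assms(2) unfolding extends_def by blast
  from univ[OF this(1) v' this(2)] show "\<exists>w \<in> Hom C (Cod j) Z. w \<cdot>\<^bsub>C\<^esub> j = v" by blast
qed

lemma functor_at:
  assumes "ordinal_functor C r X x"
  shows "i \<in> Field r ==> X i \<in> Obj C" "i \<in> Field r ==> x i i = Ident C (X i)"
    "(i, j) \<in> r ==> x i j \<in> Hom C (X i) (X j)"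
    "(i, j) \<in> r ==> (j, k) \<in> r ==> x i k = x j k \<cdot>\<^bsub>C\<^esub> x i j"
  using assms unfolding ordinal_functor_def by blast+

text \<open>
  Extension along the stages of a transfinite sequence: extend at successors, take the map induced
  on the colimit at limits.
\<close>

lemma extend_cocone:
  fixes r :: "'i rel"
  assumes r: "Well_order r" and seq: "sequence C r X x"
    and ext: "\<And>i j. successor_in r i j ==> extends C Z (x i j)"
    and i0: "i0 \<in> Field r" and v: "v \<in> Hom C (X i0) Z"
  shows "\<exists>u. cocone C r (Field r) X x Z u \<and> u i0 = v"
proof -
  have fu: "ordinal_functor C r X x"
    and lim: "\<And>j. limit_in r j ==> is_colimit C r (underS r j) X x (X j) (\<lambda>i. x i j)"
    using seq unfolding sequence_def by auto
  note at = functor_at[OF fu]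
  have refl: "\<And>i. i \<in> Field r ==> (i, i) \<in> r"
    and trans: "\<And>i j k. (i, j) \<in> r ==> (j, k) \<in> r ==> (i, k) \<in> r"
    and antisym: "\<And>i j. (i, j) \<in> r ==> (j, i) \<in> r ==> i = j"
    and total: "\<And>i j. i \<in> Field r ==> j \<in> Field r ==> (i, j) \<in> r \<or> (j, i) \<in> r"
    and wf: "wf (r - Id)"
    using well_order_facts[OF r] by blast+
  have field: "i \<in> Field r \<and> j \<in> Field r" if "(i, j) \<in> r" for i j
    using that by (auto simp: Field_def)
  have Z: "Z \<in> Obj C" using v mor_obj by (auto simp: Hom_def)
  have below: "(l, k) \<in> r" if "successor_in r k i" "(l, i) \<in> r" "l \<noteq> i" for k l i
    using that total[of l k] antisym[of l i] field unfolding successor_in_def by blast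
  have pred: "(THE k. successor_in r k i) = k" if "successor_in r k i" for k i
    using that below antisym unfolding successor_in_def by (intro the_equality) (blast, metis)
  define F where "F = (\<lambda>f i. if (i, i0) \<in> r then v \<cdot>\<^bsub>C\<^esub> x i i0
     else if \<exists>k. successor_in r k i then
       (SOME w. w \<in> Hom C (X i) Z \<and> w \<cdot>\<^bsub>C\<^esub> x (THE k. successor_in r k i) i = f (THE k. successor_in r k i))
     else (SOME w. w \<in> Hom C (X i) Z \<and> (\<forall>k \<in> underS r i. f k = w \<cdot>\<^bsub>C\<^esub> x k i)))"
  define u where "u = wfrec (r - Id) F"
  have u: "u i = F (cut u (r - Id) i) i" for i
    unfolding u_def using wf by (subst wfrec) auto
  have main: "u i \<in> Hom C (X i) Z \<and> (\<forall>k. (k, i) \<in> r \<longrightarrow> u k = u i \<cdot>\<^bsub>C\<^esub> x k i)"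
    if "i \<in> Field r" for i
    using that
  proof (induction i rule: wf_induct_rule[OF wf])
    case (1 i)
    have IH: "u k \<in> Hom C (X k) Z" "\<And>l. (l, k) \<in> r ==> u l = u k \<cdot>\<^bsub>C\<^esub> x l k"
      if "(k, i) \<in> r" "k \<noteq> i" for k
      using 1 that field by blast+
    show ?case
    proof (cases "(i, i0) \<in> r")
      case True
      have ui: "u k = v \<cdot>\<^bsub>C\<^esub> x k i0" if "(k, i0) \<in> r" for k
        using that by (subst u) (simp add: F_def)
      show ?thesis
      proof (intro conjI allI impI)
        show "u i \<in> Hom C (X i) Z" unfolding ui[OF True] using at(3)[OF True] v cmp_hom by blast
        fix k assume k: "(k, i) \<in> r"
        show "u k = u i \<cdot>\<^bsub>C\<^esub> x k i"
          unfolding ui[OF True] ui[OF trans[OF k True]] at(4)[OF k True]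
          using cmp_assoc[OF at(3)[OF k] at(3)[OF True] v] by simp
      qed
    next
      case notle: False
      show ?thesis
      proof (cases "\<exists>k. successor_in r k i")
        case True
        then obtain k where k: "successor_in r k i" by blast
        then have ki: "(k, i) \<in> r" "k \<noteq> i" by (auto simp: successor_in_def)
        have "\<exists>w. w \<in> Hom C (X i) Z \<and> w \<cdot>\<^bsub>C\<^esub> x k i = u k"
          using ext[OF k] IH(1)[OF ki] at(3)[OF ki(1)] unfolding extends_def by (auto simp: Hom_def)
        moreover have "u i = (SOME w. w \<in> Hom C (X i) Z \<and> w \<cdot>\<^bsub>C\<^esub> x k i = u k)"
          using notle True ki by (subst u) (simp add: F_def pred[OF k] cut_apply)
        ultimately have "u i \<in> Hom C (X i) Z \<and> u i \<cdot>\<^bsub>C\<^esub> x k i = u k"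
          by (rule some_eq_imp)
        then have w: "u i \<in> Hom C (X i) Z" "u i \<cdot>\<^bsub>C\<^esub> x k i = u k" by auto
        have "u l = u i \<cdot>\<^bsub>C\<^esub> x l i" if l: "(l, i) \<in> r" for l
        proof (cases "l = i")
          case True
          then show ?thesis using at(2) ident_right[OF w(1)] 1(2) by simp
        next
          case False
          then have lk: "(l, k) \<in> r" using below[OF k l] by simp
          show ?thesis
            unfolding IH(2)[OF ki lk] at(4)[OF lk ki(1)]
            using cmp_assoc[OF at(3)[OF lk] at(3)[OF ki(1)] w(1)] w(2) by simp
        qed
        then show ?thesis using w by blast
      next
        case False
        have "i0 \<in> underS r i"
          using notle total[OF i0 1(2)] refl[OF i0] by (auto simp: underS_def)
        then have "limit_in r i" using False 1(2) unfolding limit_in_def by blast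
        then have col: "is_colimit C r (underS r i) X x (X i) (\<lambda>k. x k i)" by (rule lim)
        have "cocone C r (underS r i) X x Z u"
          unfolding cocone_def using Z IH by (auto simp: underS_def)
        then have "\<exists>w. w \<in> Hom C (X i) Z \<and> (\<forall>k \<in> underS r i. u k = w \<cdot>\<^bsub>C\<^esub> x k i)"
          using col unfolding is_colimit_def by blast
        moreover have "u i = (SOME w. w \<in> Hom C (X i) Z \<and> (\<forall>k \<in> underS r i. u k = w \<cdot>\<^bsub>C\<^esub> x k i))"
          using notle False
          by (subst u) (auto simp: F_def cut_apply underS_def intro!: arg_cong[where f = Eps])
        ultimately have "u i \<in> Hom C (X i) Z \<and> (\<forall>k \<in> underS r i. u k = u i \<cdot>\<^bsub>C\<^esub> x k i)"
          by (rule some_eq_imp)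
        then have w: "u i \<in> Hom C (X i) Z" "\<forall>k \<in> underS r i. u k = u i \<cdot>\<^bsub>C\<^esub> x k i" by auto
        have "u l = u i \<cdot>\<^bsub>C\<^esub> x l i" if l: "(l, i) \<in> r" for l
        proof (cases "l = i")
          case True
          then show ?thesis using at(2) ident_right[OF w(1)] 1(2) by simp
        next
          case False
          then show ?thesis using w(2) l by (auto simp: underS_def)
        qed
        then show ?thesis using w by blast
      qed
    qed
  qed
  have "u i0 = v"
    using at(2)[OF i0] ident_right[OF v] refl[OF i0] by (subst u) (simp add: F_def)
  moreover have "cocone C r (Field r) X x Z u"
    unfolding cocone_def using Z main by blast
  ultimately show ?thesis by blast
qed

lemma extends_stage:
  assumes "Well_order r" "sequence C r X x"
    and "\<And>i j. successor_in r i j ==> extends C Z (x i j)"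
    and ij: "(i, j) \<in> r"
  shows "extends C Z (x i j)"
proof -
  have ij': "i \<in> Field r" "j \<in> Field r" using ij by (auto simp: Field_def)
  have x: "x i j \<in> Hom C (X i) (X j)"
    using assms(2) ij unfolding sequence_def ordinal_functor_def by blast
  show ?thesis
    unfolding extends_def
  proof
    fix v assume "v \<in> Hom C (Dom (x i j)) Z"
    then have "v \<in> Hom C (X i) Z" using x by (simp add: Hom_def)
    then obtain u where u: "cocone C r (Field r) X x Z u" "u i = v"
      using extend_cocone[OF assms(1-3) ij'(1)] by blast
    show "\<exists>w \<in> Hom C (Cod (x i j)) Z. w \<cdot>\<^bsub>C\<^esub> x i j = v"
      using u ij ij' x unfolding cocone_def by (intro bexI[of _ "u j"]) (auto simp: Hom_def)
  qed
qed

lemma extends_colimit: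
  assumes "Well_order r" "sequence C r X x"
    and "\<And>i j. successor_in r i j ==> extends C Z (x i j)"
    and col: "is_colimit C r (Field r) X x c q" and i: "i \<in> Field r"
  shows "extends C Z (q i)"
  unfolding extends_def
proof
  have q: "q i \<in> Hom C (X i) c" using col i unfolding is_colimit_def cocone_def by blast
  fix v assume "v \<in> Hom C (Dom (q i)) Z"
  then have "v \<in> Hom C (X i) Z" using q by (simp add: Hom_def)
  then obtain u where u: "cocone C r (Field r) X x Z u" "u i = v"
    using extend_cocone[OF assms(1-3) i] by blast
  then obtain w where "w \<in> Hom C c Z" "\<forall>i \<in> Field r. u i = w \<cdot>\<^bsub>C\<^esub> q i"
    using col unfolding is_colimit_def by blast
  then show "\<exists>w \<in> Hom C (Cod (q i)) Z. w \<cdot>\<^bsub>C\<^esub> q i = v"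
    using u i q by (intro bexI[of _ w]) (auto simp: Hom_def)
qed

text \<open>
  If all maps to the colimit are monic, two maps into stages are identified in the colimit of
  the hom sets exactly when they agree after composition with the maps to the colimit.
\<close>

lemma bij_betw_hom_colimit:
  assumes r: "Well_order r" and fu: "ordinal_functor C r X x"
    and co: "cocone C r (Field r) X x c q"
    and mono: "\<And>i g h. i \<in> Field r ==> g \<in> Hom C a (X i) ==> h \<in> Hom C a (X i) ==>
        q i \<cdot>\<^bsub>C\<^esub> g = q i \<cdot>\<^bsub>C\<^esub> h ==> g = h"
    and surj: "\<And>f. f \<in> Hom C a c ==> \<exists>i \<in> Field r. \<exists>g \<in> Hom C a (X i). q i \<cdot>\<^bsub>C\<^esub> g = f"
  shows "bij_betw (\<lambda>K. the_elem ((\<lambda>(i, g). q i \<cdot>\<^bsub>C\<^esub> g) ` K))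
          (hom_union C r X a // hom_rel C r X x a) (Hom C a c)"
proof -
  define e where "e = (\<lambda>(i, g). q i \<cdot>\<^bsub>C\<^esub> g)"
  define H where "H = hom_union C r X a"
  note at = functor_at[OF fu]
  have q: "q i \<in> Hom C (X i) c" if "i \<in> Field r" for i
    using co that unfolding cocone_def by blast
  have field: "i \<in> Field r \<and> j \<in> Field r" if "(i, j) \<in> r" for i j
    using that by (auto simp: Field_def)
  have qx: "q i = q j \<cdot>\<^bsub>C\<^esub> x i j" if "(i, j) \<in> r" for i j
    using co that field[OF that] unfolding cocone_def by blast
  have push: "q i \<cdot>\<^bsub>C\<^esub> g = q k \<cdot>\<^bsub>C\<^esub> (x i k \<cdot>\<^bsub>C\<^esub> g)" if "(i, k) \<in> r" "g \<in> Hom C a (X i)" for i k g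
    unfolding qx[OF that(1)] using cmp_assoc[OF that(2) at(3)[OF that(1)] q] field[OF that(1)] by simp
  have rel: "hom_rel C r X x a = {(p, p'). p \<in> H \<and> p' \<in> H \<and> e p = e p'}"
  proof -
    have key: "(\<exists>k. (i, k) \<in> r \<and> (j, k) \<in> r \<and> x i k \<cdot>\<^bsub>C\<^esub> g = x j k \<cdot>\<^bsub>C\<^esub> h) \<longleftrightarrow> q i \<cdot>\<^bsub>C\<^esub> g = q j \<cdot>\<^bsub>C\<^esub> h"
      if i: "i \<in> Field r" and j: "j \<in> Field r" and g: "g \<in> Hom C a (X i)" and h: "h \<in> Hom C a (X j)"
      for i j g h
    proof
      assume "\<exists>k. (i, k) \<in> r \<and> (j, k) \<in> r \<and> x i k \<cdot>\<^bsub>C\<^esub> g = x j k \<cdot>\<^bsub>C\<^esub> h"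
      then show "q i \<cdot>\<^bsub>C\<^esub> g = q j \<cdot>\<^bsub>C\<^esub> h" using push g h by metis
    next
      assume eq: "q i \<cdot>\<^bsub>C\<^esub> g = q j \<cdot>\<^bsub>C\<^esub> h"
      have "\<exists>k. (i, k) \<in> r \<and> (j, k) \<in> r"
        using well_order_facts(1)[OF r] well_order_facts(4)[OF r i j] i j by blast
      then obtain k where k: "(i, k) \<in> r" "(j, k) \<in> r" by blast
      have "x i k \<cdot>\<^bsub>C\<^esub> g = x j k \<cdot>\<^bsub>C\<^esub> h"
      proof (rule mono)
        show "k \<in> Field r" using field[OF k(1)] by blast
        show "x i k \<cdot>\<^bsub>C\<^esub> g \<in> Hom C a (X k)" by (rule cmp_hom[OF g at(3)[OF k(1)]])
        show "x j k \<cdot>\<^bsub>C\<^esub> h \<in> Hom C a (X k)" by (rule cmp_hom[OF h at(3)[OF k(2)]])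
        show "q k \<cdot>\<^bsub>C\<^esub> (x i k \<cdot>\<^bsub>C\<^esub> g) = q k \<cdot>\<^bsub>C\<^esub> (x j k \<cdot>\<^bsub>C\<^esub> h)"
          using eq push[OF k(1) g] push[OF k(2) h] by (simp only:)
      qed
      with k show "\<exists>k. (i, k) \<in> r \<and> (j, k) \<in> r \<and> x i k \<cdot>\<^bsub>C\<^esub> g = x j k \<cdot>\<^bsub>C\<^esub> h" by blast
    qed
    have "((i, g), (j, h)) \<in> hom_rel C r X x a \<longleftrightarrow>
        (i, g) \<in> H \<and> (j, h) \<in> H \<and> e (i, g) = e (j, h)" for i g j h
    proof (cases "(i, g) \<in> H \<and> (j, h) \<in> H")
      case True
      then show ?thesis
        using key[of i j g h] by (simp add: hom_rel_def H_def e_def hom_union_def)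
    next
      case False
      then show ?thesis by (auto simp: hom_rel_def H_def)
    qed
    then show ?thesis by (auto simp: set_eq_iff)
  qed
  have cls: "the_elem (e ` (hom_rel C r X x a `` {p})) = e p" if "p \<in> H" for p
  proof -
    have "e ` (hom_rel C r X x a `` {p}) = {e p}" using that unfolding rel by auto
    then show ?thesis by simp
  qed
  show ?thesis
    unfolding bij_betw_def e_def[symmetric] H_def[symmetric]
  proof
    show "inj_on (\<lambda>K. the_elem (e ` K)) (H // hom_rel C r X x a)"
      unfolding inj_on_def quotient_def
    proof clarsimp
      fix i g j h assume *: "(i, g) \<in> H" "(j, h) \<in> H"
        "the_elem (e ` hom_rel C r X x a `` {(i, g)}) = the_elem (e ` hom_rel C r X x a `` {(j, h)})"
      then show "hom_rel C r X x a `` {(i, g)} = hom_rel C r X x a `` {(j, h)}"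
        using cls unfolding rel by auto
    qed
    have "(\<lambda>K. the_elem (e ` K)) ` (H // hom_rel C r X x a) =
        (\<lambda>p. the_elem (e ` (hom_rel C r X x a `` {p}))) ` H"
      unfolding quotient_def by blast
    also have "\<dots> = e ` H" using cls by (rule image_cong[OF refl])
    also have "\<dots> = Hom C a c"
    proof
      show "e ` H \<subseteq> Hom C a c" using cmp_hom q by (auto simp: e_def H_def hom_union_def)
      show "Hom C a c \<subseteq> e ` H" using surj by (force simp: e_def H_def hom_union_def)
    qed
    finally show "(\<lambda>K. the_elem (e ` K)) ` (H // hom_rel C r X x a) = Hom C a c" .
  qed
qed

end


section \<open>Concrete models of spaces\<close>

text \<open>
  Simplicial sets and compactly generated spaces are treated together.  An object has a simplicial
  set of points: its simplices, respectively its topological points placed in every dimension with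
  trivial operators.  Morphisms are determined by their values on points.
\<close>

locale concrete_spaces =
  fixes S :: "('o, 'f) spaces"
    and pts :: "'o => nat => 'u element set"
    and rst :: "'o => nat => nat list => 'u element => 'u element"
    and ap :: "('o, 'f) arrow => nat => 'u element => 'u element"
  assumes inaccessible: "inaccessible TYPE('u)"
    and rst_pts [simp]: "X \<in> Obj S ==> \<theta> \<in> operators m n ==> x \<in> pts X n ==> rst X n \<theta> x \<in> pts X m"
    and rst_id [simp]: "X \<in> Obj S ==> x \<in> pts X n ==> rst X n [0..<Suc n] x = x"
    and rst_rst: "X \<in> Obj S ==> \<phi> \<in> operators l m ==> \<theta> \<in> operators m n ==> x \<in> pts X n ==>
        rst X m \<phi> (rst X n \<theta> x) = rst X n (map ((!) \<theta>) \<phi>) x"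
    and small_pts: "X \<in> Obj S ==> small TYPE('u) (pts X m)"
    and mor_obj_S: "f \<in> Mor S ==> Dom f \<in> Obj S \<and> Cod f \<in> Obj S"
    and ap_pts: "f \<in> Mor S ==> x \<in> pts (Dom f) m ==> ap f m x \<in> pts (Cod f) m"
    and ap_rst: "f \<in> Mor S ==> \<theta> \<in> operators m n ==> x \<in> pts (Dom f) n ==>
        ap f m (rst (Dom f) n \<theta> x) = rst (Cod f) n \<theta> (ap f n x)"
    and ap_ext: "f \<in> Mor S ==> g \<in> Mor S ==> Dom f = Dom g ==> Cod f = Cod g ==>
        (\<And>m x. x \<in> pts (Dom f) m ==> ap f m x = ap g m x) ==> f = g"
    and ident_S [simp]: "X \<in> Obj S ==> Ident S X \<in> Mor S" "Dom (Ident S X) = X" "Cod (Ident S X) = X"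
        "x \<in> pts X m ==> ap (Ident S X) m x = x"
    and cmp_S [simp]: "f \<in> Mor S ==> g \<in> Mor S ==> Cod f = Dom g ==> g \<cdot>\<^bsub>S\<^esub> f \<in> Mor S"
        "Dom (g \<cdot>\<^bsub>S\<^esub> f) = Dom f" "Cod (g \<cdot>\<^bsub>S\<^esub> f) = Cod g"
        "x \<in> pts (Dom f) m ==> ap (g \<cdot>\<^bsub>S\<^esub> f) m x = ap g m (ap f m x)"
    and prod_S [simp]: "X \<in> Obj S ==> Y \<in> Obj S ==> Prod S X Y \<in> Obj S"
        "pts (Prod S X Y) m = {Pair x y | x y. x \<in> pts X m \<and> y \<in> pts Y m}"
        "x \<in> pts X n ==> y \<in> pts Y n ==> \<theta> \<in> operators m n ==>
          rst (Prod S X Y) n \<theta> (Pair x y) = Pair (rst X n \<theta> x) (rst Y n \<theta> y)"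
    and pr1_S [simp]: "X \<in> Obj S ==> Y \<in> Obj S ==> Pr1 S X Y \<in> Mor S"
        "Dom (Pr1 S X Y) = Prod S X Y" "Cod (Pr1 S X Y) = X"
        "x \<in> pts X m ==> y \<in> pts Y m ==> ap (Pr1 S X Y) m (Pair x y) = x"
    and pr2_S [simp]: "X \<in> Obj S ==> Y \<in> Obj S ==> Pr2 S X Y \<in> Mor S"
        "Dom (Pr2 S X Y) = Prod S X Y" "Cod (Pr2 S X Y) = Y"
        "x \<in> pts X m ==> y \<in> pts Y m ==> ap (Pr2 S X Y) m (Pair x y) = y"
    and tuple_S [simp]: "f \<in> Mor S ==> g \<in> Mor S ==> Dom f = Dom g ==> Tuple S f g \<in> Mor S"
        "Dom (Tuple S f g) = Dom f" "Cod (Tuple S f g) = Prod S (Cod f) (Cod g)"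
        "x \<in> pts (Dom f) m ==> ap (Tuple S f g) m x = Pair (ap f m x) (ap g m x)"
    and one_S [simp]: "One S \<in> Obj S" "\<exists>s. pts (One S) m = {s}"
    and bang_S [simp]: "X \<in> Obj S ==> Bang S X \<in> Mor S" "Dom (Bang S X) = X" "Cod (Bang S X) = One S"
    and point_map: "Y \<in> Obj S ==> y \<in> pts Y 0 ==>
        \<exists>u \<in> Hom S (One S) Y. \<forall>m. \<forall>s \<in> pts (One S) m. ap u m s = rst Y 0 (replicate (Suc m) 0) y"
begin

text \<open>
  Morphisms are handled through the functions on points that they induce: \<open>hm\<close> singles out these
  families of functions, and \<open>mk\<close> recovers the morphism.
\<close>

definition hm :: "'o => 'o => (nat => 'u element => 'u element) => bool" where
  "hm X Y \<phi> \<longleftrightarrow> (\<exists>f \<in> Hom S X Y. \<forall>m. \<forall>x \<in> pts X m. ap f m x = \<phi> m x)"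

definition mk :: "'o => 'o => (nat => 'u element => 'u element) => ('o, 'f) arrow" where
  "mk X Y \<phi> = (SOME f. f \<in> Hom S X Y \<and> (\<forall>m. \<forall>x \<in> pts X m. ap f m x = \<phi> m x))"

definition star :: "nat => 'u element" where
  "star m = (THE s. pts (One S) m = {s})"

lemma pts_one [simp]: "pts (One S) m = {star m}"
proof -
  obtain s where "pts (One S) m = {s}" using one_S(2) by blast
  then show ?thesis by (simp add: star_def)
qed

lemma mk_hm:
  assumes "hm X Y \<phi>"
  shows "mk X Y \<phi> \<in> Hom S X Y" "mk X Y \<phi> \<in> Mor S" "x \<in> pts X m ==> ap (mk X Y \<phi>) m x = \<phi> m x"
    and "Dom (mk X Y \<phi>) = X" "Cod (mk X Y \<phi>) = Y"
proof -
  have *: "mk X Y \<phi> \<in> Hom S X Y \<and> (\<forall>m. \<forall>x \<in> pts X m. ap (mk X Y \<phi>) m x = \<phi> m x)"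
    unfolding mk_def by (rule someI_ex) (use assms in \<open>auto simp: hm_def\<close>)
  show "mk X Y \<phi> \<in> Hom S X Y" "x \<in> pts X m ==> ap (mk X Y \<phi>) m x = \<phi> m x" using * by auto
  then show "mk X Y \<phi> \<in> Mor S" "Dom (mk X Y \<phi>) = X" "Cod (mk X Y \<phi>) = Y" by (auto simp: Hom_def)
qed

lemma hm_obj: "hm X Y \<phi> ==> X \<in> Obj S \<and> Y \<in> Obj S"
  using mor_obj_S by (auto simp: hm_def Hom_def)

lemma hm_pts: "hm X Y \<phi> ==> x \<in> pts X m ==> \<phi> m x \<in> pts Y m"
  using ap_pts by (fastforce simp: hm_def Hom_def)

lemma hm_rst: "hm X Y \<phi> ==> \<theta> \<in> operators m n ==> x \<in> pts X n ==>
    \<phi> m (rst X n \<theta> x) = rst Y n \<theta> (\<phi> n x)"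
proof -
  assume "hm X Y \<phi>" and x: "\<theta> \<in> operators m n" "x \<in> pts X n"
  then obtain f where f: "f \<in> Mor S" "Dom f = X" "Cod f = Y" "\<And>m x. x \<in> pts X m ==> ap f m x = \<phi> m x"
    by (auto simp: hm_def Hom_def)
  then have "X \<in> Obj S" using mor_obj_S by blast
  then show ?thesis using ap_rst[OF f(1) x(1)] f x by auto
qed

lemma hm_cong: "(\<And>m x. x \<in> pts X m ==> \<phi> m x = \<psi> m x) ==> hm X Y \<phi> \<longleftrightarrow> hm X Y \<psi>"
  unfolding hm_def by (intro bex_cong refl all_cong1 ball_cong) auto

lemma hm_ap: "f \<in> Hom S X Y ==> hm X Y (ap f)"
  unfolding hm_def by blast

lemma hm_id: "X \<in> Obj S ==> hm X X (\<lambda>m x. x)"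
  unfolding hm_def by (intro bexI[of _ "Ident S X"]) (auto simp: Hom_def)

lemma hm_comp:
  assumes "hm X Y \<phi>" "hm Y Z \<psi>"
  shows "hm X Z (\<lambda>m x. \<psi> m (\<phi> m x))"
proof -
  obtain f g where "f \<in> Hom S X Y" "\<And>m x. x \<in> pts X m ==> ap f m x = \<phi> m x"
    and "g \<in> Hom S Y Z" "\<And>m x. x \<in> pts Y m ==> ap g m x = \<psi> m x"
    using assms unfolding hm_def by blast
  then show ?thesis
    unfolding hm_def using hm_pts[OF assms(1)]
    by (intro bexI[of _ "g \<cdot>\<^bsub>S\<^esub> f"]) (auto simp: Hom_def)
qed

lemma hm_pair:
  assumes "hm A X \<phi>" "hm A Y \<psi>"
  shows "hm A (Prod S X Y) (\<lambda>m x. Pair (\<phi> m x) (\<psi> m x))"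
proof -
  obtain f g where "f \<in> Hom S A X" "\<And>m x. x \<in> pts A m ==> ap f m x = \<phi> m x"
    and "g \<in> Hom S A Y" "\<And>m x. x \<in> pts A m ==> ap g m x = \<psi> m x"
    using assms unfolding hm_def by blast
  then show ?thesis
    unfolding hm_def by (intro bexI[of _ "Tuple S f g"]) (auto simp: Hom_def)
qed

lemma hm_pfst: "X \<in> Obj S ==> Y \<in> Obj S ==> hm (Prod S X Y) X (\<lambda>m. pfst)"
  unfolding hm_def by (intro bexI[of _ "Pr1 S X Y"]) (auto simp: Hom_def)

lemma hm_psnd: "X \<in> Obj S ==> Y \<in> Obj S ==> hm (Prod S X Y) Y (\<lambda>m. psnd)"
  unfolding hm_def by (intro bexI[of _ "Pr2 S X Y"]) (auto simp: Hom_def)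

lemma hm_fst: "hm A (Prod S X Y) \<phi> ==> X \<in> Obj S ==> Y \<in> Obj S ==> hm A X (\<lambda>m a. pfst (\<phi> m a))"
  by (rule hm_comp[OF _ hm_pfst])

lemma hm_snd: "hm A (Prod S X Y) \<phi> ==> X \<in> Obj S ==> Y \<in> Obj S ==> hm A Y (\<lambda>m a. psnd (\<phi> m a))"
  by (rule hm_comp[OF _ hm_psnd])

lemma hm_binary:
  assumes "hm (Prod S X Y) Z (\<lambda>m p. f m (pfst p) (psnd p))" "hm A X \<phi>" "hm A Y \<psi>"
  shows "hm A Z (\<lambda>m a. f m (\<phi> m a) (\<psi> m a))"
  using hm_comp[OF hm_pair[OF assms(2,3)] assms(1)] by simp

lemma hm_binary_pts:
  assumes "hm (Prod S X Y) Z (\<lambda>m p. f m (pfst p) (psnd p))" "x \<in> pts X m" "y \<in> pts Y m"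
  shows "f m x y \<in> pts Z m"
  using hm_pts[OF assms(1), of "Pair x y" m] assms(2,3) by simp

lemma hm_binary_rst:
  assumes "hm (Prod S X Y) Z (\<lambda>m p. f m (pfst p) (psnd p))" "\<theta> \<in> operators m n"
    "x \<in> pts X n" "y \<in> pts Y n"
  shows "f m (rst X n \<theta> x) (rst Y n \<theta> y) = rst Z n \<theta> (f n x y)"
  using hm_rst[OF assms(1,2), of "Pair x y"] assms(2-) by simp

lemma hm_one: "X \<in> Obj S ==> hm X (One S) (\<lambda>m x. star m)"
  unfolding hm_def
  by (intro bexI[of _ "Bang S X"]) (use ap_pts[of "Bang S X"] in \<open>auto simp: Hom_def\<close>)

lemma ap_bang [simp]: "X \<in> Obj S ==> x \<in> pts X m ==> ap (Bang S X) m x = star m"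
  using ap_pts[of "Bang S X" x m] by simp

lemma hm_point: "Y \<in> Obj S ==> y \<in> pts Y 0 ==> hm (One S) Y (\<lambda>m _. rst Y 0 (replicate (Suc m) 0) y)"
  using point_map unfolding hm_def by blast

lemma mor_eq: "f \<in> Hom S X Y ==> g \<in> Hom S X Y ==>
    (\<And>m x. x \<in> pts X m ==> ap f m x = ap g m x) ==> f = g"
  by (rule ap_ext) (auto simp: Hom_def)

definition closed_sub :: "'o => (nat => 'u element set) => bool" where
  "closed_sub X A \<longleftrightarrow> (\<forall>m. A m \<subseteq> pts X m) \<and>
     (\<forall>m n. \<forall>\<theta> \<in> operators m n. \<forall>x \<in> A n. rst X n \<theta> x \<in> A m)"

lemma const_operator: "replicate (Suc m) 0 \<in> operators m 0"
  by (auto simp: operators_def)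

lemma const_operator_comp: "\<theta> \<in> operators l m ==>
    map ((!) (replicate (Suc m) 0)) \<theta> = replicate (Suc l) (0 :: nat)"
proof -
  assume \<theta>: "\<theta> \<in> operators l m"
  then have "map ((!) (replicate (Suc m) 0)) \<theta> = map (\<lambda>_. 0 :: nat) \<theta>"
    by (intro map_cong refl) (auto simp: operators_def less_Suc_eq_le simp del: replicate_Suc)
  with \<theta> show ?thesis by (simp add: operators_def map_replicate_const)
qed

end


section \<open>Diagrams of spaces\<close>

type_synonym ('d, 'o, 'f) transformation = "(('d, 'o, 'f) diagram, 'd => ('o, 'f) arrow) arrow"

locale diagrams = concrete_spaces S pts rst ap
  for S :: "('o, 'f) spaces"
    and pts :: "'o => nat => 'u element set" and rst ap +
  fixes D :: "('d, 'o, 'f) enriched"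
  assumes enriched: "enriched_category S D"
begin

abbreviation "\<D> \<equiv> Diagrams S D"

abbreviation dcmp (infixr "\<odot>" 70) where "\<beta> \<odot> \<alpha> \<equiv> \<beta> \<cdot>\<^bsub>\<D>\<^esub> \<alpha>"

definition cmp :: "'d => 'd => 'd => nat => 'u element => 'u element => 'u element" where
  "cmp a b c m g f = ap (EComp D a b c) m (Pair g f)"

definition idn :: "'d => nat => 'u element" where
  "idn a m = ap (EId D a) m (star m)"

lemma ehom_obj [simp]: "a \<in> Ob D ==> b \<in> Ob D ==> EHom D a b \<in> Obj S"
  using enriched unfolding enriched_category_def by blast

lemma ecomp_mor:
  assumes "a \<in> Ob D" "b \<in> Ob D" "c \<in> Ob D"
  shows "EComp D a b c \<in> Mor S" "Dom (EComp D a b c) = Prod S (EHom D b c) (EHom D a b)"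
    "Cod (EComp D a b c) = EHom D a c"
proof -
  have "EComp D a b c \<in> Hom S (Prod S (EHom D b c) (EHom D a b)) (EHom D a c)"
    using enriched assms unfolding enriched_category_def by blast
  then show "EComp D a b c \<in> Mor S" "Dom (EComp D a b c) = Prod S (EHom D b c) (EHom D a b)"
    "Cod (EComp D a b c) = EHom D a c" by (auto simp: Hom_def)
qed

lemma eid_mor:
  assumes "a \<in> Ob D"
  shows "EId D a \<in> Mor S" "Dom (EId D a) = One S" "Cod (EId D a) = EHom D a a"
proof -
  have "EId D a \<in> Hom S (One S) (EHom D a a)"
    using enriched assms unfolding enriched_category_def by blast
  then show "EId D a \<in> Mor S" "Dom (EId D a) = One S" "Cod (EId D a) = EHom D a a"
    by (auto simp: Hom_def)
qed

lemma cmp_hm: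
  assumes "a \<in> Ob D" "b \<in> Ob D" "c \<in> Ob D"
  shows "hm (Prod S (EHom D b c) (EHom D a b)) (EHom D a c) (\<lambda>m p. cmp a b c m (pfst p) (psnd p))"
proof -
  have "hm (Prod S (EHom D b c) (EHom D a b)) (EHom D a c) (ap (EComp D a b c))"
    using ecomp_mor[OF assms] by (intro hm_ap) (simp add: Hom_def)
  then show ?thesis by (rule hm_cong[THEN iffD1, rotated]) (auto simp: cmp_def)
qed

lemma idn_hm: "a \<in> Ob D ==> hm (One S) (EHom D a a) (\<lambda>m _. idn a m)"
proof -
  assume a: "a \<in> Ob D"
  have "hm (One S) (EHom D a a) (ap (EId D a))"
    using eid_mor[OF a] by (intro hm_ap) (simp add: Hom_def)
  then show ?thesis by (rule hm_cong[THEN iffD1, rotated]) (auto simp: idn_def)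
qed

lemma idn_pts [simp]: "a \<in> Ob D ==> idn a m \<in> pts (EHom D a a) m"
  using hm_pts[OF idn_hm] by simp

lemma idn_rst: "a \<in> Ob D ==> \<theta> \<in> operators m n ==> rst (EHom D a a) n \<theta> (idn a n) = idn a m"
  using hm_rst[OF idn_hm, of a \<theta> m n "star n"] by simp

lemmas cmp_pts = hm_binary_pts[OF cmp_hm]
lemmas cmp_rst = hm_binary_rst[OF cmp_hm]

lemma cmp_assoc:
  assumes "a \<in> Ob D" "b \<in> Ob D" "c \<in> Ob D" "d \<in> Ob D"
    and "h \<in> pts (EHom D c d) m" "g \<in> pts (EHom D b c) m" "f \<in> pts (EHom D a b) m"
  shows "cmp a b d m (cmp b c d m h g) f = cmp a c d m h (cmp a b c m g f)"
proof -
  let ?P = "Prod S (EHom D c d) (EHom D b c)"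
  let ?h = "Pr1 S (EHom D c d) (EHom D b c) \<cdot>\<^bsub>S\<^esub> Pr1 S ?P (EHom D a b)"
  let ?g = "Pr2 S (EHom D c d) (EHom D b c) \<cdot>\<^bsub>S\<^esub> Pr1 S ?P (EHom D a b)"
  let ?f = "Pr2 S ?P (EHom D a b)"
  have "EComp D a b d \<cdot>\<^bsub>S\<^esub> Tuple S (EComp D b c d \<cdot>\<^bsub>S\<^esub> Tuple S ?h ?g) ?f =
      EComp D a c d \<cdot>\<^bsub>S\<^esub> Tuple S ?h (EComp D a b c \<cdot>\<^bsub>S\<^esub> Tuple S ?g ?f)"
    using enriched assms(1-4) unfolding enriched_category_def Let_def by blast
  from arg_cong[OF this, of "\<lambda>k. ap k m (Pair (Pair h g) f)"] show ?thesis
    using assms by (simp add: cmp_def ecomp_mor)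
qed

lemma cmp_idn [simp]:
  assumes "a \<in> Ob D" "b \<in> Ob D" "f \<in> pts (EHom D a b) m"
  shows "cmp a a b m f (idn a m) = f" "cmp a b b m (idn b m) f = f"
proof -
  have eq: "EComp D a a b \<cdot>\<^bsub>S\<^esub> Tuple S (Ident S (EHom D a b)) (EId D a \<cdot>\<^bsub>S\<^esub> Bang S (EHom D a b)) =
          Ident S (EHom D a b)"
       "EComp D a b b \<cdot>\<^bsub>S\<^esub> Tuple S (EId D b \<cdot>\<^bsub>S\<^esub> Bang S (EHom D a b)) (Ident S (EHom D a b)) =
          Ident S (EHom D a b)"
    using enriched assms(1,2) unfolding enriched_category_def by blast+
  show "cmp a a b m f (idn a m) = f" "cmp a b b m (idn b m) f = f"
    using arg_cong[OF eq(1), of "\<lambda>k. ap k m f"] arg_cong[OF eq(2), of "\<lambda>k. ap k m f"] assms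
    by (simp_all add: cmp_def idn_def eid_mor)
qed

definition act :: "('d, 'o, 'f) diagram => 'd => 'd => nat => 'u element => 'u element => 'u element" where
  "act X a b m e x = ap (Act X a b) m (Pair e x)"

context
  fixes X assumes X: "enriched_functor S D X"
begin

lemma at_obj: "a \<in> Ob D ==> At X a \<in> Obj S"
  using X unfolding enriched_functor_def by blast

lemma act_mor:
  assumes "a \<in> Ob D" "b \<in> Ob D"
  shows "Act X a b \<in> Mor S" "Dom (Act X a b) = Prod S (EHom D a b) (At X a)" "Cod (Act X a b) = At X b"
proof -
  have "Act X a b \<in> Hom S (Prod S (EHom D a b) (At X a)) (At X b)"
    using X assms unfolding enriched_functor_def by blast
  then show "Act X a b \<in> Mor S" "Dom (Act X a b) = Prod S (EHom D a b) (At X a)"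
    "Cod (Act X a b) = At X b" by (auto simp: Hom_def)
qed

lemma act_hm:
  assumes "a \<in> Ob D" "b \<in> Ob D"
  shows "hm (Prod S (EHom D a b) (At X a)) (At X b) (\<lambda>m p. act X a b m (pfst p) (psnd p))"
proof -
  have "hm (Prod S (EHom D a b) (At X a)) (At X b) (ap (Act X a b))"
    using act_mor[OF assms] by (intro hm_ap) (simp add: Hom_def)
  then show ?thesis by (rule hm_cong[THEN iffD1, rotated]) (auto simp: act_def)
qed

lemmas act_pts = hm_binary_pts[OF act_hm]
lemmas act_rst = hm_binary_rst[OF act_hm]

lemma act_cmp:
  assumes "a \<in> Ob D" "b \<in> Ob D" "c \<in> Ob D"
    and "g \<in> pts (EHom D b c) m" "f \<in> pts (EHom D a b) m" "x \<in> pts (At X a) m"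
  shows "act X a c m (cmp a b c m g f) x = act X b c m g (act X a b m f x)"
proof -
  let ?P = "Prod S (EHom D b c) (EHom D a b)"
  let ?g = "Pr1 S (EHom D b c) (EHom D a b) \<cdot>\<^bsub>S\<^esub> Pr1 S ?P (At X a)"
  let ?f = "Pr2 S (EHom D b c) (EHom D a b) \<cdot>\<^bsub>S\<^esub> Pr1 S ?P (At X a)"
  let ?x = "Pr2 S ?P (At X a)"
  have "Act X a c \<cdot>\<^bsub>S\<^esub> Tuple S (EComp D a b c \<cdot>\<^bsub>S\<^esub> Tuple S ?g ?f) ?x =
      Act X b c \<cdot>\<^bsub>S\<^esub> Tuple S ?g (Act X a b \<cdot>\<^bsub>S\<^esub> Tuple S ?f ?x)"
    using X assms(1-3) unfolding enriched_functor_def Let_def by blast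
  from arg_cong[OF this, of "\<lambda>k. ap k m (Pair (Pair g f) x)"] show ?thesis
    using assms by (simp add: act_def cmp_def ecomp_mor act_mor at_obj)
qed

lemma act_idn:
  assumes "a \<in> Ob D" "x \<in> pts (At X a) m"
  shows "act X a a m (idn a m) x = x"
proof -
  have "Act X a a \<cdot>\<^bsub>S\<^esub> Tuple S (EId D a \<cdot>\<^bsub>S\<^esub> Bang S (At X a)) (Ident S (At X a)) = Ident S (At X a)"
    using X assms unfolding enriched_functor_def by blast
  from arg_cong[OF this, of "\<lambda>k. ap k m x"] show ?thesis
    using assms by (simp add: act_def idn_def eid_mor at_obj)
qed

end

definition mkdiag :: "('d => 'o) => ('d => 'd => nat => 'u element => 'u element => 'u element) =>
    ('d, 'o, 'f) diagram" where
  "mkdiag X \<alpha> = \<lparr> At = (\<lambda>a\<in>Ob D. X a),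
     Act = (\<lambda>a\<in>Ob D. \<lambda>b\<in>Ob D.
       mk (Prod S (EHom D a b) (X a)) (X b) (\<lambda>m p. \<alpha> a b m (pfst p) (psnd p))) \<rparr>"

lemma mkdiag:
  assumes obj: "\<And>a. a \<in> Ob D ==> X a \<in> Obj S"
    and hm: "\<And>a b. a \<in> Ob D ==> b \<in> Ob D ==>
      hm (Prod S (EHom D a b) (X a)) (X b) (\<lambda>m p. \<alpha> a b m (pfst p) (psnd p))"
    and cmp: "\<And>a b c m g f x. a \<in> Ob D ==> b \<in> Ob D ==> c \<in> Ob D ==>
      g \<in> pts (EHom D b c) m ==> f \<in> pts (EHom D a b) m ==> x \<in> pts (X a) m ==>
      \<alpha> a c m (cmp a b c m g f) x = \<alpha> b c m g (\<alpha> a b m f x)"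
    and idn: "\<And>a m x. a \<in> Ob D ==> x \<in> pts (X a) m ==> \<alpha> a a m (idn a m) x = x"
  shows "enriched_functor S D (mkdiag X \<alpha>)"
    and "a \<in> Ob D ==> At (mkdiag X \<alpha>) a = X a"
    and "a \<in> Ob D ==> b \<in> Ob D ==> e \<in> pts (EHom D a b) m ==> x \<in> pts (X a) m ==>
      act (mkdiag X \<alpha>) a b m e x = \<alpha> a b m e x"
proof -
  show At: "At (mkdiag X \<alpha>) a = X a" if "a \<in> Ob D" for a using that by (simp add: mkdiag_def)
  have mor: "Act (mkdiag X \<alpha>) a b \<in> Mor S"
      "Dom (Act (mkdiag X \<alpha>) a b) = Prod S (EHom D a b) (X a)" "Cod (Act (mkdiag X \<alpha>) a b) = X b"
      "\<And>p m. p \<in> pts (Prod S (EHom D a b) (X a)) m ==>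
        ap (Act (mkdiag X \<alpha>) a b) m p = \<alpha> a b m (pfst p) (psnd p)"
    if "a \<in> Ob D" "b \<in> Ob D" for a b
    using that mk_hm[OF hm[OF that]] by (auto simp: mkdiag_def)
  show act: "act (mkdiag X \<alpha>) a b m e x = \<alpha> a b m e x"
    if "a \<in> Ob D" "b \<in> Ob D" "e \<in> pts (EHom D a b) m" "x \<in> pts (X a) m" for a b m e x
    using that mor(4) by (simp add: act_def)
  have pts: "\<alpha> a b m e x \<in> pts (X b) m" if "a \<in> Ob D" "b \<in> Ob D" "e \<in> pts (EHom D a b) m"
    "x \<in> pts (X a) m" for a b m e x
    using hm_binary_pts[OF hm] that by blast
  show "enriched_functor S D (mkdiag X \<alpha>)"
    unfolding enriched_functor_def Let_def
  proof (intro conjI ballI)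
    show "At (mkdiag X \<alpha>) \<in> extensional (Ob D)" "Act (mkdiag X \<alpha>) \<in> extensional (Ob D)"
      by (simp_all add: mkdiag_def)
    fix a assume a: "a \<in> Ob D"
    show "Act (mkdiag X \<alpha>) a \<in> extensional (Ob D)" using a by (simp add: mkdiag_def)
    show "At (mkdiag X \<alpha>) a \<in> Obj S" using a At obj by simp
    show "Act (mkdiag X \<alpha>) a a \<cdot>\<^bsub>S\<^esub> Tuple S (EId D a \<cdot>\<^bsub>S\<^esub> Bang S (At (mkdiag X \<alpha>) a))
        (Ident S (At (mkdiag X \<alpha>) a)) = Ident S (At (mkdiag X \<alpha>) a)"
      by (rule ap_ext) (use a in \<open>simp_all add: At mor eid_mor obj idn_def[symmetric] idn\<close>)
    fix b assume b: "b \<in> Ob D"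
    show "Act (mkdiag X \<alpha>) a b \<in> Hom S (Prod S (EHom D a b) (At (mkdiag X \<alpha>) a)) (At (mkdiag X \<alpha>) b)"
      using mor[OF a b] a b by (simp add: Hom_def At)
    fix c assume c: "c \<in> Ob D"
    let ?P = "Prod S (EHom D b c) (EHom D a b)"
    let ?g = "Pr1 S (EHom D b c) (EHom D a b) \<cdot>\<^bsub>S\<^esub> Pr1 S ?P (At (mkdiag X \<alpha>) a)"
    let ?f = "Pr2 S (EHom D b c) (EHom D a b) \<cdot>\<^bsub>S\<^esub> Pr1 S ?P (At (mkdiag X \<alpha>) a)"
    let ?x = "Pr2 S ?P (At (mkdiag X \<alpha>) a)"
    show "Act (mkdiag X \<alpha>) a c \<cdot>\<^bsub>S\<^esub> Tuple S (EComp D a b c \<cdot>\<^bsub>S\<^esub> Tuple S ?g ?f) ?x =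
        Act (mkdiag X \<alpha>) b c \<cdot>\<^bsub>S\<^esub> Tuple S ?g (Act (mkdiag X \<alpha>) a b \<cdot>\<^bsub>S\<^esub> Tuple S ?f ?x)"
      by (rule ap_ext)
        (use a b c in \<open>auto simp add: At mor ecomp_mor obj cmp_def[symmetric] cmp cmp_pts pts\<close>)
  qed
qed

definition el :: "('d, 'o, 'f) transformation => 'd => nat => 'u element => 'u element" where
  "el \<alpha> a m x = ap (Fn \<alpha> a) m x"

lemma nat_components:
  assumes "\<alpha> \<in> Hom \<D> X Y"
  shows "enriched_functor S D X" "enriched_functor S D Y"
    and "a \<in> Ob D ==> Fn \<alpha> a \<in> Hom S (At X a) (At Y a)"
    and "Fn \<alpha> \<in> extensional (Ob D)" "Dom \<alpha> = X" "Cod \<alpha> = Y"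
  using assms by (auto simp: Hom_def Diagrams_def natural_transformations_def)

lemma el_hm: "\<alpha> \<in> Hom \<D> X Y ==> a \<in> Ob D ==> hm (At X a) (At Y a) (el \<alpha> a)"
  using hm_ap[OF nat_components(3)] unfolding el_def .

lemmas el_pts = hm_pts[OF el_hm]
lemmas el_rst = hm_rst[OF el_hm]

lemma el_act:
  assumes \<alpha>: "\<alpha> \<in> Hom \<D> X Y" and ab: "a \<in> Ob D" "b \<in> Ob D"
    and e: "e \<in> pts (EHom D a b) m" "x \<in> pts (At X a) m"
  shows "el \<alpha> b m (act X a b m e x) = act Y a b m e (el \<alpha> a m x)"
proof -
  note c = nat_components[OF \<alpha>]
  have "Fn \<alpha> b \<cdot>\<^bsub>S\<^esub> Act X a b =
      Act Y a b \<cdot>\<^bsub>S\<^esub> Tuple S (Pr1 S (EHom D a b) (At X a)) (Fn \<alpha> a \<cdot>\<^bsub>S\<^esub> Pr2 S (EHom D a b) (At X a))"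
    using \<alpha> ab by (auto simp: Hom_def Diagrams_def natural_transformations_def)
  from arg_cong[OF this, of "\<lambda>k. ap k m (Pair e x)"] show ?thesis
    using e ab by (simp add: el_def act_def act_mor[OF c(1)])
qed

definition mknat :: "('d, 'o, 'f) diagram => ('d, 'o, 'f) diagram =>
    ('d => nat => 'u element => 'u element) => ('d, 'o, 'f) transformation" where
  "mknat X Y \<phi> = Arrow X (\<lambda>a\<in>Ob D. mk (At X a) (At Y a) (\<phi> a)) Y"

lemma nat_intro:
  assumes X: "enriched_functor S D X" and Y: "enriched_functor S D Y"
    and ext: "\<alpha> \<in> extensional (Ob D)"
    and hom: "\<And>a. a \<in> Ob D ==> \<alpha> a \<in> Hom S (At X a) (At Y a)"
    and act: "\<And>a b m e x. a \<in> Ob D ==> b \<in> Ob D ==> e \<in> pts (EHom D a b) m ==> x \<in> pts (At X a) m ==>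
      ap (\<alpha> b) m (act X a b m e x) = act Y a b m e (ap (\<alpha> a) m x)"
  shows "Arrow X \<alpha> Y \<in> Hom \<D> X Y"
proof -
  have "\<alpha> b \<cdot>\<^bsub>S\<^esub> Act X a b =
      Act Y a b \<cdot>\<^bsub>S\<^esub> Tuple S (Pr1 S (EHom D a b) (At X a)) (\<alpha> a \<cdot>\<^bsub>S\<^esub> Pr2 S (EHom D a b) (At X a))"
    if ab: "a \<in> Ob D" "b \<in> Ob D" for a b
    using hom[OF ab(1)] hom[OF ab(2)] act[OF ab] ab
    by (intro ap_ext)
      (auto simp: Hom_def act_mor[OF X] act_mor[OF Y] at_obj[OF X] at_obj[OF Y] act_def)
  then show ?thesis
    using X Y ext hom by (auto simp: Hom_def Diagrams_def natural_transformations_def)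
qed

lemma mknat:
  assumes X: "enriched_functor S D X" and Y: "enriched_functor S D Y"
    and hm: "\<And>a. a \<in> Ob D ==> hm (At X a) (At Y a) (\<phi> a)"
    and act: "\<And>a b m e x. a \<in> Ob D ==> b \<in> Ob D ==> e \<in> pts (EHom D a b) m ==> x \<in> pts (At X a) m ==>
      \<phi> b m (act X a b m e x) = act Y a b m e (\<phi> a m x)"
  shows "mknat X Y \<phi> \<in> Hom \<D> X Y"
    and "a \<in> Ob D ==> x \<in> pts (At X a) m ==> el (mknat X Y \<phi>) a m x = \<phi> a m x"
proof -
  show "mknat X Y \<phi> \<in> Hom \<D> X Y"
    unfolding mknat_def
    by (rule nat_intro[OF X Y]) (auto simp: mk_hm[OF hm] act act_pts[OF X])
  show "a \<in> Ob D ==> x \<in> pts (At X a) m ==> el (mknat X Y \<phi>) a m x = \<phi> a m x"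
    by (simp add: el_def mknat_def mk_hm[OF hm])
qed

lemma nat_eq:
  assumes "\<alpha> \<in> Hom \<D> X Y" "\<beta> \<in> Hom \<D> X Y"
    and "\<And>a m x. a \<in> Ob D ==> x \<in> pts (At X a) m ==> el \<alpha> a m x = el \<beta> a m x"
  shows "\<alpha> = \<beta>"
proof -
  note a = nat_components[OF assms(1)] and b = nat_components[OF assms(2)]
  have "Fn \<alpha> = Fn \<beta>"
    using a(4) b(4)
  proof (rule extensionalityI)
    fix c assume c: "c \<in> Ob D"
    show "Fn \<alpha> c = Fn \<beta> c"
      by (rule mor_eq[OF a(3)[OF c] b(3)[OF c]]) (use assms(3)[OF c] in \<open>simp add: el_def\<close>)
  qed
  with a b show ?thesis by (metis arrow.collapse)
qed

lemma el_cmp: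
  assumes "\<alpha> \<in> Hom \<D> X Y" "\<beta> \<in> Hom \<D> Y Z"
  shows "a \<in> Ob D ==> x \<in> pts (At X a) m ==> el (\<beta> \<odot> \<alpha>) a m x = el \<beta> a m (el \<alpha> a m x)"
    and "\<beta> \<odot> \<alpha> \<in> Hom \<D> X Z"
proof -
  note a = nat_components[OF assms(1)] and b = nat_components[OF assms(2)]
  have S: "Fn \<alpha> a \<in> Mor S" "Dom (Fn \<alpha> a) = At X a" "Cod (Fn \<alpha> a) = At Y a"
    "Fn \<beta> a \<in> Mor S" "Dom (Fn \<beta> a) = At Y a" "Cod (Fn \<beta> a) = At Z a" if "a \<in> Ob D" for a
    using a(3)[OF that] b(3)[OF that] by (auto simp: Hom_def)
  show "el (\<beta> \<odot> \<alpha>) a m x = el \<beta> a m (el \<alpha> a m x)" if "a \<in> Ob D" "x \<in> pts (At X a) m" for a m x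
    using that S by (simp add: el_def Diagrams_def)
  have "Arrow X (\<lambda>a\<in>Ob D. Fn \<beta> a \<cdot>\<^bsub>S\<^esub> Fn \<alpha> a) Z \<in> Hom \<D> X Z"
    using el_act[OF assms(1)] el_act[OF assms(2)] el_pts[OF assms(1)]
    by (intro nat_intro a b) (auto simp: S Hom_def act_pts[OF a(1)] el_def[symmetric])
  then show "\<beta> \<odot> \<alpha> \<in> Hom \<D> X Z" using a b by (simp add: Diagrams_def)
qed

lemma el_ident:
  assumes "enriched_functor S D X"
  shows "a \<in> Ob D ==> x \<in> pts (At X a) m ==> el (Ident \<D> X) a m x = x"
    and "Ident \<D> X \<in> Hom \<D> X X"
proof -
  show "a \<in> Ob D ==> x \<in> pts (At X a) m ==> el (Ident \<D> X) a m x = x" for a m x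
    by (simp add: el_def Diagrams_def)
  have "Arrow X (\<lambda>a\<in>Ob D. Ident S (At X a)) X \<in> Hom \<D> X X"
    using at_obj[OF assms] by (intro nat_intro assms) (auto simp: Hom_def act_pts[OF assms])
  then show "Ident \<D> X \<in> Hom \<D> X X" by (simp add: Diagrams_def)
qed

lemma obj_diagrams: "X \<in> Obj \<D> \<longleftrightarrow> enriched_functor S D X"
  by (simp add: Diagrams_def)

sublocale abstract_category \<D>
proof
  fix f assume "f \<in> Mor \<D>"
  then show "Dom f \<in> Obj \<D> \<and> Cod f \<in> Obj \<D>"
    by (auto simp: Diagrams_def natural_transformations_def)
next
  fix a assume "a \<in> Obj \<D>"
  then show "Ident \<D> a \<in> Hom \<D> a a" using el_ident(2) by (simp add: obj_diagrams)
next
  fix f g a b c assume "f \<in> Hom \<D> a b" "g \<in> Hom \<D> b c"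
  then show "g \<odot> f \<in> Hom \<D> a c" by (rule el_cmp(2))
next
  fix f a b assume f: "f \<in> Hom \<D> a b"
  note c = nat_components[OF f] note i = el_ident[OF c(1)] el_ident[OF c(2)]
  show "Ident \<D> b \<odot> f = f"
    by (rule nat_eq[OF el_cmp(2)[OF f i(4)] f]) (simp add: el_cmp(1)[OF f i(4)] i el_pts[OF f])
  show "f \<odot> Ident \<D> a = f"
    by (rule nat_eq[OF el_cmp(2)[OF i(2) f] f]) (simp add: el_cmp(1)[OF i(2) f] i)
next
  fix f g h a b c d assume f: "f \<in> Hom \<D> a b" and g: "g \<in> Hom \<D> b c" and h: "h \<in> Hom \<D> c d"
  note gf = el_cmp[OF f g] and hg = el_cmp[OF g h]
  show "(h \<odot> g) \<odot> f = h \<odot> (g \<odot> f)"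
    by (rule nat_eq[OF el_cmp(2)[OF f hg(2)] el_cmp(2)[OF gf(2) h]])
      (simp add: el_cmp(1)[OF f hg(2)] el_cmp(1)[OF gf(2) h] gf hg el_pts[OF f])
qed

end

context diagrams
begin

section \<open>Constant diagrams and tensors\<close>

lemma const_diagram:
  assumes Y: "Y \<in> Obj S"
  shows "enriched_functor S D (const_diagram S D Y)"
    and "a \<in> Ob D ==> At (const_diagram S D Y) a = Y"
    and "a \<in> Ob D ==> b \<in> Ob D ==> e \<in> pts (EHom D a b) m ==> x \<in> pts Y m ==>
      act (const_diagram S D Y) a b m e x = x"
proof -
  have hm: "hm (Prod S (EHom D a b) Y) Y (\<lambda>m p. psnd p)" if "a \<in> Ob D" "b \<in> Ob D" for a b
    using that Y by (intro hm_psnd) auto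
  have eq: "const_diagram S D Y = mkdiag (\<lambda>_. Y) (\<lambda>a b m e x. x)"
  proof -
    have "Pr2 S (EHom D a b) Y = mk (Prod S (EHom D a b) Y) Y (\<lambda>m p. psnd p)"
      if "a \<in> Ob D" "b \<in> Ob D" for a b
      by (rule mor_eq[OF _ mk_hm(1)[OF hm[OF that]]]) (use that Y in \<open>auto simp: Hom_def mk_hm[OF hm]\<close>)
    then show ?thesis
      unfolding const_diagram_def mkdiag_def by (auto intro!: restrict_ext)
  qed
  note d = mkdiag[of "\<lambda>_. Y" "\<lambda>a b m e x. x", OF Y hm]
  show "enriched_functor S D (const_diagram S D Y)" unfolding eq by (rule d(1)) auto
  show "a \<in> Ob D ==> At (const_diagram S D Y) a = Y" by (simp add: const_diagram_def)
  show "a \<in> Ob D ==> b \<in> Ob D ==> e \<in> pts (EHom D a b) m ==> x \<in> pts Y m ==>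
      act (const_diagram S D Y) a b m e x = x"
    unfolding eq by (rule d(3)) auto
qed

lemma const_map:
  assumes u: "u \<in> Hom S Y Z"
  shows "const_map S D u \<in> Hom \<D> (const_diagram S D Y) (const_diagram S D Z)"
    and "a \<in> Ob D ==> el (const_map S D u) a m x = ap u m x"
proof -
  have YZ: "Y \<in> Obj S" "Z \<in> Obj S" "Dom u = Y" "Cod u = Z" using u mor_obj_S by (auto simp: Hom_def)
  note c = const_diagram[OF YZ(1)] const_diagram[OF YZ(2)]
  show "const_map S D u \<in> Hom \<D> (const_diagram S D Y) (const_diagram S D Z)"
    unfolding const_map_def YZ
    by (rule nat_intro) (use c u hm_pts[OF hm_ap[OF u]] in auto)
  show "a \<in> Ob D ==> el (const_map S D u) a m x = ap u m x"
    by (simp add: const_map_def el_def)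
qed

lemma tensor:
  assumes X: "enriched_functor S D X" and K: "Rlz S K \<in> Obj S"
  shows "enriched_functor S D (tensor S D X K)"
    and "a \<in> Ob D ==> At (tensor S D X K) a = Prod S (At X a) (Rlz S K)"
    and "a \<in> Ob D ==> b \<in> Ob D ==> e \<in> pts (EHom D a b) m ==> x \<in> pts (At X a) m ==>
      k \<in> pts (Rlz S K) m ==>
      act (tensor S D X K) a b m e (Pair x k) = Pair (act X a b m e x) k"
proof -
  let ?R = "Rlz S K"
  let ?act = "\<lambda>a b m e p. Pair (act X a b m e (pfst p)) (psnd p)"
  have hm: "hm (Prod S (EHom D a b) (Prod S (At X a) ?R)) (Prod S (At X b) ?R)
      (\<lambda>m p. ?act a b m (pfst p) (psnd p))" if ab: "a \<in> Ob D" "b \<in> Ob D" for a b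
    using at_obj[OF X] K ab
    by (intro hm_pair hm_binary[OF act_hm[OF X ab]] hm_fst[OF hm_psnd] hm_snd[OF hm_psnd] hm_pfst) auto
  have eq: "tensor S D X K = mkdiag (\<lambda>a. Prod S (At X a) ?R) ?act"
  proof -
    have "(let XK = Prod S (At X a) ?R; f = Pr1 S (EHom D a b) XK;
              x = Pr1 S (At X a) ?R \<cdot>\<^bsub>S\<^esub> Pr2 S (EHom D a b) XK;
              k = Pr2 S (At X a) ?R \<cdot>\<^bsub>S\<^esub> Pr2 S (EHom D a b) XK
          in Tuple S (Act X a b \<cdot>\<^bsub>S\<^esub> Tuple S f x) k) =
        mk (Prod S (EHom D a b) (Prod S (At X a) ?R)) (Prod S (At X b) ?R)
          (\<lambda>m p. ?act a b m (pfst p) (psnd p))" if ab: "a \<in> Ob D" "b \<in> Ob D" for a b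
      unfolding Let_def
      by (rule mor_eq[OF _ mk_hm(1)[OF hm[OF ab]]])
        (use ab K in \<open>auto simp: Hom_def mk_hm(3)[OF hm[OF ab]] act_mor[OF X] at_obj[OF X] act_def[symmetric]\<close>)
    then show ?thesis
      unfolding tensor_def mkdiag_def by (auto intro!: restrict_ext)
  qed
  have obj: "Prod S (At X a) ?R \<in> Obj S" if "a \<in> Ob D" for a using that at_obj[OF X] K by simp
  note d = mkdiag[of "\<lambda>a. Prod S (At X a) ?R" ?act, OF obj hm]
  show "enriched_functor S D (tensor S D X K)" unfolding eq
    by (rule d(1)) (auto simp: act_cmp[OF X] act_idn[OF X] act_pts[OF X])
  show "a \<in> Ob D ==> At (tensor S D X K) a = Prod S (At X a) ?R" by (simp add: tensor_def)
  show "a \<in> Ob D ==> b \<in> Ob D ==> e \<in> pts (EHom D a b) m ==> x \<in> pts (At X a) m ==>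
      k \<in> pts ?R m ==> act (tensor S D X K) a b m e (Pair x k) = Pair (act X a b m e x) k"
    unfolding eq by (subst d(3)) (auto simp: act_cmp[OF X] act_idn[OF X] act_pts[OF X])
qed

lemma tensor_map:
  assumes X: "enriched_functor S D X" and i: "RlzMap S i \<in> Hom S (Rlz S (Dom i)) (Rlz S (Cod i))"
  shows "tensor_map S D X i \<in> Hom \<D> (tensor S D X (Dom i)) (tensor S D X (Cod i))"
    and "a \<in> Ob D ==> x \<in> pts (At X a) m ==> k \<in> pts (Rlz S (Dom i)) m ==>
      el (tensor_map S D X i) a m (Pair x k) = Pair x (ap (RlzMap S i) m k)"
proof -
  let ?\<iota> = "RlzMap S i"
  have R: "Rlz S (Dom i) \<in> Obj S" "Rlz S (Cod i) \<in> Obj S" "?\<iota> \<in> Mor S"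
    "Dom ?\<iota> = Rlz S (Dom i)" "Cod ?\<iota> = Rlz S (Cod i)"
    using i mor_obj_S[of ?\<iota>] by (auto simp: Hom_def)
  note t = tensor[OF X R(1)] tensor[OF X R(2)]
  have \<iota>: "ap ?\<iota> m k \<in> pts (Rlz S (Cod i)) m" if "k \<in> pts (Rlz S (Dom i)) m" for k m
    using ap_pts[OF R(3)] that R by simp
  show "tensor_map S D X i \<in> Hom \<D> (tensor S D X (Dom i)) (tensor S D X (Cod i))"
    unfolding tensor_map_def
    by (rule nat_intro[OF t(1) t(4)])
      (auto simp: t Hom_def R at_obj[OF X] act_pts[OF X] \<iota>)
  show "a \<in> Ob D ==> x \<in> pts (At X a) m ==> k \<in> pts (Rlz S (Dom i)) m ==>
      el (tensor_map S D X i) a m (Pair x k) = Pair x (ap ?\<iota> m k)"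
    by (simp add: tensor_map_def el_def R at_obj[OF X])
qed


section \<open>Components\<close>

text \<open>
  The components in dimension \<open>m\<close> are the classes of the equivalence relation generated by the action
  of \<open>D\<close> on the points of dimension \<open>m\<close>.
\<close>

definition linked :: "('d, 'o, 'f) diagram => nat => ('d \<times> 'u element) rel" where
  "linked X m = {((a, x), (b, act X a b m e x)) | a b e x.
     a \<in> Ob D \<and> b \<in> Ob D \<and> e \<in> pts (EHom D a b) m \<and> x \<in> pts (At X a) m}"

definition conn :: "('d, 'o, 'f) diagram => nat => ('d \<times> 'u element) rel" where
  "conn X m = (linked X m \<union> (linked X m)\<inverse>)\<^sup>*"

lemma conn_refl: "(p, p) \<in> conn X m"
  by (simp add: conn_def)

lemma conn_trans: "(p, q) \<in> conn X m ==> (q, r) \<in> conn X m ==> (p, r) \<in> conn X m"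
  unfolding conn_def by (rule rtrancl_trans)

lemma conn_sym: "(p, q) \<in> conn X m ==> (q, p) \<in> conn X m"
proof -
  have "sym (linked X m \<union> (linked X m)\<inverse>)" by (auto simp: sym_def)
  then show "(p, q) \<in> conn X m ==> (q, p) \<in> conn X m"
    unfolding conn_def using sym_rtrancl symD by metis
qed

lemma linked_conn: "a \<in> Ob D ==> b \<in> Ob D ==> e \<in> pts (EHom D a b) m ==> x \<in> pts (At X a) m ==>
    ((a, x), (b, act X a b m e x)) \<in> conn X m"
  unfolding conn_def linked_def by (rule r_into_rtrancl) blast

lemma conn_invariant:
  assumes inv: "\<And>a b e x. a \<in> Ob D ==> b \<in> Ob D ==> e \<in> pts (EHom D a b) m ==> x \<in> pts (At X a) m ==>
      F a x = F b (act X a b m e x)"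
    and "((a, x), (b, y)) \<in> conn X m"
  shows "F a x = F b y"
proof -
  have "F (fst p) (snd p) = F (fst q) (snd q)" if "(p, q) \<in> conn X m" for p q
    using that unfolding conn_def
    by (induction rule: rtrancl_induct) (auto simp: linked_def inv)
  from this[OF assms(2)] show ?thesis by simp
qed

lemma conn_pts:
  assumes X: "enriched_functor S D X" and c: "((a, x), (b, y)) \<in> conn X m"
    and a: "a \<in> Ob D" "x \<in> pts (At X a) m"
  shows "b \<in> Ob D" "y \<in> pts (At X b) m"
  using conn_invariant[of m X "\<lambda>a x. a \<in> Ob D \<and> x \<in> pts (At X a) m", OF _ c] a act_pts[OF X]
  by auto

lemma conn_image:
  assumes F: "\<And>a b e x. a \<in> Ob D ==> b \<in> Ob D ==> e \<in> pts (EHom D a b) m ==> x \<in> pts (At X a) m ==>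
      ((a, F a x), (b, F b (act X a b m e x))) \<in> conn Y n"
    and "((a, x), (b, y)) \<in> conn X m"
  shows "((a, F a x), (b, F b y)) \<in> conn Y n"
proof -
  have "((fst p, F (fst p) (snd p)), (fst q, F (fst q) (snd q))) \<in> conn Y n"
    if "(p, q) \<in> conn X m" for p q
    using that unfolding conn_def[of X]
  proof (induction rule: rtrancl_induct)
    case base
    then show ?case by (rule conn_refl)
  next
    case (step q r)
    have "((fst q, F (fst q) (snd q)), (fst r, F (fst r) (snd r))) \<in> conn Y n"
      using step(2) F conn_sym by (auto simp: linked_def)
    with step(3) show ?case by (rule conn_trans)
  qed
  from this[OF assms(2)] show ?thesis by simp
qed

lemma conn_el:
  assumes "\<alpha> \<in> Hom \<D> X Y" "((a, x), (b, y)) \<in> conn X m"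
  shows "((a, el \<alpha> a m x), (b, el \<alpha> b m y)) \<in> conn Y m"
  using assms(2)
  by (rule conn_image[rotated]) (auto simp: el_act[OF assms(1)] el_pts[OF assms(1)] intro: linked_conn)

lemma conn_rst:
  assumes X: "enriched_functor S D X" and "((a, x), (b, y)) \<in> conn X n" and \<theta>: "\<theta> \<in> operators m n"
  shows "((a, rst (At X a) n \<theta> x), (b, rst (At X b) n \<theta> y)) \<in> conn X m"
proof (rule conn_image[OF _ assms(2)])
  fix a b e x assume ab: "a \<in> Ob D" "b \<in> Ob D" and e: "e \<in> pts (EHom D a b) n" "x \<in> pts (At X a) n"
  have "((a, rst (At X a) n \<theta> x), (b, act X a b m (rst (EHom D a b) n \<theta> e) (rst (At X a) n \<theta> x))) \<in> conn X m"
    using ab e \<theta> at_obj[OF X] by (intro linked_conn) auto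
  then show "((a, rst (At X a) n \<theta> x), (b, rst (At X b) n \<theta> (act X a b n e x))) \<in> conn X m"
    by (simp add: act_rst[OF X ab \<theta> e])
qed

definition connected_diagram :: "('d, 'o, 'f) diagram => bool" where
  "connected_diagram X \<longleftrightarrow> (\<exists>a \<in> Ob D. pts (At X a) 0 \<noteq> {}) \<and>
     (\<forall>m. \<forall>a \<in> Ob D. \<forall>b \<in> Ob D. \<forall>x \<in> pts (At X a) m. \<forall>y \<in> pts (At X b) m.
        ((a, x), (b, y)) \<in> conn X m)"

text \<open>
  The degenerate simplex on a vertex.
\<close>

definition vtx :: "('d, 'o, 'f) diagram => 'd => 'u element => nat => 'u element" where
  "vtx X a x m = rst (At X a) 0 (replicate (Suc m) 0) x"

lemma vtx_pts: "enriched_functor S D X ==> a \<in> Ob D ==> x \<in> pts (At X a) 0 ==>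
    vtx X a x m \<in> pts (At X a) m"
  unfolding vtx_def by (rule rst_pts[OF at_obj const_operator])

lemma vtx_rst: "enriched_functor S D X ==> a \<in> Ob D ==> x \<in> pts (At X a) 0 ==> \<theta> \<in> operators l m ==>
    rst (At X a) m \<theta> (vtx X a x m) = vtx X a x l"
  unfolding vtx_def by (simp add: rst_rst[OF at_obj _ const_operator] const_operator_comp del: replicate_Suc)

lemma vtx_el: "\<alpha> \<in> Hom \<D> X Y ==> a \<in> Ob D ==> x \<in> pts (At X a) 0 ==>
    el \<alpha> a m (vtx X a x m) = vtx Y a (el \<alpha> a 0 x) m"
  unfolding vtx_def by (rule el_rst[OF _ _ const_operator])

text \<open>
  A natural transformation to a constant diagram takes the same value on linked points.  If there is only
  one component, the values are the degeneracies of one vertex, and a vertex is a map from the terminal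
  object.
\<close>

lemma connected_orbit:
  assumes T: "enriched_functor S D T" and c: "connected_diagram T"
  shows "orbit S D T"
proof -
  obtain a0 x0 where x0: "a0 \<in> Ob D" "x0 \<in> pts (At T a0) 0"
    using c unfolding connected_diagram_def by blast
  note O = const_diagram[OF one_S(1)]
  define \<tau> where "\<tau> = mknat T (const_diagram S D (One S)) (\<lambda>a m x. star m)"
  have \<tau>: "\<tau> \<in> Hom \<D> T (const_diagram S D (One S))"
    and el_\<tau>: "\<And>a x m. a \<in> Ob D ==> x \<in> pts (At T a) m ==> el \<tau> a m x = star m"
    unfolding \<tau>_def
    using mknat[OF T O(1), of "\<lambda>a m x. star m"] hm_one[OF at_obj[OF T]] O(2,3) by auto
  have "\<exists>!u. u \<in> Hom S (One S) Y \<and> \<sigma> = const_map S D u \<odot> \<tau>"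
    if Y: "Y \<in> Obj S" and \<sigma>: "\<sigma> \<in> Hom \<D> T (const_diagram S D Y)" for Y \<sigma>
  proof -
    note cY = const_diagram[OF Y]
    define y where "y = el \<sigma> a0 0 x0"
    have y: "y \<in> pts Y 0" using el_pts[OF \<sigma> x0] x0 by (simp add: y_def cY)
    have \<sigma>_const: "el \<sigma> b m z = rst Y 0 (replicate (Suc m) 0) y"
      if b: "b \<in> Ob D" and z: "z \<in> pts (At T b) m" for b m z
    proof -
      have "((a0, vtx T a0 x0 m), (b, z)) \<in> conn T m"
        using c x0 b z vtx_pts[OF T x0] unfolding connected_diagram_def by blast
      then have "el \<sigma> a0 m (vtx T a0 x0 m) = el \<sigma> b m z"
      proof (rule conn_invariant[of m T "\<lambda>a. el \<sigma> a m", rotated])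
        fix a b e x assume ab: "a \<in> Ob D" "b \<in> Ob D"
          and e: "e \<in> pts (EHom D a b) m" "x \<in> pts (At T a) m"
        show "el \<sigma> a m x = el \<sigma> b m (act T a b m e x)"
          using el_act[OF \<sigma> ab e] el_pts[OF \<sigma> ab(1) e(2)] ab e by (simp add: cY)
      qed
      then show ?thesis
        using vtx_el[OF \<sigma> x0] x0 by (simp add: vtx_def y_def cY)
    qed
    have eq: "\<sigma> = const_map S D u \<odot> \<tau> \<longleftrightarrow> (\<forall>m. ap u m (star m) = rst Y 0 (replicate (Suc m) 0) y)"
      if u: "u \<in> Hom S (One S) Y" for u
    proof -
      note k = const_map(1)[OF u]
      have el: "el (const_map S D u \<odot> \<tau>) b m z = ap u m (star m)"
        if "b \<in> Ob D" "z \<in> pts (At T b) m" for b m z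
        using that by (simp add: el_cmp(1)[OF \<tau> k] const_map(2)[OF u] el_\<tau>)
      show ?thesis
      proof
        assume "\<sigma> = const_map S D u \<odot> \<tau>"
        then show "\<forall>m. ap u m (star m) = rst Y 0 (replicate (Suc m) 0) y"
          using el \<sigma>_const x0(1) vtx_pts[OF T x0] by metis
      next
        assume "\<forall>m. ap u m (star m) = rst Y 0 (replicate (Suc m) 0) y"
        then show "\<sigma> = const_map S D u \<odot> \<tau>"
          by (intro nat_eq[OF \<sigma> el_cmp(2)[OF \<tau> k]]) (simp add: el \<sigma>_const)
      qed
    qed
    let ?u = "mk (One S) Y (\<lambda>m _. rst Y 0 (replicate (Suc m) 0) y)"
    note hu = hm_point[OF Y y]
    show ?thesis
    proof (rule ex1I[of _ ?u])
      show "?u \<in> Hom S (One S) Y \<and> \<sigma> = const_map S D ?u \<odot> \<tau>"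
        using eq[OF mk_hm(1)[OF hu]] mk_hm(1,3)[OF hu] by simp
      fix u assume "u \<in> Hom S (One S) Y \<and> \<sigma> = const_map S D u \<odot> \<tau>"
      then show "u = ?u"
        using eq[of u] mk_hm(1,3)[OF hu] by (intro mor_eq[of u "One S" Y ?u]) auto
    qed
  qed
  then have "is_diagram_colimit S D T (One S) \<tau>"
    unfolding is_diagram_colimit_def using \<tau> by auto
  then show ?thesis using T unfolding orbit_def obj_diagrams by blast
qed

end


section \<open>Models of spaces\<close>

text \<open>
  Besides internal homs (\<open>Exp\<close>, \<open>evl\<close>), subobjects (\<open>Sub\<close>) and one-point objects (\<open>Tag\<close>), a model has
  objects \<open>G m\<close> classifying arbitrary sets of points of dimension \<open>m\<close>, with \<open>tr m\<close> as truth value, and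
  \<open>Zs\<close> is a set of test objects such that maps against which all maps to test objects extend are
  embeddings.  In the topological case \<open>G m\<close> is an indiscrete pair of points, and the test objects
  are this pair and the Sierpinski space.
\<close>

locale space_model = concrete_spaces S pts rst ap
  for S :: "('o, 'f) spaces"
    and pts :: "'o => nat => 'u element set" and rst ap +
  fixes Exp :: "'o => 'o => 'o"
    and evl :: "'o => 'o => nat => 'u element => 'u element => 'u element"
    and Sub :: "'o => (nat => 'u element set) => 'o"
    and Tag :: "nat list => 'o"
    and G :: "nat => 'o" and tr :: "nat => 'u element => bool"
    and Zs :: "'o set"
    and \<iota> :: "nat list => (nat list sset, nat => nat list => nat list) arrow"
    and N :: "nat list set"
  assumes exp_obj [simp]: "B \<in> Obj S ==> X \<in> Obj S ==> Exp B X \<in> Obj S"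
    and evl_hm: "B \<in> Obj S ==> X \<in> Obj S ==>
        hm (Prod S (Exp B X) B) X (\<lambda>m p. evl B X m (pfst p) (psnd p))"
    and lam_ex: "V \<in> Obj S ==> B \<in> Obj S ==> X \<in> Obj S ==>
        hm (Prod S V B) X (\<lambda>m p. \<beta> m (pfst p) (psnd p)) ==>
        \<exists>\<psi>. hm V (Exp B X) \<psi> \<and> (\<forall>m. \<forall>a \<in> pts V m. \<forall>b \<in> pts B m. evl B X m (\<psi> m a) b = \<beta> m a b)"
    and exp_eqI: "B \<in> Obj S ==> X \<in> Obj S ==> w \<in> pts (Exp B X) m ==> w' \<in> pts (Exp B X) m ==>
        (\<And>l \<theta> b. \<theta> \<in> operators l m ==> b \<in> pts B l ==>
          evl B X l (rst (Exp B X) m \<theta> w) b = evl B X l (rst (Exp B X) m \<theta> w') b) ==> w = w'"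
    and sub_obj: "X \<in> Obj S ==> closed_sub X A ==> Sub X A \<in> Obj S"
    and sub_pts: "X \<in> Obj S ==> closed_sub X A ==> pts (Sub X A) m = A m"
    and sub_incl: "X \<in> Obj S ==> closed_sub X A ==> hm (Sub X A) X (\<lambda>m x. x)"
    and sub_lift: "X \<in> Obj S ==> closed_sub X A ==> hm W X \<phi> ==>
        (\<And>m w. w \<in> pts W m ==> \<phi> m w \<in> A m) ==> hm W (Sub X A) \<phi>"
    and tag [simp]: "Tag \<nu> \<in> Obj S" "pts (Tag \<nu>) m = {Simplex \<nu>}"
    and classifier [simp]: "G m \<in> Obj S"
    and classify: "X \<in> Obj S ==> P \<subseteq> pts X m ==>
        \<exists>\<phi>. hm X (G m) \<phi> \<and> (\<forall>x \<in> pts X m. tr m (\<phi> m x) \<longleftrightarrow> x \<in> P)"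
    and classify_unique: "hm X (G m) \<phi> ==> hm X (G m) \<psi> ==>
        (\<And>x. x \<in> pts X m ==> tr m (\<phi> m x) \<longleftrightarrow> tr m (\<psi> m x)) ==> x \<in> pts X l ==> \<phi> l x = \<psi> l x"
    and test_obj: "Z \<in> Zs ==> Z \<in> Obj S"
    and test_inj: "f \<in> Mor S ==> (\<And>Z. Z \<in> Zs ==> extends S Z f) ==> inj_on (ap f m) (pts (Dom f) m)"
    and test_lift: "f \<in> Mor S ==> (\<And>Z. Z \<in> Zs ==> extends S Z f) ==> h \<in> Mor S ==> Cod h = Cod f ==>
        (\<And>m x. x \<in> pts (Dom h) m ==> ap h m x \<in> ap f m ` pts (Dom f) m) ==>
        \<exists>k \<in> Hom S (Dom h) (Dom f). f \<cdot>\<^bsub>S\<^esub> k = h"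
    and rlz_hom: "\<nu> \<in> N ==> RlzMap S (\<iota> \<nu>) \<in> Hom S (Rlz S (Dom (\<iota> \<nu>))) (Rlz S (Cod (\<iota> \<nu>)))"
    and rlz_nonempty: "\<nu> \<in> N ==> pts (Rlz S (Cod (\<iota> \<nu>))) m \<noteq> {}"
    and rlz_card: "\<nu> \<in> N ==> |SIGMA m : (UNIV :: nat set). pts (Rlz S (Dom (\<iota> \<nu>))) m| \<le>o
        |UNIV :: (nat \<times> nat list \<times> (nat => real)) set|"
    and rlz_extends: "\<nu> \<in> N ==> X \<in> Obj S ==> Z \<in> Zs ==>
        extends S Z (Tuple S (Pr1 S X (Rlz S (Dom (\<iota> \<nu>))))
          (RlzMap S (\<iota> \<nu>) \<cdot>\<^bsub>S\<^esub> Pr2 S X (Rlz S (Dom (\<iota> \<nu>)))))"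
begin

definition lam :: "'o => 'o => 'o => (nat => 'u element => 'u element => 'u element) =>
    nat => 'u element => 'u element" where
  "lam A B X \<phi> = (SOME \<psi>. hm A (Exp B X) \<psi> \<and>
     (\<forall>m. \<forall>a \<in> pts A m. \<forall>b \<in> pts B m. evl B X m (\<psi> m a) b = \<phi> m a b))"

lemma lam:
  assumes A: "A \<in> Obj S" and B: "B \<in> Obj S" and X: "X \<in> Obj S"
    and \<phi>: "hm (Prod S A B) X (\<lambda>m p. \<phi> m (pfst p) (psnd p))"
  shows "hm A (Exp B X) (lam A B X \<phi>)"
    and "a \<in> pts A m ==> lam A B X \<phi> m a \<in> pts (Exp B X) m"
    and "a \<in> pts A m ==> b \<in> pts B m ==> evl B X m (lam A B X \<phi> m a) b = \<phi> m a b"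
    and "\<theta> \<in> operators l m ==> a \<in> pts A m ==> b \<in> pts B l ==>
      evl B X l (rst (Exp B X) m \<theta> (lam A B X \<phi> m a)) b = \<phi> l (rst A m \<theta> a) b"
proof -
  have *: "hm A (Exp B X) (lam A B X \<phi>) \<and>
     (\<forall>m. \<forall>a \<in> pts A m. \<forall>b \<in> pts B m. evl B X m (lam A B X \<phi> m a) b = \<phi> m a b)"
    unfolding lam_def by (rule someI_ex[OF lam_ex[OF assms]])
  then show hm: "hm A (Exp B X) (lam A B X \<phi>)" by blast
  show "a \<in> pts A m ==> lam A B X \<phi> m a \<in> pts (Exp B X) m" by (rule hm_pts[OF hm])
  show "a \<in> pts A m ==> b \<in> pts B m ==> evl B X m (lam A B X \<phi> m a) b = \<phi> m a b" using * by blast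
  show "\<theta> \<in> operators l m ==> a \<in> pts A m ==> b \<in> pts B l ==>
      evl B X l (rst (Exp B X) m \<theta> (lam A B X \<phi> m a)) b = \<phi> l (rst A m \<theta> a) b"
    using * A by (simp add: hm_rst[OF hm, symmetric])
qed

lemmas evl_pts = hm_binary_pts[OF evl_hm]
lemma sub_rst: "X \<in> Obj S ==> closed_sub X A ==> \<theta> \<in> operators m n ==> x \<in> A n ==>
    rst (Sub X A) n \<theta> x = rst X n \<theta> x"
  using hm_rst[OF sub_incl] by (simp add: sub_pts)

lemma hm_tag: "X \<in> Obj S ==> hm X (Tag \<nu>) (\<lambda>m x. Simplex \<nu>)"
proof -
  assume X: "X \<in> Obj S"
  have *: "rst (Tag \<nu>) 0 (replicate (Suc m) 0) (Simplex \<nu>) = Simplex \<nu>" for m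
    using rst_pts[OF tag(1) const_operator, of "Simplex \<nu>" \<nu> m] by simp
  show ?thesis
    using hm_comp[OF hm_one[OF X] hm_point[OF tag(1), of "Simplex \<nu>" \<nu>]] unfolding * by simp
qed

abbreviation RK :: "nat list => 'o" where "RK \<nu> \<equiv> Rlz S (Dom (\<iota> \<nu>))"
abbreviation RL :: "nat list => 'o" where "RL \<nu> \<equiv> Rlz S (Cod (\<iota> \<nu>))"
abbreviation inc :: "nat list => nat => 'u element => 'u element" where "inc \<nu> \<equiv> ap (RlzMap S (\<iota> \<nu>))"

lemma rlz_obj: "\<nu> \<in> N ==> RK \<nu> \<in> Obj S" "\<nu> \<in> N ==> RL \<nu> \<in> Obj S"
  using hm_obj[OF hm_ap[OF rlz_hom]] by auto

lemma inc_hm: "\<nu> \<in> N ==> hm (RK \<nu>) (RL \<nu>) (inc \<nu>)"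
  by (rule hm_ap[OF rlz_hom])

lemmas inc_pts = hm_pts[OF inc_hm]
end

locale model_diagrams = space_model S pts rst ap Exp evl Sub Tag G tr Zs \<iota> N + diagrams S pts rst ap D
  for S :: "('o, 'f) spaces"
    and pts :: "'o => nat => 'u element set" and rst ap Exp evl Sub Tag G tr Zs \<iota> N
    and D :: "('d, 'o, 'f) enriched" +
  assumes small_Ob: "small TYPE('u) (Ob D)"
begin

section \<open>Subdiagrams\<close>

definition subdiag :: "('d, 'o, 'f) diagram => ('d => nat => 'u element set) => ('d, 'o, 'f) diagram" where
  "subdiag X A = mkdiag (\<lambda>a. Sub (At X a) (A a)) (act X)"

definition invariant :: "('d, 'o, 'f) diagram => ('d => nat => 'u element set) => bool" where
  "invariant X A \<longleftrightarrow> (\<forall>a \<in> Ob D. closed_sub (At X a) (A a)) \<and>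
     (\<forall>a \<in> Ob D. \<forall>b \<in> Ob D. \<forall>m. \<forall>e \<in> pts (EHom D a b) m. \<forall>x \<in> A a m. act X a b m e x \<in> A b m)"

context
  fixes X A assumes X: "enriched_functor S D X" and A: "invariant X A"
begin

lemma invariant_sub: "a \<in> Ob D ==> closed_sub (At X a) (A a)"
  using A unfolding invariant_def by blast

lemma invariant_pts: "a \<in> Ob D ==> x \<in> A a m ==> x \<in> pts (At X a) m"
  using invariant_sub unfolding closed_sub_def by blast

lemma invariant_act: "a \<in> Ob D ==> b \<in> Ob D ==> e \<in> pts (EHom D a b) m ==> x \<in> A a m ==>
    act X a b m e x \<in> A b m"
  using A unfolding invariant_def by blast

lemma subdiag:
  shows "enriched_functor S D (subdiag X A)"
    and "a \<in> Ob D ==> At (subdiag X A) a = Sub (At X a) (A a)"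
    and "a \<in> Ob D ==> pts (At (subdiag X A) a) m = A a m"
    and "a \<in> Ob D ==> b \<in> Ob D ==> e \<in> pts (EHom D a b) m ==> x \<in> A a m ==>
      act (subdiag X A) a b m e x = act X a b m e x"
    and "a \<in> Ob D ==> \<theta> \<in> operators m n ==> x \<in> A a n ==>
      rst (At (subdiag X A) a) n \<theta> x = rst (At X a) n \<theta> x"
proof -
  note obj = at_obj[OF X] and sub = invariant_sub
  have pts: "pts (Sub (At X a) (A a)) m = A a m" if "a \<in> Ob D" for a m
    using sub_pts[OF obj sub] that by blast
  have hm: "hm (Prod S (EHom D a b) (Sub (At X a) (A a))) (Sub (At X b) (A b))
      (\<lambda>m p. act X a b m (pfst p) (psnd p))" if ab: "a \<in> Ob D" "b \<in> Ob D" for a b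
  proof (rule sub_lift[OF obj[OF ab(2)] sub[OF ab(2)]])
    show "hm (Prod S (EHom D a b) (Sub (At X a) (A a))) (At X b) (\<lambda>m p. act X a b m (pfst p) (psnd p))"
      using ab sub_obj[OF obj sub]
      by (intro hm_binary[OF act_hm[OF X]] hm_pfst hm_comp[OF hm_psnd sub_incl] obj sub) auto
    show "act X a b m (pfst p) (psnd p) \<in> A b m"
      if "p \<in> pts (Prod S (EHom D a b) (Sub (At X a) (A a))) m" for m p
      using that ab invariant_act[OF ab] by (auto simp: pts)
  qed
  note d = mkdiag[of "\<lambda>a. Sub (At X a) (A a)" "act X", OF sub_obj[OF obj sub] hm]
  have d1: "enriched_functor S D (mkdiag (\<lambda>a. Sub (At X a) (A a)) (act X))"
    by (rule d(1)) (auto simp: pts invariant_pts intro!: act_cmp[OF X] act_idn[OF X])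
  then show "enriched_functor S D (subdiag X A)" by (simp add: subdiag_def)
  show At: "At (subdiag X A) a = Sub (At X a) (A a)" if "a \<in> Ob D" for a
    using that by (simp add: subdiag_def mkdiag_def)
  show "a \<in> Ob D ==> pts (At (subdiag X A) a) m = A a m" by (simp add: At pts)
  show "a \<in> Ob D ==> b \<in> Ob D ==> e \<in> pts (EHom D a b) m ==> x \<in> A a m ==>
      act (subdiag X A) a b m e x = act X a b m e x"
    unfolding subdiag_def
    by (rule d(3)) (auto simp: pts invariant_pts intro!: act_cmp[OF X] act_idn[OF X])
  show "a \<in> Ob D ==> \<theta> \<in> operators m n ==> x \<in> A a n ==>
      rst (At (subdiag X A) a) n \<theta> x = rst (At X a) n \<theta> x"
    by (simp add: At sub_rst[OF obj sub])
qed

lemma subdiag_incl: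
  shows "mknat (subdiag X A) X (\<lambda>a m x. x) \<in> Hom \<D> (subdiag X A) X"
    and "a \<in> Ob D ==> x \<in> A a m ==> el (mknat (subdiag X A) X (\<lambda>a m x. x)) a m x = x"
proof -
  have hm: "hm (At (subdiag X A) a) (At X a) (\<lambda>m x. x)" if "a \<in> Ob D" for a
    using that sub_incl[OF at_obj[OF X] invariant_sub] by (simp add: subdiag)
  note n = mknat[OF subdiag(1) X, of "\<lambda>a m x. x", OF hm]
  show "mknat (subdiag X A) X (\<lambda>a m x. x) \<in> Hom \<D> (subdiag X A) X"
    by (rule n(1)) (auto simp: subdiag sub_pts[OF at_obj[OF X] invariant_sub])
  show "a \<in> Ob D ==> x \<in> A a m ==> el (mknat (subdiag X A) X (\<lambda>a m x. x)) a m x = x"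
    by (rule n(2)) (auto simp: subdiag sub_pts[OF at_obj[OF X] invariant_sub])
qed

lemma subdiag_lift:
  assumes \<alpha>: "\<alpha> \<in> Hom \<D> W X"
    and img: "\<And>a m w. a \<in> Ob D ==> w \<in> pts (At W a) m ==> el \<alpha> a m w \<in> A a m"
  shows "mknat W (subdiag X A) (el \<alpha>) \<in> Hom \<D> W (subdiag X A)"
    and "a \<in> Ob D ==> w \<in> pts (At W a) m ==> el (mknat W (subdiag X A) (el \<alpha>)) a m w = el \<alpha> a m w"
proof -
  have hm: "hm (At W a) (At (subdiag X A) a) (el \<alpha> a)" if "a \<in> Ob D" for a
    using that sub_lift[OF at_obj[OF X] invariant_sub el_hm[OF \<alpha>]] img by (simp add: subdiag)
  note n = mknat[OF nat_components(1)[OF \<alpha>] subdiag(1), of "el \<alpha>", OF hm]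
  show "mknat W (subdiag X A) (el \<alpha>) \<in> Hom \<D> W (subdiag X A)"
    by (rule n(1)) (auto simp: subdiag img el_act[OF \<alpha>])
  show "a \<in> Ob D ==> w \<in> pts (At W a) m ==> el (mknat W (subdiag X A) (el \<alpha>)) a m w = el \<alpha> a m w"
    by (rule n(2)) (auto simp: subdiag img el_act[OF \<alpha>])
qed

end


section \<open>Orbits are the connected diagrams\<close>

text \<open>
  The indicator of a union of components is invariant under the action, hence natural as a map to a
  constant diagram.
\<close>

lemma classify_component:
  assumes X: "enriched_functor S D X"
    and B: "\<And>a. a \<in> Ob D ==> B a \<subseteq> pts (At X a) m"
    and inv: "\<And>a b e x. a \<in> Ob D ==> b \<in> Ob D ==> e \<in> pts (EHom D a b) m ==> x \<in> pts (At X a) m ==>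
      act X a b m e x \<in> B b \<longleftrightarrow> x \<in> B a"
  shows "\<exists>\<xi> \<in> Hom \<D> X (const_diagram S D (G m)).
    \<forall>a \<in> Ob D. \<forall>x \<in> pts (At X a) m. tr m (el \<xi> a m x) \<longleftrightarrow> x \<in> B a"
proof -
  have "\<forall>a \<in> Ob D. \<exists>\<phi>. hm (At X a) (G m) \<phi> \<and> (\<forall>x \<in> pts (At X a) m. tr m (\<phi> m x) \<longleftrightarrow> x \<in> B a)"
    using classify[OF at_obj[OF X] B] by blast
  then obtain \<phi> where \<phi>: "\<And>a. a \<in> Ob D ==> hm (At X a) (G m) (\<phi> a)"
    and tr: "\<And>a x. a \<in> Ob D ==> x \<in> pts (At X a) m ==> tr m (\<phi> a m x) \<longleftrightarrow> x \<in> B a"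
    by metis
  note G = const_diagram[OF classifier[of m]]
  have hm: "hm (At X a) (At (const_diagram S D (G m)) a) (\<phi> a)" if "a \<in> Ob D" for a
    using \<phi> that by (simp add: G)
  have nat: "\<phi> b l (act X a b l e x) = act (const_diagram S D (G m)) a b l e (\<phi> a l x)"
    if ab: "a \<in> Ob D" "b \<in> Ob D" and e: "e \<in> pts (EHom D a b) l" "x \<in> pts (At X a) l" for a b l e x
  proof -
    let ?P = "Prod S (EHom D a b) (At X a)"
    let ?f = "\<lambda>l p. \<phi> b l (act X a b l (pfst p) (psnd p))" and ?g = "\<lambda>l p. \<phi> a l (psnd p)"
    have "?f l (Pair e x) = ?g l (Pair e x)"
    proof (rule classify_unique[of ?P m ?f ?g "Pair e x" l])
      show "hm ?P (G m) ?f"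
        by (rule hm_comp[OF act_hm[OF X ab] \<phi>[OF ab(2)]])
      show "hm ?P (G m) ?g"
        using ab at_obj[OF X] by (intro hm_comp[OF hm_psnd \<phi>]) auto
      show "tr m (?f m p) \<longleftrightarrow> tr m (?g m p)"
        if "p \<in> pts ?P m" for p
        using that ab by (auto simp: tr inv act_pts[OF X])
      show "Pair e x \<in> pts ?P l" using e by simp
    qed
    then show ?thesis using ab e hm_pts[OF \<phi>] by (simp add: G)
  qed
  note n = mknat[OF X G(1), of \<phi>, OF hm nat]
  show ?thesis
    by (rule bexI[OF _ n(1)]) (auto simp: n(2) tr)
qed

lemma orbit_functor: "orbit S D T ==> enriched_functor S D T"
  unfolding orbit_def obj_diagrams by blast

text \<open>
  The classifying map of a component extends over the colimit, which is a point, and is therefore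
  constant.  There is a point at all, since the colimit of an empty diagram is not a point.
\<close>

lemma orbit_connected:
  assumes "orbit S D T"
  shows "connected_diagram T"
proof -
  obtain \<tau> where T: "enriched_functor S D T" and \<tau>: "is_diagram_colimit S D T (One S) \<tau>"
    using assms unfolding orbit_def obj_diagrams by blast
  have \<tau>_hom: "\<tau> \<in> Hom \<D> T (const_diagram S D (One S))"
    and univ: "\<And>Y \<sigma>. Y \<in> Obj S ==> \<sigma> \<in> Hom \<D> T (const_diagram S D Y) ==>
       \<exists>!u. u \<in> Hom S (One S) Y \<and> \<sigma> = const_map S D u \<odot> \<tau>"
    using \<tau> unfolding is_diagram_colimit_def by blast+
  note O = const_diagram[OF one_S(1)]
  have el_\<tau>: "el \<tau> a m x = star m" if "a \<in> Ob D" "x \<in> pts (At T a) m" for a m x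
    using el_pts[OF \<tau>_hom that] that by (simp add: O)
  \<comment> \<open>The two maps from the terminal object to a classifier are separated by points of the orbit.\<close>
  have "\<exists>a \<in> Ob D. pts (At T a) 0 \<noteq> {}"
  proof (rule ccontr)
    assume "\<not> ?thesis"
    then have empty: "pts (At T a) 0 = {}" if "a \<in> Ob D" for a using that by blast
    have const0: "replicate (Suc 0) 0 \<in> operators 0 m" for m by (simp add: operators_def)
    have empty': "pts (At T a) m = {}" if "a \<in> Ob D" for a m
      using rst_pts[OF at_obj[OF T that] const0] empty[OF that] by blast
    obtain \<phi> \<psi> where \<phi>: "hm (One S) (G 0) \<phi>" "tr 0 (\<phi> 0 (star 0))"
      and \<psi>: "hm (One S) (G 0) \<psi>" "\<not> tr 0 (\<psi> 0 (star 0))"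
      using classify[OF one_S(1), of "pts (One S) 0" 0] classify[OF one_S(1), of "{}" 0] by auto
    let ?u = "mk (One S) (G 0) \<phi>" and ?v = "mk (One S) (G 0) \<psi>"
    have hom: "const_map S D w \<odot> \<tau> \<in> Hom \<D> T (const_diagram S D (G 0))"
      if "w \<in> Hom S (One S) (G 0)" for w
      by (rule el_cmp(2)[OF \<tau>_hom const_map(1)[OF that]])
    have "const_map S D ?u \<odot> \<tau> = const_map S D ?v \<odot> \<tau>"
      by (rule nat_eq[OF hom hom]) (auto simp: mk_hm \<phi> \<psi> empty')
    then have "?u = ?v"
      using univ[OF classifier hom[OF mk_hm(1)[OF \<phi>(1)]]] mk_hm(1)[OF \<phi>(1)] mk_hm(1)[OF \<psi>(1)] by metis
    then show False using \<phi>(2) \<psi>(2) mk_hm(3)[OF \<phi>(1), of "star 0" 0] mk_hm(3)[OF \<psi>(1), of "star 0" 0] by simp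
  qed
  moreover have "((a, x), (b, y)) \<in> conn T m"
    if ab: "a \<in> Ob D" "b \<in> Ob D" and x: "x \<in> pts (At T a) m" and y: "y \<in> pts (At T b) m" for a b x y m
  proof -
    let ?B = "\<lambda>c. {z \<in> pts (At T c) m. ((a, x), (c, z)) \<in> conn T m}"
    have "\<exists>\<xi> \<in> Hom \<D> T (const_diagram S D (G m)).
        \<forall>c \<in> Ob D. \<forall>z \<in> pts (At T c) m. tr m (el \<xi> c m z) \<longleftrightarrow> z \<in> ?B c"
    proof (rule classify_component[OF T])
      fix c d e z assume cd: "c \<in> Ob D" "d \<in> Ob D" and e: "e \<in> pts (EHom D c d) m" "z \<in> pts (At T c) m"
      show "act T c d m e z \<in> ?B d \<longleftrightarrow> z \<in> ?B c"
        using linked_conn[OF cd e] conn_trans conn_sym act_pts[OF T cd e] e by blast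
    qed auto
    then obtain \<xi> where \<xi>: "\<xi> \<in> Hom \<D> T (const_diagram S D (G m))"
      and tr: "\<And>c z. c \<in> Ob D ==> z \<in> pts (At T c) m ==> tr m (el \<xi> c m z) \<longleftrightarrow> z \<in> ?B c"
      by blast
    obtain u where u: "u \<in> Hom S (One S) (G m)" "\<xi> = const_map S D u \<odot> \<tau>"
      using univ[OF classifier \<xi>] by blast
    have "el \<xi> c m z = ap u m (star m)" if "c \<in> Ob D" "z \<in> pts (At T c) m" for c z
      using that by (simp add: u(2) el_cmp(1)[OF \<tau>_hom const_map(1)[OF u(1)]] const_map(2)[OF u(1)] el_\<tau>)
    then have "tr m (el \<xi> a m x) \<longleftrightarrow> tr m (el \<xi> b m y)" using ab x y by simp
    then show ?thesis using tr[OF ab(1) x] tr[OF ab(2) y] x conn_refl by simp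
  qed
  ultimately show ?thesis unfolding connected_diagram_def by blast
qed

definition component :: "('d, 'o, 'f) diagram => 'd => 'u element => 'd => nat => 'u element set" where
  "component X a x b m = {y. b \<in> Ob D \<and> ((a, vtx X a x m), (b, y)) \<in> conn X m}"

context
  fixes X a x
  assumes X: "enriched_functor S D X" and a: "a \<in> Ob D" and x: "x \<in> pts (At X a) 0"
begin

lemma component_pts: "y \<in> component X a x b m ==> y \<in> pts (At X b) m"
  unfolding component_def using conn_pts[OF X _ a vtx_pts[OF X a x]] by blast

lemma component_invariant: "invariant X (component X a x)"
  unfolding invariant_def closed_sub_def
proof (intro conjI ballI allI subsetI)
  fix b m y assume "b \<in> Ob D" "y \<in> component X a x b m"
  then show "y \<in> pts (At X b) m" using component_pts by blast
next
  fix b m n \<theta> y assume b: "b \<in> Ob D" and \<theta>: "\<theta> \<in> operators m n" and y: "y \<in> component X a x b n"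
  show "rst (At X b) n \<theta> y \<in> component X a x b m"
    using y conn_rst[OF X _ \<theta>] vtx_rst[OF X a x \<theta>] unfolding component_def by fastforce
next
  fix b c m e y assume bc: "b \<in> Ob D" "c \<in> Ob D" and e: "e \<in> pts (EHom D b c) m"
    and y: "y \<in> component X a x b m"
  show "act X b c m e y \<in> component X a x c m"
    using y linked_conn[OF bc e component_pts[OF y]] bc conn_trans unfolding component_def by blast
qed

text \<open>
  The action cannot leave a component, and within it any two points of equal dimension are linked.
\<close>

lemma component_orbit: "orbit S D (subdiag X (component X a x))"
proof (rule connected_orbit)
  let ?C = "component X a x"
  note C = component_invariant and s = subdiag[OF X component_invariant]
  show "enriched_functor S D (subdiag X ?C)" by (rule s)
  have vtx: "vtx X a x m \<in> ?C a m" for m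
    unfolding component_def using a conn_refl by simp
  have reach: "((a, vtx X a x m), (b, y)) \<in> conn (subdiag X ?C) m"
    if "((a, vtx X a x m), (b, y)) \<in> conn X m" for b y m
  proof -
    have "(p, q) \<in> conn (subdiag X ?C) m \<and> snd q \<in> ?C (fst q) m"
      if "(p, q) \<in> conn X m" "p = (a, vtx X a x m)" for p q
      using that unfolding conn_def[of X]
    proof (induction rule: rtrancl_induct)
      case base
      then show ?case using conn_refl vtx by simp
    next
      case (step q r)
      have pq: "(p, q) \<in> conn X m" "(p, q) \<in> conn (subdiag X ?C) m" "snd q \<in> ?C (fst q) m"
        using step unfolding conn_def[of X] by auto
      have qr: "(q, r) \<in> conn X m" using step(2) unfolding conn_def by blast
      have rO: "fst r \<in> Ob D" using step(2) by (auto simp: linked_def)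
      have r: "snd r \<in> ?C (fst r) m"
        using conn_trans[OF pq(1) qr] rO step(4) unfolding component_def by (cases r) simp
      have "(q, r) \<in> conn (subdiag X ?C) m"
        using step(2)
      proof
        assume "(q, r) \<in> linked X m"
        then obtain b c e y where *: "q = (b, y)" "r = (c, act X b c m e y)" "b \<in> Ob D" "c \<in> Ob D"
          "e \<in> pts (EHom D b c) m" unfolding linked_def by blast
        then show ?thesis using linked_conn[of b c e m y "subdiag X ?C"] pq(3) by (simp add: s(3,4))
      next
        assume "(q, r) \<in> (linked X m)\<inverse>"
        then obtain b c e y where *: "r = (b, y)" "q = (c, act X b c m e y)" "b \<in> Ob D" "c \<in> Ob D"
          "e \<in> pts (EHom D b c) m" unfolding linked_def by blast
        then have "(r, q) \<in> conn (subdiag X ?C) m"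
          using linked_conn[of b c e m y "subdiag X ?C"] r by (simp add: s(3,4))
        then show ?thesis by (rule conn_sym)
      qed
      then show ?case using conn_trans[OF pq(2)] r by blast
    qed
    from this[OF that refl] show ?thesis by blast
  qed
  show "connected_diagram (subdiag X ?C)"
    unfolding connected_diagram_def
  proof (intro conjI allI ballI)
    show "\<exists>a \<in> Ob D. pts (At (subdiag X ?C) a) 0 \<noteq> {}" using a vtx[of 0] by (auto simp: s(3))
    fix m b c y z assume "b \<in> Ob D" "c \<in> Ob D"
      "y \<in> pts (At (subdiag X ?C) b) m" "z \<in> pts (At (subdiag X ?C) c) m"
    then have "((a, vtx X a x m), (b, y)) \<in> conn (subdiag X ?C) m"
      "((a, vtx X a x m), (c, z)) \<in> conn (subdiag X ?C) m"
      using reach by (auto simp: s(3)) (auto simp: component_def)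
    then show "((b, y), (c, z)) \<in> conn (subdiag X ?C) m" using conn_trans conn_sym by blast
  qed
qed

end

end

context model_diagrams
begin

section \<open>Cofree diagrams\<close>

definition cof_act :: "'d => 'o => 'd => 'd => nat => 'u element => 'u element => 'u element" where
  "cof_act d Z a b m e w = lam (Prod S (EHom D a b) (Exp (EHom D a d) Z)) (EHom D b d) Z
     (\<lambda>m p f. evl (EHom D a d) Z m (psnd p) (cmp a b d m f (pfst p))) m (Pair e w)"

text \<open>The value at \<open>d\<close> has a right adjoint, which sends \<open>Z\<close> to the functions on \<open>D(-, d)\<close>.\<close>

definition Cof :: "'d => 'o => ('d, 'o, 'f) diagram" where
  "Cof d Z = mkdiag (\<lambda>a. Exp (EHom D a d) Z) (cof_act d Z)"

context
  fixes d Z assumes d: "d \<in> Ob D" and Z: "Z \<in> Obj S"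
begin

lemma cof_act:
  assumes ab: "a \<in> Ob D" "b \<in> Ob D"
  shows "hm (Prod S (EHom D a b) (Exp (EHom D a d) Z)) (Exp (EHom D b d) Z)
      (\<lambda>m p. cof_act d Z a b m (pfst p) (psnd p))"
    and "e \<in> pts (EHom D a b) m ==> w \<in> pts (Exp (EHom D a d) Z) m ==> f \<in> pts (EHom D b d) m ==>
      evl (EHom D b d) Z m (cof_act d Z a b m e w) f = evl (EHom D a d) Z m w (cmp a b d m f e)"
proof -
  let ?A = "Prod S (EHom D a b) (Exp (EHom D a d) Z)"
  have obj: "?A \<in> Obj S" "EHom D b d \<in> Obj S" "EHom D a b \<in> Obj S" "Exp (EHom D a d) Z \<in> Obj S"
    using ab d Z by auto
  have hm: "hm (Prod S ?A (EHom D b d)) Z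
      (\<lambda>m p. evl (EHom D a d) Z m (psnd (pfst p)) (cmp a b d m (psnd p) (pfst (pfst p))))"
    using ab d Z obj
    by (intro hm_binary[OF evl_hm] hm_binary[OF cmp_hm] hm_fst[OF hm_pfst] hm_snd[OF hm_pfst] hm_psnd) auto
  note l = lam[OF obj(1,2) Z hm]
  show "hm ?A (Exp (EHom D b d) Z) (\<lambda>m p. cof_act d Z a b m (pfst p) (psnd p))"
    by (rule hm_cong[THEN iffD1, OF _ l(1)]) (auto simp: cof_act_def)
  show "e \<in> pts (EHom D a b) m ==> w \<in> pts (Exp (EHom D a d) Z) m ==> f \<in> pts (EHom D b d) m ==>
      evl (EHom D b d) Z m (cof_act d Z a b m e w) f = evl (EHom D a d) Z m w (cmp a b d m f e)"
    using l(3)[of "Pair e w" m f] by (simp add: cof_act_def)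
qed

lemma exp_obj_d: "a \<in> Ob D ==> Exp (EHom D a d) Z \<in> Obj S"
  using d Z by simp

lemma Cof:
  shows "enriched_functor S D (Cof d Z)"
    and "a \<in> Ob D ==> At (Cof d Z) a = Exp (EHom D a d) Z"
    and "a \<in> Ob D ==> b \<in> Ob D ==> e \<in> pts (EHom D a b) m ==> w \<in> pts (Exp (EHom D a d) Z) m ==>
      act (Cof d Z) a b m e w = cof_act d Z a b m e w"
proof -
  have E: "EHom D a d \<in> Obj S" if "a \<in> Ob D" for a using that d by simp
  have pts: "cof_act d Z a b m e w \<in> pts (Exp (EHom D b d) Z) m"
    if "a \<in> Ob D" "b \<in> Ob D" "e \<in> pts (EHom D a b) m" "w \<in> pts (Exp (EHom D a d) Z) m" for a b m e w
    using hm_binary_pts[OF cof_act(1)] that by blast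
  have rst: "rst (Exp (EHom D b d) Z) n \<theta> (cof_act d Z a b n e w) =
      cof_act d Z a b m (rst (EHom D a b) n \<theta> e) (rst (Exp (EHom D a d) Z) n \<theta> w)"
    if "a \<in> Ob D" "b \<in> Ob D" "\<theta> \<in> operators m n" "e \<in> pts (EHom D a b) n" "w \<in> pts (Exp (EHom D a d) Z) n"
    for a b m n \<theta> e w
    using hm_binary_rst[OF cof_act(1)[OF that(1,2)] that(3-)] by simp
  have cmp: "cof_act d Z a c m (cmp a b c m g f) w = cof_act d Z b c m g (cof_act d Z a b m f w)"
    if abc: "a \<in> Ob D" "b \<in> Ob D" "c \<in> Ob D" and gf: "g \<in> pts (EHom D b c) m" "f \<in> pts (EHom D a b) m"
      and w: "w \<in> pts (Exp (EHom D a d) Z) m" for a b c m g f w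
  proof (rule exp_eqI[OF E[OF abc(3)] Z])
    show "cof_act d Z a c m (cmp a b c m g f) w \<in> pts (Exp (EHom D c d) Z) m"
      "cof_act d Z b c m g (cof_act d Z a b m f w) \<in> pts (Exp (EHom D c d) Z) m"
      using abc gf w by (auto intro!: pts cmp_pts)
    fix l \<theta> h assume \<theta>: "\<theta> \<in> operators l m" and h: "h \<in> pts (EHom D c d) l"
    have "rst (EHom D b c) m \<theta> g \<in> pts (EHom D b c) l" "rst (EHom D a b) m \<theta> f \<in> pts (EHom D a b) l"
      "rst (Exp (EHom D a d) Z) m \<theta> w \<in> pts (Exp (EHom D a d) Z) l"
      using abc gf w \<theta> exp_obj_d by auto
    then show "evl (EHom D c d) Z l (rst (Exp (EHom D c d) Z) m \<theta> (cof_act d Z a c m (cmp a b c m g f) w)) h =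
        evl (EHom D c d) Z l (rst (Exp (EHom D c d) Z) m \<theta> (cof_act d Z b c m g (cof_act d Z a b m f w))) h"
      using abc d gf w \<theta> h
      by (simp add: rst cmp_pts pts cmp_rst[symmetric] cof_act(2) cmp_assoc)
  qed
  have idn: "cof_act d Z a a m (idn a m) w = w"
    if a: "a \<in> Ob D" and w: "w \<in> pts (Exp (EHom D a d) Z) m" for a m w
  proof (rule exp_eqI[OF E[OF a] Z])
    show "cof_act d Z a a m (idn a m) w \<in> pts (Exp (EHom D a d) Z) m" using a w by (auto intro!: pts)
    fix l \<theta> h assume \<theta>: "\<theta> \<in> operators l m" and h: "h \<in> pts (EHom D a d) l"
    show "evl (EHom D a d) Z l (rst (Exp (EHom D a d) Z) m \<theta> (cof_act d Z a a m (idn a m) w)) h =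
        evl (EHom D a d) Z l (rst (Exp (EHom D a d) Z) m \<theta> w) h"
      using a w \<theta> h d exp_obj_d[OF a] by (simp add: rst idn_rst cof_act(2))
  qed (rule w)
  note k = mkdiag[of "\<lambda>a. Exp (EHom D a d) Z" "cof_act d Z", OF exp_obj_d cof_act(1) cmp idn]
  show "enriched_functor S D (Cof d Z)" unfolding Cof_def by (rule k(1))
  show "a \<in> Ob D ==> At (Cof d Z) a = Exp (EHom D a d) Z" unfolding Cof_def by (rule k(2))
  show "a \<in> Ob D ==> b \<in> Ob D ==> e \<in> pts (EHom D a b) m ==> w \<in> pts (Exp (EHom D a d) Z) m ==>
      act (Cof d Z) a b m e w = cof_act d Z a b m e w" unfolding Cof_def by (rule k(3))
qed

definition flat :: "('d, 'o, 'f) transformation => nat => 'u element => 'u element" where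
  "flat \<alpha> m x = evl (EHom D d d) Z m (el \<alpha> d m x) (idn d m)"

definition sharp :: "('d, 'o, 'f) diagram => (nat => 'u element => 'u element) =>
    ('d, 'o, 'f) transformation" where
  "sharp X \<phi> = mknat X (Cof d Z) (\<lambda>a. lam (At X a) (EHom D a d) Z (\<lambda>m x e. \<phi> m (act X a d m e x)))"

lemma flat_hm:
  assumes \<alpha>: "\<alpha> \<in> Hom \<D> X (Cof d Z)"
  shows "hm (At X d) Z (flat \<alpha>)"
proof -
  have X: "At X d \<in> Obj S" using nat_components(1)[OF \<alpha>] at_obj d by blast
  have "hm (At X d) Z (\<lambda>m x. evl (EHom D d d) Z m (el \<alpha> d m x) (idn d m))"
    using el_hm[OF \<alpha> d] d Z
    by (intro hm_binary[OF evl_hm] hm_comp[OF hm_one[OF X] idn_hm]) (auto simp: Cof)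
  then show ?thesis by (simp add: flat_def[abs_def])
qed

lemma evl_flat:
  assumes \<alpha>: "\<alpha> \<in> Hom \<D> X (Cof d Z)" and a: "a \<in> Ob D"
    and x: "x \<in> pts (At X a) m" and e: "e \<in> pts (EHom D a d) m"
  shows "evl (EHom D a d) Z m (el \<alpha> a m x) e = flat \<alpha> m (act X a d m e x)"
proof -
  have "el \<alpha> a m x \<in> pts (Exp (EHom D a d) Z) m" using el_pts[OF \<alpha> a x] a by (simp add: Cof)
  then show ?thesis
    using a d e by (simp add: flat_def el_act[OF \<alpha> a d e x] Cof cof_act(2))
qed

lemma sharp:
  assumes X: "enriched_functor S D X" and \<phi>: "hm (At X d) Z \<phi>"
  shows "sharp X \<phi> \<in> Hom \<D> X (Cof d Z)"
    and "x \<in> pts (At X d) m ==> flat (sharp X \<phi>) m x = \<phi> m x"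
proof -
  let ?l = "\<lambda>a. lam (At X a) (EHom D a d) Z (\<lambda>m x e. \<phi> m (act X a d m e x))"
  have hm: "hm (Prod S (At X a) (EHom D a d)) Z (\<lambda>m p. \<phi> m (act X a d m (psnd p) (pfst p)))"
    if a: "a \<in> Ob D" for a
    using a d at_obj[OF X]
    by (intro hm_comp[OF hm_binary[OF act_hm[OF X]] \<phi>] hm_pfst hm_psnd) auto
  have E: "EHom D a d \<in> Obj S" if "a \<in> Ob D" for a using that d by simp
  note l = lam[OF at_obj[OF X] E Z hm]
  have lhm: "hm (At X a) (At (Cof d Z) a) (?l a)" if a: "a \<in> Ob D" for a
    using l(1)[OF a a a] by (simp add: Cof a)
  have nat: "?l b m (act X a b m e x) = act (Cof d Z) a b m e (?l a m x)"
    if ab: "a \<in> Ob D" "b \<in> Ob D" and e: "e \<in> pts (EHom D a b) m" and x: "x \<in> pts (At X a) m" for a b m e x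
  proof (rule exp_eqI[OF E[OF ab(2)] Z])
    have p: "?l a m x \<in> pts (Exp (EHom D a d) Z) m" using l(2) ab x by blast
    show "?l b m (act X a b m e x) \<in> pts (Exp (EHom D b d) Z) m"
      using l(2) ab act_pts[OF X ab e x] by blast
    show "act (Cof d Z) a b m e (?l a m x) \<in> pts (Exp (EHom D b d) Z) m"
      using act_pts[OF Cof(1), of a b e m "?l a m x"] p ab e by (simp add: Cof)
    fix k \<theta> f assume \<theta>: "\<theta> \<in> operators k m" and f: "f \<in> pts (EHom D b d) k"
    have re: "rst (EHom D a b) m \<theta> e \<in> pts (EHom D a b) k" using ab e \<theta> by auto
    have rx: "rst (At X a) m \<theta> x \<in> pts (At X a) k" using ab x \<theta> at_obj[OF X] by auto
    have rp: "rst (Exp (EHom D a d) Z) m \<theta> (?l a m x) \<in> pts (Exp (EHom D a d) Z) k"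
      using p \<theta> exp_obj_d[OF ab(1)] by auto
    have "evl (EHom D b d) Z k (rst (Exp (EHom D b d) Z) m \<theta> (?l b m (act X a b m e x))) f =
        \<phi> k (act X b d k f (act X a b k (rst (EHom D a b) m \<theta> e) (rst (At X a) m \<theta> x)))"
      using l(4)[OF ab(2) ab(2) ab(2) \<theta> act_pts[OF X ab e x] f] act_rst[OF X ab \<theta> e x] by simp
    also have "\<dots> = \<phi> k (act X a d k (cmp a b d k f (rst (EHom D a b) m \<theta> e)) (rst (At X a) m \<theta> x))"
      using act_cmp[OF X ab d f re rx] by simp
    also have "\<dots> = evl (EHom D a d) Z k (rst (Exp (EHom D a d) Z) m \<theta> (?l a m x))
        (cmp a b d k f (rst (EHom D a b) m \<theta> e))"
      using l(4)[OF ab(1) ab(1) ab(1) \<theta> x cmp_pts[OF ab d f re]] by simp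
    also have "\<dots> = evl (EHom D b d) Z k
        (rst (Exp (EHom D b d) Z) m \<theta> (act (Cof d Z) a b m e (?l a m x))) f"
      using hm_binary_rst[OF cof_act(1)[OF ab] \<theta> e p] cof_act(2)[OF ab re rp f] ab e p
      by (simp add: Cof)
    finally show "evl (EHom D b d) Z k (rst (Exp (EHom D b d) Z) m \<theta> (?l b m (act X a b m e x))) f =
      evl (EHom D b d) Z k (rst (Exp (EHom D b d) Z) m \<theta> (act (Cof d Z) a b m e (?l a m x))) f" .
  qed
  note n = mknat[OF X Cof(1), of ?l, OF lhm nat]
  show "sharp X \<phi> \<in> Hom \<D> X (Cof d Z)" unfolding sharp_def by (rule n(1))
  show "x \<in> pts (At X d) m ==> flat (sharp X \<phi>) m x = \<phi> m x"
    using d l(3)[OF d d d, of x m "idn d m"] by (simp add: flat_def sharp_def n(2) act_idn[OF X])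
qed

lemma cofree_eqI:
  assumes \<alpha>: "\<alpha> \<in> Hom \<D> X (Cof d Z)" and \<beta>: "\<beta> \<in> Hom \<D> X (Cof d Z)"
    and flat: "\<And>m x. x \<in> pts (At X d) m ==> flat \<alpha> m x = flat \<beta> m x"
  shows "\<alpha> = \<beta>"
proof (rule nat_eq[OF \<alpha> \<beta>])
  fix a m x assume a: "a \<in> Ob D" and x: "x \<in> pts (At X a) m"
  note X = nat_components(1)[OF \<alpha>]
  have E: "EHom D a d \<in> Obj S" using a d by simp
  show "el \<alpha> a m x = el \<beta> a m x"
  proof (rule exp_eqI[OF E Z])
    show "el \<alpha> a m x \<in> pts (Exp (EHom D a d) Z) m" "el \<beta> a m x \<in> pts (Exp (EHom D a d) Z) m"
      using el_pts[OF \<alpha> a x] el_pts[OF \<beta> a x] a by (simp_all add: Cof)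
    fix l \<theta> e assume \<theta>: "\<theta> \<in> operators l m" and e: "e \<in> pts (EHom D a d) l"
    have rx: "rst (At X a) m \<theta> x \<in> pts (At X a) l" using a x \<theta> at_obj[OF X] by auto
    show "evl (EHom D a d) Z l (rst (Exp (EHom D a d) Z) m \<theta> (el \<alpha> a m x)) e =
        evl (EHom D a d) Z l (rst (Exp (EHom D a d) Z) m \<theta> (el \<beta> a m x)) e"
      using evl_flat[OF \<alpha> a rx e] evl_flat[OF \<beta> a rx e] el_rst[OF \<alpha> a \<theta> x] el_rst[OF \<beta> a \<theta> x]
        flat[OF act_pts[OF X a d e rx]] a
      by (simp add: Cof)
  qed
qed

text \<open>
  Extending maps into a cofree diagram amounts, by adjunction, to extending maps at one object of \<open>D\<close>.
\<close>

lemma extends_cofree: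
  assumes j: "j \<in> Hom \<D> X Y"
  shows "extends \<D> (Cof d Z) j \<longleftrightarrow> extends S Z (Fn j d)"
proof -
  note c = nat_components[OF j]
  have jd: "Dom (Fn j d) = At X d" "Cod (Fn j d) = At Y d" "Fn j d \<in> Mor S"
    using c(3)[OF d] by (auto simp: Hom_def)
  have Yd: "At Y d \<in> Obj S" using at_obj[OF c(2) d] .
  show ?thesis
  proof
    assume ext: "extends \<D> (Cof d Z) j"
    show "extends S Z (Fn j d)"
      unfolding extends_def jd
    proof
      fix v assume v: "v \<in> Hom S (At X d) Z"
      note s = sharp[OF c(1) hm_ap[OF v]]
      obtain \<beta> where \<beta>: "\<beta> \<in> Hom \<D> Y (Cof d Z)" "\<beta> \<odot> j = sharp X (ap v)"
        using ext s(1) c(5,6) unfolding extends_def by metis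
      note hb = flat_hm[OF \<beta>(1)]
      have eq: "flat \<beta> m (ap (Fn j d) m x) = ap v m x" if x: "x \<in> pts (At X d) m" for m x
      proof -
        have "flat \<beta> m (el j d m x) = flat (\<beta> \<odot> j) m x"
          using x by (simp add: flat_def el_cmp(1)[OF j \<beta>(1) d])
        then show ?thesis using s(2)[OF x] by (simp add: \<beta>(2) el_def)
      qed
      let ?w = "mk (At Y d) Z (flat \<beta>)"
      have "?w \<cdot>\<^bsub>S\<^esub> Fn j d = v"
        by (rule mor_eq[of _ "At X d" Z])
          (use v jd eq ap_pts[OF jd(3)] in \<open>auto simp: mk_hm[OF hb] Hom_def\<close>)
      then show "\<exists>w \<in> Hom S (At Y d) Z. w \<cdot>\<^bsub>S\<^esub> Fn j d = v"
        using mk_hm(1)[OF hb] by blast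
    qed
  next
    assume ext: "extends S Z (Fn j d)"
    show "extends \<D> (Cof d Z) j"
      unfolding extends_def c(5,6)
    proof
      fix \<alpha> assume \<alpha>: "\<alpha> \<in> Hom \<D> X (Cof d Z)"
      note ha = flat_hm[OF \<alpha>]
      obtain w where w: "w \<in> Hom S (At Y d) Z" "w \<cdot>\<^bsub>S\<^esub> Fn j d = mk (At X d) Z (flat \<alpha>)"
        using ext mk_hm(1)[OF ha] unfolding extends_def jd by blast
      note s = sharp[OF c(2) hm_ap[OF w(1)]]
      have "sharp Y (ap w) \<odot> j = \<alpha>"
      proof (rule cofree_eqI[OF el_cmp(2)[OF j s(1)] \<alpha>])
        fix m x assume x: "x \<in> pts (At X d) m"
        have "flat (sharp Y (ap w) \<odot> j) m x = ap w m (el j d m x)"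
          using x s(2)[OF el_pts[OF j d x]] by (simp add: flat_def el_cmp(1)[OF j s(1) d])
        also have "\<dots> = ap (w \<cdot>\<^bsub>S\<^esub> Fn j d) m x" using x jd by (simp add: el_def)
        also have "\<dots> = flat \<alpha> m x" using x by (simp add: w(2) mk_hm[OF ha])
        finally show "flat (sharp Y (ap w) \<odot> j) m x = flat \<alpha> m x" .
      qed
      then show "\<exists>w \<in> Hom \<D> Y (Cof d Z). w \<odot> j = \<alpha>" using s(1) by blast
    qed
  qed
qed

end


section \<open>Detached embeddings\<close>

definition image :: "('d, 'o, 'f) transformation => 'd => nat => 'u element set" where
  "image j a m = el j a m ` pts (At (Dom j) a) m"

text \<open>
  The image is a union of components: it is stable under the action in any case, and the condition
  says that the action does not lead into it from outside.
\<close>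

definition detached :: "('d, 'o, 'f) transformation => bool" where
  "detached j \<longleftrightarrow> (\<forall>a \<in> Ob D. \<forall>b \<in> Ob D. \<forall>m. \<forall>e \<in> pts (EHom D a b) m. \<forall>y \<in> pts (At (Cod j) a) m.
     act (Cod j) a b m e y \<in> image j b m \<longrightarrow> y \<in> image j a m)"

text \<open>
  The class of maps in which relative cell complexes are shown to lie: objectwise embeddings
  (expressed by extending maps into cofree diagrams, a property inherited by pushouts and
  transfinite compositions) whose image is a union of components.
\<close>

definition good :: "('d, 'o, 'f) transformation => bool" where
  "good j \<longleftrightarrow> j \<in> Mor \<D> \<and> (\<forall>d \<in> Ob D. \<forall>Z \<in> Zs. extends \<D> (Cof d Z) j) \<and> detached j"

lemma detachedD: "detached j ==> a \<in> Ob D ==> b \<in> Ob D ==> e \<in> pts (EHom D a b) m ==>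
    y \<in> pts (At (Cod j) a) m ==> act (Cod j) a b m e y \<in> image j b m ==> y \<in> image j a m"
  unfolding detached_def by blast

lemma imageD: "j \<in> Hom \<D> X Y ==> a \<in> Ob D ==> y \<in> image j a m ==>
    y \<in> pts (At Y a) m \<and> (\<exists>x \<in> pts (At X a) m. y = el j a m x)"
  using el_pts by (auto simp: image_def Hom_def)

lemma imageI: "j \<in> Hom \<D> X Y ==> x \<in> pts (At X a) m ==> el j a m x \<in> image j a m"
  by (auto simp: image_def Hom_def)

lemma image_invariant:
  assumes j: "j \<in> Hom \<D> X Y"
  shows "invariant Y (image j)"
  unfolding invariant_def closed_sub_def
proof (intro conjI ballI allI subsetI)
  fix a m y assume "a \<in> Ob D" "y \<in> image j a m"
  then show "y \<in> pts (At Y a) m" using imageD[OF j] by blast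
next
  fix a m n \<theta> y assume a: "a \<in> Ob D" and \<theta>: "\<theta> \<in> operators m n" and "y \<in> image j a n"
  then obtain x where x: "x \<in> pts (At X a) n" "y = el j a n x" using imageD[OF j] by blast
  show "rst (At Y a) n \<theta> y \<in> image j a m"
    using imageI[OF j, of "rst (At X a) n \<theta> x" a m] el_rst[OF j a \<theta> x(1)] x a \<theta>
      at_obj[OF nat_components(1)[OF j]] by simp
next
  fix a b m e y assume ab: "a \<in> Ob D" "b \<in> Ob D" and e: "e \<in> pts (EHom D a b) m" and "y \<in> image j a m"
  then obtain x where x: "x \<in> pts (At X a) m" "y = el j a m x" using imageD[OF j] by blast
  show "act Y a b m e y \<in> image j b m"
    using imageI[OF j, of "act X a b m e x" b m] el_act[OF j ab e x(1)] x
      act_pts[OF nat_components(1)[OF j] ab e x(1)] by simp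
qed

lemma invariant_UN:
  assumes X: "enriched_functor S D X" and A: "\<And>i. i \<in> I ==> invariant X (A i)"
  shows "invariant X (\<lambda>a m. \<Union>i\<in>I. A i a m)"
  unfolding invariant_def closed_sub_def
proof (intro conjI ballI allI UN_least; (elim UN_E)?)
  fix a m i assume "a \<in> Ob D" "i \<in> I"
  then show "A i a m \<subseteq> pts (At X a) m" using invariant_pts[OF X A] by blast
next
  fix a m n \<theta> x i assume "a \<in> Ob D" "\<theta> \<in> operators m n" and i: "i \<in> I" and "x \<in> A i a n"
  then have "rst (At X a) n \<theta> x \<in> A i a m"
    using invariant_sub[OF X A[OF i], of a] unfolding closed_sub_def by simp
  with i show "rst (At X a) n \<theta> x \<in> (\<Union>i\<in>I. A i a m)" by blast
next
  fix a b m e x i assume ab: "a \<in> Ob D" "b \<in> Ob D" "e \<in> pts (EHom D a b) m"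
    and i: "i \<in> I" and x: "x \<in> A i a m"
  show "act X a b m e x \<in> (\<Union>i\<in>I. A i b m)" using invariant_act[OF X A[OF i] ab x] i by blast
qed

context
  fixes j X Y assumes j: "j \<in> Hom \<D> X Y" and ext: "\<forall>d \<in> Ob D. \<forall>Z \<in> Zs. extends \<D> (Cof d Z) j"
begin

lemma extends_component: "a \<in> Ob D ==> Z \<in> Zs ==> extends S Z (Fn j a)"
  using ext extends_cofree[OF _ test_obj j] by blast

lemma embedding_inj: "a \<in> Ob D ==> inj_on (el j a m) (pts (At X a) m)"
  using test_inj[OF _ extends_component, of a m] nat_components(3)[OF j, of a]
  by (auto simp: Hom_def el_def inj_on_def)

lemma embedding_lift:
  assumes h: "h \<in> Hom \<D> W Y"
    and img: "\<And>a m w. a \<in> Ob D ==> w \<in> pts (At W a) m ==> el h a m w \<in> image j a m"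
  shows "\<exists>k \<in> Hom \<D> W X. j \<odot> k = h"
proof -
  note cj = nat_components[OF j] and ch = nat_components[OF h]
  have "\<forall>a \<in> Ob D. \<exists>k \<in> Hom S (At W a) (At X a). Fn j a \<cdot>\<^bsub>S\<^esub> k = Fn h a"
  proof
    fix a assume a: "a \<in> Ob D"
    have S: "Fn j a \<in> Mor S" "Dom (Fn j a) = At X a" "Cod (Fn j a) = At Y a"
      "Fn h a \<in> Mor S" "Dom (Fn h a) = At W a" "Cod (Fn h a) = At Y a"
      using cj(3)[OF a] ch(3)[OF a] by (auto simp: Hom_def)
    show "\<exists>k \<in> Hom S (At W a) (At X a). Fn j a \<cdot>\<^bsub>S\<^esub> k = Fn h a"
      using test_lift[OF S(1) extends_component[OF a] S(4)] S img[OF a]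
      by (simp add: el_def image_def cj(5))
  qed
  then obtain k where k: "\<And>a. a \<in> Ob D ==> k a \<in> Hom S (At W a) (At X a)"
    and jk: "\<And>a. a \<in> Ob D ==> Fn j a \<cdot>\<^bsub>S\<^esub> k a = Fn h a" by metis
  have el: "el j a m (ap (k a) m w) = el h a m w" if a: "a \<in> Ob D" and w: "w \<in> pts (At W a) m" for a m w
    using arg_cong[OF jk[OF a], of "\<lambda>f. ap f m w"] k[OF a] w by (simp add: el_def Hom_def)
  have kp: "ap (k a) m w \<in> pts (At X a) m" if "a \<in> Ob D" "w \<in> pts (At W a) m" for a m w
    using hm_pts[OF hm_ap[OF k]] that by blast
  have nat: "ap (k b) m (act W a b m e w) = act X a b m e (ap (k a) m w)"
    if ab: "a \<in> Ob D" "b \<in> Ob D" and e: "e \<in> pts (EHom D a b) m" and w: "w \<in> pts (At W a) m" for a b m e w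
  proof (rule inj_onD[OF embedding_inj[OF ab(2)]])
    note aw = act_pts[OF ch(1) ab e w] and ax = act_pts[OF cj(1) ab e kp[OF ab(1) w]]
    show "el j b m (ap (k b) m (act W a b m e w)) = el j b m (act X a b m e (ap (k a) m w))"
      using el[OF ab(2) aw] el_act[OF j ab e kp[OF ab(1) w]] el[OF ab(1) w] el_act[OF h ab e w] by simp
    show "ap (k b) m (act W a b m e w) \<in> pts (At X b) m" by (rule kp[OF ab(2) aw])
    show "act X a b m e (ap (k a) m w) \<in> pts (At X b) m" by (rule ax)
  qed
  note n = mknat[OF ch(1) cj(1), of "\<lambda>a. ap (k a)", OF hm_ap[OF k] nat]
  have "j \<odot> mknat W X (\<lambda>a. ap (k a)) = h"
    by (rule nat_eq[OF el_cmp(2)[OF n(1) j] h]) (simp_all add: el_cmp(1)[OF n(1) j] n(2) el)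
  then show ?thesis using n(1) by blast
qed

end

text \<open>The points of a pushout come from its two legs, as the subdiagram of such points shows.\<close>

lemma pushout_points:
  assumes po: "is_pushout \<D> i f g j" and a: "a \<in> Ob D" and y: "y \<in> pts (At (Cod j) a) m"
  shows "y \<in> image g a m \<or> y \<in> image j a m"
proof -
  have i: "i \<in> Hom \<D> (Dom i) (Cod i)" and f: "f \<in> Hom \<D> (Dom i) (Cod f)"
    and g: "g \<in> Hom \<D> (Cod i) (Cod j)" and j: "j \<in> Hom \<D> (Cod f) (Cod j)"
    and sq: "g \<odot> i = j \<odot> f"
    and univ: "\<And>e g' j'. g' \<in> Hom \<D> (Cod i) e ==> j' \<in> Hom \<D> (Cod f) e ==> g' \<odot> i = j' \<odot> f ==>
        \<exists>!u. u \<in> Hom \<D> (Cod j) e \<and> g' = u \<odot> g \<and> j' = u \<odot> j"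
    using po unfolding is_pushout_def by (auto simp: Hom_def)
  let ?Y = "Cod j"
  let ?A = "\<lambda>a m. image g a m \<union> image j a m"
  note Y = nat_components(2)[OF j]
  have A: "invariant ?Y ?A"
    using invariant_UN[OF Y, of "{g, j}" image] image_invariant[OF g] image_invariant[OF j] by auto
  define c where "c = mknat (subdiag ?Y ?A) ?Y (\<lambda>a m x. x)"
  define g' where "g' = mknat (Cod i) (subdiag ?Y ?A) (el g)"
  define j' where "j' = mknat (Cod f) (subdiag ?Y ?A) (el j)"
  note c = subdiag_incl[OF Y A, folded c_def]
  have g': "g' \<in> Hom \<D> (Cod i) (subdiag ?Y ?A)"
      "\<And>a m w. a \<in> Ob D ==> w \<in> pts (At (Cod i) a) m ==> el g' a m w = el g a m w"
    unfolding g'_def using subdiag_lift[OF Y A g] imageI[OF g] by auto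
  have j': "j' \<in> Hom \<D> (Cod f) (subdiag ?Y ?A)"
      "\<And>a m w. a \<in> Ob D ==> w \<in> pts (At (Cod f) a) m ==> el j' a m w = el j a m w"
    unfolding j'_def using subdiag_lift[OF Y A j] imageI[OF j] by auto
  have cg: "c \<odot> g' = g"
    by (rule nat_eq[OF el_cmp(2)[OF g'(1) c(1)] g])
      (simp add: el_cmp(1)[OF g'(1) c(1)] g' c imageI[OF g])
  have cj: "c \<odot> j' = j"
    by (rule nat_eq[OF el_cmp(2)[OF j'(1) c(1)] j])
      (simp add: el_cmp(1)[OF j'(1) c(1)] j' c imageI[OF j])
  have "g' \<odot> i = j' \<odot> f"
  proof (rule nat_eq[OF el_cmp(2)[OF i g'(1)] el_cmp(2)[OF f j'(1)]])
    fix a m x assume a: "a \<in> Ob D" and x: "x \<in> pts (At (Dom i) a) m"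
    show "el (g' \<odot> i) a m x = el (j' \<odot> f) a m x"
      using arg_cong[OF sq, of "\<lambda>h. el h a m x"] a x
      by (simp add: el_cmp(1)[OF i g'(1)] el_cmp(1)[OF f j'(1)] el_cmp(1)[OF i g] el_cmp(1)[OF f j]
          g' j' el_pts[OF i] el_pts[OF f])
  qed
  from univ[OF g'(1) j'(1) this] obtain u where
    u: "u \<in> Hom \<D> ?Y (subdiag ?Y ?A)" "g' = u \<odot> g" "j' = u \<odot> j" by blast
  have id: "Ident \<D> ?Y \<in> Hom \<D> ?Y ?Y" using el_ident(2)[OF Y] .
  have "g = (c \<odot> u) \<odot> g \<and> j = (c \<odot> u) \<odot> j"
    using cg cj u(2,3) abstract_category.cmp_assoc[OF abstract_category_axioms g u(1) c(1)]
      abstract_category.cmp_assoc[OF abstract_category_axioms j u(1) c(1)] by simp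
  moreover have "g = Ident \<D> ?Y \<odot> g \<and> j = Ident \<D> ?Y \<odot> j"
    using ident_left[OF g] ident_left[OF j] by simp
  ultimately have "c \<odot> u = Ident \<D> ?Y"
    using univ[OF g j sq] cmp_hom[OF u(1) c(1)] id by blast
  then have "el c a m (el u a m y) = y"
    using el_cmp(1)[OF u(1) c(1) a y] el_ident(1)[OF Y a y] by simp
  moreover have "el u a m y \<in> ?A a m" using el_pts[OF u(1) a y] by (simp add: subdiag(3)[OF Y A a])
  ultimately show ?thesis using c(2)[OF a] by auto
qed

text \<open>
  Suppose that the action leads from a point \<open>y\<close> outside the image of \<open>j\<close> into this image.  The indicator of the
  image of \<open>i\<close> and the constant map with value true glue to an invariant map on the pushout, which is true
  on the image of \<open>j\<close> but not at \<open>y\<close>.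
\<close>

lemma pushout_good:
  assumes po: "is_pushout \<D> i f g j" and i_good: "good i"
  shows "good j"
proof -
  have i: "i \<in> Hom \<D> (Dom i) (Cod i)" and f: "f \<in> Hom \<D> (Dom i) (Cod f)"
    and g: "g \<in> Hom \<D> (Cod i) (Cod j)" and j: "j \<in> Hom \<D> (Cod f) (Cod j)"
    and sq: "g \<odot> i = j \<odot> f"
    and univ: "\<And>e g' j'. g' \<in> Hom \<D> (Cod i) e ==> j' \<in> Hom \<D> (Cod f) e ==> g' \<odot> i = j' \<odot> f ==>
        \<exists>!u. u \<in> Hom \<D> (Cod j) e \<and> g' = u \<odot> g \<and> j' = u \<odot> j"
    using po unfolding is_pushout_def by (auto simp: Hom_def)
  note B = nat_components(2)[OF i] and X = nat_components(1)[OF j] and Y = nat_components(2)[OF j]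
  have idet: "detached i" using i_good by (simp add: good_def)
  \<comment> \<open>The image of \<open>i\<close> is a union of components, so its indicator and the constant map glue.\<close>
  have separate: "b \<in> image i a m" if a: "a \<in> Ob D" and b: "b \<in> pts (At (Cod i) a) m"
    and gb: "el g a m b \<in> image j a m" for a b m
  proof -
    obtain \<xi> where \<xi>: "\<xi> \<in> Hom \<D> (Cod i) (const_diagram S D (G m))"
      and tr\<xi>: "\<And>c z. c \<in> Ob D ==> z \<in> pts (At (Cod i) c) m ==> tr m (el \<xi> c m z) \<longleftrightarrow> z \<in> image i c m"
    proof -
      have "\<exists>\<xi> \<in> Hom \<D> (Cod i) (const_diagram S D (G m)).
          \<forall>c \<in> Ob D. \<forall>z \<in> pts (At (Cod i) c) m. tr m (el \<xi> c m z) \<longleftrightarrow> z \<in> image i c m"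
      proof (rule classify_component[OF B])
        show "image i c m \<subseteq> pts (At (Cod i) c) m" if "c \<in> Ob D" for c
          using imageD[OF i that] by blast
        fix c c' e z assume c: "c \<in> Ob D" "c' \<in> Ob D" "e \<in> pts (EHom D c c') m"
          and z: "z \<in> pts (At (Cod i) c) m"
        show "act (Cod i) c c' m e z \<in> image i c' m \<longleftrightarrow> z \<in> image i c m"
          using detachedD[OF idet c z] invariant_act[OF B image_invariant[OF i] c] by blast
      qed
      then show ?thesis using that by blast
    qed
    obtain \<eta> where \<eta>: "\<eta> \<in> Hom \<D> (Cod f) (const_diagram S D (G m))"
      and tr\<eta>: "\<And>c z. c \<in> Ob D ==> z \<in> pts (At (Cod f) c) m ==> tr m (el \<eta> c m z)"
    proof -
      have "\<exists>\<eta> \<in> Hom \<D> (Cod f) (const_diagram S D (G m)).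
          \<forall>c \<in> Ob D. \<forall>z \<in> pts (At (Cod f) c) m. tr m (el \<eta> c m z) \<longleftrightarrow> z \<in> pts (At (Cod f) c) m"
        using act_pts[OF X] by (intro classify_component[OF X]) auto
      then show ?thesis using that by blast
    qed
    have "\<xi> \<odot> i = \<eta> \<odot> f"
    proof (rule nat_eq[OF el_cmp(2)[OF i \<xi>] el_cmp(2)[OF f \<eta>]])
      fix c l x assume c: "c \<in> Ob D" and x: "x \<in> pts (At (Dom i) c) l"
      show "el (\<xi> \<odot> i) c l x = el (\<eta> \<odot> f) c l x"
      proof (rule classify_unique[of "At (Dom i) c" m _ _ x l])
        show "hm (At (Dom i) c) (G m) (el (\<xi> \<odot> i) c)" "hm (At (Dom i) c) (G m) (el (\<eta> \<odot> f) c)"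
          using el_hm[OF el_cmp(2)[OF i \<xi>] c] el_hm[OF el_cmp(2)[OF f \<eta>] c] c
          by (simp_all add: const_diagram)
        show "tr m (el (\<xi> \<odot> i) c m z) \<longleftrightarrow> tr m (el (\<eta> \<odot> f) c m z)"
          if z: "z \<in> pts (At (Dom i) c) m" for z
          using c z imageI[OF i z] by (simp add: el_cmp(1)[OF i \<xi>] el_cmp(1)[OF f \<eta>] tr\<xi> tr\<eta> el_pts[OF i] el_pts[OF f])
      qed (rule x)
    qed
    from univ[OF \<xi> \<eta> this] obtain u where
      u: "u \<in> Hom \<D> (Cod j) (const_diagram S D (G m))" "\<xi> = u \<odot> g" "\<eta> = u \<odot> j" by blast
    obtain x where x: "x \<in> pts (At (Cod f) a) m" "el g a m b = el j a m x" using imageD[OF j a gb] by blast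
    have "el \<xi> a m b = el \<eta> a m x"
      using el_cmp(1)[OF g u(1) a b] el_cmp(1)[OF j u(1) a x(1)] x(2) u(2,3) by simp
    then show ?thesis using tr\<xi>[OF a b] tr\<eta>[OF a x(1)] by simp
  qed
  have "detached j"
    unfolding detached_def
  proof (intro ballI allI impI)
    fix a b m e y assume ab: "a \<in> Ob D" "b \<in> Ob D" and e: "e \<in> pts (EHom D a b) m"
      and y: "y \<in> pts (At (Cod j) a) m" and ey: "act (Cod j) a b m e y \<in> image j b m"
    show "y \<in> image j a m"
    proof (rule ccontr)
      assume nj: "y \<notin> image j a m"
      then have "y \<in> image g a m" using pushout_points[OF po ab(1) y] by blast
      then obtain z where z: "z \<in> pts (At (Cod i) a) m" "y = el g a m z" using imageD[OF g ab(1)] by blast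
      have "el g b m (act (Cod i) a b m e z) \<in> image j b m" using ey z el_act[OF g ab e z(1)] by simp
      then have "act (Cod i) a b m e z \<in> image i b m"
        using separate[OF ab(2) act_pts[OF B ab e z(1)]] by blast
      then have "z \<in> image i a m" using detachedD[OF idet ab e z(1)] by blast
      then obtain x where x: "x \<in> pts (At (Dom i) a) m" "z = el i a m x" using imageD[OF i ab(1)] by blast
      have "y = el j a m (el f a m x)"
        using arg_cong[OF sq, of "\<lambda>h. el h a m x"] el_cmp(1)[OF i g ab(1) x(1)]
          el_cmp(1)[OF f j ab(1) x(1)] z x by simp
      then show False using nj imageI[OF j el_pts[OF f ab(1) x(1)]] by simp
    qed
  qed
  moreover have "j \<in> Mor \<D>" using j by (simp add: Hom_def)
  moreover have "extends \<D> (Cof d Z) j" if "d \<in> Ob D" "Z \<in> Zs" for d Z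
    using extends_pushout[OF po] i_good that unfolding good_def by blast
  ultimately show ?thesis unfolding good_def by blast
qed

lemma colimit_points:
  assumes col: "is_colimit \<D> r A X x c q"
    and x: "\<And>i k. (i, k) \<in> r ==> x i k \<in> Hom \<D> (X i) (X k)"
    and a: "a \<in> Ob D" and y: "y \<in> pts (At c a) m"
  shows "\<exists>i \<in> A. y \<in> image (q i) a m"
proof -
  have co: "cocone \<D> r A X x c q"
    and univ: "\<And>c' q'. cocone \<D> r A X x c' q' ==> \<exists>!u. u \<in> Hom \<D> c c' \<and> (\<forall>i \<in> A. q' i = u \<odot> q i)"
    using col unfolding is_colimit_def by blast+
  have c: "enriched_functor S D c" and q: "\<And>i. i \<in> A ==> q i \<in> Hom \<D> (X i) c"
    and qx: "\<And>i k. i \<in> A ==> k \<in> A ==> (i, k) \<in> r ==> q i = q k \<odot> x i k"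
    using co unfolding cocone_def obj_diagrams by blast+
  let ?B = "\<lambda>a m. \<Union>i\<in>A. image (q i) a m"
  have B: "invariant c ?B"
    using invariant_UN[OF c image_invariant[OF q]] .
  define k where "k = mknat (subdiag c ?B) c (\<lambda>a m x. x)"
  note k = subdiag_incl[OF c B, folded k_def]
  define p where "p = (\<lambda>i. mknat (X i) (subdiag c ?B) (el (q i)))"
  have img: "el (q i) a m w \<in> ?B a m" if "i \<in> A" "w \<in> pts (At (X i) a) m" for i a m w
    using imageI[OF q[OF that(1)] that(2)] that(1) by blast
  have p: "p i \<in> Hom \<D> (X i) (subdiag c ?B)" if i: "i \<in> A" for i
    unfolding p_def by (rule subdiag_lift(1)[OF c B q[OF i] img[OF i]])
  have el_p: "el (p i) a m w = el (q i) a m w"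
    if i: "i \<in> A" and a: "a \<in> Ob D" and w: "w \<in> pts (At (X i) a) m" for i a m w
    unfolding p_def by (rule subdiag_lift(2)[OF c B q[OF i] img[OF i] a w])
  have kp: "k \<odot> p i = q i" if i: "i \<in> A" for i
    by (rule nat_eq[OF el_cmp(2)[OF p[OF i] k(1)] q[OF i]])
      (use img[OF i] in \<open>simp add: el_cmp(1)[OF p[OF i] k(1)] el_p[OF i] k(2)\<close>)
  have "cocone \<D> r A X x (subdiag c ?B) p"
    unfolding cocone_def
  proof (intro conjI ballI impI)
    show "subdiag c ?B \<in> Obj \<D>" using subdiag(1)[OF c B] by (simp add: obj_diagrams)
    fix i l assume il: "i \<in> A" "l \<in> A" "(i, l) \<in> r"
    show "p i = p l \<odot> x i l"
    proof (rule nat_eq[OF p[OF il(1)] el_cmp(2)[OF x[OF il(3)] p[OF il(2)]]])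
      fix a m w assume aw: "a \<in> Ob D" "w \<in> pts (At (X i) a) m"
      show "el (p i) a m w = el (p l \<odot> x i l) a m w"
        using aw il arg_cong[OF qx[OF il], of "\<lambda>h. el h a m w"]
        by (simp add: el_cmp(1)[OF x[OF il(3)] p] el_cmp(1)[OF x[OF il(3)] q] el_p el_pts[OF x[OF il(3)]])
    qed
  qed (rule p)
  from univ[OF this] obtain u where u: "u \<in> Hom \<D> c (subdiag c ?B)" "\<forall>i \<in> A. p i = u \<odot> q i" by blast
  have "\<forall>i \<in> A. q i = (k \<odot> u) \<odot> q i"
    using kp u(2) abstract_category.cmp_assoc[OF abstract_category_axioms q u(1) k(1)] by simp
  moreover have "\<forall>i \<in> A. q i = Ident \<D> c \<odot> q i" using ident_left[OF q] by simp
  ultimately have "k \<odot> u = Ident \<D> c"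
    using univ[OF co] cmp_hom[OF u(1) k(1)] el_ident(2)[OF c] by blast
  then have "el k a m (el u a m y) = y"
    using el_cmp(1)[OF u(1) k(1) a y] el_ident(1)[OF c a y] by simp
  moreover have "el u a m y \<in> ?B a m" using el_pts[OF u(1) a y] by (simp add: subdiag(3)[OF c B a])
  ultimately show ?thesis using k(2)[OF a] by auto
qed

end

context model_diagrams
begin

lemma good_inj: "good j ==> j \<in> Hom \<D> X Y ==> a \<in> Ob D ==> inj_on (el j a m) (pts (At X a) m)"
  unfolding good_def using embedding_inj by blast

lemma detached_ident:
  assumes X: "enriched_functor S D X"
  shows "detached (Ident \<D> X)"
proof -
  note i = el_ident[OF X] and c = nat_components(6)[OF el_ident(2)[OF X]]
  have "y \<in> image (Ident \<D> X) a m" if "a \<in> Ob D" "y \<in> pts (At X a) m" for a m y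
    using imageI[OF i(2) that(2)] i(1)[OF that] by simp
  then show ?thesis unfolding detached_def c by blast
qed

lemma detached_cmp:
  assumes f: "f \<in> Hom \<D> X Y" "detached f" and g: "g \<in> Hom \<D> Y Z" "detached g"
    and inj: "\<And>a m. a \<in> Ob D ==> inj_on (el g a m) (pts (At Y a) m)"
  shows "detached (g \<odot> f)"
proof -
  note gf = el_cmp[OF f(1) g(1)] and Y = nat_components(1)[OF g(1)]
  have c: "Cod f = Y" "Cod g = Z" "Cod (g \<odot> f) = Z" using f g gf(2) by (auto simp: Hom_def)
  show ?thesis
    unfolding detached_def c
  proof (intro ballI allI impI)
    fix a b m e z assume ab: "a \<in> Ob D" "b \<in> Ob D" and e: "e \<in> pts (EHom D a b) m"
      and z: "z \<in> pts (At Z a) m" and ez: "act Z a b m e z \<in> image (g \<odot> f) b m"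
    obtain x where x: "x \<in> pts (At X b) m" "act Z a b m e z = el g b m (el f b m x)"
      using imageD[OF gf(2) ab(2) ez] gf(1)[OF ab(2)] by auto
    have "act Z a b m e z \<in> image g b m"
      using imageI[OF g(1) el_pts[OF f(1) ab(2) x(1)]] x(2) by simp
    then have "z \<in> image g a m" using detachedD[OF g(2) ab e] z c by simp
    then obtain y where y: "y \<in> pts (At Y a) m" "z = el g a m y" using imageD[OF g(1) ab(1)] by blast
    have "act Y a b m e y = el f b m x"
    proof (rule inj_onD[OF inj[OF ab(2)] _ act_pts[OF Y ab e y(1)] el_pts[OF f(1) ab(2) x(1)]])
      show "el g b m (act Y a b m e y) = el g b m (el f b m x)"
        using x(2) y(2) el_act[OF g(1) ab e y(1)] by simp
    qed
    then have "act Y a b m e y \<in> image f b m" using imageI[OF f(1) x(1)] by simp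
    then have "y \<in> image f a m" using detachedD[OF f(2) ab e] y(1) c by simp
    then obtain w where w: "w \<in> pts (At X a) m" "y = el f a m w" using imageD[OF f(1) ab(1)] by blast
    show "z \<in> image (g \<odot> f) a m"
      using imageI[OF gf(2) w(1)] gf(1)[OF ab(1) w(1)] w y by simp
  qed
qed

lemma colimit_detached:
  assumes r: "Well_order r" and fu: "ordinal_functor \<D> r X x" and A: "A \<subseteq> Field r"
    and col: "is_colimit \<D> r A X x c q"
    and inj: "\<And>k a m. k \<in> A ==> a \<in> Ob D ==> inj_on (el (q k) a m) (pts (At (X k) a) m)"
    and det: "\<And>k. k \<in> A ==> (i, k) \<in> r ==> detached (x i k)"
    and i: "i \<in> A"
  shows "detached (q i)"
proof -
  note x = functor_at(3)[OF fu]
  have q: "q k \<in> Hom \<D> (X k) c" if "k \<in> A" for k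
    using col that unfolding is_colimit_def cocone_def by blast
  have qx: "q k = q l \<odot> x k l" if "k \<in> A" "l \<in> A" "(k, l) \<in> r" for k l
    using col that unfolding is_colimit_def cocone_def by blast
  have cod: "Cod (q i) = c" using q[OF i] by (simp add: Hom_def)
  show ?thesis
    unfolding detached_def cod
  proof (intro ballI allI impI)
    fix a b m e y assume ab: "a \<in> Ob D" "b \<in> Ob D" and e: "e \<in> pts (EHom D a b) m"
      and y: "y \<in> pts (At c a) m" and ey: "act c a b m e y \<in> image (q i) b m"
    obtain k y' where k: "k \<in> A" and y': "y' \<in> pts (At (X k) a) m" "y = el (q k) a m y'"
      using colimit_points[OF col x ab(1) y] imageD[OF q ab(1)] by metis
    have "\<exists>l \<in> A. (i, l) \<in> r \<and> (k, l) \<in> r"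
      using well_order_facts(1)[OF r, of i] well_order_facts(1)[OF r, of k]
        well_order_facts(4)[OF r, of i k] A i k by blast
    then obtain l where l: "l \<in> A" "(i, l) \<in> r" "(k, l) \<in> r" by blast
    note xi = x[OF l(2)] and xk = x[OF l(3)]
    let ?z = "el (x k l) a m y'"
    have z: "?z \<in> pts (At (X l) a) m" "y = el (q l) a m ?z"
      using el_pts[OF xk ab(1) y'(1)] y'(2) qx[OF k l(1,3)] el_cmp(1)[OF xk q[OF l(1)] ab(1) y'(1)] by simp_all
    obtain w where w: "w \<in> pts (At (X i) b) m" "act c a b m e y = el (q i) b m w"
      using imageD[OF q[OF i] ab(2) ey] by blast
    have "act (X l) a b m e ?z = el (x i l) b m w"
    proof (rule inj_onD[OF inj[OF l(1) ab(2)]])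
      show "el (q l) b m (act (X l) a b m e ?z) = el (q l) b m (el (x i l) b m w)"
        using el_act[OF q[OF l(1)] ab e z(1)] z(2) w qx[OF i l(1,2)]
          el_cmp(1)[OF xi q[OF l(1)] ab(2) w(1)] by simp
      show "act (X l) a b m e ?z \<in> pts (At (X l) b) m"
        by (rule act_pts[OF nat_components(2)[OF xi] ab e z(1)])
      show "el (x i l) b m w \<in> pts (At (X l) b) m" by (rule el_pts[OF xi ab(2) w(1)])
    qed
    then have "act (X l) a b m e ?z \<in> image (x i l) b m" using imageI[OF xi w(1)] by simp
    then have "?z \<in> image (x i l) a m"
      using detachedD[OF det[OF l(1,2)] ab e] z(1) xi by (simp add: Hom_def)
    then obtain v where v: "v \<in> pts (At (X i) a) m" "?z = el (x i l) a m v"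
      using imageD[OF xi ab(1)] by blast
    have "y = el (q i) a m v"
      using z(2) v(2) qx[OF i l(1,2)] el_cmp(1)[OF xi q[OF l(1)] ab(1) v(1)] by simp
    then show "y \<in> image (q i) a m" using imageI[OF q[OF i] v(1)] by simp
  qed
qed

context
  fixes r :: "'i rel" and X x
  assumes r: "Well_order r" and seq: "sequence \<D> r X x"
    and succ_good: "\<And>i j. successor_in r i j ==> good (x i j)"
begin

lemma stages_functor: "ordinal_functor \<D> r X x"
  using seq unfolding sequence_def by blast

lemma stage_extends: "(i, j) \<in> r ==> d \<in> Ob D ==> Z \<in> Zs ==> extends \<D> (Cof d Z) (x i j)"
  by (rule extends_stage[OF r seq]) (use succ_good in \<open>auto simp: good_def\<close>)

lemma stage_inj: "(i, j) \<in> r ==> a \<in> Ob D ==> inj_on (el (x i j) a m) (pts (At (X i) a) m)"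
  by (rule embedding_inj[OF functor_at(3)[OF stages_functor]]) (auto intro: stage_extends)

lemma stage_good:
  assumes ij: "(i, j) \<in> r"
  shows "good (x i j)"
proof -
  note fu = stages_functor
  note at = functor_at[OF fu] and wo = well_order_facts[OF r]
  have "detached (x i j)" if "(i, j) \<in> r" for j
    using that
  proof (induction j rule: wf_induct_rule[OF wo(5)])
    case (1 j)
    have F: "i \<in> Field r" "j \<in> Field r" using 1(2) by (auto simp: Field_def)
    show ?case
    proof (cases "i = j")
      case True
      then show ?thesis using at(1,2) F detached_ident by (simp add: obj_diagrams)
    next
      case ne: False
      show ?thesis
      proof (cases "\<exists>k. successor_in r k j")
        case True
        then obtain k where k: "successor_in r k j" by blast
        then have kj: "(k, j) \<in> r" "k \<noteq> j" and up: "\<And>l. (k, l) \<in> r ==> l \<noteq> k ==> (j, l) \<in> r"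
          by (auto simp: successor_in_def)
        have "k \<in> Field r" using kj by (auto simp: Field_def)
        then have ik: "(i, k) \<in> r" using wo(4)[OF F(1), of k] up[of i] wo(3)[OF 1(2)] ne by auto
        have "detached (x i k)" using 1(1)[of k] kj ik by simp
        then show ?thesis
          unfolding at(4)[OF ik kj(1)]
          using detached_cmp[OF at(3)[OF ik] _ at(3)[OF kj(1)] _ stage_inj[OF kj(1)]]
            succ_good[OF k] by (simp add: good_def)
      next
        case False
        have iu: "i \<in> underS r j" using 1(2) ne by (simp add: underS_def)
        then have "limit_in r j" using F False unfolding limit_in_def by blast
        then have col: "is_colimit \<D> r (underS r j) X x (X j) (\<lambda>k. x k j)"
          using seq unfolding sequence_def by blast
        show ?thesis
        proof (rule colimit_detached[OF r fu _ col _ _ iu])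
          show "underS r j \<subseteq> Field r" by (auto simp: underS_def Field_def)
          show "inj_on (el (x k j) a m) (pts (At (X k) a) m)" if "k \<in> underS r j" "a \<in> Ob D" for k a m
            using stage_inj that by (simp add: underS_def)
          show "detached (x i k)" if "k \<in> underS r j" "(i, k) \<in> r" for k
            using 1(1)[of k] that by (simp add: underS_def)
        qed
      qed
    qed
  qed
  then show ?thesis
    unfolding good_def using ij at(3)[OF ij] stage_extends[OF ij] by (simp add: Hom_def)
qed

lemma colimit_good:
  assumes col: "is_colimit \<D> r (Field r) X x c q" and i: "i \<in> Field r"
  shows "good (q i)"
proof -
  have q: "q k \<in> Hom \<D> (X k) c" if "k \<in> Field r" for k
    using col that unfolding is_colimit_def cocone_def by blast
  have ext: "\<forall>d \<in> Ob D. \<forall>Z \<in> Zs. extends \<D> (Cof d Z) (q k)" if "k \<in> Field r" for k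
    using extends_colimit[OF r seq _ col that] succ_good unfolding good_def by blast
  have "detached (q i)"
  proof (rule colimit_detached[OF r stages_functor subset_refl col _ _ i])
    show "inj_on (el (q k) a m) (pts (At (X k) a) m)" if "k \<in> Field r" "a \<in> Ob D" for k a m
      by (rule embedding_inj[OF q ext]) (use that in auto)
    show "detached (x i k)" if "(i, k) \<in> r" for k
      using stage_good[OF that] by (simp add: good_def)
  qed
  then show ?thesis unfolding good_def using q[OF i] ext[OF i] by (simp add: Hom_def)
qed

end

lemma cell_good:
  fixes U :: "'v itself"
  assumes I: "\<And>i. i \<in> I ==> good i" and h: "h \<in> cell U \<D> I"
  shows "good h"
proof -
  obtain r :: "'v rel" and X x c q z where r: "Well_order r" "sequence \<D> r X x"
    and succ: "\<forall>i j. successor_in r i j \<longrightarrow> x i j \<in> pushouts \<D> I"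
    and col: "is_colimit \<D> r (Field r) X x c q" and z: "z \<in> Field r" "h = q z"
    using h unfolding cell_def by blast
  have "good (x i j)" if "successor_in r i j" for i j
    using succ that I pushout_good unfolding pushouts_def by blast
  then show ?thesis using colimit_good[OF r _ col z(1)] z(2) by blast
qed

text \<open>
  The action does not change the coordinate in the realization of \<open>L\<close>, so it cannot lead into
  \<open>T \<otimes> K\<close> from outside.
\<close>

lemma tensor_map_good:
  assumes T: "enriched_functor S D T" and \<nu>: "\<nu> \<in> N"
  shows "good (tensor_map S D T (\<iota> \<nu>))"
proof -
  let ?i = "tensor_map S D T (\<iota> \<nu>)"
  note i = tensor_map[OF T rlz_hom[OF \<nu>]] and t = tensor[OF T rlz_obj(1)[OF \<nu>]] and t' = tensor[OF T rlz_obj(2)[OF \<nu>]]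
  have "extends \<D> (Cof d Z) ?i" if "d \<in> Ob D" "Z \<in> Zs" for d Z
    unfolding extends_cofree[OF that(1) test_obj[OF that(2)] i(1)]
    using rlz_extends[OF \<nu> at_obj[OF T that(1)] that(2)] that(1) by (simp add: tensor_map_def)
  moreover have "detached ?i"
    unfolding detached_def
  proof (intro ballI allI impI)
    fix a b m e y assume ab: "a \<in> Ob D" "b \<in> Ob D" and e: "e \<in> pts (EHom D a b) m"
      and y: "y \<in> pts (At (Cod ?i) a) m" and ey: "act (Cod ?i) a b m e y \<in> image ?i b m"
    have c: "Cod ?i = tensor S D T (Cod (\<iota> \<nu>))" using i(1) by (simp add: Hom_def)
    obtain t l where tl: "y = Pair t l" "t \<in> pts (At T a) m" "l \<in> pts (RL \<nu>) m"
      using y ab by (auto simp: c t')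
    obtain p where p: "p \<in> pts (At (tensor S D T (Dom (\<iota> \<nu>))) b) m" "act (Cod ?i) a b m e y = el ?i b m p"
      using imageD[OF i(1) ab(2) ey] by blast
    obtain s k where sk: "p = Pair s k" "s \<in> pts (At T b) m" "k \<in> pts (RK \<nu>) m"
      using p ab by (auto simp: t)
    have "l = inc \<nu> m k" using p(2) tl sk ab e by (simp add: c t' i(2))
    then have "y = el ?i a m (Pair t k)" using tl sk ab by (simp add: i(2))
    moreover have "Pair t k \<in> pts (At (tensor S D T (Dom (\<iota> \<nu>))) a) m" using tl sk ab by (simp add: t)
    ultimately show "y \<in> image ?i a m" using imageI[OF i(1)] by blast
  qed
  ultimately show ?thesis unfolding good_def using i(1) by (simp add: Hom_def)
qed


section \<open>Smallness\<close>

text \<open>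
  Let \<open>t\<close> be a vertex of the orbit \<open>T\<close>.  The values of a map from \<open>T \<otimes> K\<close> at the points over \<open>t\<close> come from a common
  stage, because \<open>K\<close> has few points, and so does everything linked to them, because stages are unions of
  components of the colimit.  Hence the size of \<open>T\<close> does not enter.
\<close>

lemma tensor_small_relative:
  fixes \<kappa> :: "'u rel"
  assumes T: "orbit S D T" and \<nu>: "\<nu> \<in> N"
    and \<kappa>: "|UNIV :: (nat \<times> nat list \<times> (nat => real)) set| \<le>o \<kappa>"
    and I: "\<And>i. i \<in> I ==> good i"
  shows "small_relative TYPE('u) \<D> \<kappa> (cell TYPE('u) \<D> I) (tensor S D T (Dom (\<iota> \<nu>)))"
  unfolding small_relative_def
proof (intro allI impI)
  fix r :: "'u rel" and X x c q
  assume filt: "filtered_ordinal \<kappa> r" and seq: "sequence \<D> r X x"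
    and succ: "\<forall>i j. successor_in r i j \<longrightarrow> x i j \<in> cell TYPE('u) \<D> I"
    and col: "is_colimit \<D> r (Field r) X x c q"
  let ?A = "tensor S D T (Dom (\<iota> \<nu>))"
  note TF = orbit_functor[OF T]
  note t = tensor[OF TF rlz_obj(1)[OF \<nu>]]
  have r: "Well_order r"
    and bound: "\<And>A. A \<subseteq> Field r ==> |A| \<le>o \<kappa> ==> \<exists>b \<in> Field r. \<forall>a \<in> A. (a, b) \<in> r"
    using filt unfolding filtered_ordinal_def by blast+
  have succ_good: "good (x i j)" if "successor_in r i j" for i j
    using succ that cell_good[OF I] by blast
  have fu: "ordinal_functor \<D> r X x" using seq unfolding sequence_def by blast
  have co: "cocone \<D> r (Field r) X x c q" using col unfolding is_colimit_def by blast
  have q: "q k \<in> Hom \<D> (X k) c" if "k \<in> Field r" for k using co that unfolding cocone_def by blast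
  have qg: "good (q k)" if "k \<in> Field r" for k
    by (rule colimit_good[OF r seq succ_good col that])
  have c: "enriched_functor S D c" using co by (simp add: cocone_def obj_diagrams)
  show "bij_betw (\<lambda>K. the_elem ((\<lambda>(i, g). q i \<odot> g) ` K))
      (hom_union \<D> r X ?A // hom_rel \<D> r X x ?A) (Hom \<D> ?A c)"
  proof (rule bij_betw_hom_colimit[OF r fu co])
    fix i g h assume i: "i \<in> Field r" and g: "g \<in> Hom \<D> ?A (X i)" and h: "h \<in> Hom \<D> ?A (X i)"
      and eq: "q i \<odot> g = q i \<odot> h"
    show "g = h"
    proof (rule nat_eq[OF g h])
      fix a m y assume a: "a \<in> Ob D" and y: "y \<in> pts (At ?A a) m"
      show "el g a m y = el h a m y"
      proof (rule inj_onD[OF good_inj[OF qg[OF i] q[OF i] a] _ el_pts[OF g a y] el_pts[OF h a y]])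
        show "el (q i) a m (el g a m y) = el (q i) a m (el h a m y)"
          using eq el_cmp(1)[OF g q[OF i] a y] el_cmp(1)[OF h q[OF i] a y] by simp
      qed
    qed
  next
    fix f assume f: "f \<in> Hom \<D> ?A c"
    have conn: "connected_diagram T" by (rule orbit_connected[OF T])
    then obtain a0 t0 where t0: "a0 \<in> Ob D" "t0 \<in> pts (At T a0) 0"
      unfolding connected_diagram_def by blast
    let ?t = "vtx T a0 t0"
    have tp: "?t m \<in> pts (At T a0) m" for m by (rule vtx_pts[OF TF t0])
    let ?K = "SIGMA m : (UNIV :: nat set). pts (RK \<nu>) m"
    have "\<forall>p \<in> ?K. \<exists>i \<in> Field r. el f a0 (fst p) (Pair (?t (fst p)) (snd p)) \<in> image (q i) a0 (fst p)"
    proof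
      fix p assume p: "p \<in> ?K"
      have "Pair (?t (fst p)) (snd p) \<in> pts (At ?A a0) (fst p)" using p t0 tp by (auto simp: t)
      note fp = el_pts[OF f t0(1) this]
      show "\<exists>i \<in> Field r. el f a0 (fst p) (Pair (?t (fst p)) (snd p)) \<in> image (q i) a0 (fst p)"
        by (rule colimit_points[OF col _ t0(1) fp]) (rule functor_at(3)[OF fu])
    qed
    then obtain \<sigma> where \<sigma>: "\<And>p. p \<in> ?K ==> \<sigma> p \<in> Field r"
      and img: "\<And>p. p \<in> ?K ==> el f a0 (fst p) (Pair (?t (fst p)) (snd p)) \<in> image (q (\<sigma> p)) a0 (fst p)"
      by metis
    have "|\<sigma> ` ?K| \<le>o \<kappa>"
      using ordLeq_transitive[OF card_of_image] rlz_card[OF \<nu>] \<kappa> ordLeq_transitive by blast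
    moreover have "\<sigma> ` ?K \<subseteq> Field r" using \<sigma> by blast
    ultimately have "\<exists>b \<in> Field r. \<forall>i \<in> \<sigma> ` ?K. (i, b) \<in> r" by (rule bound[rotated])
    then obtain b where b: "b \<in> Field r" "\<And>p. p \<in> ?K ==> (\<sigma> p, b) \<in> r" by blast
    have det: "detached (q b)" using qg[OF b(1)] by (simp add: good_def)
    have base: "el f a0 m (Pair (?t m) k) \<in> image (q b) a0 m" if k: "k \<in> pts (RK \<nu>) m" for m k
    proof -
      have p: "(m, k) \<in> ?K" using k by simp
      note xb = functor_at(3)[OF fu b(2)[OF p]]
      obtain y where y: "y \<in> pts (At (X (\<sigma> (m, k))) a0) m" "el f a0 m (Pair (?t m) k) = el (q (\<sigma> (m, k))) a0 m y"
        using img[OF p] imageD[OF q[OF \<sigma>[OF p]] t0(1)] by (metis fst_conv snd_conv)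
      have "q (\<sigma> (m, k)) = q b \<odot> x (\<sigma> (m, k)) b"
        using co \<sigma>[OF p] b(1) b(2)[OF p] unfolding cocone_def by blast
      then have "el f a0 m (Pair (?t m) k) = el (q b) a0 m (el (x (\<sigma> (m, k)) b) a0 m y)"
        using y(2) el_cmp(1)[OF xb q[OF b(1)] t0(1) y(1)] by simp
      then show ?thesis using imageI[OF q[OF b(1)] el_pts[OF xb t0(1) y(1)]] by simp
    qed
    have all: "el f a m y \<in> image (q b) a m" if a: "a \<in> Ob D" and y: "y \<in> pts (At ?A a) m" for a m y
    proof -
      obtain s k where sk: "y = Pair s k" "s \<in> pts (At T a) m" "k \<in> pts (RK \<nu>) m"
        using y a by (auto simp: t)
      have "((a0, ?t m), (a, s)) \<in> conn T m"
        using conn t0(1) a sk(2) tp unfolding connected_diagram_def by blast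
      then have "el f a0 m (Pair (?t m) k) \<in> image (q b) a0 m \<longleftrightarrow> el f a m (Pair s k) \<in> image (q b) a m"
      proof (rule conn_invariant[of m T "\<lambda>a s. el f a m (Pair s k) \<in> image (q b) a m", rotated])
        fix a a' e s assume aa: "a \<in> Ob D" "a' \<in> Ob D" and e: "e \<in> pts (EHom D a a') m"
          and s: "s \<in> pts (At T a) m"
        have p: "Pair s k \<in> pts (At ?A a) m" using s sk(3) aa by (simp add: t)
        have eq: "el f a' m (Pair (act T a a' m e s) k) = act c a a' m e (el f a m (Pair s k))"
          using el_act[OF f aa e p] t(3)[OF aa e s sk(3)] by simp
        show "el f a m (Pair s k) \<in> image (q b) a m \<longleftrightarrow> el f a' m (Pair (act T a a' m e s) k) \<in> image (q b) a' m"
          unfolding eq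
          using invariant_act[OF c image_invariant[OF q[OF b(1)]] aa e]
            detachedD[OF det aa e] el_pts[OF f aa(1) p] q[OF b(1)] by (auto simp: Hom_def)
      qed
      then show ?thesis using base[OF sk(3)] sk(1) by simp
    qed
    have "\<exists>g \<in> Hom \<D> ?A (X b). q b \<odot> g = f"
      using embedding_lift[OF q[OF b(1)] _ f all] qg[OF b(1)] unfolding good_def by blast
    then show "\<exists>i \<in> Field r. \<exists>g \<in> Hom \<D> ?A (X i). q i \<odot> g = f" using b(1) by blast
  qed
qed

end

context model_diagrams
begin

section \<open>Products and cotensors of diagrams\<close>

definition dprod :: "('d, 'o, 'f) diagram => ('d, 'o, 'f) diagram => ('d, 'o, 'f) diagram" where
  "dprod X Y = mkdiag (\<lambda>a. Prod S (At X a) (At Y a))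
     (\<lambda>a b m e p. Pair (act X a b m e (pfst p)) (act Y a b m e (psnd p)))"

lemma dprod:
  assumes X: "enriched_functor S D X" and Y: "enriched_functor S D Y"
  shows "enriched_functor S D (dprod X Y)"
    and "a \<in> Ob D ==> At (dprod X Y) a = Prod S (At X a) (At Y a)"
    and "a \<in> Ob D ==> b \<in> Ob D ==> e \<in> pts (EHom D a b) m ==> x \<in> pts (At X a) m ==> y \<in> pts (At Y a) m ==>
      act (dprod X Y) a b m e (Pair x y) = Pair (act X a b m e x) (act Y a b m e y)"
proof -
  have obj: "Prod S (At X a) (At Y a) \<in> Obj S" if "a \<in> Ob D" for a
    using that at_obj[OF X] at_obj[OF Y] by simp
  let ?act = "\<lambda>a b m e p. Pair (act X a b m e (pfst p)) (act Y a b m e (psnd p))"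
  have hm: "hm (Prod S (EHom D a b) (Prod S (At X a) (At Y a))) (Prod S (At X b) (At Y b))
      (\<lambda>m p. ?act a b m (pfst p) (psnd p))" if ab: "a \<in> Ob D" "b \<in> Ob D" for a b
    using at_obj[OF X] at_obj[OF Y] ab
    by (intro hm_pair hm_binary[OF act_hm[OF X ab]] hm_binary[OF act_hm[OF Y ab]]
        hm_fst[OF hm_psnd] hm_snd[OF hm_psnd] hm_pfst) auto
  note d = mkdiag[of "\<lambda>a. Prod S (At X a) (At Y a)" ?act, OF obj hm]
  have d1: "enriched_functor S D (mkdiag (\<lambda>a. Prod S (At X a) (At Y a)) ?act)"
    by (rule d(1)) (auto simp: act_cmp[OF X] act_cmp[OF Y] act_idn[OF X] act_idn[OF Y])
  then show "enriched_functor S D (dprod X Y)" by (simp add: dprod_def)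
  show "a \<in> Ob D ==> At (dprod X Y) a = Prod S (At X a) (At Y a)" by (simp add: dprod_def mkdiag_def)
  show "a \<in> Ob D ==> b \<in> Ob D ==> e \<in> pts (EHom D a b) m ==> x \<in> pts (At X a) m ==> y \<in> pts (At Y a) m ==>
      act (dprod X Y) a b m e (Pair x y) = Pair (act X a b m e x) (act Y a b m e y)"
    unfolding dprod_def
    by (subst d(3)) (auto simp: act_cmp[OF X] act_cmp[OF Y] act_idn[OF X] act_idn[OF Y])
qed

definition cot_act :: "'o => ('d, 'o, 'f) diagram => 'd => 'd => nat => 'u element => 'u element => 'u element" where
  "cot_act B X a b m e u = lam (Prod S (EHom D a b) (Exp B (At X a))) B (At X b)
     (\<lambda>m p k. act X a b m (pfst p) (evl B (At X a) m (psnd p) k)) m (Pair e u)"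

definition Cot :: "'o => ('d, 'o, 'f) diagram => ('d, 'o, 'f) diagram" where
  "Cot B X = mkdiag (\<lambda>a. Exp B (At X a)) (cot_act B X)"

context
  fixes B X assumes B: "B \<in> Obj S" and X: "enriched_functor S D X"
begin

lemma cot_act:
  assumes ab: "a \<in> Ob D" "b \<in> Ob D"
  shows "hm (Prod S (EHom D a b) (Exp B (At X a))) (Exp B (At X b)) (\<lambda>m p. cot_act B X a b m (pfst p) (psnd p))"
    and "e \<in> pts (EHom D a b) m ==> u \<in> pts (Exp B (At X a)) m ==> k \<in> pts B m ==>
      evl B (At X b) m (cot_act B X a b m e u) k = act X a b m e (evl B (At X a) m u k)"
proof -
  let ?A = "Prod S (EHom D a b) (Exp B (At X a))"
  note obj = at_obj[OF X ab(1)] at_obj[OF X ab(2)]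
  have A: "?A \<in> Obj S" "Exp B (At X a) \<in> Obj S" "EHom D a b \<in> Obj S" using ab B obj by auto
  have hm: "hm (Prod S ?A B) (At X b)
      (\<lambda>m p. act X a b m (pfst (pfst p)) (evl B (At X a) m (psnd (pfst p)) (psnd p)))"
    using A B obj
    by (intro hm_binary[OF act_hm[OF X ab]] hm_binary[OF evl_hm] hm_fst[OF hm_pfst] hm_snd[OF hm_pfst] hm_psnd) auto
  note l = lam[OF A(1) B obj(2) hm]
  show "hm ?A (Exp B (At X b)) (\<lambda>m p. cot_act B X a b m (pfst p) (psnd p))"
    by (rule hm_cong[THEN iffD1, OF _ l(1)]) (auto simp: cot_act_def)
  show "e \<in> pts (EHom D a b) m ==> u \<in> pts (Exp B (At X a)) m ==> k \<in> pts B m ==>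
      evl B (At X b) m (cot_act B X a b m e u) k = act X a b m e (evl B (At X a) m u k)"
    using l(3)[of "Pair e u" m k] by (simp add: cot_act_def)
qed

lemma Cot:
  shows "enriched_functor S D (Cot B X)"
    and "a \<in> Ob D ==> At (Cot B X) a = Exp B (At X a)"
    and "a \<in> Ob D ==> b \<in> Ob D ==> e \<in> pts (EHom D a b) m ==> u \<in> pts (Exp B (At X a)) m ==>
      act (Cot B X) a b m e u = cot_act B X a b m e u"
proof -
  have obj: "Exp B (At X a) \<in> Obj S" if "a \<in> Ob D" for a using that at_obj[OF X] B by simp
  have pts: "cot_act B X a b m e u \<in> pts (Exp B (At X b)) m"
    if "a \<in> Ob D" "b \<in> Ob D" "e \<in> pts (EHom D a b) m" "u \<in> pts (Exp B (At X a)) m" for a b m e u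
    using hm_binary_pts[OF cot_act(1)] that by blast
  have rst: "rst (Exp B (At X b)) n \<theta> (cot_act B X a b n e u) =
      cot_act B X a b m (rst (EHom D a b) n \<theta> e) (rst (Exp B (At X a)) n \<theta> u)"
    if "a \<in> Ob D" "b \<in> Ob D" "\<theta> \<in> operators m n" "e \<in> pts (EHom D a b) n" "u \<in> pts (Exp B (At X a)) n"
    for a b m n \<theta> e u
    using hm_binary_rst[OF cot_act(1)[OF that(1,2)] that(3-)] by simp
  have evp: "evl B (At X a) m u k \<in> pts (At X a) m"
    if "a \<in> Ob D" "u \<in> pts (Exp B (At X a)) m" "k \<in> pts B m" for a m u k
    using evl_pts[OF B at_obj[OF X]] that by blast
  have cmp: "cot_act B X a c m (cmp a b c m g f) u = cot_act B X b c m g (cot_act B X a b m f u)"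
    if abc: "a \<in> Ob D" "b \<in> Ob D" "c \<in> Ob D" and gf: "g \<in> pts (EHom D b c) m" "f \<in> pts (EHom D a b) m"
      and u: "u \<in> pts (Exp B (At X a)) m" for a b c m g f u
  proof (rule exp_eqI[OF B at_obj[OF X abc(3)]])
    show "cot_act B X a c m (cmp a b c m g f) u \<in> pts (Exp B (At X c)) m"
      "cot_act B X b c m g (cot_act B X a b m f u) \<in> pts (Exp B (At X c)) m"
      using abc gf u by (auto intro!: pts cmp_pts)
    fix l \<theta> k assume \<theta>: "\<theta> \<in> operators l m" and k: "k \<in> pts B l"
    have "rst (EHom D b c) m \<theta> g \<in> pts (EHom D b c) l" "rst (EHom D a b) m \<theta> f \<in> pts (EHom D a b) l"
      "rst (Exp B (At X a)) m \<theta> u \<in> pts (Exp B (At X a)) l"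
      using abc gf u \<theta> obj by auto
    then show "evl B (At X c) l (rst (Exp B (At X c)) m \<theta> (cot_act B X a c m (cmp a b c m g f) u)) k =
        evl B (At X c) l (rst (Exp B (At X c)) m \<theta> (cot_act B X b c m g (cot_act B X a b m f u))) k"
      using abc gf u \<theta> k
      by (simp add: rst cmp_pts pts cmp_rst[symmetric] cot_act(2) act_cmp[OF X] evp)
  qed
  have idn: "cot_act B X a a m (idn a m) u = u"
    if a: "a \<in> Ob D" and u: "u \<in> pts (Exp B (At X a)) m" for a m u
  proof (rule exp_eqI[OF B at_obj[OF X a]])
    show "cot_act B X a a m (idn a m) u \<in> pts (Exp B (At X a)) m" using a u by (auto intro!: pts)
    fix l \<theta> k assume \<theta>: "\<theta> \<in> operators l m" and k: "k \<in> pts B l"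
    show "evl B (At X a) l (rst (Exp B (At X a)) m \<theta> (cot_act B X a a m (idn a m) u)) k =
        evl B (At X a) l (rst (Exp B (At X a)) m \<theta> u) k"
      using a u \<theta> k obj[OF a] by (simp add: rst idn_rst cot_act(2) act_idn[OF X] evp)
  qed (rule u)
  note k = mkdiag[of "\<lambda>a. Exp B (At X a)" "cot_act B X", OF obj cot_act(1) cmp idn]
  show "enriched_functor S D (Cot B X)" unfolding Cot_def by (rule k(1))
  show "a \<in> Ob D ==> At (Cot B X) a = Exp B (At X a)" unfolding Cot_def by (rule k(2))
  show "a \<in> Ob D ==> b \<in> Ob D ==> e \<in> pts (EHom D a b) m ==> u \<in> pts (Exp B (At X a)) m ==>
      act (Cot B X) a b m e u = cot_act B X a b m e u" unfolding Cot_def by (rule k(3))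
qed

lemma cot_act_pts: "a \<in> Ob D ==> b \<in> Ob D ==> e \<in> pts (EHom D a b) m ==> u \<in> pts (Exp B (At X a)) m ==>
    act (Cot B X) a b m e u \<in> pts (Exp B (At X b)) m"
  using act_pts[OF Cot(1), of a b e m u] by (simp add: Cot(2))

lemma cot_act_rst: "a \<in> Ob D ==> b \<in> Ob D ==> e \<in> pts (EHom D a b) n ==> u \<in> pts (Exp B (At X a)) n ==>
    \<theta> \<in> operators m n ==> rst (Exp B (At X b)) n \<theta> (act (Cot B X) a b n e u) =
      act (Cot B X) a b m (rst (EHom D a b) n \<theta> e) (rst (Exp B (At X a)) n \<theta> u)"
  using act_rst[OF Cot(1), of a b \<theta> m n e u] by (simp add: Cot(2))

lemma cot_act_evl: "a \<in> Ob D ==> b \<in> Ob D ==> e \<in> pts (EHom D a b) m ==> u \<in> pts (Exp B (At X a)) m ==>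
    k \<in> pts B m ==> evl B (At X b) m (act (Cot B X) a b m e u) k = act X a b m e (evl B (At X a) m u k)"
  by (simp add: Cot(3) cot_act(2))

lemma cot_obj: "a \<in> Ob D ==> Exp B (At X a) \<in> Obj S"
  using at_obj[OF X] B by simp

end

text \<open>Post-composition with a natural transformation.\<close>

definition post :: "'o => ('d, 'o, 'f) transformation =>
    'd => nat => 'u element => 'u element" where
  "post B s a = lam (Exp B (At (Dom s) a)) B (At (Cod s) a)
     (\<lambda>m u k. el s a m (evl B (At (Dom s) a) m u k))"

lemma post:
  assumes B: "B \<in> Obj S" and s: "s \<in> Hom \<D> X X'" and a: "a \<in> Ob D"
  shows "hm (Exp B (At X a)) (Exp B (At X' a)) (post B s a)"
    and "u \<in> pts (Exp B (At X a)) m ==> post B s a m u \<in> pts (Exp B (At X' a)) m"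
    and "u \<in> pts (Exp B (At X a)) m ==> k \<in> pts B m ==>
      evl B (At X' a) m (post B s a m u) k = el s a m (evl B (At X a) m u k)"
    and "\<theta> \<in> operators l m ==> u \<in> pts (Exp B (At X a)) m ==> k \<in> pts B l ==>
      evl B (At X' a) l (rst (Exp B (At X' a)) m \<theta> (post B s a m u)) k =
      el s a l (evl B (At X a) l (rst (Exp B (At X a)) m \<theta> u) k)"
proof -
  note c = nat_components[OF s]
  have obj: "At X a \<in> Obj S" "At X' a \<in> Obj S" using at_obj[OF c(1) a] at_obj[OF c(2) a] by auto
  have E: "Exp B (At X a) \<in> Obj S" using B obj by simp
  have hm: "hm (Prod S (Exp B (At X a)) B) (At X' a) (\<lambda>m p. el s a m (evl B (At X a) m (pfst p) (psnd p)))"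
    by (rule hm_comp[OF evl_hm[OF B obj(1)] el_hm[OF s a]])
  note l = lam[OF E B obj(2) hm]
  show "hm (Exp B (At X a)) (Exp B (At X' a)) (post B s a)" using l(1) by (simp add: post_def c)
  show "u \<in> pts (Exp B (At X a)) m ==> post B s a m u \<in> pts (Exp B (At X' a)) m"
    using l(2) by (simp add: post_def c)
  show "u \<in> pts (Exp B (At X a)) m ==> k \<in> pts B m ==>
      evl B (At X' a) m (post B s a m u) k = el s a m (evl B (At X a) m u k)"
    using l(3) by (simp add: post_def c)
  show "\<theta> \<in> operators l m ==> u \<in> pts (Exp B (At X a)) m ==> k \<in> pts B l ==>
      evl B (At X' a) l (rst (Exp B (At X' a)) m \<theta> (post B s a m u)) k =
      el s a l (evl B (At X a) l (rst (Exp B (At X a)) m \<theta> u) k)"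
    using l(4) by (simp add: post_def c)
qed

lemma post_act:
  assumes B: "B \<in> Obj S" and s: "s \<in> Hom \<D> X X'" and ab: "a \<in> Ob D" "b \<in> Ob D"
    and e: "e \<in> pts (EHom D a b) m" and u: "u \<in> pts (Exp B (At X a)) m"
  shows "post B s b m (act (Cot B X) a b m e u) = act (Cot B X') a b m e (post B s a m u)"
proof -
  note c = nat_components[OF s]
  note pa = post[OF B s ab(1)] and pb = post[OF B s ab(2)]
  show ?thesis
  proof (rule exp_eqI[OF B at_obj[OF c(2) ab(2)]])
    show "post B s b m (act (Cot B X) a b m e u) \<in> pts (Exp B (At X' b)) m"
      by (rule pb(2)[OF cot_act_pts[OF B c(1) ab e u]])
    show "act (Cot B X') a b m e (post B s a m u) \<in> pts (Exp B (At X' b)) m"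
      by (rule cot_act_pts[OF B c(2) ab e pa(2)[OF u]])
    fix l \<theta> k assume \<theta>: "\<theta> \<in> operators l m" and k: "k \<in> pts B l"
    have re: "rst (EHom D a b) m \<theta> e \<in> pts (EHom D a b) l" using ab e \<theta> by simp
    have ru: "rst (Exp B (At X a)) m \<theta> u \<in> pts (Exp B (At X a)) l" using cot_obj[OF B c(1) ab(1)] u \<theta> by simp
    have rp: "rst (Exp B (At X' a)) m \<theta> (post B s a m u) \<in> pts (Exp B (At X' a)) l"
      using cot_obj[OF B c(2) ab(1)] pa(2)[OF u] \<theta> by simp
    have ev: "evl B (At X a) l (rst (Exp B (At X a)) m \<theta> u) k \<in> pts (At X a) l"
      by (rule evl_pts[OF B at_obj[OF c(1) ab(1)] ru k])
    show "evl B (At X' b) l (rst (Exp B (At X' b)) m \<theta> (post B s b m (act (Cot B X) a b m e u))) k =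
        evl B (At X' b) l (rst (Exp B (At X' b)) m \<theta> (act (Cot B X') a b m e (post B s a m u))) k"
      using pb(4)[OF \<theta> cot_act_pts[OF B c(1) ab e u] k] cot_act_rst[OF B c(1) ab e u \<theta>]
        cot_act_evl[OF B c(1) ab re ru k] el_act[OF s ab re ev] cot_act_rst[OF B c(2) ab e pa(2)[OF u] \<theta>]
        cot_act_evl[OF B c(2) ab re rp k] pa(4)[OF \<theta> u k] by simp
  qed
qed

lemma post_ident:
  assumes B: "B \<in> Obj S" and X: "enriched_functor S D X" and a: "a \<in> Ob D"
    and u: "u \<in> pts (Exp B (At X a)) m"
  shows "post B (Ident \<D> X) a m u = u"
proof -
  note p = post[OF B el_ident(2)[OF X] a]
  show ?thesis
  proof (rule exp_eqI[OF B at_obj[OF X a] p(2)[OF u] u])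
    fix l \<theta> k assume \<theta>: "\<theta> \<in> operators l m" and k: "k \<in> pts B l"
    have ru: "rst (Exp B (At X a)) m \<theta> u \<in> pts (Exp B (At X a)) l" using cot_obj[OF B X a] u \<theta> by simp
    show "evl B (At X a) l (rst (Exp B (At X a)) m \<theta> (post B (Ident \<D> X) a m u)) k =
        evl B (At X a) l (rst (Exp B (At X a)) m \<theta> u) k"
      using p(4)[OF \<theta> u k] el_ident(1)[OF X a evl_pts[OF B at_obj[OF X a] ru k]] by simp
  qed
qed

lemma post_cmp:
  assumes B: "B \<in> Obj S" and s: "s \<in> Hom \<D> X Y" and t: "t \<in> Hom \<D> Y Z" and a: "a \<in> Ob D"
    and u: "u \<in> pts (Exp B (At X a)) m"
  shows "post B (t \<odot> s) a m u = post B t a m (post B s a m u)"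
proof -
  note p = post[OF B s a] and p' = post[OF B t a] and q = post[OF B el_cmp(2)[OF s t] a]
  note X = nat_components(1)[OF s] and Z = nat_components(2)[OF t]
  show ?thesis
  proof (rule exp_eqI[OF B at_obj[OF Z a] q(2)[OF u] p'(2)[OF p(2)[OF u]]])
    fix l \<theta> k assume \<theta>: "\<theta> \<in> operators l m" and k: "k \<in> pts B l"
    have ru: "rst (Exp B (At X a)) m \<theta> u \<in> pts (Exp B (At X a)) l" using cot_obj[OF B X a] u \<theta> by simp
    show "evl B (At Z a) l (rst (Exp B (At Z a)) m \<theta> (post B (t \<odot> s) a m u)) k =
        evl B (At Z a) l (rst (Exp B (At Z a)) m \<theta> (post B t a m (post B s a m u))) k"
      using q(4)[OF \<theta> u k] p'(4)[OF \<theta> p(2)[OF u] k] p(4)[OF \<theta> u k]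
        el_cmp(1)[OF s t a evl_pts[OF B at_obj[OF X a] ru k]] by simp
  qed
qed


section \<open>The diagram of squares\<close>

definition squares_in :: "nat list => ('d, 'o, 'f) diagram => ('d, 'o, 'f) diagram => ('d, 'o, 'f) diagram" where
  "squares_in \<nu> X Y = dprod (const_diagram S D (Tag \<nu>)) (dprod (Cot (RK \<nu>) X) (Cot (RL \<nu>) Y))"

definition compatible :: "nat list => ('d, 'o, 'f) transformation =>
    'd => nat => 'u element set" where
  "compatible \<nu> f a m = {Pair (Simplex \<nu>) (Pair u v) | u v.
     u \<in> pts (Exp (RK \<nu>) (At (Dom f) a)) m \<and> v \<in> pts (Exp (RL \<nu>) (At (Cod f) a)) m \<and>
     (\<forall>l. \<forall>\<theta> \<in> operators l m. \<forall>k \<in> pts (RK \<nu>) l.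
        el f a l (evl (RK \<nu>) (At (Dom f) a) l (rst (Exp (RK \<nu>) (At (Dom f) a)) m \<theta> u) k) =
        evl (RL \<nu>) (At (Cod f) a) l (rst (Exp (RL \<nu>) (At (Cod f) a)) m \<theta> v) (inc \<nu> l k))}"

text \<open>
  Maps from an orbit \<open>T\<close> to this diagram are the squares from \<open>T \<otimes> K \<rightarrow> T \<otimes> L\<close> to \<open>f\<close>.  The
  tag records which inclusion \<open>K \<rightarrow> L\<close> is meant.
\<close>

definition Squares :: "nat list => ('d, 'o, 'f) transformation => ('d, 'o, 'f) diagram" where
  "Squares \<nu> f = subdiag (squares_in \<nu> (Dom f) (Cod f)) (compatible \<nu> f)"

context
  fixes \<nu> f X Y assumes \<nu>: "\<nu> \<in> N" and f: "f \<in> Hom \<D> X Y"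
begin

lemma squares_functors: "enriched_functor S D X" "enriched_functor S D Y"
  "enriched_functor S D (Cot (RK \<nu>) X)" "enriched_functor S D (Cot (RL \<nu>) Y)"
  "enriched_functor S D (const_diagram S D (Tag \<nu>))"
  "enriched_functor S D (dprod (Cot (RK \<nu>) X) (Cot (RL \<nu>) Y))"
  using nat_components[OF f] Cot(1)[OF rlz_obj(1)[OF \<nu>]] Cot(1)[OF rlz_obj(2)[OF \<nu>]]
    const_diagram(1)[OF tag(1)] dprod(1) by blast+

lemma compatible_iff: "Pair t (Pair u v) \<in> compatible \<nu> f a m \<longleftrightarrow> t = Simplex \<nu> \<and>
     u \<in> pts (Exp (RK \<nu>) (At X a)) m \<and> v \<in> pts (Exp (RL \<nu>) (At Y a)) m \<and>
     (\<forall>l. \<forall>\<theta> \<in> operators l m. \<forall>k \<in> pts (RK \<nu>) l.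
        el f a l (evl (RK \<nu>) (At X a) l (rst (Exp (RK \<nu>) (At X a)) m \<theta> u) k) =
        evl (RL \<nu>) (At Y a) l (rst (Exp (RL \<nu>) (At Y a)) m \<theta> v) (inc \<nu> l k))"
  using f by (simp add: compatible_def Hom_def)

lemma compatible_cases:
  assumes "p \<in> compatible \<nu> f a m"
  obtains u v where "p = Pair (Simplex \<nu>) (Pair u v)" "Pair (Simplex \<nu>) (Pair u v) \<in> compatible \<nu> f a m"
    "u \<in> pts (Exp (RK \<nu>) (At X a)) m" "v \<in> pts (Exp (RL \<nu>) (At Y a)) m"
  using assms compatible_iff unfolding compatible_def by blast

lemma squares_in:
  shows "enriched_functor S D (squares_in \<nu> X Y)"
    and "a \<in> Ob D ==> At (squares_in \<nu> X Y) a =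
      Prod S (Tag \<nu>) (Prod S (Exp (RK \<nu>) (At X a)) (Exp (RL \<nu>) (At Y a)))"
    and "a \<in> Ob D ==> b \<in> Ob D ==> e \<in> pts (EHom D a b) m ==> u \<in> pts (Exp (RK \<nu>) (At X a)) m ==>
      v \<in> pts (Exp (RL \<nu>) (At Y a)) m ==>
      act (squares_in \<nu> X Y) a b m e (Pair (Simplex \<nu>) (Pair u v)) =
      Pair (Simplex \<nu>) (Pair (act (Cot (RK \<nu>) X) a b m e u) (act (Cot (RL \<nu>) Y) a b m e v))"
proof -
  note F = squares_functors and R = rlz_obj[OF \<nu>]
  note o = dprod[OF F(5,6)] and i = dprod[OF F(3,4)]
  note KX = Cot(2)[OF R(1) F(1)] and LY = Cot(2)[OF R(2) F(2)]
  show "enriched_functor S D (squares_in \<nu> X Y)" unfolding squares_in_def by (rule o)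
  show "a \<in> Ob D ==> At (squares_in \<nu> X Y) a =
      Prod S (Tag \<nu>) (Prod S (Exp (RK \<nu>) (At X a)) (Exp (RL \<nu>) (At Y a)))"
    by (simp add: squares_in_def o i KX LY const_diagram(2))
  show "a \<in> Ob D ==> b \<in> Ob D ==> e \<in> pts (EHom D a b) m ==> u \<in> pts (Exp (RK \<nu>) (At X a)) m ==>
      v \<in> pts (Exp (RL \<nu>) (At Y a)) m ==>
      act (squares_in \<nu> X Y) a b m e (Pair (Simplex \<nu>) (Pair u v)) =
      Pair (Simplex \<nu>) (Pair (act (Cot (RK \<nu>) X) a b m e u) (act (Cot (RL \<nu>) Y) a b m e v))"
    by (simp add: squares_in_def o(3) i KX LY const_diagram)
qed

lemma compatible_invariant: "invariant (squares_in \<nu> X Y) (compatible \<nu> f)"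
  unfolding invariant_def closed_sub_def
proof (intro conjI ballI allI subsetI)
  fix a m p assume a: "a \<in> Ob D" and p: "p \<in> compatible \<nu> f a m"
  show "p \<in> pts (At (squares_in \<nu> X Y) a) m"
    by (rule compatible_cases[OF p]) (simp add: squares_in(2)[OF a])
next
  fix a m n \<theta> p assume a: "a \<in> Ob D" and \<theta>: "\<theta> \<in> operators m n" and p: "p \<in> compatible \<nu> f a n"
  obtain u v where p': "p = Pair (Simplex \<nu>) (Pair u v)" and uv: "Pair (Simplex \<nu>) (Pair u v) \<in> compatible \<nu> f a n"
    "u \<in> pts (Exp (RK \<nu>) (At X a)) n" "v \<in> pts (Exp (RL \<nu>) (At Y a)) n"
    using compatible_cases[OF p] .
  note E = cot_obj[OF rlz_obj(1)[OF \<nu>] squares_functors(1) a] cot_obj[OF rlz_obj(2)[OF \<nu>] squares_functors(2) a]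
  have st: "rst (Tag \<nu>) n \<theta> (Simplex \<nu>) = Simplex \<nu>"
    using rst_pts[OF tag(1) \<theta>, of "Simplex \<nu>" \<nu>] by simp
  have "rst (At (squares_in \<nu> X Y) a) n \<theta> p =
      Pair (Simplex \<nu>) (Pair (rst (Exp (RK \<nu>) (At X a)) n \<theta> u) (rst (Exp (RL \<nu>) (At Y a)) n \<theta> v))"
    using a \<theta> uv by (simp add: p' squares_in st)
  also have "\<dots> \<in> compatible \<nu> f a m"
    using uv E \<theta> operator_comp[OF _ \<theta>] by (simp add: compatible_iff rst_rst)
  finally show "rst (At (squares_in \<nu> X Y) a) n \<theta> p \<in> compatible \<nu> f a m" .
next
  fix a b m e p assume ab: "a \<in> Ob D" "b \<in> Ob D" and e: "e \<in> pts (EHom D a b) m"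
    and p: "p \<in> compatible \<nu> f a m"
  obtain u v where p': "p = Pair (Simplex \<nu>) (Pair u v)" and uv: "Pair (Simplex \<nu>) (Pair u v) \<in> compatible \<nu> f a m"
    "u \<in> pts (Exp (RK \<nu>) (At X a)) m" "v \<in> pts (Exp (RL \<nu>) (At Y a)) m"
    using compatible_cases[OF p] .
  note R = rlz_obj[OF \<nu>] and F = squares_functors
  have "Pair (Simplex \<nu>) (Pair (act (Cot (RK \<nu>) X) a b m e u) (act (Cot (RL \<nu>) Y) a b m e v)) \<in> compatible \<nu> f b m"
    unfolding compatible_iff
  proof (intro conjI allI ballI)
    show "act (Cot (RK \<nu>) X) a b m e u \<in> pts (Exp (RK \<nu>) (At X b)) m" by (rule cot_act_pts[OF R(1) F(1) ab e uv(2)])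
    show "act (Cot (RL \<nu>) Y) a b m e v \<in> pts (Exp (RL \<nu>) (At Y b)) m" by (rule cot_act_pts[OF R(2) F(2) ab e uv(3)])
    fix l \<theta> k assume \<theta>: "\<theta> \<in> operators l m" and k: "k \<in> pts (RK \<nu>) l"
    have re: "rst (EHom D a b) m \<theta> e \<in> pts (EHom D a b) l" using ab e \<theta> by simp
    have ru: "rst (Exp (RK \<nu>) (At X a)) m \<theta> u \<in> pts (Exp (RK \<nu>) (At X a)) l"
      using cot_obj[OF R(1) F(1) ab(1)] uv \<theta> by simp
    have rv: "rst (Exp (RL \<nu>) (At Y a)) m \<theta> v \<in> pts (Exp (RL \<nu>) (At Y a)) l"
      using cot_obj[OF R(2) F(2) ab(1)] uv \<theta> by simp
    have ev: "evl (RK \<nu>) (At X a) l (rst (Exp (RK \<nu>) (At X a)) m \<theta> u) k \<in> pts (At X a) l"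
      by (rule evl_pts[OF R(1) at_obj[OF F(1) ab(1)] ru k])
    show "el f b l (evl (RK \<nu>) (At X b) l (rst (Exp (RK \<nu>) (At X b)) m \<theta> (act (Cot (RK \<nu>) X) a b m e u)) k) =
        evl (RL \<nu>) (At Y b) l (rst (Exp (RL \<nu>) (At Y b)) m \<theta> (act (Cot (RL \<nu>) Y) a b m e v)) (inc \<nu> l k)"
      using cot_act_rst[OF R(1) F(1) ab e uv(2) \<theta>] cot_act_rst[OF R(2) F(2) ab e uv(3) \<theta>]
        cot_act_evl[OF R(1) F(1) ab re ru k] cot_act_evl[OF R(2) F(2) ab re rv inc_pts[OF \<nu> k]]
        el_act[OF f ab re ev] uv(1) \<theta> k by (simp add: compatible_iff)
  qed simp
  then show "act (squares_in \<nu> X Y) a b m e p \<in> compatible \<nu> f b m"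
    using ab e uv by (simp add: p' squares_in(3))
qed

lemma Squares:
  shows "enriched_functor S D (Squares \<nu> f)"
    and "a \<in> Ob D ==> pts (At (Squares \<nu> f) a) m = compatible \<nu> f a m"
    and "a \<in> Ob D ==> b \<in> Ob D ==> e \<in> pts (EHom D a b) m ==>
      Pair (Simplex \<nu>) (Pair u v) \<in> compatible \<nu> f a m ==>
      act (Squares \<nu> f) a b m e (Pair (Simplex \<nu>) (Pair u v)) =
      Pair (Simplex \<nu>) (Pair (act (Cot (RK \<nu>) X) a b m e u) (act (Cot (RL \<nu>) Y) a b m e v))"
    and "a \<in> Ob D ==> \<theta> \<in> operators m n ==> Pair (Simplex \<nu>) (Pair u v) \<in> compatible \<nu> f a n ==>
      rst (At (Squares \<nu> f) a) n \<theta> (Pair (Simplex \<nu>) (Pair u v)) =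
      Pair (Simplex \<nu>) (Pair (rst (Exp (RK \<nu>) (At X a)) n \<theta> u) (rst (Exp (RL \<nu>) (At Y a)) n \<theta> v))"
proof -
  have XY: "Dom f = X" "Cod f = Y" using f by (auto simp: Hom_def)
  note s = subdiag[OF squares_in(1) compatible_invariant]
  show "enriched_functor S D (Squares \<nu> f)" unfolding Squares_def XY by (rule s)
  show "a \<in> Ob D ==> pts (At (Squares \<nu> f) a) m = compatible \<nu> f a m" unfolding Squares_def XY by (rule s)
  show "a \<in> Ob D ==> b \<in> Ob D ==> e \<in> pts (EHom D a b) m ==>
      Pair (Simplex \<nu>) (Pair u v) \<in> compatible \<nu> f a m ==>
      act (Squares \<nu> f) a b m e (Pair (Simplex \<nu>) (Pair u v)) =
      Pair (Simplex \<nu>) (Pair (act (Cot (RK \<nu>) X) a b m e u) (act (Cot (RL \<nu>) Y) a b m e v))"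
    unfolding Squares_def XY by (simp add: s(4) squares_in(3) compatible_iff)
  have st: "rst (Tag \<nu>) n \<theta> (Simplex \<nu>) = Simplex \<nu>" if "\<theta> \<in> operators m n"
    using rst_pts[OF tag(1) that, of "Simplex \<nu>" \<nu>] by simp
  show "a \<in> Ob D ==> \<theta> \<in> operators m n ==> Pair (Simplex \<nu>) (Pair u v) \<in> compatible \<nu> f a n ==>
      rst (At (Squares \<nu> f) a) n \<theta> (Pair (Simplex \<nu>) (Pair u v)) =
      Pair (Simplex \<nu>) (Pair (rst (Exp (RK \<nu>) (At X a)) n \<theta> u) (rst (Exp (RL \<nu>) (At Y a)) n \<theta> v))"
    unfolding Squares_def XY by (simp add: s(5) squares_in(2) compatible_iff st)
qed

lemma Squares_incl: "a \<in> Ob D ==>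
    hm (At (Squares \<nu> f) a) (Prod S (Tag \<nu>) (Prod S (Exp (RK \<nu>) (At X a)) (Exp (RL \<nu>) (At Y a)))) (\<lambda>m p. p)"
proof -
  assume a: "a \<in> Ob D"
  have XY: "Dom f = X" "Cod f = Y" using f by (auto simp: Hom_def)
  show ?thesis
    using sub_incl[OF at_obj[OF squares_in(1) a] invariant_sub[OF squares_in(1) compatible_invariant a]] a
    by (simp add: Squares_def XY subdiag(2)[OF squares_in(1) compatible_invariant] squares_in(2))
qed

lemma Squares_lift:
  assumes a: "a \<in> Ob D" and u: "hm W (Exp (RK \<nu>) (At X a)) \<phi>" and v: "hm W (Exp (RL \<nu>) (At Y a)) \<psi>"
    and c: "\<And>m w. w \<in> pts W m ==> Pair (Simplex \<nu>) (Pair (\<phi> m w) (\<psi> m w)) \<in> compatible \<nu> f a m"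
  shows "hm W (At (Squares \<nu> f) a) (\<lambda>m w. Pair (Simplex \<nu>) (Pair (\<phi> m w) (\<psi> m w)))"
proof -
  have XY: "Dom f = X" "Cod f = Y" using f by (auto simp: Hom_def)
  have W: "W \<in> Obj S" using hm_obj[OF u] by blast
  show ?thesis
    using sub_lift[OF at_obj[OF squares_in(1) a] invariant_sub[OF squares_in(1) compatible_invariant a],
        of W "\<lambda>m w. Pair (Simplex \<nu>) (Pair (\<phi> m w) (\<psi> m w))"] hm_pair[OF hm_tag[OF W] hm_pair[OF u v]] c a
    by (simp add: Squares_def XY subdiag(2)[OF squares_in(1) compatible_invariant] squares_in(2))
qed

end

end

context model_diagrams
begin

abbreviation square_map :: "nat list => (('d, 'o, 'f) transformation,
    ('d, 'o, 'f) transformation \<times> ('d, 'o, 'f) transformation) arrow =>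
    ('d, 'o, 'f) transformation" where
  "square_map \<nu> g \<equiv> mknat (Squares \<nu> (Dom g)) (Squares \<nu> (Cod g))
     (\<lambda>a m p. Pair (Simplex \<nu>) (Pair (post (RK \<nu>) (fst (Fn g)) a m (pfst (psnd p)))
       (post (RL \<nu>) (snd (Fn g)) a m (psnd (psnd p)))))"

lemma mapcat_mor:
  assumes "g \<in> Mor (MapCat \<D>)"
  shows "Dom g \<in> Mor \<D>" "Cod g \<in> Mor \<D>"
    and "fst (Fn g) \<in> Hom \<D> (Dom (Dom g)) (Dom (Cod g))" "snd (Fn g) \<in> Hom \<D> (Cod (Dom g)) (Cod (Cod g))"
    and "Cod g \<odot> fst (Fn g) = snd (Fn g) \<odot> Dom g"
  using assms by (auto simp: MapCat_def)

lemma mor_hom: "f \<in> Mor \<D> ==> f \<in> Hom \<D> (Dom f) (Cod f)"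
  by (simp add: Hom_def)

lemma square_map:
  assumes \<nu>: "\<nu> \<in> N" and g: "g \<in> Mor (MapCat \<D>)"
  shows "square_map \<nu> g \<in> Hom \<D> (Squares \<nu> (Dom g)) (Squares \<nu> (Cod g))"
    and "a \<in> Ob D ==> Pair (Simplex \<nu>) (Pair u v) \<in> compatible \<nu> (Dom g) a m ==>
      el (square_map \<nu> g) a m (Pair (Simplex \<nu>) (Pair u v)) =
      Pair (Simplex \<nu>) (Pair (post (RK \<nu>) (fst (Fn g)) a m u) (post (RL \<nu>) (snd (Fn g)) a m v))"
proof -
  let ?X = "Dom (Dom g)" and ?Y = "Cod (Dom g)" and ?X' = "Dom (Cod g)" and ?Y' = "Cod (Cod g)"
  let ?s = "fst (Fn g)" and ?t = "snd (Fn g)"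
  note G = mapcat_mor[OF g]
  note f = mor_hom[OF G(1)] and f' = mor_hom[OF G(2)]
  note R = rlz_obj[OF \<nu>]
  note Sq = Squares[OF \<nu> f] and Sq' = Squares[OF \<nu> f']
  note F = nat_components(1,2)[OF f] nat_components(1,2)[OF f']
  let ?\<phi> = "\<lambda>a m p. Pair (Simplex \<nu>) (Pair (post (RK \<nu>) ?s a m (pfst (psnd p))) (post (RL \<nu>) ?t a m (psnd (psnd p))))"
  have comp: "?\<phi> a m p \<in> compatible \<nu> (Cod g) a m" if a: "a \<in> Ob D" and p: "p \<in> compatible \<nu> (Dom g) a m" for a m p
  proof -
    obtain u v where p': "p = Pair (Simplex \<nu>) (Pair u v)"
      and uv: "Pair (Simplex \<nu>) (Pair u v) \<in> compatible \<nu> (Dom g) a m"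
        "u \<in> pts (Exp (RK \<nu>) (At ?X a)) m" "v \<in> pts (Exp (RL \<nu>) (At ?Y a)) m"
      using compatible_cases[OF \<nu> f p] .
    note ps = post[OF R(1) G(3) a] and pt = post[OF R(2) G(4) a]
    show ?thesis
      unfolding compatible_iff[OF \<nu> f'] p' element.sel
    proof (intro conjI allI ballI)
      show "post (RK \<nu>) ?s a m u \<in> pts (Exp (RK \<nu>) (At ?X' a)) m" by (rule ps(2)[OF uv(2)])
      show "post (RL \<nu>) ?t a m v \<in> pts (Exp (RL \<nu>) (At ?Y' a)) m" by (rule pt(2)[OF uv(3)])
      fix l \<theta> k assume \<theta>: "\<theta> \<in> operators l m" and k: "k \<in> pts (RK \<nu>) l"
      have ru: "rst (Exp (RK \<nu>) (At ?X a)) m \<theta> u \<in> pts (Exp (RK \<nu>) (At ?X a)) l"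
        using cot_obj[OF R(1) F(1) a] uv \<theta> by simp
      have ev: "evl (RK \<nu>) (At ?X a) l (rst (Exp (RK \<nu>) (At ?X a)) m \<theta> u) k \<in> pts (At ?X a) l"
        by (rule evl_pts[OF R(1) at_obj[OF F(1) a] ru k])
      show "el (Cod g) a l (evl (RK \<nu>) (At ?X' a) l (rst (Exp (RK \<nu>) (At ?X' a)) m \<theta> (post (RK \<nu>) ?s a m u)) k) =
          evl (RL \<nu>) (At ?Y' a) l (rst (Exp (RL \<nu>) (At ?Y' a)) m \<theta> (post (RL \<nu>) ?t a m v)) (inc \<nu> l k)"
        using ps(4)[OF \<theta> uv(2) k] pt(4)[OF \<theta> uv(3) inc_pts[OF \<nu> k]] uv(1) \<theta> k
          el_cmp(1)[OF G(3) f' a ev] el_cmp(1)[OF f G(4) a ev] G(5)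
        by (simp add: compatible_iff[OF \<nu> f])
    qed simp
  qed
  have hm: "hm (At (Squares \<nu> (Dom g)) a) (At (Squares \<nu> (Cod g)) a) (?\<phi> a)" if a: "a \<in> Ob D" for a
  proof (rule Squares_lift[OF \<nu> f' a])
    note i = Squares_incl[OF \<nu> f a]
    have E: "Exp (RK \<nu>) (At ?X a) \<in> Obj S" "Exp (RL \<nu>) (At ?Y a) \<in> Obj S"
      using cot_obj[OF R(1) F(1) a] cot_obj[OF R(2) F(2) a] by auto
    note i2 = hm_snd[OF i tag(1) prod_S(1)[OF E]]
    show "hm (At (Squares \<nu> (Dom g)) a) (Exp (RK \<nu>) (At ?X' a)) (\<lambda>m p. post (RK \<nu>) ?s a m (pfst (psnd p)))"
      by (rule hm_comp[OF hm_fst[OF i2 E] post(1)[OF R(1) G(3) a]])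
    show "hm (At (Squares \<nu> (Dom g)) a) (Exp (RL \<nu>) (At ?Y' a)) (\<lambda>m p. post (RL \<nu>) ?t a m (psnd (psnd p)))"
      by (rule hm_comp[OF hm_snd[OF i2 E] post(1)[OF R(2) G(4) a]])
  qed (use comp[OF a] Sq(2)[OF a] in blast)
  have nat: "?\<phi> b m (act (Squares \<nu> (Dom g)) a b m e p) = act (Squares \<nu> (Cod g)) a b m e (?\<phi> a m p)"
    if ab: "a \<in> Ob D" "b \<in> Ob D" and e: "e \<in> pts (EHom D a b) m"
      and "p \<in> pts (At (Squares \<nu> (Dom g)) a) m" for a b m e p
  proof -
    have p: "p \<in> compatible \<nu> (Dom g) a m" using that Sq(2)[OF ab(1)] by blast
    obtain u v where p': "p = Pair (Simplex \<nu>) (Pair u v)"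
      and uv: "Pair (Simplex \<nu>) (Pair u v) \<in> compatible \<nu> (Dom g) a m"
        "u \<in> pts (Exp (RK \<nu>) (At ?X a)) m" "v \<in> pts (Exp (RL \<nu>) (At ?Y a)) m"
      using compatible_cases[OF \<nu> f p] .
    show ?thesis
      using comp[OF ab(1) p] post_act[OF R(1) G(3) ab e uv(2)] post_act[OF R(2) G(4) ab e uv(3)]
      by (simp add: p' Sq(3)[OF ab e uv(1)] Sq'(3)[OF ab e])
  qed
  note n = mknat[OF Sq(1) Sq'(1), of ?\<phi>, OF hm nat]
  show "square_map \<nu> g \<in> Hom \<D> (Squares \<nu> (Dom g)) (Squares \<nu> (Cod g))" by (rule n(1))
  show "a \<in> Ob D ==> Pair (Simplex \<nu>) (Pair u v) \<in> compatible \<nu> (Dom g) a m ==>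
      el (square_map \<nu> g) a m (Pair (Simplex \<nu>) (Pair u v)) =
      Pair (Simplex \<nu>) (Pair (post (RK \<nu>) ?s a m u) (post (RL \<nu>) ?t a m v))"
    by (subst n(2)) (simp_all add: Sq(2))
qed

lemma mapcat_ident:
  assumes "f \<in> Mor \<D>"
  shows "Ident (MapCat \<D>) f \<in> Mor (MapCat \<D>)" "Dom (Ident (MapCat \<D>) f) = f" "Cod (Ident (MapCat \<D>) f) = f"
    "Fn (Ident (MapCat \<D>) f) = (Ident \<D> (Dom f), Ident \<D> (Cod f))"
proof -
  note f = mor_hom[OF assms]
  show "Ident (MapCat \<D>) f \<in> Mor (MapCat \<D>)"
    using el_ident(2)[OF nat_components(1)[OF f]] el_ident(2)[OF nat_components(2)[OF f]] assms
      ident_left[OF f] ident_right[OF f] by (simp add: MapCat_def)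
qed (simp_all add: MapCat_def)

lemma mapcat_cmp:
  assumes g: "g \<in> Mor (MapCat \<D>)" and h: "h \<in> Mor (MapCat \<D>)" and gh: "Cod g = Dom h"
  shows "h \<cdot>\<^bsub>MapCat \<D>\<^esub> g \<in> Mor (MapCat \<D>)" "Dom (h \<cdot>\<^bsub>MapCat \<D>\<^esub> g) = Dom g"
    "Cod (h \<cdot>\<^bsub>MapCat \<D>\<^esub> g) = Cod h"
    "Fn (h \<cdot>\<^bsub>MapCat \<D>\<^esub> g) = (fst (Fn h) \<odot> fst (Fn g), snd (Fn h) \<odot> snd (Fn g))"
proof -
  note G = mapcat_mor[OF g] and H = mapcat_mor[OF h]
  note f = mor_hom[OF G(1)] and f' = mor_hom[OF G(2)] and f'' = mor_hom[OF H(2)]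
  note st = G(3,4) and st' = H(3,4)[folded gh]
  note A = abstract_category.cmp_assoc[OF abstract_category_axioms]
  have "Cod h \<odot> (fst (Fn h) \<odot> fst (Fn g)) = (snd (Fn h) \<odot> snd (Fn g)) \<odot> Dom g"
    using A[OF st(1) st'(1) f''] A[OF st(1) f' st'(2)] A[OF f st(2) st'(2)] G(5) H(5) gh by simp
  then show "h \<cdot>\<^bsub>MapCat \<D>\<^esub> g \<in> Mor (MapCat \<D>)"
    using G(1) H(2) cmp_hom[OF st(1) st'(1)] cmp_hom[OF st(2) st'(2)] by (simp add: MapCat_def)
qed (simp_all add: MapCat_def)

lemma square_map_ident:
  assumes \<nu>: "\<nu> \<in> N" and f: "f \<in> Mor \<D>" and a: "a \<in> Ob D" and p: "p \<in> compatible \<nu> f a m"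
  shows "el (square_map \<nu> (Ident (MapCat \<D>) f)) a m p = p"
proof -
  note f' = mor_hom[OF f] and I = mapcat_ident[OF f]
  obtain u v where p': "p = Pair (Simplex \<nu>) (Pair u v)"
    and uv: "Pair (Simplex \<nu>) (Pair u v) \<in> compatible \<nu> f a m"
      "u \<in> pts (Exp (RK \<nu>) (At (Dom f) a)) m" "v \<in> pts (Exp (RL \<nu>) (At (Cod f) a)) m"
    using compatible_cases[OF \<nu> f' p] .
  show ?thesis
    using square_map(2)[OF \<nu> I(1) a, of u v m] uv post_ident[OF rlz_obj(1)[OF \<nu>] nat_components(1)[OF f'] a uv(2)]
      post_ident[OF rlz_obj(2)[OF \<nu>] nat_components(2)[OF f'] a uv(3)] by (simp add: p' I)
qed

lemma square_map_cmp:
  assumes \<nu>: "\<nu> \<in> N" and g: "g \<in> Mor (MapCat \<D>)" and h: "h \<in> Mor (MapCat \<D>)" and gh: "Cod g = Dom h"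
    and a: "a \<in> Ob D" and p: "p \<in> compatible \<nu> (Dom g) a m"
  shows "el (square_map \<nu> (h \<cdot>\<^bsub>MapCat \<D>\<^esub> g)) a m p = el (square_map \<nu> h) a m (el (square_map \<nu> g) a m p)"
proof -
  note C = mapcat_cmp[OF g h gh] and G = mapcat_mor[OF g] and H = mapcat_mor[OF h]
  note f = mor_hom[OF G(1)] and f' = mor_hom[OF G(2)]
  note st' = H(3,4)[folded gh]
  note R = rlz_obj[OF \<nu>]
  obtain u v where p': "p = Pair (Simplex \<nu>) (Pair u v)"
    and uv: "Pair (Simplex \<nu>) (Pair u v) \<in> compatible \<nu> (Dom g) a m"
      "u \<in> pts (Exp (RK \<nu>) (At (Dom (Dom g)) a)) m" "v \<in> pts (Exp (RL \<nu>) (At (Cod (Dom g)) a)) m"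
    using compatible_cases[OF \<nu> f p] .
  note e1 = square_map(2)[OF \<nu> g a uv(1)]
  have "el (square_map \<nu> g) a m (Pair (Simplex \<nu>) (Pair u v)) \<in> compatible \<nu> (Cod g) a m"
    using el_pts[OF square_map(1)[OF \<nu> g] a] uv(1) a by (simp add: Squares(2)[OF \<nu> f] Squares(2)[OF \<nu> f'])
  then have "Pair (Simplex \<nu>) (Pair (post (RK \<nu>) (fst (Fn g)) a m u) (post (RL \<nu>) (snd (Fn g)) a m v))
      \<in> compatible \<nu> (Dom h) a m" using e1 gh by simp
  note e2 = square_map(2)[OF \<nu> h a this]
  have "Pair (Simplex \<nu>) (Pair u v) \<in> compatible \<nu> (Dom (h \<cdot>\<^bsub>MapCat \<D>\<^esub> g)) a m" using uv(1) C by simp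
  note e3 = square_map(2)[OF \<nu> C(1) a this]
  show ?thesis
    unfolding p' e1 e2 e3
    using post_cmp[OF R(1) G(3) st'(1) a uv(2)] post_cmp[OF R(2) G(4) st'(2) a uv(3)] by (simp add: C(4))
qed


section \<open>The factorization setup\<close>

definition tmap :: "('d, 'o, 'f) transformation => nat list sset =>
    ('d, 'o, 'f) transformation" where
  "tmap \<xi> K = mknat (tensor S D (Dom \<xi>) K) (tensor S D (Cod \<xi>) K)
     (\<lambda>a m p. Pair (el \<xi> a m (pfst p)) (psnd p))"

lemma tmap:
  assumes \<xi>: "\<xi> \<in> Hom \<D> T T'" and K: "Rlz S K \<in> Obj S"
  shows "tmap \<xi> K \<in> Hom \<D> (tensor S D T K) (tensor S D T' K)"
    and "a \<in> Ob D ==> x \<in> pts (At T a) m ==> k \<in> pts (Rlz S K) m ==>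
      el (tmap \<xi> K) a m (Pair x k) = Pair (el \<xi> a m x) k"
proof -
  note c = nat_components[OF \<xi>]
  note t = tensor[OF c(1) K] and t' = tensor[OF c(2) K]
  let ?\<phi> = "\<lambda>a m p. Pair (el \<xi> a m (pfst p)) (psnd p)"
  have hm: "hm (At (tensor S D T K) a) (At (tensor S D T' K) a) (?\<phi> a)" if a: "a \<in> Ob D" for a
    unfolding t(2)[OF a] t'(2)[OF a]
    using at_obj[OF c(1) a] K by (intro hm_pair hm_comp[OF hm_pfst el_hm[OF \<xi> a]] hm_psnd)
  have nat: "?\<phi> b m (act (tensor S D T K) a b m e p) = act (tensor S D T' K) a b m e (?\<phi> a m p)"
    if ab: "a \<in> Ob D" "b \<in> Ob D" and e: "e \<in> pts (EHom D a b) m" and p: "p \<in> pts (At (tensor S D T K) a) m"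
    for a b m e p
    using p ab e by (auto simp: t t' el_pts[OF \<xi>] el_act[OF \<xi>])
  note n = mknat[OF t(1) t'(1), of ?\<phi>, OF hm nat]
  show "tmap \<xi> K \<in> Hom \<D> (tensor S D T K) (tensor S D T' K)" unfolding tmap_def c(5,6) by (rule n(1))
  show "a \<in> Ob D ==> x \<in> pts (At T a) m ==> k \<in> pts (Rlz S K) m ==>
      el (tmap \<xi> K) a m (Pair x k) = Pair (el \<xi> a m x) k"
    unfolding tmap_def c(5,6) by (subst n(2)) (auto simp: t(2))
qed

lemma tensor_eqI:
  assumes T: "enriched_functor S D T" and K: "Rlz S K \<in> Obj S"
    and \<alpha>: "\<alpha> \<in> Hom \<D> (tensor S D T K) Z" and \<beta>: "\<beta> \<in> Hom \<D> (tensor S D T K) Z"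
    and eq: "\<And>a m x k. a \<in> Ob D ==> x \<in> pts (At T a) m ==> k \<in> pts (Rlz S K) m ==>
      el \<alpha> a m (Pair x k) = el \<beta> a m (Pair x k)"
  shows "\<alpha> = \<beta>"
  by (rule nat_eq[OF \<alpha> \<beta>]) (auto simp: tensor(2)[OF T K] eq)

lemma tmap_tensor_map:
  assumes \<xi>: "\<xi> \<in> Hom \<D> T T'" and \<nu>: "\<nu> \<in> N"
  shows "Arrow (tensor_map S D T (\<iota> \<nu>)) (tmap \<xi> (Dom (\<iota> \<nu>)), tmap \<xi> (Cod (\<iota> \<nu>))) (tensor_map S D T' (\<iota> \<nu>))
    \<in> Hom (MapCat \<D>) (tensor_map S D T (\<iota> \<nu>)) (tensor_map S D T' (\<iota> \<nu>))"
proof -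
  note c = nat_components[OF \<xi>] and R = rlz_obj[OF \<nu>]
  note i = tensor_map[OF c(1) rlz_hom[OF \<nu>]] and i' = tensor_map[OF c(2) rlz_hom[OF \<nu>]]
  note k = tmap[OF \<xi> R(1)] and l = tmap[OF \<xi> R(2)]
  have "tensor_map S D T' (\<iota> \<nu>) \<odot> tmap \<xi> (Dom (\<iota> \<nu>)) = tmap \<xi> (Cod (\<iota> \<nu>)) \<odot> tensor_map S D T (\<iota> \<nu>)"
    by (rule tensor_eqI[OF c(1) R(1) el_cmp(2)[OF k(1) i'(1)] el_cmp(2)[OF i(1) l(1)]])
      (simp add: el_cmp(1)[OF k(1) i'(1)] el_cmp(1)[OF i(1) l(1)] tensor(2)[OF c(1) R(1)]
        k(2) l(2) i(2) i'(2) el_pts[OF \<xi>] inc_pts[OF \<nu>])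
  then show ?thesis using i(1) i'(1) k(1) l(1) by (auto simp: MapCat_def Hom_def)
qed

text \<open>
  A label names a component of a diagram of squares.  It consists of the tag of the inclusion and the
  family of subsets itself; as no vertex of the component is chosen, labels can be transported functorially.
\<close>

definition labels :: "nat list set => ('d, 'o, 'f) transformation =>
    (nat list \<times> ('d => nat => 'u element set)) set" where
  "labels M f = {(\<nu>, component (Squares \<nu> f) a x) | \<nu> a x. \<nu> \<in> M \<and> a \<in> Ob D \<and> x \<in> compatible \<nu> f a 0}"

definition piece :: "('d, 'o, 'f) transformation =>
    nat list \<times> ('d => nat => 'u element set) => ('d, 'o, 'f) diagram" where
  "piece f l = subdiag (Squares (fst l) f) (snd l)"

definition top_map :: "('d, 'o, 'f) transformation =>
    nat list \<times> ('d => nat => 'u element set) => ('d, 'o, 'f) transformation" where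
  "top_map f l = mknat (tensor S D (piece f l) (Dom (\<iota> (fst l)))) (Dom f)
     (\<lambda>a m p. evl (RK (fst l)) (At (Dom f) a) m (pfst (psnd (pfst p))) (psnd p))"

definition bottom_map :: "('d, 'o, 'f) transformation =>
    nat list \<times> ('d => nat => 'u element set) => ('d, 'o, 'f) transformation" where
  "bottom_map f l = mknat (tensor S D (piece f l) (Cod (\<iota> (fst l)))) (Cod f)
     (\<lambda>a m p. evl (RL (fst l)) (At (Cod f) a) m (psnd (psnd (pfst p))) (psnd p))"

text \<open>The evaluation square on one component of the diagram of squares.\<close>

definition evaluation where
  "evaluation f l = Arrow (tensor_map S D (piece f l) (\<iota> (fst l))) (top_map f l, bottom_map f l) f"

lemma label_cases:
  assumes "l \<in> labels M f"
  obtains \<nu> a x where "l = (\<nu>, component (Squares \<nu> f) a x)" "\<nu> \<in> M" "a \<in> Ob D" "x \<in> compatible \<nu> f a 0"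
  using assms unfolding labels_def by blast

context
  fixes M assumes M: "M \<subseteq> N"
begin

lemma label_facts:
  assumes f: "f \<in> Mor \<D>" and l: "l \<in> labels M f"
  shows "fst l \<in> N" "fst l \<in> M" "invariant (Squares (fst l) f) (snd l)" "orbit S D (piece f l)"
    and "a \<in> Ob D ==> p \<in> snd l a m ==> p \<in> compatible (fst l) f a m"
    and "a \<notin> Ob D ==> snd l a m = {}"
proof -
  obtain \<nu> a x where l': "l = (\<nu>, component (Squares \<nu> f) a x)" and \<nu>: "\<nu> \<in> M"
    and a: "a \<in> Ob D" and x: "x \<in> compatible \<nu> f a 0"
    using l by (rule label_cases)
  show "fst l \<in> N" "fst l \<in> M" using \<nu> M l' by auto
  have \<nu>N: "\<nu> \<in> N" using \<nu> M by blast
  note Sq = Squares[OF \<nu>N mor_hom[OF f]]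
  have x': "x \<in> pts (At (Squares \<nu> f) a) 0" using x Sq(2)[OF a] by simp
  show "invariant (Squares (fst l) f) (snd l)" using component_invariant[OF Sq(1) a x'] l' by simp
  show "orbit S D (piece f l)" using component_orbit[OF Sq(1) a x'] l' by (simp add: piece_def)
  note cp = component_pts[OF Sq(1) a x']
  show "p \<in> compatible (fst l) f b m" if "b \<in> Ob D" "p \<in> snd l b m" for b p m
    using cp[of p b m] that l' Sq(2)[OF that(1)] by simp
  show "a \<notin> Ob D ==> snd l a m = {}" for a m using l' by (simp add: component_def)
qed

context
  fixes f l assumes f: "f \<in> Mor \<D>" and l: "l \<in> labels M f"
begin

lemma piece:
  shows "enriched_functor S D (piece f l)"
    and "a \<in> Ob D ==> pts (At (piece f l) a) m = snd l a m"
    and "a \<in> Ob D ==> b \<in> Ob D ==> e \<in> pts (EHom D a b) m ==> x \<in> snd l a m ==>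
      act (piece f l) a b m e x = act (Squares (fst l) f) a b m e x"
    and "a \<in> Ob D ==> hm (At (piece f l) a) (At (Squares (fst l) f) a) (\<lambda>m x. x)"
proof -
  note L = label_facts[OF f l]
  note Sq = Squares[OF L(1) mor_hom[OF f]]
  note s = subdiag[OF Sq(1) L(3)]
  show "enriched_functor S D (piece f l)" unfolding piece_def by (rule s)
  show "a \<in> Ob D ==> pts (At (piece f l) a) m = snd l a m" unfolding piece_def by (rule s)
  show "a \<in> Ob D ==> b \<in> Ob D ==> e \<in> pts (EHom D a b) m ==> x \<in> snd l a m ==>
      act (piece f l) a b m e x = act (Squares (fst l) f) a b m e x" unfolding piece_def by (rule s)
  show "a \<in> Ob D ==> hm (At (piece f l) a) (At (Squares (fst l) f) a) (\<lambda>m x. x)"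
    using sub_incl[OF at_obj[OF Sq(1)] invariant_sub[OF Sq(1) L(3)]] by (simp add: piece_def s(2))
qed

lemma piece_cases:
  assumes a: "a \<in> Ob D" and p: "p \<in> snd l a m"
  obtains u v where "p = Pair (Simplex (fst l)) (Pair u v)"
    "Pair (Simplex (fst l)) (Pair u v) \<in> compatible (fst l) f a m"
    "u \<in> pts (Exp (RK (fst l)) (At (Dom f) a)) m" "v \<in> pts (Exp (RL (fst l)) (At (Cod f) a)) m"
  using compatible_cases[OF label_facts(1)[OF f l] mor_hom[OF f] label_facts(5)[OF f l a p]] by blast

lemma piece_projections:
  assumes a: "a \<in> Ob D"
  shows "hm (At (piece f l) a) (Exp (RK (fst l)) (At (Dom f) a)) (\<lambda>m p. pfst (psnd p))"
    "hm (At (piece f l) a) (Exp (RL (fst l)) (At (Cod f) a)) (\<lambda>m p. psnd (psnd p))"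
proof -
  note L = label_facts[OF f l] and F = nat_components(1,2)[OF mor_hom[OF f]]
  note E = cot_obj[OF rlz_obj(1)[OF L(1)] F(1) a] cot_obj[OF rlz_obj(2)[OF L(1)] F(2) a]
  note i = hm_comp[OF piece(4)[OF a] Squares_incl[OF L(1) mor_hom[OF f] a]]
  note i2 = hm_snd[OF i tag(1) prod_S(1)[OF E]]
  show "hm (At (piece f l) a) (Exp (RK (fst l)) (At (Dom f) a)) (\<lambda>m p. pfst (psnd p))" by (rule hm_fst[OF i2 E])
  show "hm (At (piece f l) a) (Exp (RL (fst l)) (At (Cod f) a)) (\<lambda>m p. psnd (psnd p))" by (rule hm_snd[OF i2 E])
qed

lemma top_map:
  shows "top_map f l \<in> Hom \<D> (tensor S D (piece f l) (Dom (\<iota> (fst l)))) (Dom f)"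
    and "a \<in> Ob D ==> Pair t (Pair u v) \<in> snd l a m ==> k \<in> pts (RK (fst l)) m ==>
      el (top_map f l) a m (Pair (Pair t (Pair u v)) k) = evl (RK (fst l)) (At (Dom f) a) m u k"
proof -
  note L = label_facts[OF f l] and F = nat_components(1,2)[OF mor_hom[OF f]]
  note R = rlz_obj[OF L(1)] and Sq = Squares[OF L(1) mor_hom[OF f]]
  note t = tensor[OF piece(1) R(1)]
  let ?\<phi> = "\<lambda>a m p. evl (RK (fst l)) (At (Dom f) a) m (pfst (psnd (pfst p))) (psnd p)"
  have hm: "hm (At (tensor S D (piece f l) (Dom (\<iota> (fst l)))) a) (At (Dom f) a) (?\<phi> a)" if a: "a \<in> Ob D" for a
    unfolding t(2)[OF a]
    using R at_obj[OF F(1) a] at_obj[OF piece(1) a]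
    by (intro hm_binary[OF evl_hm] hm_comp[OF hm_pfst piece_projections(1)[OF a]] hm_psnd)
  have nat: "?\<phi> b m (act (tensor S D (piece f l) (Dom (\<iota> (fst l)))) a b m e p) = act (Dom f) a b m e (?\<phi> a m p)"
    if ab: "a \<in> Ob D" "b \<in> Ob D" and e: "e \<in> pts (EHom D a b) m"
      and p: "p \<in> pts (At (tensor S D (piece f l) (Dom (\<iota> (fst l)))) a) m" for a b m e p
  proof -
    obtain x k where p': "p = Pair x k" "x \<in> snd l a m" "k \<in> pts (RK (fst l)) m"
      using p ab by (auto simp: t(2) piece(2))
    obtain u v where x: "x = Pair (Simplex (fst l)) (Pair u v)"
      "Pair (Simplex (fst l)) (Pair u v) \<in> compatible (fst l) f a m"
      "u \<in> pts (Exp (RK (fst l)) (At (Dom f) a)) m" using piece_cases[OF ab(1) p'(2)] by blast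
    show ?thesis
      using p'(2) cot_act_evl[OF R(1) F(1) ab e x(3) p'(3)]
      by (simp add: p'(1) t(3)[OF ab e _ p'(3)] piece(2)[OF ab(1)] piece(3)[OF ab e] x(1) Sq(3)[OF ab e x(2)])
  qed
  note n = mknat[OF t(1) F(1), of ?\<phi>, OF hm nat]
  show "top_map f l \<in> Hom \<D> (tensor S D (piece f l) (Dom (\<iota> (fst l)))) (Dom f)" unfolding top_map_def by (rule n(1))
  show "a \<in> Ob D ==> Pair t (Pair u v) \<in> snd l a m ==> k \<in> pts (RK (fst l)) m ==>
      el (top_map f l) a m (Pair (Pair t (Pair u v)) k) = evl (RK (fst l)) (At (Dom f) a) m u k"
    unfolding top_map_def by (subst n(2)) (auto simp: t(2) piece(2))
qed

lemma bottom_map: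
  shows "bottom_map f l \<in> Hom \<D> (tensor S D (piece f l) (Cod (\<iota> (fst l)))) (Cod f)"
    and "a \<in> Ob D ==> Pair t (Pair u v) \<in> snd l a m ==> k \<in> pts (RL (fst l)) m ==>
      el (bottom_map f l) a m (Pair (Pair t (Pair u v)) k) = evl (RL (fst l)) (At (Cod f) a) m v k"
proof -
  note L = label_facts[OF f l] and F = nat_components(1,2)[OF mor_hom[OF f]]
  note R = rlz_obj[OF L(1)] and Sq = Squares[OF L(1) mor_hom[OF f]]
  note t = tensor[OF piece(1) R(2)]
  let ?\<phi> = "\<lambda>a m p. evl (RL (fst l)) (At (Cod f) a) m (psnd (psnd (pfst p))) (psnd p)"
  have hm: "hm (At (tensor S D (piece f l) (Cod (\<iota> (fst l)))) a) (At (Cod f) a) (?\<phi> a)" if a: "a \<in> Ob D" for a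
    unfolding t(2)[OF a]
    using R at_obj[OF F(2) a] at_obj[OF piece(1) a]
    by (intro hm_binary[OF evl_hm] hm_comp[OF hm_pfst piece_projections(2)[OF a]] hm_psnd)
  have nat: "?\<phi> b m (act (tensor S D (piece f l) (Cod (\<iota> (fst l)))) a b m e p) = act (Cod f) a b m e (?\<phi> a m p)"
    if ab: "a \<in> Ob D" "b \<in> Ob D" and e: "e \<in> pts (EHom D a b) m"
      and p: "p \<in> pts (At (tensor S D (piece f l) (Cod (\<iota> (fst l)))) a) m" for a b m e p
  proof -
    obtain x k where p': "p = Pair x k" "x \<in> snd l a m" "k \<in> pts (RL (fst l)) m"
      using p ab by (auto simp: t(2) piece(2))
    obtain u v where x: "x = Pair (Simplex (fst l)) (Pair u v)"
      "Pair (Simplex (fst l)) (Pair u v) \<in> compatible (fst l) f a m"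
      "v \<in> pts (Exp (RL (fst l)) (At (Cod f) a)) m" using piece_cases[OF ab(1) p'(2)] by blast
    show ?thesis
      using p'(2) cot_act_evl[OF R(2) F(2) ab e x(3) p'(3)]
      by (simp add: p'(1) t(3)[OF ab e _ p'(3)] piece(2)[OF ab(1)] piece(3)[OF ab e] x(1) Sq(3)[OF ab e x(2)])
  qed
  note n = mknat[OF t(1) F(2), of ?\<phi>, OF hm nat]
  show "bottom_map f l \<in> Hom \<D> (tensor S D (piece f l) (Cod (\<iota> (fst l)))) (Cod f)" unfolding bottom_map_def by (rule n(1))
  show "a \<in> Ob D ==> Pair t (Pair u v) \<in> snd l a m ==> k \<in> pts (RL (fst l)) m ==>
      el (bottom_map f l) a m (Pair (Pair t (Pair u v)) k) = evl (RL (fst l)) (At (Cod f) a) m v k"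
    unfolding bottom_map_def by (subst n(2)) (auto simp: t(2) piece(2))
qed

lemma evaluation_mor: "evaluation f l \<in> Mor (MapCat \<D>)"
proof -
  note L = label_facts[OF f l] and R = rlz_obj[OF L(1)] and F = nat_components(1,2)[OF mor_hom[OF f]]
  note i = tensor_map[OF piece(1) rlz_hom[OF L(1)]]
  have idm: "[0..<Suc m] \<in> operators m m" for m by (auto simp: operators_def simp del: upt_Suc)
  have "f \<odot> top_map f l = bottom_map f l \<odot> tensor_map S D (piece f l) (\<iota> (fst l))"
  proof (rule tensor_eqI[OF piece(1) R(1) el_cmp(2)[OF top_map(1) mor_hom[OF f]] el_cmp(2)[OF i(1) bottom_map(1)]])
    fix a m x k assume a: "a \<in> Ob D" and x: "x \<in> pts (At (piece f l) a) m" and k: "k \<in> pts (RK (fst l)) m"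
    have x': "x \<in> snd l a m" using x a by (simp add: piece(2))
    obtain u v where uv: "x = Pair (Simplex (fst l)) (Pair u v)"
      "Pair (Simplex (fst l)) (Pair u v) \<in> compatible (fst l) f a m"
      "u \<in> pts (Exp (RK (fst l)) (At (Dom f) a)) m" "v \<in> pts (Exp (RL (fst l)) (At (Cod f) a)) m"
      using piece_cases[OF a x'] .
    have "el f a m (evl (RK (fst l)) (At (Dom f) a) m u k) = evl (RL (fst l)) (At (Cod f) a) m v (inc (fst l) m k)"
      using uv(2) k idm[of m] rst_id[OF cot_obj[OF R(1) F(1) a] uv(3)] rst_id[OF cot_obj[OF R(2) F(2) a] uv(4)]
      unfolding compatible_iff[OF L(1) mor_hom[OF f]] by (metis)
    then show "el (f \<odot> top_map f l) a m (Pair x k) =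
        el (bottom_map f l \<odot> tensor_map S D (piece f l) (\<iota> (fst l))) a m (Pair x k)"
      using x x' k a i(2)[OF a x k] top_map(2)[OF a, of _ u v m k] bottom_map(2)[OF a, of _ u v m] inc_pts[OF L(1) k]
      by (simp add: el_cmp(1)[OF top_map(1) mor_hom[OF f] a] el_cmp(1)[OF i(1) bottom_map(1) a]
          tensor(2)[OF piece(1) R(1)] uv(1))
  qed
  then show ?thesis
    using i(1) f top_map(1) bottom_map(1) by (simp add: evaluation_def MapCat_def Hom_def)
qed

end

end

end

context model_diagrams
begin

text \<open>
  The component that contains the image of a given component under the map of diagrams of squares
  induced by \<open>g\<close>.
\<close>

definition push_label where
  "push_label g l = (fst l, \<lambda>b m. {y. b \<in> Ob D \<and> (\<exists>a \<in> Ob D. \<exists>x \<in> snd l a m.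
     ((a, el (square_map (fst l) g) a m x), (b, y)) \<in> conn (Squares (fst l) (Cod g)) m)})"

definition push_piece where
  "push_piece g l = mknat (piece (Dom g) l) (piece (Cod g) (push_label g l)) (el (square_map (fst l) g))"

definition push_square where
  "push_square g l = Arrow (tensor_map S D (piece (Dom g) l) (\<iota> (fst l)))
     (tmap (push_piece g l) (Dom (\<iota> (fst l))), tmap (push_piece g l) (Cod (\<iota> (fst l))))
     (tensor_map S D (piece (Cod g) (push_label g l)) (\<iota> (fst l)))"

lemma push_label_fst [simp]: "fst (push_label g l) = fst l"
  by (simp add: push_label_def)

lemma push_component:
  assumes \<nu>: "\<nu> \<in> N" and g: "g \<in> Mor (MapCat \<D>)" and a: "a \<in> Ob D" and x: "x \<in> compatible \<nu> (Dom g) a 0"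
  shows "push_label g (\<nu>, component (Squares \<nu> (Dom g)) a x) =
    (\<nu>, component (Squares \<nu> (Cod g)) a (el (square_map \<nu> g) a 0 x))"
proof -
  note G = mapcat_mor[OF g]
  note s = square_map(1)[OF \<nu> g]
  have x': "x \<in> pts (At (Squares \<nu> (Dom g)) a) 0" using x a by (simp add: Squares(2)[OF \<nu> mor_hom[OF G(1)]])
  note v = vtx_el[OF s a x']
  have "(\<exists>c \<in> Ob D. \<exists>z \<in> component (Squares \<nu> (Dom g)) a x c m.
      ((c, el (square_map \<nu> g) c m z), (b, y)) \<in> conn (Squares \<nu> (Cod g)) m) \<longleftrightarrow>
    ((a, vtx (Squares \<nu> (Cod g)) a (el (square_map \<nu> g) a 0 x) m), (b, y)) \<in> conn (Squares \<nu> (Cod g)) m"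
    for b m y
  proof
    assume "\<exists>c \<in> Ob D. \<exists>z \<in> component (Squares \<nu> (Dom g)) a x c m.
      ((c, el (square_map \<nu> g) c m z), (b, y)) \<in> conn (Squares \<nu> (Cod g)) m"
    then obtain c z where "((a, vtx (Squares \<nu> (Dom g)) a x m), (c, z)) \<in> conn (Squares \<nu> (Dom g)) m"
      and *: "((c, el (square_map \<nu> g) c m z), (b, y)) \<in> conn (Squares \<nu> (Cod g)) m"
      unfolding component_def by blast
    from conn_trans[OF conn_el[OF s this(1)] *]
    show "((a, vtx (Squares \<nu> (Cod g)) a (el (square_map \<nu> g) a 0 x) m), (b, y)) \<in> conn (Squares \<nu> (Cod g)) m"
      by (simp add: v)
  next
    assume *: "((a, vtx (Squares \<nu> (Cod g)) a (el (square_map \<nu> g) a 0 x) m), (b, y)) \<in> conn (Squares \<nu> (Cod g)) m"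
    have "vtx (Squares \<nu> (Dom g)) a x m \<in> component (Squares \<nu> (Dom g)) a x a m"
      using a conn_refl by (simp add: component_def)
    then show "\<exists>c \<in> Ob D. \<exists>z \<in> component (Squares \<nu> (Dom g)) a x c m.
      ((c, el (square_map \<nu> g) c m z), (b, y)) \<in> conn (Squares \<nu> (Cod g)) m"
      using a * by (intro bexI[of _ a] bexI[of _ "vtx (Squares \<nu> (Dom g)) a x m"]) (simp_all add: v)
  qed
  then show ?thesis unfolding push_label_def by (simp add: component_def fun_eq_iff)
qed

context
  fixes M assumes M: "M \<subseteq> N"
begin

lemma push_label:
  assumes g: "g \<in> Mor (MapCat \<D>)" and l: "l \<in> labels M (Dom g)"
  shows "push_label g l \<in> labels M (Cod g)"
    and "a \<in> Ob D ==> x \<in> snd l a m ==> el (square_map (fst l) g) a m x \<in> snd (push_label g l) a m"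
proof -
  note G = mapcat_mor[OF g]
  obtain \<nu> b y where l': "l = (\<nu>, component (Squares \<nu> (Dom g)) b y)" and \<nu>: "\<nu> \<in> M"
    and b: "b \<in> Ob D" and y: "y \<in> compatible \<nu> (Dom g) b 0"
    using l by (rule label_cases)
  have \<nu>N: "\<nu> \<in> N" using \<nu> M by blast
  have "el (square_map \<nu> g) b 0 y \<in> compatible \<nu> (Cod g) b 0"
    using el_pts[OF square_map(1)[OF \<nu>N g] b] y b
    by (simp add: Squares(2)[OF \<nu>N mor_hom[OF G(1)]] Squares(2)[OF \<nu>N mor_hom[OF G(2)]])
  then show "push_label g l \<in> labels M (Cod g)"
    unfolding l' push_component[OF \<nu>N g b y] labels_def using \<nu> b by blast
  show "a \<in> Ob D ==> x \<in> snd l a m ==> el (square_map (fst l) g) a m x \<in> snd (push_label g l) a m" for a x m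
    unfolding push_label_def snd_conv using conn_refl by blast
qed

lemma push_piece:
  assumes g: "g \<in> Mor (MapCat \<D>)" and l: "l \<in> labels M (Dom g)"
  shows "push_piece g l \<in> Hom \<D> (piece (Dom g) l) (piece (Cod g) (push_label g l))"
    and "a \<in> Ob D ==> x \<in> snd l a m ==> el (push_piece g l) a m x = el (square_map (fst l) g) a m x"
proof -
  note G = mapcat_mor[OF g] and P = push_label[OF g l]
  note L = label_facts[OF M G(1) l] and L' = label_facts[OF M G(2) P(1), simplified]
  note p = piece[OF M G(1) l] and p' = piece[OF M G(2) P(1), simplified]
  note s = square_map(1)[OF L(1) g]
  note Sq' = Squares(1)[OF L(1) mor_hom[OF G(2)]] and Sq = Squares(2)[OF L(1) mor_hom[OF G(1)]]
  let ?\<phi> = "el (square_map (fst l) g)"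
  have hm: "hm (At (piece (Dom g) l) a) (At (piece (Cod g) (push_label g l)) a) (?\<phi> a)" if a: "a \<in> Ob D" for a
    using sub_lift[OF at_obj[OF Sq' a] invariant_sub[OF Sq' L'(3) a] hm_comp[OF p(4)[OF a] el_hm[OF s a]]]
      P(2)[OF a] a p(2)[OF a]
    by (simp add: piece_def[of "Cod g"] subdiag(2)[OF Sq' L'(3)])
  have nat: "?\<phi> b m (act (piece (Dom g) l) a b m e x) = act (piece (Cod g) (push_label g l)) a b m e (?\<phi> a m x)"
    if ab: "a \<in> Ob D" "b \<in> Ob D" and e: "e \<in> pts (EHom D a b) m" and "x \<in> pts (At (piece (Dom g) l) a) m"
    for a b m e x
  proof -
    have x: "x \<in> snd l a m" using that p(2) by blast
    then have "x \<in> pts (At (Squares (fst l) (Dom g)) a) m" using L(5)[OF ab(1)] Sq[OF ab(1)] by simp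
    from el_act[OF s ab e this] show ?thesis
      by (simp add: p(3)[OF ab e x] p'(3)[OF ab e P(2)[OF ab(1) x]])
  qed
  note n = mknat[OF p(1) p'(1), of ?\<phi>, OF hm nat]
  show "push_piece g l \<in> Hom \<D> (piece (Dom g) l) (piece (Cod g) (push_label g l))"
    unfolding push_piece_def by (rule n(1))
  show "a \<in> Ob D ==> x \<in> snd l a m ==> el (push_piece g l) a m x = el (square_map (fst l) g) a m x"
    unfolding push_piece_def by (rule n(2)) (simp_all add: p(2))
qed

lemma push_square_hom:
  assumes g: "g \<in> Mor (MapCat \<D>)" and l: "l \<in> labels M (Dom g)"
  shows "push_square g l \<in> Hom (MapCat \<D>) (Dom (evaluation (Dom g) l)) (Dom (evaluation (Cod g) (push_label g l)))"
  using tmap_tensor_map[OF push_piece(1)[OF g l] label_facts(1)[OF M mapcat_mor(1)[OF g] l]]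
  by (simp add: push_square_def evaluation_def)

lemma push_square_comm:
  assumes g: "g \<in> Mor (MapCat \<D>)" and l: "l \<in> labels M (Dom g)"
  shows "evaluation (Cod g) (push_label g l) \<cdot>\<^bsub>MapCat \<D>\<^esub> push_square g l = g \<cdot>\<^bsub>MapCat \<D>\<^esub> evaluation (Dom g) l"
proof -
  let ?l = "push_label g l" and ?f = "Dom g" and ?f' = "Cod g"
  note G = mapcat_mor[OF g] and P = push_label[OF g l]
  note L = label_facts[OF M G(1) l]
  note p = piece[OF M G(1) l] and p' = piece[OF M G(2) P(1), simplified]
  note R = rlz_obj[OF L(1)]
  note q = push_piece[OF g l]
  note k = tmap[OF q(1) R(1)] and j = tmap[OF q(1) R(2)]
  note top = top_map[OF M G(1) l] and top' = top_map[OF M G(2) P(1), simplified]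
  note bot = bottom_map[OF M G(1) l] and bot' = bottom_map[OF M G(2) P(1), simplified]
  have uv: "\<exists>u v. x = Pair (Simplex (fst l)) (Pair u v) \<and> u \<in> pts (Exp (RK (fst l)) (At (Dom ?f) a)) m \<and>
      v \<in> pts (Exp (RL (fst l)) (At (Cod ?f) a)) m \<and>
      el (push_piece g l) a m x = Pair (Simplex (fst l)) (Pair (post (RK (fst l)) (fst (Fn g)) a m u)
        (post (RL (fst l)) (snd (Fn g)) a m v)) \<and>
      Pair (Simplex (fst l)) (Pair (post (RK (fst l)) (fst (Fn g)) a m u)
        (post (RL (fst l)) (snd (Fn g)) a m v)) \<in> snd ?l a m"
    if a: "a \<in> Ob D" and x: "x \<in> snd l a m" for a m x
  proof -
    obtain u v where uv: "x = Pair (Simplex (fst l)) (Pair u v)"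
      "Pair (Simplex (fst l)) (Pair u v) \<in> compatible (fst l) ?f a m"
      "u \<in> pts (Exp (RK (fst l)) (At (Dom ?f) a)) m" "v \<in> pts (Exp (RL (fst l)) (At (Cod ?f) a)) m"
      using piece_cases[OF M G(1) l a x] .
    show ?thesis using P(2)[OF a x] q(2)[OF a x] square_map(2)[OF L(1) g a uv(2)] uv by auto
  qed
  have t: "top_map ?f' ?l \<odot> tmap (push_piece g l) (Dom (\<iota> (fst l))) = fst (Fn g) \<odot> top_map ?f l"
  proof (rule tensor_eqI[OF p(1) R(1) el_cmp(2)[OF k(1) top'(1)] el_cmp(2)[OF top(1) G(3)]])
    fix a m x c assume a: "a \<in> Ob D" and x: "x \<in> pts (At (piece ?f l) a) m" and c: "c \<in> pts (RK (fst l)) m"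
    have x': "x \<in> snd l a m" using x a by (simp add: p(2))
    obtain u v where uv: "x = Pair (Simplex (fst l)) (Pair u v)" "u \<in> pts (Exp (RK (fst l)) (At (Dom ?f) a)) m"
      "el (push_piece g l) a m x = Pair (Simplex (fst l)) (Pair (post (RK (fst l)) (fst (Fn g)) a m u)
        (post (RL (fst l)) (snd (Fn g)) a m v))"
      "Pair (Simplex (fst l)) (Pair (post (RK (fst l)) (fst (Fn g)) a m u)
        (post (RL (fst l)) (snd (Fn g)) a m v)) \<in> snd ?l a m" using uv[OF a x'] by blast
    have px: "Pair x c \<in> pts (At (tensor S D (piece ?f l) (Dom (\<iota> (fst l)))) a) m"
      using x c a by (simp add: tensor(2)[OF p(1) R(1)])
    show "el (top_map ?f' ?l \<odot> tmap (push_piece g l) (Dom (\<iota> (fst l)))) a m (Pair x c) =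
        el (fst (Fn g) \<odot> top_map ?f l) a m (Pair x c)"
      unfolding el_cmp(1)[OF k(1) top'(1) a px] el_cmp(1)[OF top(1) G(3) a px] k(2)[OF a x c] uv(3)
      using top'(2)[OF a uv(4) c] post(3)[OF R(1) G(3) a uv(2) c] top(2)[OF a x'[unfolded uv(1)] c] uv(1) by simp
  qed
  have b: "bottom_map ?f' ?l \<odot> tmap (push_piece g l) (Cod (\<iota> (fst l))) = snd (Fn g) \<odot> bottom_map ?f l"
  proof (rule tensor_eqI[OF p(1) R(2) el_cmp(2)[OF j(1) bot'(1)] el_cmp(2)[OF bot(1) G(4)]])
    fix a m x c assume a: "a \<in> Ob D" and x: "x \<in> pts (At (piece ?f l) a) m" and c: "c \<in> pts (RL (fst l)) m"
    have x': "x \<in> snd l a m" using x a by (simp add: p(2))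
    obtain u v where uv: "x = Pair (Simplex (fst l)) (Pair u v)" "v \<in> pts (Exp (RL (fst l)) (At (Cod ?f) a)) m"
      "el (push_piece g l) a m x = Pair (Simplex (fst l)) (Pair (post (RK (fst l)) (fst (Fn g)) a m u)
        (post (RL (fst l)) (snd (Fn g)) a m v))"
      "Pair (Simplex (fst l)) (Pair (post (RK (fst l)) (fst (Fn g)) a m u)
        (post (RL (fst l)) (snd (Fn g)) a m v)) \<in> snd ?l a m" using uv[OF a x'] by blast
    have px: "Pair x c \<in> pts (At (tensor S D (piece ?f l) (Cod (\<iota> (fst l)))) a) m"
      using x c a by (simp add: tensor(2)[OF p(1) R(2)])
    show "el (bottom_map ?f' ?l \<odot> tmap (push_piece g l) (Cod (\<iota> (fst l)))) a m (Pair x c) =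
        el (snd (Fn g) \<odot> bottom_map ?f l) a m (Pair x c)"
      unfolding el_cmp(1)[OF j(1) bot'(1) a px] el_cmp(1)[OF bot(1) G(4) a px] j(2)[OF a x c] uv(3)
      using bot'(2)[OF a uv(4) c] post(3)[OF R(2) G(4) a uv(2) c] bot(2)[OF a x'[unfolded uv(1)] c] uv(1) by simp
  qed
  show ?thesis by (simp add: evaluation_def push_square_def MapCat_def t b)
qed

lemma push_label_ident:
  assumes f: "f \<in> Mor \<D>" and l: "l \<in> labels M f"
  shows "push_label (Ident (MapCat \<D>) f) l = l"
proof -
  note I = mapcat_ident[OF f]
  obtain \<nu> a x where l': "l = (\<nu>, component (Squares \<nu> f) a x)" and \<nu>: "\<nu> \<in> M"
    and a: "a \<in> Ob D" and x: "x \<in> compatible \<nu> f a 0"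
    using l by (rule label_cases)
  have \<nu>N: "\<nu> \<in> N" using \<nu> M by blast
  show ?thesis
    using push_component[OF \<nu>N I(1) a] x square_map_ident[OF \<nu>N f a x] by (simp add: l' I(2,3))
qed

lemma tensor_map_ident:
  assumes \<alpha>: "\<alpha> \<in> Hom \<D> T T" and id: "\<And>a m x. a \<in> Ob D ==> x \<in> pts (At T a) m ==> el \<alpha> a m x = x"
    and K: "Rlz S K \<in> Obj S"
  shows "tmap \<alpha> K = Ident \<D> (tensor S D T K)"
proof -
  note T = nat_components(1)[OF \<alpha>] and k = tmap[OF \<alpha> K]
  note i = el_ident[OF tensor(1)[OF T K]]
  show ?thesis
    by (rule tensor_eqI[OF T K k(1) i(2)]) (simp add: k(2) id i(1) tensor(2)[OF T K])
qed

lemma push_square_ident: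
  assumes f: "f \<in> Mor \<D>" and l: "l \<in> labels M f"
  shows "push_square (Ident (MapCat \<D>) f) l = Ident (MapCat \<D>) (Dom (evaluation f l))"
proof -
  note I = mapcat_ident[OF f] and L = label_facts[OF M f l]
  have l2: "l \<in> labels M (Dom (Ident (MapCat \<D>) f))" using l I by simp
  note q = push_piece[OF I(1) l2, unfolded I(2,3) push_label_ident[OF f l]]
  note p = piece[OF M f l] and R = rlz_obj[OF L(1)]
  have id: "el (push_piece (Ident (MapCat \<D>) f) l) a m x = x" if a: "a \<in> Ob D" and "x \<in> pts (At (piece f l) a) m" for a m x
  proof -
    have x: "x \<in> snd l a m" using that p(2) by blast
    have "el (push_piece (Ident (MapCat \<D>) f) l) a m x = el (square_map (fst l) (Ident (MapCat \<D>) f)) a m x"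
      using push_piece(2)[OF I(1) l2 a x] .
    then show ?thesis using square_map_ident[OF L(1) f a L(5)[OF a x]] by simp
  qed
  let ?i = "tensor_map S D (piece f l) (\<iota> (fst l))"
  have i: "Dom ?i = tensor S D (piece f l) (Dom (\<iota> (fst l)))" "Cod ?i = tensor S D (piece f l) (Cod (\<iota> (fst l)))"
    using tensor_map(1)[OF p(1) rlz_hom[OF L(1)]] by (simp_all add: Hom_def)
  have "Ident (MapCat \<D>) ?i = Arrow ?i (Ident \<D> (Dom ?i), Ident \<D> (Cod ?i)) ?i" by (simp add: MapCat_def)
  then show ?thesis
    unfolding push_square_def I(2,3) push_label_ident[OF f l] evaluation_def arrow.sel i
    using tensor_map_ident[OF q(1) id R(1)] tensor_map_ident[OF q(1) id R(2)] by simp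
qed

context
  fixes g h l assumes g: "g \<in> Mor (MapCat \<D>)" and h: "h \<in> Mor (MapCat \<D>)" and gh: "Cod g = Dom h"
    and l: "l \<in> labels M (Dom g)"
begin

lemma push_label_cmp: "push_label (h \<cdot>\<^bsub>MapCat \<D>\<^esub> g) l = push_label h (push_label g l)"
proof -
  note C = mapcat_cmp[OF g h gh] and G = mapcat_mor[OF g]
  obtain \<nu> a x where l': "l = (\<nu>, component (Squares \<nu> (Dom g)) a x)" and \<nu>: "\<nu> \<in> M"
    and a: "a \<in> Ob D" and x: "x \<in> compatible \<nu> (Dom g) a 0"
    using l by (rule label_cases)
  have \<nu>N: "\<nu> \<in> N" using \<nu> M by blast
  have "el (square_map \<nu> g) a 0 x \<in> compatible \<nu> (Dom h) a 0"
    using el_pts[OF square_map(1)[OF \<nu>N g] a] x a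
    by (simp add: Squares(2)[OF \<nu>N mor_hom[OF G(1)]] Squares(2)[OF \<nu>N mor_hom[OF G(2)]] gh[symmetric])
  note ph = push_component[OF \<nu>N h a this]
  have "x \<in> compatible \<nu> (Dom (h \<cdot>\<^bsub>MapCat \<D>\<^esub> g)) a 0" using x C(2) by simp
  note pc = push_component[OF \<nu>N C(1) a this]
  have "push_label (h \<cdot>\<^bsub>MapCat \<D>\<^esub> g) l =
      (\<nu>, component (Squares \<nu> (Cod h)) a (el (square_map \<nu> (h \<cdot>\<^bsub>MapCat \<D>\<^esub> g)) a 0 x))"
    using pc unfolding l' C(2,3) .
  also have "\<dots> = push_label h (\<nu>, component (Squares \<nu> (Cod g)) a (el (square_map \<nu> g) a 0 x))"
    unfolding square_map_cmp[OF \<nu>N g h gh a x] gh by (rule ph[unfolded gh, symmetric])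
  also have "\<dots> = push_label h (push_label g l)"
    unfolding l' push_component[OF \<nu>N g a x] ..
  finally show ?thesis .
qed

lemma push_square_cmp:
  "push_square (h \<cdot>\<^bsub>MapCat \<D>\<^esub> g) l = push_square h (push_label g l) \<cdot>\<^bsub>MapCat \<D>\<^esub> push_square g l"
proof -
  note C = mapcat_cmp[OF g h gh] and G = mapcat_mor[OF g] and H = mapcat_mor[OF h]
  note P = push_label[OF g l]
  have l2: "l \<in> labels M (Dom (h \<cdot>\<^bsub>MapCat \<D>\<^esub> g))" using l C by simp
  have l3: "push_label g l \<in> labels M (Dom h)" using P(1) gh by simp
  note L = label_facts[OF M G(1) l]
  note p = piece[OF M G(1) l] and R = rlz_obj[OF L(1)]
  note q = push_piece[OF g l] and q' = push_piece[OF h l3, folded gh, simplified]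
  note r = push_piece[OF C(1) l2, unfolded C(2,3) push_label_cmp]
  have eq: "el (push_piece (h \<cdot>\<^bsub>MapCat \<D>\<^esub> g) l) a m x =
      el (push_piece h (push_label g l)) a m (el (push_piece g l) a m x)"
    if a: "a \<in> Ob D" and "x \<in> pts (At (piece (Dom g) l) a) m" for a m x
  proof -
    have x: "x \<in> snd l a m" using that p(2) by blast
    have "el (push_piece (h \<cdot>\<^bsub>MapCat \<D>\<^esub> g) l) a m x = el (square_map (fst l) (h \<cdot>\<^bsub>MapCat \<D>\<^esub> g)) a m x"
      using push_piece(2)[OF C(1) l2 a x] .
    then show ?thesis
      using square_map_cmp[OF L(1) g h gh a L(5)[OF a x]] q(2)[OF a x] push_piece(2)[OF h l3 a P(2)[OF a x]] by simp
  qed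
  have tm: "tmap (push_piece (h \<cdot>\<^bsub>MapCat \<D>\<^esub> g) l) K =
      tmap (push_piece h (push_label g l)) K \<odot> tmap (push_piece g l) K" if K: "Rlz S K \<in> Obj S" for K
  proof -
    note t = tmap[OF r(1) K] and t1 = tmap[OF q(1) K] and t2 = tmap[OF q'(1) K]
    show ?thesis
      by (rule tensor_eqI[OF p(1) K t(1) el_cmp(2)[OF t1(1) t2(1)]])
        (simp add: el_cmp(1)[OF t1(1) t2(1)] tensor(2)[OF p(1) K] t(2) t1(2) t2(2) el_pts[OF q(1)] eq)
  qed
  have cmp: "Q \<cdot>\<^bsub>MapCat \<D>\<^esub> P = Arrow (Dom P)
      (fst (Fn Q) \<odot> fst (Fn P), snd (Fn Q) \<odot> snd (Fn P)) (Cod Q)" for P Q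
    by (simp add: MapCat_def)
  show ?thesis
    unfolding push_square_def C(2,3) push_label_cmp tm[OF R(1)] tm[OF R(2)] by (simp add: cmp)
qed

end

text \<open>
  The domain of the evaluation square is built from the subdiagram \<open>piece f l\<close>, whose points are those of the
  component and carry the tag.
\<close>

lemma evaluation_inj:
  assumes f: "f \<in> Mor \<D>"
  shows "inj_on (evaluation f) (labels M f)"
proof (rule inj_onI)
  fix l l' assume l: "l \<in> labels M f" and l': "l' \<in> labels M f" and eq: "evaluation f l = evaluation f l'"
  note L = label_facts[OF M f l] and L' = label_facts[OF M f l']
  note p = piece[OF M f l] and p' = piece[OF M f l']
  note R = rlz_obj(2)[OF L(1)] and R' = rlz_obj(2)[OF L'(1)]
  have "Cod (Dom (evaluation f l)) = Cod (Dom (evaluation f l'))" using eq by simp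
  then have t: "tensor S D (piece f l) (Cod (\<iota> (fst l))) = tensor S D (piece f l') (Cod (\<iota> (fst l')))"
    using tensor_map(1)[OF p(1) rlz_hom[OF L(1)]] tensor_map(1)[OF p'(1) rlz_hom[OF L'(1)]]
    by (simp add: evaluation_def Hom_def)
  have "x \<in> snd l a m \<longleftrightarrow> x \<in> snd l' a m" if a: "a \<in> Ob D" for a m x
  proof -
    have eq: "{Pair x k | x k. x \<in> snd l a m \<and> k \<in> pts (RL (fst l)) m} =
        {Pair x k | x k. x \<in> snd l' a m \<and> k \<in> pts (RL (fst l')) m}"
      using arg_cong[OF t, of "\<lambda>T. pts (At T a) m"] a
      by (simp add: tensor(2)[OF p(1) R] tensor(2)[OF p'(1) R'] p(2) p'(2))
    obtain k k' where k: "k \<in> pts (RL (fst l)) m" "k' \<in> pts (RL (fst l')) m"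
      using rlz_nonempty[OF L(1), of m] rlz_nonempty[OF L'(1), of m] by blast
    have "y \<in> snd l a m \<and> z \<in> pts (RL (fst l)) m \<longleftrightarrow> y \<in> snd l' a m \<and> z \<in> pts (RL (fst l')) m" for y z
      using eqset_imp_iff[OF eq, of "Pair y z"] by simp
    with k show ?thesis by blast
  qed
  then have s: "snd l = snd l'" using L(6) L'(6) by (intro ext) blast
  obtain \<nu> a x where c: "l = (\<nu>, component (Squares \<nu> f) a x)" and \<nu>: "\<nu> \<in> M" and a: "a \<in> Ob D"
    and x: "x \<in> compatible \<nu> f a 0" using l by (rule label_cases)
  have "vtx (Squares \<nu> f) a x 0 \<in> snd l a 0" using a conn_refl by (simp add: c component_def)
  then have "\<exists>z. z \<in> compatible (fst l) f a 0 \<and> z \<in> compatible (fst l') f a 0"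
    using L(5)[OF a] L'(5)[OF a] unfolding s by blast
  then have "fst l = fst l'" by (auto simp: compatible_def)
  with s show "l = l'" by (rule prod_eqI[rotated])
qed

lemma labels_small:
  assumes f: "f \<in> Mor \<D>"
  shows "small TYPE('u) (labels M f)"
proof -
  have "labels M f \<subseteq> (\<lambda>(\<nu>, a, x). (\<nu>, component (Squares \<nu> f) a x)) `
      (SIGMA \<nu>:M. SIGMA a:Ob D. pts (At (Squares \<nu> f) a) 0)"
  proof
    fix l assume "l \<in> labels M f"
    then obtain \<nu> a x where l: "l = (\<nu>, component (Squares \<nu> f) a x)" "\<nu> \<in> M" "a \<in> Ob D" "x \<in> compatible \<nu> f a 0"
      by (rule label_cases)
    then have "(\<nu>, a, x) \<in> (SIGMA \<nu>:M. SIGMA a:Ob D. pts (At (Squares \<nu> f) a) 0)"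
      using Squares(2)[OF _ mor_hom[OF f]] M by auto
    then show "l \<in> (\<lambda>(\<nu>, a, x). (\<nu>, component (Squares \<nu> f) a x)) `
        (SIGMA \<nu>:M. SIGMA a:Ob D. pts (At (Squares \<nu> f) a) 0)" unfolding l(1) by (rule rev_image_eqI) simp
  qed
  moreover have "small TYPE('u) (SIGMA \<nu>:M. SIGMA a:Ob D. pts (At (Squares \<nu> f) a) 0)"
    using small_pts[OF at_obj[OF Squares(1)[OF _ mor_hom[OF f]]]] M small_Ob small_countable[OF inaccessible, of M]
    by (intro small_Sigma[OF inaccessible]) auto
  ultimately show ?thesis by (blast intro: small_subset small_image)
qed

end


section \<open>Factoring squares through components\<close>

text \<open>
  The transpose of a map \<open>T \<otimes> K \<rightarrow> X\<close>, as a map from \<open>T\<close> to the cotensor \<open>X\<^sup>K\<close>.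
\<close>

definition adj :: "'o => ('d, 'o, 'f) transformation => ('d, 'o, 'f) diagram =>
    'd => nat => 'u element => 'u element" where
  "adj B p T a = lam (At T a) B (At (Cod p) a) (\<lambda>m x k. el p a m (Pair x k))"

context
  fixes p T K X
  assumes T: "enriched_functor S D T" and K: "Rlz S K \<in> Obj S" and p: "p \<in> Hom \<D> (tensor S D T K) X"
begin

lemma adj:
  assumes a: "a \<in> Ob D"
  shows "hm (At T a) (Exp (Rlz S K) (At X a)) (adj (Rlz S K) p T a)"
    and "x \<in> pts (At T a) m ==> adj (Rlz S K) p T a m x \<in> pts (Exp (Rlz S K) (At X a)) m"
    and "x \<in> pts (At T a) m ==> k \<in> pts (Rlz S K) m ==>
      evl (Rlz S K) (At X a) m (adj (Rlz S K) p T a m x) k = el p a m (Pair x k)"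
    and "\<theta> \<in> operators l m ==> x \<in> pts (At T a) m ==> k \<in> pts (Rlz S K) l ==>
      evl (Rlz S K) (At X a) l (rst (Exp (Rlz S K) (At X a)) m \<theta> (adj (Rlz S K) p T a m x)) k =
      el p a l (Pair (rst (At T a) m \<theta> x) k)"
proof -
  note c = nat_components[OF p]
  have "hm (Prod S (At T a) (Rlz S K)) (At X a) (el p a)"
    using el_hm[OF p a] by (simp add: tensor(2)[OF T K a])
  then have hm: "hm (Prod S (At T a) (Rlz S K)) (At X a) (\<lambda>m q. el p a m (Pair (pfst q) (psnd q)))"
    by (rule hm_cong[THEN iffD1, rotated]) auto
  note l = lam[OF at_obj[OF T a] K at_obj[OF c(2) a] hm]
  show "hm (At T a) (Exp (Rlz S K) (At X a)) (adj (Rlz S K) p T a)" using l(1) by (simp add: adj_def c)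
  show "x \<in> pts (At T a) m ==> adj (Rlz S K) p T a m x \<in> pts (Exp (Rlz S K) (At X a)) m"
    using l(2) by (simp add: adj_def c)
  show "x \<in> pts (At T a) m ==> k \<in> pts (Rlz S K) m ==>
      evl (Rlz S K) (At X a) m (adj (Rlz S K) p T a m x) k = el p a m (Pair x k)"
    using l(3) by (simp add: adj_def c)
  show "\<theta> \<in> operators l m ==> x \<in> pts (At T a) m ==> k \<in> pts (Rlz S K) l ==>
      evl (Rlz S K) (At X a) l (rst (Exp (Rlz S K) (At X a)) m \<theta> (adj (Rlz S K) p T a m x)) k =
      el p a l (Pair (rst (At T a) m \<theta> x) k)"
    using l(4) by (simp add: adj_def c)
qed

lemma adj_act:
  assumes ab: "a \<in> Ob D" "b \<in> Ob D" and e: "e \<in> pts (EHom D a b) m" and x: "x \<in> pts (At T a) m"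
  shows "adj (Rlz S K) p T b m (act T a b m e x) = act (Cot (Rlz S K) X) a b m e (adj (Rlz S K) p T a m x)"
proof -
  let ?B = "Rlz S K"
  note X = nat_components(2)[OF p]
  note pa = adj[OF ab(1)] and pb = adj[OF ab(2)]
  show ?thesis
  proof (rule exp_eqI[OF K at_obj[OF X ab(2)]])
    show "adj ?B p T b m (act T a b m e x) \<in> pts (Exp ?B (At X b)) m"
      by (rule pb(2)[OF act_pts[OF T ab e x]])
    show "act (Cot ?B X) a b m e (adj ?B p T a m x) \<in> pts (Exp ?B (At X b)) m"
      by (rule cot_act_pts[OF K X ab e pa(2)[OF x]])
    fix l \<theta> k assume \<theta>: "\<theta> \<in> operators l m" and k: "k \<in> pts ?B l"
    have re: "rst (EHom D a b) m \<theta> e \<in> pts (EHom D a b) l" using ab e \<theta> by simp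
    have rx: "rst (At T a) m \<theta> x \<in> pts (At T a) l" using at_obj[OF T ab(1)] x \<theta> by simp
    have rp: "rst (Exp ?B (At X a)) m \<theta> (adj ?B p T a m x) \<in> pts (Exp ?B (At X a)) l"
      using cot_obj[OF K X ab(1)] pa(2)[OF x] \<theta> by simp
    have "Pair (rst (At T a) m \<theta> x) k \<in> pts (At (tensor S D T K) a) l"
      using rx k by (simp add: tensor(2)[OF T K ab(1)])
    note ea = el_act[OF p ab re this]
    show "evl ?B (At X b) l (rst (Exp ?B (At X b)) m \<theta> (adj ?B p T b m (act T a b m e x))) k =
        evl ?B (At X b) l (rst (Exp ?B (At X b)) m \<theta> (act (Cot ?B X) a b m e (adj ?B p T a m x))) k"
      using pb(4)[OF \<theta> act_pts[OF T ab e x] k] act_rst[OF T ab \<theta> e x] tensor(3)[OF T K ab re rx k] ea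
        cot_act_rst[OF K X ab e pa(2)[OF x] \<theta>] cot_act_evl[OF K X ab re rp k] pa(4)[OF \<theta> x k] by simp
  qed
qed

end

text \<open>
  The transposes of the two maps of a square form a map from \<open>T\<close> to the diagram of squares.  As \<open>T\<close> is an orbit, it
  lands in the component of the image of any vertex of \<open>T\<close>, and evaluation there gives back the square.
\<close>

lemma factorization:
  assumes M: "M \<subseteq> N" and f: "f \<in> Mor \<D>"
  shows "factorization_property (MapCat \<D>) {tensor_map S D T (\<iota> \<nu>) | T \<nu>. orbit S D T \<and> \<nu> \<in> M} f
    (evaluation f ` labels M f)"
  unfolding factorization_property_def
proof (intro ballI)
  fix i \<psi> assume "i \<in> {tensor_map S D T (\<iota> \<nu>) | T \<nu>. orbit S D T \<and> \<nu> \<in> M}" and \<psi>: "\<psi> \<in> Hom (MapCat \<D>) i f"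
  then obtain T \<nu> where i: "i = tensor_map S D T (\<iota> \<nu>)" and T: "orbit S D T" and \<nu>: "\<nu> \<in> M" by blast
  have \<nu>N: "\<nu> \<in> N" using \<nu> M by blast
  note TF = orbit_functor[OF T] and R = rlz_obj[OF \<nu>N] and fh = mor_hom[OF f]
  note F = nat_components(1,2)[OF fh]
  note tm = tensor_map[OF TF rlz_hom[OF \<nu>N]]
  define p where "p = fst (Fn \<psi>)"
  define b where "b = snd (Fn \<psi>)"
  have \<psi>': "\<psi> = Arrow i (p, b) f" "\<psi> \<in> Mor (MapCat \<D>)"
    using \<psi> by (auto simp: Hom_def p_def b_def)
  note mm = mapcat_mor[OF \<psi>'(2)]
  have ph: "p \<in> Hom \<D> (tensor S D T (Dom (\<iota> \<nu>))) (Dom f)" and bh: "b \<in> Hom \<D> (tensor S D T (Cod (\<iota> \<nu>))) (Cod f)"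
    and sq: "f \<odot> p = b \<odot> i"
    using mm(3-5) tm(1) by (auto simp: \<psi>'(1) i Hom_def)
  note ap = adj[OF TF R(1) ph] and ab = adj[OF TF R(2) bh]
  note Sq = Squares[OF \<nu>N fh]
  let ?\<phi> = "\<lambda>a m x. Pair (Simplex \<nu>) (Pair (adj (RK \<nu>) p T a m x) (adj (RL \<nu>) b T a m x))"
  have comp: "?\<phi> a m x \<in> compatible \<nu> f a m" if a: "a \<in> Ob D" and x: "x \<in> pts (At T a) m" for a m x
    unfolding compatible_iff[OF \<nu>N fh]
  proof (intro conjI allI ballI)
    show "adj (RK \<nu>) p T a m x \<in> pts (Exp (RK \<nu>) (At (Dom f) a)) m" by (rule ap(2)[OF a x])
    show "adj (RL \<nu>) b T a m x \<in> pts (Exp (RL \<nu>) (At (Cod f) a)) m" by (rule ab(2)[OF a x])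
    fix l \<theta> k assume \<theta>: "\<theta> \<in> operators l m" and k: "k \<in> pts (RK \<nu>) l"
    have rx: "rst (At T a) m \<theta> x \<in> pts (At T a) l" using at_obj[OF TF a] x \<theta> by simp
    have px: "Pair (rst (At T a) m \<theta> x) k \<in> pts (At (tensor S D T (Dom (\<iota> \<nu>))) a) l"
      using rx k by (simp add: tensor(2)[OF TF R(1) a])
    show "el f a l (evl (RK \<nu>) (At (Dom f) a) l (rst (Exp (RK \<nu>) (At (Dom f) a)) m \<theta> (adj (RK \<nu>) p T a m x)) k) =
        evl (RL \<nu>) (At (Cod f) a) l (rst (Exp (RL \<nu>) (At (Cod f) a)) m \<theta> (adj (RL \<nu>) b T a m x)) (inc \<nu> l k)"
      using arg_cong[OF sq, of "\<lambda>h. el h a l (Pair (rst (At T a) m \<theta> x) k)"] tm(2)[OF a rx k]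
        el_cmp(1)[OF ph fh a px] el_cmp(1)[OF tm(1) bh a px]
      by (simp add: ap(4)[OF a \<theta> x k] ab(4)[OF a \<theta> x inc_pts[OF \<nu>N k]] i)
  qed simp
  have hm: "hm (At T a) (At (Squares \<nu> f) a) (?\<phi> a)" if a: "a \<in> Ob D" for a
    by (rule Squares_lift[OF \<nu>N fh a ap(1)[OF a] ab(1)[OF a] comp[OF a]])
  have nat: "?\<phi> b' m (act T a b' m e x) = act (Squares \<nu> f) a b' m e (?\<phi> a m x)"
    if ab': "a \<in> Ob D" "b' \<in> Ob D" and e: "e \<in> pts (EHom D a b') m" and x: "x \<in> pts (At T a) m" for a b' m e x
    using adj_act[OF TF R(1) ph ab' e x] adj_act[OF TF R(2) bh ab' e x]
    by (simp add: Sq(3)[OF ab' e comp[OF ab'(1) x]])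
  define \<xi> where "\<xi> = mknat T (Squares \<nu> f) ?\<phi>"
  note n = mknat[OF TF Sq(1), of ?\<phi>, OF hm nat]
  have \<xi>_hom: "\<xi> \<in> Hom \<D> T (Squares \<nu> f)" unfolding \<xi>_def by (rule n(1))
  have \<xi>_el: "el \<xi> a m x = ?\<phi> a m x" if "a \<in> Ob D" "x \<in> pts (At T a) m" for a m x
    unfolding \<xi>_def by (rule n(2)) (use that in auto)
  note \<xi> = \<xi>_hom \<xi>_el
  have conn: "connected_diagram T" by (rule orbit_connected[OF T])
  then obtain a0 t0 where t0: "a0 \<in> Ob D" "t0 \<in> pts (At T a0) 0" unfolding connected_diagram_def by blast
  let ?C = "component (Squares \<nu> f) a0 (el \<xi> a0 0 t0)"
  have l: "(\<nu>, ?C) \<in> labels M f"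
    using \<nu> t0 \<xi>(2)[OF t0] comp[OF t0] unfolding labels_def by auto
  note L = label_facts[OF M f l, unfolded fst_conv snd_conv] and pc = piece[OF M f l, unfolded fst_conv snd_conv]
  have img: "el \<xi> a m x \<in> ?C a m" if a: "a \<in> Ob D" and x: "x \<in> pts (At T a) m" for a m x
  proof -
    have "((a0, vtx T a0 t0 m), (a, x)) \<in> conn T m"
      using conn t0(1) a x vtx_pts[OF TF t0] unfolding connected_diagram_def by blast
    from conn_el[OF \<xi>(1) this] show ?thesis using a vtx_el[OF \<xi>(1) t0] by (simp add: component_def)
  qed
  define \<xi>' where "\<xi>' = mknat T (piece f (\<nu>, ?C)) (el \<xi>)"
  note n' = subdiag_lift[OF Sq(1) L(3) \<xi>(1) img]
  have \<xi>'_hom: "\<xi>' \<in> Hom \<D> T (piece f (\<nu>, ?C))"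
    unfolding \<xi>'_def piece_def fst_conv snd_conv by (rule n'(1))
  have \<xi>'_el: "el \<xi>' a m x = el \<xi> a m x" if "a \<in> Ob D" "x \<in> pts (At T a) m" for a m x
    unfolding \<xi>'_def piece_def fst_conv snd_conv by (rule n'(2)) (use that in auto)
  note \<xi>' = \<xi>'_hom \<xi>'_el
  note k = tmap[OF \<xi>'(1) R(1)] and j = tmap[OF \<xi>'(1) R(2)]
  note top = top_map[OF M f l, unfolded fst_conv snd_conv] and bot = bottom_map[OF M f l, unfolded fst_conv snd_conv]
  let ?h = "Arrow i (tmap \<xi>' (Dom (\<iota> \<nu>)), tmap \<xi>' (Cod (\<iota> \<nu>))) (tensor_map S D (piece f (\<nu>, ?C)) (\<iota> \<nu>))"
  have "top_map f (\<nu>, ?C) \<odot> tmap \<xi>' (Dom (\<iota> \<nu>)) = p"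
  proof (rule tensor_eqI[OF TF R(1) el_cmp(2)[OF k(1) top(1)] ph])
    fix a m x c assume a: "a \<in> Ob D" and x: "x \<in> pts (At T a) m" and c: "c \<in> pts (RK \<nu>) m"
    have px: "Pair x c \<in> pts (At (tensor S D T (Dom (\<iota> \<nu>))) a) m" using x c by (simp add: tensor(2)[OF TF R(1) a])
    show "el (top_map f (\<nu>, ?C) \<odot> tmap \<xi>' (Dom (\<iota> \<nu>))) a m (Pair x c) = el p a m (Pair x c)"
      using top(2)[OF a img[OF a x, unfolded \<xi>(2)[OF a x]] c]
      by (simp add: el_cmp(1)[OF k(1) top(1) a px] k(2)[OF a x c] \<xi>'(2)[OF a x] \<xi>(2)[OF a x] ap(3)[OF a x c])
  qed
  moreover have "bottom_map f (\<nu>, ?C) \<odot> tmap \<xi>' (Cod (\<iota> \<nu>)) = b"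
  proof (rule tensor_eqI[OF TF R(2) el_cmp(2)[OF j(1) bot(1)] bh])
    fix a m x c assume a: "a \<in> Ob D" and x: "x \<in> pts (At T a) m" and c: "c \<in> pts (RL \<nu>) m"
    have px: "Pair x c \<in> pts (At (tensor S D T (Cod (\<iota> \<nu>))) a) m" using x c by (simp add: tensor(2)[OF TF R(2) a])
    show "el (bottom_map f (\<nu>, ?C) \<odot> tmap \<xi>' (Cod (\<iota> \<nu>))) a m (Pair x c) = el b a m (Pair x c)"
      using bot(2)[OF a img[OF a x, unfolded \<xi>(2)[OF a x]] c]
      by (simp add: el_cmp(1)[OF j(1) bot(1) a px] j(2)[OF a x c] \<xi>'(2)[OF a x] \<xi>(2)[OF a x] ab(3)[OF a x c])
  qed
  ultimately have "\<psi> = evaluation f (\<nu>, ?C) \<cdot>\<^bsub>MapCat \<D>\<^esub> ?h"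
    by (simp add: \<psi>'(1) evaluation_def MapCat_def)
  moreover have "?h \<in> Hom (MapCat \<D>) i (Dom (evaluation f (\<nu>, ?C)))"
    using tmap_tensor_map[OF \<xi>'(1) \<nu>N] by (simp add: i evaluation_def)
  ultimately show "\<exists>\<phi> \<in> evaluation f ` labels M f. \<exists>h \<in> Hom (MapCat \<D>) i (Dom \<phi>). \<psi> = \<phi> \<cdot>\<^bsub>MapCat \<D>\<^esub> h"
    using l by blast
qed

text \<open>
  The smallness cardinal bounds the number of points of the objects \<open>RK \<nu>\<close>; it is uniform in the orbit.
\<close>

theorem instrumented_tensor_maps:
  assumes M: "M \<subseteq> N"
  shows "instrumented TYPE('u) \<D> {tensor_map S D T (\<iota> \<nu>) | T \<nu>. orbit S D T \<and> \<nu> \<in> M}"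
proof -
  let ?I = "{tensor_map S D T (\<iota> \<nu>) | T \<nu>. orbit S D T \<and> \<nu> \<in> M}"
  have obj: "Obj (MapCat \<D>) = Mor \<D>" by (simp add: MapCat_def)
  have I: "?I \<subseteq> Mor \<D>"
  proof
    fix i assume "i \<in> ?I"
    then obtain T \<nu> where "i = tensor_map S D T (\<iota> \<nu>)" "orbit S D T" "\<nu> \<in> N" using M by blast
    then show "i \<in> Mor \<D>" using tensor_map(1)[OF orbit_functor rlz_hom] by (auto simp: Hom_def)
  qed
  have "locally_small TYPE('u) (MapCat \<D>) ?I \<and> (\<exists>Fo Fm. factorization_setup TYPE('u) (MapCat \<D>) ?I Fo Fm)"
  proof (rule factorization_setup_from_labels[where L = "labels M" and \<phi> = evaluation
        and lm = push_label and hm = push_square])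
    show "?I \<subseteq> Obj (MapCat \<D>)" using I obj by simp
    fix g assume g: "g \<in> Mor (MapCat \<D>)"
    show "Dom g \<in> Obj (MapCat \<D>) \<and> Cod g \<in> Obj (MapCat \<D>)" using mapcat_mor[OF g] obj by simp
    fix l assume l: "l \<in> labels M (Dom g)"
    show "push_label g l \<in> labels M (Cod g)" by (rule push_label(1)[OF M g l])
    show "push_square g l \<in> Hom (MapCat \<D>) (Dom (evaluation (Dom g) l)) (Dom (evaluation (Cod g) (push_label g l)))"
      by (rule push_square_hom[OF M g l])
    show "evaluation (Cod g) (push_label g l) \<cdot>\<^bsub>MapCat \<D>\<^esub> push_square g l = g \<cdot>\<^bsub>MapCat \<D>\<^esub> evaluation (Dom g) l"
      by (rule push_square_comm[OF M g l])
  next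
    fix f g assume "f \<in> Mor (MapCat \<D>)" "g \<in> Mor (MapCat \<D>)" "Cod f = Dom g"
    note fg = this
    show "g \<cdot>\<^bsub>MapCat \<D>\<^esub> f \<in> Hom (MapCat \<D>) (Dom f) (Cod g)" using mapcat_cmp[OF fg] by (simp add: Hom_def)
    fix l assume l: "l \<in> labels M (Dom f)"
    show "push_label (g \<cdot>\<^bsub>MapCat \<D>\<^esub> f) l = push_label g (push_label f l)" by (rule push_label_cmp[OF M fg l])
    show "push_square (g \<cdot>\<^bsub>MapCat \<D>\<^esub> f) l = push_square g (push_label f l) \<cdot>\<^bsub>MapCat \<D>\<^esub> push_square f l"
      by (rule push_square_cmp[OF M fg l])
  next
    fix f assume "f \<in> Obj (MapCat \<D>)"
    then have f: "f \<in> Mor \<D>" using obj by simp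
    show "Ident (MapCat \<D>) f \<in> Hom (MapCat \<D>) f f" using mapcat_ident[OF f] by (simp add: Hom_def)
    show "inj_on (evaluation f) (labels M f)" by (rule evaluation_inj[OF M f])
    show "small TYPE('u) (labels M f)" by (rule labels_small[OF M f])
    show "factorization_property (MapCat \<D>) ?I f (evaluation f ` labels M f)" by (rule factorization[OF M f])
    fix l assume l: "l \<in> labels M f"
    note L = label_facts[OF M f l]
    show "evaluation f l \<in> arrows_into (MapCat \<D>) ?I f"
      using evaluation_mor[OF M f l] L(2,4) by (auto simp: arrows_into_def evaluation_def)
    show "push_label (Ident (MapCat \<D>) f) l = l" by (rule push_label_ident[OF M f l])
    show "push_square (Ident (MapCat \<D>) f) l = Ident (MapCat \<D>) (Dom (evaluation f l))"
      by (rule push_square_ident[OF M f l])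
  qed
  moreover have "\<exists>\<kappa> :: 'u rel. Card_order \<kappa> \<and> \<kappa> <o |UNIV :: 'u set| \<and>
      (\<forall>i \<in> ?I. small_relative TYPE('u) \<D> \<kappa> (cell TYPE('u) \<D> ?I) (Dom i))"
  proof -
    let ?P = "UNIV :: (nat \<times> nat list \<times> (nat => real)) set"
    have P: "small TYPE('u) ?P" by (rule small_simplex_points[OF inaccessible])
    obtain c :: "nat \<times> nat list \<times> (nat => real) => 'u" where c: "inj_on c ?P" using small_embedding[OF P] .
    let ?\<kappa> = "|c ` ?P|"
    have bound: "|?P| \<le>o ?\<kappa>" using c card_of_ordLeq by blast
    have good: "good i" if "i \<in> ?I" for i
      using that M tensor_map_good orbit_functor by blast
    have "small_relative TYPE('u) \<D> ?\<kappa> (cell TYPE('u) \<D> ?I) (Dom i)" if iI: "i \<in> ?I" for i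
    proof -
      obtain T \<nu> where T: "i = tensor_map S D T (\<iota> \<nu>)" "orbit S D T" "\<nu> \<in> N" using iI M by blast
      have i: "Dom i = tensor S D T (Dom (\<iota> \<nu>))"
        using tensor_map(1)[OF orbit_functor[OF T(2)] rlz_hom[OF T(3)]] by (simp add: T(1) Hom_def)
      show ?thesis unfolding i by (rule tensor_small_relative[OF T(2,3) bound good])
    qed
    moreover have "?\<kappa> <o |UNIV :: 'u set|" using small_image[OF P, of c] by (simp add: small_def)
    ultimately show ?thesis using card_of_Card_order by blast
  qed
  ultimately show ?thesis unfolding instrumented_def by blast
qed

end


section \<open>The generating inclusions\<close>

text \<open>
  Boundaries and horns are subcomplexes of the simplex determined by the possible vertex sets.
\<close>

definition inclusions :: "nat list set" where
  "inclusions = {[n] | n. True} \<union> {[n, k] | n k. k \<le> n \<and> 1 \<le> n}"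

definition generator :: "nat list => (nat list sset, nat => nat list => nat list) arrow" where
  "generator \<nu> = inclusion (if length \<nu> = 1 then boundary (\<nu> ! 0) else horn (\<nu> ! 0) (\<nu> ! 1)) (Delta (\<nu> ! 0))"

lemma generator_cases:
  assumes "\<nu> \<in> inclusions"
  obtains n Q where "generator \<nu> = inclusion (subsimplex n (\<lambda>\<sigma>. Q (set \<sigma>))) (Delta n)"
    "\<And>A B. A \<subseteq> B ==> Q B ==> Q A"
proof -
  have "\<exists>n Q. generator \<nu> = inclusion (subsimplex n (\<lambda>\<sigma>. Q (set \<sigma>))) (Delta n) \<and>
      (\<forall>A B. A \<subseteq> B \<longrightarrow> Q B \<longrightarrow> Q A)"
    using assms unfolding inclusions_def
  proof
    assume "\<nu> \<in> {[n] | n. True}"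
    then obtain n where "\<nu> = [n]" by blast
    then show ?thesis
      by (intro exI[of _ n] exI[of _ "\<lambda>A. \<exists>i\<le>n. i \<notin> A"]) (auto simp: generator_def boundary_def)
  next
    assume "\<nu> \<in> {[n, k] | n k. k \<le> n \<and> 1 \<le> n}"
    then obtain n k where "\<nu> = [n, k]" by blast
    then show ?thesis
      by (intro exI[of _ n] exI[of _ "\<lambda>A. \<exists>i\<le>n. i \<noteq> k \<and> i \<notin> A"]) (auto simp: generator_def horn_def)
  qed
  then show ?thesis using that by blast
qed

lemma operator_comp_assoc: "\<tau> \<in> operators k l ==> \<rho> \<in> operators l m ==>
    map ((!) (map f \<rho>)) \<tau> = map f (map ((!) \<rho>) \<tau>)"
  by (auto simp: operators_def)

lemma operator_id: "[0..<Suc m] \<in> operators m m"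
  by (auto simp: operators_def simp del: upt_Suc)

lemma operator_id_left: "\<theta> \<in> operators l m ==> map ((!) [0..<Suc m]) \<theta> = \<theta>"
  by (rule map_idI) (auto simp: operators_def less_Suc_eq_le simp del: upt_Suc)

lemma operator_id_right: "\<theta> \<in> operators l m ==> map ((!) \<theta>) [0..<Suc l] = \<theta>"
  using map_nth[of \<theta>] by (simp add: operators_def)

lemma operators_0: "operators m 0 = {replicate (Suc m) 0}"
proof -
  have "\<theta> = replicate (Suc m) 0" if "\<theta> \<in> operators m 0" for \<theta>
    using that by (intro replicate_eqI) (auto simp: operators_def)
  then show ?thesis by (auto simp: operators_def)
qed

lemma operators_length: "\<theta> \<in> operators l m ==> length \<theta> = Suc l"
  by (simp add: operators_def)

lemma simplicial_setD:
  assumes "simplicial_set X"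
  shows "\<theta> \<in> operators m n ==> x \<in> Smp X n ==> Op X n \<theta> x \<in> Smp X m"
    and "x \<in> Smp X n ==> Op X n [0..<Suc n] x = x"
    and "\<phi> \<in> operators l m ==> \<theta> \<in> operators m n ==> x \<in> Smp X n ==>
        Op X m \<phi> (Op X n \<theta> x) = Op X n (map ((!) \<theta>) \<phi>) x"
  using assms unfolding simplicial_set_def by blast+

lemma simplicial_setI:
  assumes "\<And>m n \<theta> x. \<theta> \<in> operators m n ==> x \<in> Smp X n ==> Op X n \<theta> x \<in> Smp X m"
    and "\<And>n x. x \<in> Smp X n ==> Op X n [0..<Suc n] x = x"
    and "\<And>l m n \<phi> \<theta> x. \<phi> \<in> operators l m ==> \<theta> \<in> operators m n ==> x \<in> Smp X n ==>
        Op X m \<phi> (Op X n \<theta> x) = Op X n (map ((!) \<theta>) \<phi>) x"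
    and "\<And>n \<theta> x. \<not> ((\<exists>m. \<theta> \<in> operators m n) \<and> x \<in> Smp X n) ==> Op X n \<theta> x = undefined"
  shows "simplicial_set X"
  unfolding simplicial_set_def
  by (intro conjI allI ballI impI) (rule assms; assumption)+

lemma subsimplex_simplicial:
  assumes Q: "\<And>A B. A \<subseteq> B ==> Q B ==> Q A"
  shows "simplicial_set (subsimplex n (\<lambda>\<sigma>. Q (set \<sigma>)))"
proof -
  have sub: "Q (set (map ((!) \<sigma>) \<theta>))" if "\<theta> \<in> operators l m" "\<sigma> \<in> operators m n" "Q (set \<sigma>)" for \<theta> \<sigma> l m
    by (rule Q[OF _ that(3)]) (use that(1,2) in \<open>auto simp: operators_def\<close>)
  show ?thesis
  proof (rule simplicial_setI)
    fix m k \<theta> \<sigma> assume *: "\<theta> \<in> operators m k" "\<sigma> \<in> Smp (subsimplex n (\<lambda>\<sigma>. Q (set \<sigma>))) k"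
    then show "Op (subsimplex n (\<lambda>\<sigma>. Q (set \<sigma>))) k \<theta> \<sigma> \<in> Smp (subsimplex n (\<lambda>\<sigma>. Q (set \<sigma>))) m"
      using operator_comp sub by (auto simp: subsimplex_def)
  next
    fix k \<sigma> assume "\<sigma> \<in> Smp (subsimplex n (\<lambda>\<sigma>. Q (set \<sigma>))) k"
    then show "Op (subsimplex n (\<lambda>\<sigma>. Q (set \<sigma>))) k [0..<Suc k] \<sigma> = \<sigma>"
      using operator_id[of k] operator_id_right[of \<sigma> k n] by (auto simp: subsimplex_def simp del: upt_Suc)
  next
    fix k l m \<phi> \<theta> \<sigma> assume *: "\<phi> \<in> operators l m" "\<theta> \<in> operators m k" "\<sigma> \<in> Smp (subsimplex n (\<lambda>\<sigma>. Q (set \<sigma>))) k"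
    then have "map ((!) \<sigma>) \<theta> \<in> operators m n" "Q (set (map ((!) \<sigma>) \<theta>))" "map ((!) \<theta>) \<phi> \<in> operators l k"
      using operator_comp sub by (auto simp: subsimplex_def)
    then show "Op (subsimplex n (\<lambda>\<sigma>. Q (set \<sigma>))) m \<phi> (Op (subsimplex n (\<lambda>\<sigma>. Q (set \<sigma>))) k \<theta> \<sigma>) =
        Op (subsimplex n (\<lambda>\<sigma>. Q (set \<sigma>))) k (map ((!) \<theta>) \<phi>) \<sigma>"
      using * operator_comp_assoc[OF *(1,2)] by (auto simp: subsimplex_def)
  qed (auto simp: subsimplex_def)
qed

lemma Delta_simplicial: "simplicial_set (Delta n)"
  using subsimplex_simplicial[of "\<lambda>_. True" n] by (simp add: Delta_def)


section \<open>Simplicial sets\<close>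

context concrete_spaces
begin

lemma extends_classifier:
  assumes classify: "\<And>X P. X \<in> Obj S ==> P \<subseteq> pts X m ==>
        \<exists>\<phi>. hm X Z \<phi> \<and> (\<forall>x \<in> pts X m. t (\<phi> m x) \<longleftrightarrow> x \<in> P)"
    and unique: "\<And>X \<phi> \<psi> x l. hm X Z \<phi> ==> hm X Z \<psi> ==>
        (\<And>x. x \<in> pts X m ==> t (\<phi> m x) \<longleftrightarrow> t (\<psi> m x)) ==> x \<in> pts X l ==> \<phi> l x = \<psi> l x"
    and f: "f \<in> Mor S" and inj: "inj_on (ap f m) (pts (Dom f) m)"
  shows "extends S Z f"
  unfolding extends_def
proof
  fix v assume v: "v \<in> Hom S (Dom f) Z"
  let ?P = "ap f m ` {x \<in> pts (Dom f) m. t (ap v m x)}"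
  have "?P \<subseteq> pts (Cod f) m" using ap_pts[OF f] by blast
  then obtain \<phi> where \<phi>: "hm (Cod f) Z \<phi>" "\<And>y. y \<in> pts (Cod f) m ==> t (\<phi> m y) \<longleftrightarrow> y \<in> ?P"
    using classify[of "Cod f" ?P] mor_obj_S[OF f] by blast
  let ?w = "mk (Cod f) Z \<phi>"
  have ff: "f \<in> Hom S (Dom f) (Cod f)" using f by (simp add: Hom_def)
  note c = hm_comp[OF hm_ap[OF ff] \<phi>(1)]
  have t: "t (\<phi> m (ap f m x)) \<longleftrightarrow> t (ap v m x)" if x: "x \<in> pts (Dom f) m" for x
    using \<phi>(2)[OF ap_pts[OF f x]] inj x by (auto simp: inj_on_def)
  have "\<phi> l (ap f l x) = ap v l x" if "x \<in> pts (Dom f) l" for l x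
    using unique[OF c hm_ap[OF v]] t that by blast
  then have "?w \<cdot>\<^bsub>S\<^esub> f = v"
    using v f ap_pts[OF f] by (intro ap_ext) (auto simp: mk_hm[OF \<phi>(1)] Hom_def)
  then show "\<exists>w \<in> Hom S (Cod f) Z. w \<cdot>\<^bsub>S\<^esub> f = v" using mk_hm(1)[OF \<phi>(1)] by blast
qed

end

locale inaccessible_universe =
  fixes dummy :: "'u itself"
  assumes inaccessible_u: "inaccessible TYPE('u)"
begin

abbreviation SS :: "('u element sset, nat => 'u element => 'u element) spaces" where
  "SS \<equiv> SSet"

lemma small_countable_UNIV [simp]: "small TYPE('u) (UNIV :: 'c :: countable set)"
  by (rule small_countable[OF inaccessible_u]) simp

lemma sset_obj: "X \<in> Obj SS \<longleftrightarrow> simplicial_set X \<and> (\<forall>n. small TYPE('u) (Smp X n))"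
  by (simp add: SSet_def)

lemma sset_mor: "f \<in> Mor SS \<longleftrightarrow> Dom f \<in> Obj SS \<and> Cod f \<in> Obj SS \<and>
    (\<forall>n. Fn f n \<in> extensional (Smp (Dom f) n) \<and> Fn f n ` Smp (Dom f) n \<subseteq> Smp (Cod f) n) \<and>
    (\<forall>m n. \<forall>\<theta> \<in> operators m n. \<forall>x \<in> Smp (Dom f) n. Fn f m (Op (Dom f) n \<theta> x) = Op (Cod f) n \<theta> (Fn f n x))"
  by (cases f) (auto simp: SSet_def sset_maps_def)

lemma sset_Arrow_mor:
  assumes "X \<in> Obj SS" "Y \<in> Obj SS"
    and "\<And>n x. x \<in> Smp X n ==> \<phi> n x \<in> Smp Y n"
    and "\<And>m n \<theta> x. \<theta> \<in> operators m n ==> x \<in> Smp X n ==> \<phi> m (Op X n \<theta> x) = Op Y n \<theta> (\<phi> n x)"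
  shows "Arrow X (\<lambda>n. \<lambda>x\<in>Smp X n. \<phi> n x) Y \<in> Mor SS"
proof -
  have "Op X n \<theta> x \<in> Smp X m" if "\<theta> \<in> operators m n" "x \<in> Smp X n" for m n \<theta> x
    using simplicial_setD(1)[OF _ that] assms(1) by (simp add: sset_obj)
  then show ?thesis
    using assms by (simp add: sset_mor image_subset_iff)
qed

lemma sset_product_obj:
  assumes X: "X \<in> Obj SS" and Y: "Y \<in> Obj SS"
  shows "sset_product X Y \<in> Obj SS"
  unfolding sset_obj
proof (intro conjI allI)
  note x = simplicial_setD[OF conjunct1[OF X[unfolded sset_obj]]]
  note y = simplicial_setD[OF conjunct1[OF Y[unfolded sset_obj]]]
  show "simplicial_set (sset_product X Y)"
  proof (rule simplicial_setI)
    fix m n \<theta> p assume "\<theta> \<in> operators m n" "p \<in> Smp (sset_product X Y) n"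
    then show "Op (sset_product X Y) n \<theta> p \<in> Smp (sset_product X Y) m"
      using x(1) y(1) by (auto simp: sset_product_def)
  next
    fix n p assume "p \<in> Smp (sset_product X Y) n"
    then show "Op (sset_product X Y) n [0..<Suc n] p = p"
      using x(2) y(2) operator_id[of n] by (auto simp: sset_product_def simp del: upt_Suc)
  next
    fix l m n \<phi> \<theta> p assume *: "\<phi> \<in> operators l m" "\<theta> \<in> operators m n" "p \<in> Smp (sset_product X Y) n"
    then show "Op (sset_product X Y) m \<phi> (Op (sset_product X Y) n \<theta> p) = Op (sset_product X Y) n (map ((!) \<theta>) \<phi>) p"
      using x(1,3) y(1,3) operator_comp[OF *(1,2)] by (auto simp: sset_product_def)
  qed (auto simp: sset_product_def)
  fix n
  have "Smp (sset_product X Y) n = (\<lambda>(x, y). Pair x y) ` (Smp X n \<times> Smp Y n)"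
    by (auto simp: sset_product_def)
  then show "small TYPE('u) (Smp (sset_product X Y) n)"
    using X Y by (auto simp: sset_obj intro!: small_image small_Times[OF inaccessible_u])
qed

lemma sset_embed_obj:
  assumes K: "simplicial_set K"
  shows "(sset_embed K :: 'u element sset) \<in> Obj SS"
  unfolding sset_obj
proof (intro conjI allI)
  note k = simplicial_setD[OF K]
  show "simplicial_set (sset_embed K :: 'u element sset)"
  proof (rule simplicial_setI)
    fix m n \<theta> and p :: "'u element" assume "\<theta> \<in> operators m n" "p \<in> Smp (sset_embed K) n"
    then show "Op (sset_embed K) n \<theta> p \<in> Smp (sset_embed K) m"
      using k(1) by (auto simp: sset_embed_def)
  next
    fix n and p :: "'u element" assume "p \<in> Smp (sset_embed K) n"
    then show "Op (sset_embed K) n [0..<Suc n] p = p"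
      using k(2) operator_id[of n] by (auto simp: sset_embed_def simp del: upt_Suc)
  next
    fix l m n \<phi> \<theta> and p :: "'u element"
    assume *: "\<phi> \<in> operators l m" "\<theta> \<in> operators m n" "p \<in> Smp (sset_embed K) n"
    then show "Op (sset_embed K) m \<phi> (Op (sset_embed K) n \<theta> p) = Op (sset_embed K) n (map ((!) \<theta>) \<phi>) p"
      using k(1,3) operator_comp[OF *(1,2)] by (auto simp: sset_embed_def)
  qed (auto simp: sset_embed_def)
  show "small TYPE('u) (Smp (sset_embed K :: 'u element sset) n)" for n
    by (auto simp: sset_embed_def intro!: small_image small_countable[OF inaccessible_u])
qed

sublocale sset: concrete_spaces SS Smp Op Fn
proof
  show "inaccessible TYPE('u)" by (rule inaccessible_u)
  fix X Y :: "'u element sset"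
  assume X: "X \<in> Obj SS"
  note x = simplicial_setD[OF conjunct1[OF X[unfolded sset_obj]]]
  show "\<theta> \<in> operators m n ==> a \<in> Smp X n ==> Op X n \<theta> a \<in> Smp X m" for \<theta> m n a by (rule x)
  show "a \<in> Smp X n ==> Op X n [0..<Suc n] a = a" for n a by (rule x)
  show "\<phi> \<in> operators l m ==> \<theta> \<in> operators m n ==> a \<in> Smp X n ==>
        Op X m \<phi> (Op X n \<theta> a) = Op X n (map ((!) \<theta>) \<phi>) a" for \<phi> \<theta> l m n a by (rule x)
  show "small TYPE('u) (Smp X m)" for m using X by (simp add: sset_obj)
  show "Ident SS X \<in> Mor SS"
    using X by (simp add: SSet_def) (auto simp: sset_maps_def intro: x)
  show "Bang SS X \<in> Mor SS"
  proof -
    have "Arrow X (\<lambda>n. \<lambda>x\<in>Smp X n. Simplex (replicate (Suc n) 0)) (sset_embed (Delta 0)) \<in> Mor SS"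
      by (rule sset_Arrow_mor[OF X sset_embed_obj[OF Delta_simplicial]])
        (auto simp: sset_embed_def Delta_def subsimplex_def operators_0 operator_comp
          sset_embed_def simp del: replicate_Suc dest: operator_comp[of _ _ _ "replicate (Suc _) 0" 0])
    then show ?thesis by (simp add: SSet_def)
  qed
  {
    assume Y: "Y \<in> Obj SS"
    show "Prod SS X Y \<in> Obj SS" using sset_product_obj[OF X Y] by (simp add: SSet_def)
    have "Arrow (sset_product X Y) (\<lambda>n. \<lambda>p\<in>Smp (sset_product X Y) n. pfst p) X \<in> Mor SS"
      by (rule sset_Arrow_mor[OF sset_product_obj[OF X Y] X]) (auto simp: sset_product_def)
    then show "Pr1 SS X Y \<in> Mor SS" by (simp add: SSet_def)
    have "Arrow (sset_product X Y) (\<lambda>n. \<lambda>p\<in>Smp (sset_product X Y) n. psnd p) Y \<in> Mor SS"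
      by (rule sset_Arrow_mor[OF sset_product_obj[OF X Y] Y]) (auto simp: sset_product_def)
    then show "Pr2 SS X Y \<in> Mor SS" by (simp add: SSet_def)
  }
  fix y assume y: "y \<in> Smp X 0"
  let ?\<phi> = "\<lambda>m (_ :: 'u element). Op X 0 (replicate (Suc m) 0) y"
  have r: "replicate (Suc m) 0 \<in> operators m 0" for m by (simp add: operators_0)
  have c: "map ((!) (replicate (Suc n) 0)) \<theta> = replicate (Suc m) (0 :: nat)" if "\<theta> \<in> operators m n" for \<theta> m n
    using operator_comp[OF that r] by (simp add: operators_0 del: replicate_Suc)
  have "Arrow (sset_embed (Delta 0)) (\<lambda>n. \<lambda>p\<in>Smp (sset_embed (Delta 0)) n. ?\<phi> n p) X \<in> Mor SS"
  proof (rule sset_Arrow_mor[OF sset_embed_obj[OF Delta_simplicial] X])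
    show "?\<phi> n p \<in> Smp X n" for n p using x(1)[OF r y] .
    show "?\<phi> m (Op (sset_embed (Delta 0)) n \<theta> p) = Op X n \<theta> (?\<phi> n p)" if "\<theta> \<in> operators m n" for m n \<theta> p
      using x(3)[OF that r y] c[OF that] by simp
  qed
  then show "\<exists>u \<in> Hom SS (One SS) X. \<forall>m. \<forall>s \<in> Smp (One SS) m. Fn u m s = Op X 0 (replicate (Suc m) 0) y"
    by (intro bexI[of _ "Arrow (sset_embed (Delta 0)) (\<lambda>n. \<lambda>p\<in>Smp (sset_embed (Delta 0)) n. ?\<phi> n p) X"])
      (auto simp: Hom_def SSet_def)
next
  fix f g :: "('u element sset, nat => 'u element => 'u element) arrow"
  assume f: "f \<in> Mor SS"
  show "Dom f \<in> Obj SS \<and> Cod f \<in> Obj SS" using f sset_mor by blast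
  show "x \<in> Smp (Dom f) m ==> Fn f m x \<in> Smp (Cod f) m" for x m using f sset_mor by blast
  show "\<theta> \<in> operators m n ==> x \<in> Smp (Dom f) n ==> Fn f m (Op (Dom f) n \<theta> x) = Op (Cod f) n \<theta> (Fn f n x)" for \<theta> m n x
    using f sset_mor by blast
  assume g: "g \<in> Mor SS"
  {
    assume "Dom f = Dom g" "Cod f = Cod g" "\<And>m x. x \<in> Smp (Dom f) m ==> Fn f m x = Fn g m x"
    moreover have "Fn f = Fn g"
    proof
      fix n show "Fn f n = Fn g n"
        by (rule extensionalityI[of _ "Smp (Dom f) n"]) (use f g calculation in \<open>auto simp: sset_mor\<close>)
    qed
    ultimately show "f = g" by (metis arrow.collapse)
  }
  {
    assume "Cod f = Dom g"
    then have "Arrow (Dom f) (\<lambda>n. \<lambda>x\<in>Smp (Dom f) n. Fn g n (Fn f n x)) (Cod g) \<in> Mor SS"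
      using f g by (intro sset_Arrow_mor) (auto simp: sset_mor image_subset_iff)
    then show "g \<cdot>\<^bsub>SS\<^esub> f \<in> Mor SS" by (simp add: SSet_def)
  }
  {
    assume "Dom f = Dom g"
    then have "Arrow (Dom f) (\<lambda>n. \<lambda>x\<in>Smp (Dom f) n. Pair (Fn f n x) (Fn g n x)) (sset_product (Cod f) (Cod g)) \<in> Mor SS"
      using f g sset_product_obj
      by (intro sset_Arrow_mor) (auto simp: sset_mor image_subset_iff sset_product_def)
    then show "Tuple SS f g \<in> Mor SS" by (simp add: SSet_def)
  }
next
  show "One SS \<in> Obj SS" using sset_embed_obj[OF Delta_simplicial] by (simp add: SSet_def)
  show "\<exists>s. Smp (One SS) m = {s}" for m
    by (simp add: SSet_def sset_embed_def Delta_def subsimplex_def operators_0)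
qed (auto simp: SSet_def sset_product_def)

end

context inaccessible_universe
begin

text \<open>
  A simplex of dimension \<open>m\<close> of the function complex is a map \<open>\<Delta>\<^sup>m \<times> B \<rightarrow> X\<close>, stored under a code
  from the universe.
\<close>

definition fun_simplices :: "'u element sset => 'u element sset => nat =>
    (nat => nat list => 'u element => 'u element) set" where
  "fun_simplices B X m = {\<phi>.
     (\<forall>l \<theta> b. if \<theta> \<in> operators l m \<and> b \<in> Smp B l then \<phi> l \<theta> b \<in> Smp X l else \<phi> l \<theta> b = undefined) \<and>
     (\<forall>l k. \<forall>\<theta> \<in> operators l m. \<forall>\<rho> \<in> operators k l. \<forall>b \<in> Smp B l.
        \<phi> k (map ((!) \<theta>) \<rho>) (Op B l \<rho> b) = Op X l \<rho> (\<phi> l \<theta> b))}"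

definition fun_code :: "'u element sset => 'u element sset => nat =>
    (nat => nat list => 'u element => 'u element) => 'u element" where
  "fun_code B X m \<phi> = Atom ((SOME c. inj_on c (fun_simplices B X m)) \<phi>)"

definition fun_decode where
  "fun_decode B X m = inv_into (fun_simplices B X m) (fun_code B X m)"

definition fun_pull :: "'u element sset => nat => nat list => (nat => nat list => 'u element => 'u element) =>
    nat => nat list => 'u element => 'u element" where
  "fun_pull B l \<theta> \<phi> k \<rho> b = (if \<rho> \<in> operators k l \<and> b \<in> Smp B k then \<phi> k (map ((!) \<theta>) \<rho>) b else undefined)"

definition sset_exp :: "'u element sset => 'u element sset => 'u element sset" where
  "sset_exp B X = \<lparr> Smp = (\<lambda>m. fun_code B X m ` fun_simplices B X m),
     Op = (\<lambda>m \<theta> w. if (\<exists>l. \<theta> \<in> operators l m) \<and> w \<in> fun_code B X m ` fun_simplices B X m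
       then fun_code B X (length \<theta> - 1) (fun_pull B (length \<theta> - 1) \<theta> (fun_decode B X m w)) else undefined) \<rparr>"

definition sset_eval :: "'u element sset => 'u element sset => nat => 'u element => 'u element => 'u element" where
  "sset_eval B X m w b = fun_decode B X m w m [0..<Suc m] b"

definition sset_sub :: "'u element sset => (nat => 'u element set) => 'u element sset" where
  "sset_sub X A = \<lparr> Smp = A,
     Op = (\<lambda>n \<theta> x. if (\<exists>m. \<theta> \<in> operators m n) \<and> x \<in> A n then Op X n \<theta> x else undefined) \<rparr>"

definition sset_tag :: "nat list => 'u element sset" where
  "sset_tag \<nu> = \<lparr> Smp = (\<lambda>n. {Simplex \<nu>}),
     Op = (\<lambda>n \<theta> x. if (\<exists>m. \<theta> \<in> operators m n) \<and> x = Simplex \<nu> then Simplex \<nu> else undefined) \<rparr>"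

definition code_set :: "nat list set => 'u element" where
  "code_set B = Point ((\<lambda>\<sigma>. (0, \<sigma>, \<lambda>_. 0)) ` B)"

definition decode_set :: "'u element => nat list set" where
  "decode_set w = {\<sigma>. (0, \<sigma>, \<lambda>_. 0) \<in> un_Point w}"

lemma decode_code [simp]: "decode_set (code_set B) = B"
  by (auto simp: code_set_def decode_set_def)

text \<open>
  The right adjoint of the functor of \<open>m\<close>-simplices, on a set with two elements: its \<open>k\<close>-simplices
  are the subsets of the set of operators from \<open>m\<close> to \<open>k\<close>.
\<close>

definition sset_classifier :: "nat => 'u element sset" where
  "sset_classifier m = \<lparr> Smp = (\<lambda>k. code_set ` Pow (operators m k)),
     Op = (\<lambda>k \<theta> w. if (\<exists>l. \<theta> \<in> operators l k) \<and> w \<in> code_set ` Pow (operators m k)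
       then code_set {\<sigma> \<in> operators m (length \<theta> - 1). map ((!) \<theta>) \<sigma> \<in> decode_set w} else undefined) \<rparr>"

definition sset_true :: "nat => 'u element => bool" where
  "sset_true m w \<longleftrightarrow> [0..<Suc m] \<in> decode_set w"

context
  fixes B X assumes B: "B \<in> Obj SS" and X: "X \<in> Obj SS"
begin

lemmas B_set = simplicial_setD[OF conjunct1[OF B[unfolded sset_obj]]]
lemma fun_simplicesD:
  assumes "\<phi> \<in> fun_simplices B X m"
  shows "\<theta> \<in> operators l m ==> b \<in> Smp B l ==> \<phi> l \<theta> b \<in> Smp X l"
    and "\<not> (\<theta> \<in> operators l m \<and> b \<in> Smp B l) ==> \<phi> l \<theta> b = undefined"
    and "\<theta> \<in> operators l m ==> \<rho> \<in> operators k l ==> b \<in> Smp B l ==>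
      \<phi> k (map ((!) \<theta>) \<rho>) (Op B l \<rho> b) = Op X l \<rho> (\<phi> l \<theta> b)"
proof -
  have 1: "\<forall>l \<theta> b. if \<theta> \<in> operators l m \<and> b \<in> Smp B l then \<phi> l \<theta> b \<in> Smp X l else \<phi> l \<theta> b = undefined"
    and 2: "\<forall>l k. \<forall>\<theta> \<in> operators l m. \<forall>\<rho> \<in> operators k l. \<forall>b \<in> Smp B l.
        \<phi> k (map ((!) \<theta>) \<rho>) (Op B l \<rho> b) = Op X l \<rho> (\<phi> l \<theta> b)"
    using assms unfolding fun_simplices_def by auto
  show "\<theta> \<in> operators l m ==> b \<in> Smp B l ==> \<phi> l \<theta> b \<in> Smp X l"
    "\<not> (\<theta> \<in> operators l m \<and> b \<in> Smp B l) ==> \<phi> l \<theta> b = undefined"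
    using 1[rule_format, of \<theta> l b] by (simp_all split: if_splits)
  show "\<theta> \<in> operators l m ==> \<rho> \<in> operators k l ==> b \<in> Smp B l ==>
      \<phi> k (map ((!) \<theta>) \<rho>) (Op B l \<rho> b) = Op X l \<rho> (\<phi> l \<theta> b)"
    using 2 by blast
qed

lemma fun_simplicesI:
  assumes "\<And>l \<theta> b. \<theta> \<in> operators l m ==> b \<in> Smp B l ==> \<phi> l \<theta> b \<in> Smp X l"
    and "\<And>l \<theta> b. \<not> (\<theta> \<in> operators l m \<and> b \<in> Smp B l) ==> \<phi> l \<theta> b = undefined"
    and "\<And>l k \<theta> \<rho> b. \<theta> \<in> operators l m ==> \<rho> \<in> operators k l ==> b \<in> Smp B l ==>
      \<phi> k (map ((!) \<theta>) \<rho>) (Op B l \<rho> b) = Op X l \<rho> (\<phi> l \<theta> b)"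
  shows "\<phi> \<in> fun_simplices B X m"
  unfolding fun_simplices_def using assms by simp

text \<open>
  A simplex of the function complex is a function on a small set of triples with small codomain.
\<close>

lemma small_fun_simplices: "small TYPE('u) (fun_simplices B X m)"
proof (rule small_inj_on)
  let ?A = "SIGMA l : UNIV. SIGMA \<theta> : (UNIV :: nat list set). Smp B l"
  let ?r = "\<lambda>\<phi>. (\<lambda>(l, \<theta>, b) \<in> {(l, \<theta>, b) \<in> ?A. \<theta> \<in> operators l m}. \<phi> l \<theta> b)"
  let ?D = "{(l, \<theta>, b) \<in> ?A. \<theta> \<in> operators l m}"
  show "inj_on ?r (fun_simplices B X m)"
  proof (rule inj_onI)
    fix \<phi> \<psi> assume \<phi>: "\<phi> \<in> fun_simplices B X m" and \<psi>: "\<psi> \<in> fun_simplices B X m" and eq: "?r \<phi> = ?r \<psi>"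
    have "\<phi> l \<theta> b = \<psi> l \<theta> b" for l \<theta> b
    proof (cases "\<theta> \<in> operators l m \<and> b \<in> Smp B l")
      case True
      then show ?thesis using fun_cong[OF eq, of "(l, \<theta>, b)"] by simp
    next
      case False
      then show ?thesis using fun_simplicesD(2)[OF \<phi> False] fun_simplicesD(2)[OF \<psi> False] by simp
    qed
    then show "\<phi> = \<psi>" by (simp add: fun_eq_iff)
  qed
  show "?r ` fun_simplices B X m \<subseteq> ?D \<rightarrow>\<^sub>E (\<Union>l. Smp X l)"
  proof (rule image_subsetI)
    fix \<phi> assume "\<phi> \<in> fun_simplices B X m"
    note d = fun_simplicesD(1)[OF this]
    show "?r \<phi> \<in> ?D \<rightarrow>\<^sub>E (\<Union>l. Smp X l)"
      unfolding restrict_PiE_iff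
    proof
      fix p assume "p \<in> ?D"
      then obtain l \<theta> b where "p = (l, \<theta>, b)" "\<theta> \<in> operators l m" "b \<in> Smp B l" by auto
      then show "(\<lambda>(l, \<theta>, b). \<phi> l \<theta> b) p \<in> (\<Union>l. Smp X l)" using d[of \<theta> l b] by auto
    qed
  qed
  have "small TYPE('u) ?A" using B by (intro small_Sigma[OF inaccessible_u]) (auto simp: sset_obj)
  then have "small TYPE('u) ?D" by (rule small_subset) auto
  moreover have "small TYPE('u) (\<Union>l. Smp X l)" using X by (intro small_UN[OF inaccessible_u]) (auto simp: sset_obj)
  ultimately show "small TYPE('u) (?D \<rightarrow>\<^sub>E (\<Union>l. Smp X l))" by (rule small_PiE[OF inaccessible_u])
qed

lemma fun_code_inj: "inj_on (fun_code B X m) (fun_simplices B X m)"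
proof -
  have "\<exists>c :: _ => 'u. inj_on c (fun_simplices B X m)"
    using small_embedding[OF small_fun_simplices] by blast
  then have "inj_on (SOME c :: _ => 'u. inj_on c (fun_simplices B X m)) (fun_simplices B X m)"
    by (rule someI_ex)
  then show ?thesis by (simp add: fun_code_def inj_on_def)
qed

lemma fun_decode_code [simp]: "\<phi> \<in> fun_simplices B X m ==> fun_decode B X m (fun_code B X m \<phi>) = \<phi>"
  unfolding fun_decode_def by (rule inv_into_f_f[OF fun_code_inj])

lemma fun_pull:
  assumes \<phi>: "\<phi> \<in> fun_simplices B X m" and \<theta>: "\<theta> \<in> operators l m"
  shows "fun_pull B l \<theta> \<phi> \<in> fun_simplices B X l"
proof (rule fun_simplicesI)
  note d = fun_simplicesD[OF \<phi>]
  show "fun_pull B l \<theta> \<phi> k \<rho> b \<in> Smp X k" if "\<rho> \<in> operators k l" "b \<in> Smp B k" for k \<rho> b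
    using d(1)[OF operator_comp[OF that(1) \<theta>] that(2)] that by (simp add: fun_pull_def)
  show "fun_pull B l \<theta> \<phi> k \<rho> b = undefined" if "\<not> (\<rho> \<in> operators k l \<and> b \<in> Smp B k)" for k \<rho> b
    using that by (simp only: fun_pull_def if_False)
  fix k j \<rho> \<tau> b assume \<rho>: "\<rho> \<in> operators k l" and \<tau>: "\<tau> \<in> operators j k" and b: "b \<in> Smp B k"
  show "fun_pull B l \<theta> \<phi> j (map ((!) \<rho>) \<tau>) (Op B k \<tau> b) = Op X k \<tau> (fun_pull B l \<theta> \<phi> k \<rho> b)"
    using d(3)[OF operator_comp[OF \<rho> \<theta>] \<tau> b] operator_comp[OF \<tau> \<rho>] B_set(1)[OF \<tau> b] \<rho> b
    by (simp only: fun_pull_def operator_comp_assoc[OF \<tau> \<rho>] if_True simp_thms)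
qed

lemma exp_Smp: "Smp (sset_exp B X) m = fun_code B X m ` fun_simplices B X m"
  by (simp add: sset_exp_def)

lemma exp_Op: "\<phi> \<in> fun_simplices B X m ==> \<theta> \<in> operators l m ==>
    Op (sset_exp B X) m \<theta> (fun_code B X m \<phi>) = fun_code B X l (fun_pull B l \<theta> \<phi>)"
  using operators_length[of \<theta> l m] by (auto simp: sset_exp_def)

lemma sset_exp_obj: "sset_exp B X \<in> Obj SS"
  unfolding sset_obj
proof (intro conjI allI)
  show "simplicial_set (sset_exp B X)"
  proof (rule simplicial_setI)
    fix m n \<theta> w assume *: "\<theta> \<in> operators m n" "w \<in> Smp (sset_exp B X) n"
    then show "Op (sset_exp B X) n \<theta> w \<in> Smp (sset_exp B X) m"
      using fun_pull[OF _ *(1)] by (auto simp: exp_Smp exp_Op)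
  next
    fix n w assume "w \<in> Smp (sset_exp B X) n"
    then obtain \<phi> where \<phi>: "\<phi> \<in> fun_simplices B X n" "w = fun_code B X n \<phi>" by (auto simp: exp_Smp)
    have "fun_pull B n [0..<Suc n] \<phi> k \<rho> b = \<phi> k \<rho> b" for k \<rho> b
      using fun_simplicesD(2)[OF \<phi>(1), of \<rho> k b] operator_id_left[of \<rho> k n]
      by (auto simp: fun_pull_def simp del: upt_Suc)
    then have "fun_pull B n [0..<Suc n] \<phi> = \<phi>" by (simp add: fun_eq_iff)
    then show "Op (sset_exp B X) n [0..<Suc n] w = w" using exp_Op[OF \<phi>(1) operator_id] \<phi>(2) by simp
  next
    fix l m n \<rho> \<theta> w assume \<rho>: "\<rho> \<in> operators l m" and \<theta>: "\<theta> \<in> operators m n" and "w \<in> Smp (sset_exp B X) n"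
    then obtain \<phi> where \<phi>: "\<phi> \<in> fun_simplices B X n" "w = fun_code B X n \<phi>" by (auto simp: exp_Smp)
    have "fun_pull B l \<rho> (fun_pull B m \<theta> \<phi>) k \<tau> b = fun_pull B l (map ((!) \<theta>) \<rho>) \<phi> k \<tau> b" for k \<tau> b
      using operator_comp[OF _ \<rho>, of \<tau> k]
      by (auto simp: fun_pull_def operator_comp_assoc[OF _ \<rho>] simp del: map_map)
    then have "fun_pull B l \<rho> (fun_pull B m \<theta> \<phi>) = fun_pull B l (map ((!) \<theta>) \<rho>) \<phi>" by (simp add: fun_eq_iff)
    then show "Op (sset_exp B X) m \<rho> (Op (sset_exp B X) n \<theta> w) = Op (sset_exp B X) n (map ((!) \<theta>) \<rho>) w"
      using exp_Op[OF \<phi>(1) \<theta>] exp_Op[OF fun_pull[OF \<phi>(1) \<theta>] \<rho>] exp_Op[OF \<phi>(1) operator_comp[OF \<rho> \<theta>]] \<phi>(2) by simp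
  next
    show "\<not> ((\<exists>m. \<theta> \<in> operators m n) \<and> w \<in> Smp (sset_exp B X) n) ==> Op (sset_exp B X) n \<theta> w = undefined" for n \<theta> w
      by (auto simp: sset_exp_def)
  qed
  show "small TYPE('u) (Smp (sset_exp B X) n)" for n
    unfolding exp_Smp by (rule small_image[OF small_fun_simplices])
qed

lemma eval_Op:
  assumes \<phi>: "\<phi> \<in> fun_simplices B X m" and \<theta>: "\<theta> \<in> operators l m" and b: "b \<in> Smp B l"
  shows "sset_eval B X l (Op (sset_exp B X) m \<theta> (fun_code B X m \<phi>)) b = \<phi> l \<theta> b"
  using fun_pull[OF \<phi> \<theta>] operator_id[of l] operator_id_right[OF \<theta>] b
  by (simp add: exp_Op[OF \<phi> \<theta>] sset_eval_def fun_pull_def del: upt_Suc)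

lemma sset_exp_eqI:
  assumes w: "w \<in> Smp (sset_exp B X) m" "w' \<in> Smp (sset_exp B X) m"
    and eq: "\<And>l \<theta> b. \<theta> \<in> operators l m ==> b \<in> Smp B l ==>
      sset_eval B X l (Op (sset_exp B X) m \<theta> w) b = sset_eval B X l (Op (sset_exp B X) m \<theta> w') b"
  shows "w = w'"
proof -
  obtain \<phi> \<psi> where \<phi>: "\<phi> \<in> fun_simplices B X m" "w = fun_code B X m \<phi>"
    and \<psi>: "\<psi> \<in> fun_simplices B X m" "w' = fun_code B X m \<psi>" using w by (auto simp: exp_Smp)
  have "\<phi> l \<theta> b = \<psi> l \<theta> b" for l \<theta> b
  proof (cases "\<theta> \<in> operators l m \<and> b \<in> Smp B l")
    case True
    then show ?thesis using eq[of \<theta> l b] eval_Op[OF \<phi>(1)] eval_Op[OF \<psi>(1)] \<phi>(2) \<psi>(2) by simp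
  next
    case False
    then show ?thesis using fun_simplicesD(2)[OF \<phi>(1) False] fun_simplicesD(2)[OF \<psi>(1) False] by simp
  qed
  then have "\<phi> = \<psi>" by (simp add: fun_eq_iff)
  then show ?thesis using \<phi> \<psi> by simp
qed

lemma sset_hmI:
  assumes "V \<in> Obj SS" "W \<in> Obj SS"
    and "\<And>n x. x \<in> Smp V n ==> \<phi> n x \<in> Smp W n"
    and "\<And>m n \<theta> x. \<theta> \<in> operators m n ==> x \<in> Smp V n ==> \<phi> m (Op V n \<theta> x) = Op W n \<theta> (\<phi> n x)"
  shows "sset.hm V W \<phi>"
  unfolding sset.hm_def
  by (rule bexI[of _ "Arrow V (\<lambda>n. \<lambda>x\<in>Smp V n. \<phi> n x) W"]) (use sset_Arrow_mor[OF assms] in \<open>auto simp: Hom_def\<close>)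

lemma sset_eval_hm: "sset.hm (Prod SS (sset_exp B X) B) X (\<lambda>m p. sset_eval B X m (pfst p) (psnd p))"
proof (rule sset_hmI[OF sset.prod_S(1)[OF sset_exp_obj B] X])
  fix n p assume "p \<in> Smp (Prod SS (sset_exp B X) B) n"
  then obtain \<phi> b where p: "p = Pair (fun_code B X n \<phi>) b" "\<phi> \<in> fun_simplices B X n" "b \<in> Smp B n"
    by (auto simp: exp_Smp)
  show "sset_eval B X n (pfst p) (psnd p) \<in> Smp X n"
    using fun_simplicesD(1)[OF p(2) operator_id p(3)] p by (simp add: sset_eval_def del: upt_Suc)
  fix m \<theta> assume \<theta>: "\<theta> \<in> operators m n"
  have "Op (Prod SS (sset_exp B X) B) n \<theta> p = Pair (Op (sset_exp B X) n \<theta> (fun_code B X n \<phi>)) (Op B n \<theta> b)"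
    using p \<theta> by (simp add: exp_Smp)
  then show "sset_eval B X m (pfst (Op (Prod SS (sset_exp B X) B) n \<theta> p)) (psnd (Op (Prod SS (sset_exp B X) B) n \<theta> p)) =
      Op X n \<theta> (sset_eval B X n (pfst p) (psnd p))"
    using eval_Op[OF p(2) \<theta> B_set(1)[OF \<theta> p(3)]] fun_simplicesD(3)[OF p(2) operator_id \<theta> p(3)]
      operator_id_left[OF \<theta>] p by (simp add: sset_eval_def del: upt_Suc)
qed

lemma sset_lam:
  assumes A: "A \<in> Obj SS" and \<beta>: "sset.hm (Prod SS A B) X (\<lambda>m p. \<beta> m (pfst p) (psnd p))"
  shows "\<exists>\<psi>. sset.hm A (sset_exp B X) \<psi> \<and>
    (\<forall>m. \<forall>a \<in> Smp A m. \<forall>b \<in> Smp B m. sset_eval B X m (\<psi> m a) b = \<beta> m a b)"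
proof -
  note A_set = simplicial_setD[OF conjunct1[OF A[unfolded sset_obj]]]
  note bp = sset.hm_binary_pts[OF \<beta>] and br = sset.hm_binary_rst[OF \<beta>]
  define \<psi> where "\<psi> m a = (\<lambda>l \<theta> b. if \<theta> \<in> operators l m \<and> b \<in> Smp B l then \<beta> l (Op A m \<theta> a) b else undefined)" for m a
  have \<psi>: "\<psi> m a \<in> fun_simplices B X m" if a: "a \<in> Smp A m" for m a
  proof (rule fun_simplicesI)
    show "\<psi> m a l \<theta> b \<in> Smp X l" if "\<theta> \<in> operators l m" "b \<in> Smp B l" for l \<theta> b
      using bp[OF A_set(1)[OF that(1) a] that(2)] that by (simp add: \<psi>_def)
    show "\<psi> m a l \<theta> b = undefined" if "\<not> (\<theta> \<in> operators l m \<and> b \<in> Smp B l)" for l \<theta> b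
      using that by (simp only: \<psi>_def if_False)
    fix l k \<theta> \<rho> b assume \<theta>: "\<theta> \<in> operators l m" and \<rho>: "\<rho> \<in> operators k l" and b: "b \<in> Smp B l"
    show "\<psi> m a k (map ((!) \<theta>) \<rho>) (Op B l \<rho> b) = Op X l \<rho> (\<psi> m a l \<theta> b)"
      using br[OF \<rho> A_set(1)[OF \<theta> a] b] A_set(3)[OF \<rho> \<theta> a] operator_comp[OF \<rho> \<theta>] B_set(1)[OF \<rho> b] \<theta> b
      by (simp add: \<psi>_def)
  qed
  have "sset.hm A (sset_exp B X) (\<lambda>m a. fun_code B X m (\<psi> m a))"
  proof (rule sset_hmI[OF A sset_exp_obj])
    show "fun_code B X n (\<psi> n a) \<in> Smp (sset_exp B X) n" if "a \<in> Smp A n" for n a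
      using \<psi>[OF that] by (simp add: exp_Smp)
    fix m n \<theta> a assume \<theta>: "\<theta> \<in> operators m n" and a: "a \<in> Smp A n"
    have "\<psi> m (Op A n \<theta> a) k \<rho> b = fun_pull B m \<theta> (\<psi> n a) k \<rho> b" for k \<rho> b
      using A_set(3)[OF _ \<theta> a, of \<rho> k] operator_comp[OF _ \<theta>, of \<rho> k] by (auto simp: \<psi>_def fun_pull_def)
    then have "\<psi> m (Op A n \<theta> a) = fun_pull B m \<theta> (\<psi> n a)" by (simp add: fun_eq_iff)
    then show "fun_code B X m (\<psi> m (Op A n \<theta> a)) = Op (sset_exp B X) n \<theta> (fun_code B X n (\<psi> n a))"
      by (simp add: exp_Op[OF \<psi>[OF a] \<theta>])
  qed
  moreover have "sset_eval B X m (fun_code B X m (\<psi> m a)) b = \<beta> m a b"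
    if a: "a \<in> Smp A m" and b: "b \<in> Smp B m" for m a b
    using \<psi>[OF a] operator_id[of m] A_set(2)[OF a] b by (simp add: sset_eval_def \<psi>_def del: upt_Suc)
  ultimately show ?thesis by blast
qed

end

lemma sset_classifier_obj: "sset_classifier m \<in> Obj SS"
  unfolding sset_obj
proof (intro conjI allI)
  show "simplicial_set (sset_classifier m)"
  proof (rule simplicial_setI)
    fix l n \<theta> w assume *: "\<theta> \<in> operators l n" "w \<in> Smp (sset_classifier m) n"
    then show "Op (sset_classifier m) n \<theta> w \<in> Smp (sset_classifier m) l"
      using operators_length[OF *(1)] by (auto simp: sset_classifier_def)
  next
    fix n w assume "w \<in> Smp (sset_classifier m) n"
    then obtain P where P: "P \<subseteq> operators m n" "w = code_set P" by (auto simp: sset_classifier_def)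
    have "{\<sigma> \<in> operators m n. map ((!) [0..<Suc n]) \<sigma> \<in> P} = P"
      using P operator_id_left[of _ m n] by (auto simp del: upt_Suc)
    then show "Op (sset_classifier m) n [0..<Suc n] w = w"
      using P operator_id[of n] by (auto simp: sset_classifier_def simp del: upt_Suc)
  next
    fix k l n \<rho> \<theta> w assume \<rho>: "\<rho> \<in> operators k l" and \<theta>: "\<theta> \<in> operators l n" and "w \<in> Smp (sset_classifier m) n"
    then obtain P where P: "P \<subseteq> operators m n" "w = code_set P" by (auto simp: sset_classifier_def)
    have "{\<sigma> \<in> operators m k. map ((!) \<rho>) \<sigma> \<in> {\<sigma> \<in> operators m l. map ((!) \<theta>) \<sigma> \<in> P}} =
        {\<sigma> \<in> operators m k. map ((!) (map ((!) \<theta>) \<rho>)) \<sigma> \<in> P}"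
      using operator_comp[OF _ \<rho>, of _ m] by (auto simp: operator_comp_assoc[OF _ \<rho>] simp del: map_map)
    then show "Op (sset_classifier m) l \<rho> (Op (sset_classifier m) n \<theta> w) =
        Op (sset_classifier m) n (map ((!) \<theta>) \<rho>) w"
      using P \<rho> \<theta> operator_comp[OF \<rho> \<theta>] operators_length[OF \<theta>] operators_length[OF \<rho>]
      by (auto simp: sset_classifier_def)
  qed (auto simp: sset_classifier_def)
  fix n
  have "operators m n \<subseteq> {xs. set xs \<subseteq> {..n} \<and> length xs = Suc m}" by (auto simp: operators_def)
  then have "finite (operators m n)" using finite_lists_length_eq[of "{..n}" "Suc m"] finite_subset by blast
  then show "small TYPE('u) (Smp (sset_classifier m) n)"
    by (auto simp: sset_classifier_def intro!: small_image small_countable[OF inaccessible_u] countable_finite)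
qed

lemma sset_classify:
  assumes X: "X \<in> Obj SS"
  shows "\<exists>\<phi>. sset.hm X (sset_classifier m) \<phi> \<and> (\<forall>x \<in> Smp X m. sset_true m (\<phi> m x) \<longleftrightarrow> x \<in> P)"
proof -
  note x = simplicial_setD[OF conjunct1[OF X[unfolded sset_obj]]]
  let ?\<phi> = "\<lambda>k x. code_set {\<sigma> \<in> operators m k. Op X k \<sigma> x \<in> P}"
  have "sset.hm X (sset_classifier m) ?\<phi>"
  proof (rule sset_hmI[OF X X X sset_classifier_obj])
    show "?\<phi> n a \<in> Smp (sset_classifier m) n" for n a by (auto simp: sset_classifier_def)
    fix l n \<theta> a assume \<theta>: "\<theta> \<in> operators l n" and a: "a \<in> Smp X n"
    have "{\<sigma> \<in> operators m l. Op X l \<sigma> (Op X n \<theta> a) \<in> P} =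
        {\<sigma> \<in> operators m l. map ((!) \<theta>) \<sigma> \<in> {\<sigma> \<in> operators m n. Op X n \<sigma> a \<in> P}}"
      using x(3)[OF _ \<theta> a] operator_comp[OF _ \<theta>] by auto
    then show "?\<phi> l (Op X n \<theta> a) = Op (sset_classifier m) n \<theta> (?\<phi> n a)"
      using \<theta> operators_length[OF \<theta>] by (auto simp: sset_classifier_def)
  qed
  moreover have "sset_true m (?\<phi> m a) \<longleftrightarrow> a \<in> P" if "a \<in> Smp X m" for a
    using operator_id[of m] x(2)[OF that] by (simp add: sset_true_def del: upt_Suc)
  ultimately show ?thesis by blast
qed

lemma sset_classify_unique:
  assumes \<phi>: "sset.hm X (sset_classifier m) \<phi>" and \<psi>: "sset.hm X (sset_classifier m) \<psi>"
    and eq: "\<And>x. x \<in> Smp X m ==> sset_true m (\<phi> m x) \<longleftrightarrow> sset_true m (\<psi> m x)"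
    and x: "x \<in> Smp X l"
  shows "\<phi> l x = \<psi> l x"
proof -
  have X: "X \<in> Obj SS" using sset.hm_obj[OF \<phi>] by blast
  have mem: "\<sigma> \<in> decode_set (\<xi> l x) \<longleftrightarrow> sset_true m (\<xi> m (Op X l \<sigma> x))"
    if \<xi>: "sset.hm X (sset_classifier m) \<xi>" and \<sigma>: "\<sigma> \<in> operators m l" for \<xi> \<sigma>
  proof -
    have "\<xi> m (Op X l \<sigma> x) = Op (sset_classifier m) l \<sigma> (\<xi> l x)" by (rule sset.hm_rst[OF \<xi> \<sigma> x])
    moreover have "\<xi> l x \<in> code_set ` Pow (operators m l)"
      using sset.hm_pts[OF \<xi> x] by (simp add: sset_classifier_def)
    ultimately show ?thesis
      using \<sigma> operators_length[OF \<sigma>] operator_id[of m] operator_id_right[OF \<sigma>]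
      by (auto simp: sset_classifier_def sset_true_def simp del: upt_Suc)
  qed
  obtain P Q where P: "P \<subseteq> operators m l" "\<phi> l x = code_set P" and Q: "Q \<subseteq> operators m l" "\<psi> l x = code_set Q"
    using sset.hm_pts[OF \<phi> x] sset.hm_pts[OF \<psi> x] by (auto simp: sset_classifier_def)
  have "\<sigma> \<in> P \<longleftrightarrow> \<sigma> \<in> Q" if \<sigma>: "\<sigma> \<in> operators m l" for \<sigma>
    using mem[OF \<phi> \<sigma>] mem[OF \<psi> \<sigma>] eq[OF sset.rst_pts[OF X \<sigma> x]] P(2) Q(2) by simp
  then have "P = Q" using P(1) Q(1) by blast
  then show ?thesis using P Q by simp
qed

lemma sset_extends_classifier:
  assumes "f \<in> Mor SS" "inj_on (Fn f m) (Smp (Dom f) m)"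
  shows "extends SS (sset_classifier m) f"
proof (rule sset.extends_classifier[where t = "sset_true m", OF _ _ assms])
  show "\<exists>\<phi>. sset.hm X (sset_classifier m) \<phi> \<and> (\<forall>x\<in>Smp X m. sset_true m (\<phi> m x) \<longleftrightarrow> x \<in> P)"
    if "X \<in> Obj SS" for X P using sset_classify[OF that] .
  show "\<phi> l x = \<psi> l x" if "sset.hm X (sset_classifier m) \<phi>" "sset.hm X (sset_classifier m) \<psi>"
    "\<And>x. x \<in> Smp X m ==> sset_true m (\<phi> m x) \<longleftrightarrow> sset_true m (\<psi> m x)" "x \<in> Smp X l" for X \<phi> \<psi> x l
    using sset_classify_unique[OF that] .
qed

lemma sset_generator:
  assumes \<nu>: "\<nu> \<in> inclusions"
  shows "Rlz SS (Dom (generator \<nu>)) \<in> Obj SS" "Rlz SS (Cod (generator \<nu>)) \<in> Obj SS"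
    and "RlzMap SS (generator \<nu>) \<in> Hom SS (Rlz SS (Dom (generator \<nu>))) (Rlz SS (Cod (generator \<nu>)))"
    and "p \<in> Smp (Rlz SS (Dom (generator \<nu>))) m ==> Fn (RlzMap SS (generator \<nu>)) m p = p"
    and "Smp (Rlz SS (Cod (generator \<nu>))) m \<noteq> {}"
    and "Smp (Rlz SS (Dom (generator \<nu>))) m \<subseteq> range Simplex"
proof -
  obtain n Q where g: "generator \<nu> = inclusion (subsimplex n (\<lambda>\<sigma>. Q (set \<sigma>))) (Delta n)"
    and Q: "\<And>A B. A \<subseteq> B ==> Q B ==> Q A" using generator_cases[OF \<nu>] by blast
  let ?K = "subsimplex n (\<lambda>\<sigma>. Q (set \<sigma>))"
  have R: "Rlz SS (Dom (generator \<nu>)) = sset_embed ?K" "Rlz SS (Cod (generator \<nu>)) = sset_embed (Delta n)"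
    by (simp_all add: g inclusion_def SSet_def)
  show obj: "Rlz SS (Dom (generator \<nu>)) \<in> Obj SS" "Rlz SS (Cod (generator \<nu>)) \<in> Obj SS"
    unfolding R using sset_embed_obj[OF subsimplex_simplicial[OF Q]] sset_embed_obj[OF Delta_simplicial] by auto
  have "Arrow (sset_embed ?K) (\<lambda>n. \<lambda>p\<in>Smp (sset_embed ?K) n. p) (sset_embed (Delta n)) \<in> Mor SS"
    using obj unfolding R
    by (intro sset_Arrow_mor) (auto simp: sset_embed_def Delta_def subsimplex_def)
  moreover have "RlzMap SS (generator \<nu>) = Arrow (sset_embed ?K) (\<lambda>n. \<lambda>p\<in>Smp (sset_embed ?K) n. p) (sset_embed (Delta n))"
    by (auto simp: g inclusion_def SSet_def sset_embed_def intro!: ext restrict_ext)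
  ultimately show "RlzMap SS (generator \<nu>) \<in> Hom SS (Rlz SS (Dom (generator \<nu>))) (Rlz SS (Cod (generator \<nu>)))"
    "p \<in> Smp (Rlz SS (Dom (generator \<nu>))) m ==> Fn (RlzMap SS (generator \<nu>)) m p = p"
    unfolding R by (auto simp: Hom_def)
  have "replicate (Suc m) 0 \<in> operators m n" by (auto simp: operators_def)
  then show "Smp (Rlz SS (Cod (generator \<nu>))) m \<noteq> {}"
    unfolding R by (auto simp: sset_embed_def Delta_def subsimplex_def)
  show "Smp (Rlz SS (Dom (generator \<nu>))) m \<subseteq> range Simplex"
    unfolding R by (auto simp: sset_embed_def)
qed

sublocale sset: space_model SS Smp Op Fn sset_exp sset_eval sset_sub sset_tag sset_classifier sset_true
  "range sset_classifier" generator inclusions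
proof
  fix X B :: "'u element sset" assume B: "B \<in> Obj SS" and X: "X \<in> Obj SS"
  show "sset_exp B X \<in> Obj SS" by (rule sset_exp_obj[OF B X])
  show "sset.hm (Prod SS (sset_exp B X) B) X (\<lambda>m p. sset_eval B X m (pfst p) (psnd p))"
    by (rule sset_eval_hm[OF B X])
  show "w = w'" if "w \<in> Smp (sset_exp B X) m" "w' \<in> Smp (sset_exp B X) m"
    "\<And>l \<theta> b. \<theta> \<in> operators l m ==> b \<in> Smp B l ==>
      sset_eval B X l (Op (sset_exp B X) m \<theta> w) b = sset_eval B X l (Op (sset_exp B X) m \<theta> w') b" for w w' m
    by (rule sset_exp_eqI[OF B X that])
next
  fix V B X :: "'u element sset" and \<beta>
  assume "V \<in> Obj SS" "B \<in> Obj SS" "X \<in> Obj SS" "sset.hm (Prod SS V B) X (\<lambda>m p. \<beta> m (pfst p) (psnd p))"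
  then show "\<exists>\<psi>. sset.hm V (sset_exp B X) \<psi> \<and>
      (\<forall>m. \<forall>a\<in>Smp V m. \<forall>b\<in>Smp B m. sset_eval B X m (\<psi> m a) b = \<beta> m a b)"
    by (intro sset_lam)
next
  fix X :: "'u element sset" and A assume X: "X \<in> Obj SS" and A: "sset.closed_sub X A"
  note x = simplicial_setD[OF conjunct1[OF X[unfolded sset_obj]]]
  have sub: "A m \<subseteq> Smp X m" and cl: "\<theta> \<in> operators m n ==> a \<in> A n ==> Op X n \<theta> a \<in> A m" for m n \<theta> a
    using A unfolding sset.closed_sub_def by blast+
  show obj: "sset_sub X A \<in> Obj SS"
    unfolding sset_obj
  proof (intro conjI allI)
    show "simplicial_set (sset_sub X A)"
    proof (rule simplicial_setI)
      fix n a assume "a \<in> Smp (sset_sub X A) n"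
      then show "Op (sset_sub X A) n [0..<Suc n] a = a"
        using x(2) sub operator_id[of n] by (auto simp: sset_sub_def simp del: upt_Suc)
    next
      fix l m n \<phi> \<theta> a assume *: "\<phi> \<in> operators l m" "\<theta> \<in> operators m n" "a \<in> Smp (sset_sub X A) n"
      then show "Op (sset_sub X A) m \<phi> (Op (sset_sub X A) n \<theta> a) = Op (sset_sub X A) n (map ((!) \<theta>) \<phi>) a"
        using x(3)[OF *(1,2)] cl sub operator_comp[OF *(1,2)] by (auto simp: sset_sub_def subset_iff)
    qed (auto simp: sset_sub_def cl)
    show "small TYPE('u) (Smp (sset_sub X A) n)" for n
      using X small_subset[of "TYPE('u)" "Smp X n" "A n"] sub by (simp add: sset_sub_def sset_obj)
  qed
  show "Smp (sset_sub X A) m = A m" for m by (simp add: sset_sub_def)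
  show "sset.hm (sset_sub X A) X (\<lambda>m x. x)"
    by (rule sset_hmI[OF X X obj X]) (use sub in \<open>auto simp: sset_sub_def\<close>)
  fix W \<phi> assume \<phi>: "sset.hm W X \<phi>" and img: "\<And>m w. w \<in> Smp W m ==> \<phi> m w \<in> A m"
  show "sset.hm W (sset_sub X A) \<phi>"
    by (rule sset_hmI[OF X X _ obj]) (use sset.hm_obj[OF \<phi>] sset.hm_rst[OF \<phi>] img in \<open>auto simp: sset_sub_def\<close>)
next
  fix \<nu>
  show "sset_tag \<nu> \<in> Obj SS"
    unfolding sset_obj
  proof (intro conjI allI)
    show "simplicial_set (sset_tag \<nu>)"
    proof (rule simplicial_setI)
      show "x \<in> Smp (sset_tag \<nu>) n ==> Op (sset_tag \<nu>) n [0..<Suc n] x = x" for n x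
        using operator_id[of n] by (auto simp: sset_tag_def simp del: upt_Suc)
      show "\<phi> \<in> operators l m ==> \<theta> \<in> operators m n ==> x \<in> Smp (sset_tag \<nu>) n ==>
        Op (sset_tag \<nu>) m \<phi> (Op (sset_tag \<nu>) n \<theta> x) = Op (sset_tag \<nu>) n (map ((!) \<theta>) \<phi>) x" for \<phi> \<theta> l m n x
        using operator_comp[of \<phi> l m \<theta> n] by (auto simp: sset_tag_def)
    qed (auto simp: sset_tag_def)
    show "small TYPE('u) (Smp (sset_tag \<nu>) n)" for n
      using small_singleton[OF inaccessible_u] by (simp add: sset_tag_def)
  qed
  show "Smp (sset_tag \<nu>) m = {Simplex \<nu>}" for m by (simp add: sset_tag_def)
next
  show "sset_classifier m \<in> Obj SS" for m by (rule sset_classifier_obj)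
  show "\<exists>\<phi>. sset.hm X (sset_classifier m) \<phi> \<and> (\<forall>x\<in>Smp X m. sset_true m (\<phi> m x) \<longleftrightarrow> x \<in> P)"
    if "X \<in> Obj SS" for X m P using sset_classify[OF that] .
  show "\<phi> l x = \<psi> l x" if "sset.hm X (sset_classifier m) \<phi>" "sset.hm X (sset_classifier m) \<psi>"
    "\<And>x. x \<in> Smp X m ==> sset_true m (\<phi> m x) \<longleftrightarrow> sset_true m (\<psi> m x)" "x \<in> Smp X l" for X m \<phi> \<psi> x l
    using sset_classify_unique[OF that] .
  show "Z \<in> range sset_classifier ==> Z \<in> Obj SS" for Z using sset_classifier_obj by blast
next
  fix f :: "('u element sset, nat => 'u element => 'u element) arrow"
  assume f: "f \<in> Mor SS" and ext: "\<And>Z. Z \<in> range sset_classifier ==> extends SS Z f"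
  have F: "Dom f \<in> Obj SS" "Cod f \<in> Obj SS" using f sset_mor by blast+
  show inj: "inj_on (Fn f m) (Smp (Dom f) m)" for m
  proof (rule inj_onI)
    fix x y assume x: "x \<in> Smp (Dom f) m" and y: "y \<in> Smp (Dom f) m" and eq: "Fn f m x = Fn f m y"
    obtain \<phi> where \<phi>: "sset.hm (Dom f) (sset_classifier m) \<phi>"
      "\<forall>z\<in>Smp (Dom f) m. sset_true m (\<phi> m z) \<longleftrightarrow> z \<in> {x}" using sset_classify[OF F(1)] by blast
    note v = sset.mk_hm[OF \<phi>(1)]
    obtain w where w: "w \<in> Hom SS (Cod f) (sset_classifier m)" "w \<cdot>\<^bsub>SS\<^esub> f = sset.mk (Dom f) (sset_classifier m) \<phi>"
      using ext v(1) unfolding extends_def by blast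
    have "Fn w m (Fn f m z) = \<phi> m z" if "z \<in> Smp (Dom f) m" for z
      using arg_cong[OF w(2), of "\<lambda>h. Fn h m z"] that v(3) by simp
    then have "\<phi> m x = \<phi> m y" using x y eq by metis
    moreover have "sset_true m (\<phi> m x)" using \<phi>(2) x by blast
    ultimately have "sset_true m (\<phi> m y)" by (simp only:)
    with bspec[OF \<phi>(2) y] have "y \<in> {x}" by (rule iffD1)
    then show "x = y" by (rule singletonD[symmetric])
  qed
  fix h :: "('u element sset, nat => 'u element => 'u element) arrow"
  assume h: "h \<in> Mor SS" and hf: "Cod h = Cod f"
    and img: "\<And>m x. x \<in> Smp (Dom h) m ==> Fn h m x \<in> Fn f m ` Smp (Dom f) m"
  have H: "Dom h \<in> Obj SS" using h sset_mor by blast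
  let ?k = "\<lambda>m x. inv_into (Smp (Dom f) m) (Fn f m) (Fn h m x)"
  have k: "?k m x \<in> Smp (Dom f) m" "Fn f m (?k m x) = Fn h m x" if "x \<in> Smp (Dom h) m" for m x
    using img[OF that] by (simp_all add: inv_into_into f_inv_into_f)
  have hm: "sset.hm (Dom h) (Dom f) ?k"
  proof (rule sset_hmI[OF F H F(1)])
    show "?k n x \<in> Smp (Dom f) n" if "x \<in> Smp (Dom h) n" for n x by (rule k(1)[OF that])
    fix m n \<theta> x assume \<theta>: "\<theta> \<in> operators m n" and x: "x \<in> Smp (Dom h) n"
    have r: "Op (Dom h) n \<theta> x \<in> Smp (Dom h) m" using sset.rst_pts[OF H \<theta> x] .
    show "?k m (Op (Dom h) n \<theta> x) = Op (Dom f) n \<theta> (?k n x)"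
    proof (rule inj_onD[OF inj _ k(1)[OF r] sset.rst_pts[OF F(1) \<theta> k(1)[OF x]]])
      show "Fn f m (?k m (Op (Dom h) n \<theta> x)) = Fn f m (Op (Dom f) n \<theta> (?k n x))"
        using k(2)[OF r] k(2)[OF x] sset.ap_rst[OF f \<theta> k(1)[OF x]] sset.ap_rst[OF h \<theta> x] hf by simp
    qed
  qed
  note K = sset.mk_hm[OF hm]
  have "f \<cdot>\<^bsub>SS\<^esub> sset.mk (Dom h) (Dom f) ?k = h"
    by (rule sset.ap_ext) (use f h hf K k in auto)
  then show "\<exists>k\<in>Hom SS (Dom h) (Dom f). f \<cdot>\<^bsub>SS\<^esub> k = h" using K(1) by blast
next
  fix \<nu> assume \<nu>: "\<nu> \<in> inclusions"
  note g = sset_generator[OF \<nu>]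
  show "RlzMap SS (generator \<nu>) \<in> Hom SS (Rlz SS (Dom (generator \<nu>))) (Rlz SS (Cod (generator \<nu>)))" by (rule g)
  show "Smp (Rlz SS (Cod (generator \<nu>))) m \<noteq> {}" for m by (rule g)
  have "inj_on (\<lambda>(m, p). (m, un_Simplex p, \<lambda>_. 0)) (SIGMA m:UNIV. Smp (Rlz SS (Dom (generator \<nu>))) m)"
  proof (rule inj_onI)
    have *: "\<exists>m \<sigma>. p = (m, Simplex \<sigma>)" if "p \<in> (SIGMA m:UNIV. Smp (Rlz SS (Dom (generator \<nu>))) m)" for p
      using that g(6) by blast
    fix p q assume "p \<in> (SIGMA m:UNIV. Smp (Rlz SS (Dom (generator \<nu>))) m)"
      "q \<in> (SIGMA m:UNIV. Smp (Rlz SS (Dom (generator \<nu>))) m)"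
      and eq: "(\<lambda>(m, p). (m, un_Simplex p, \<lambda>_. 0)) p = (\<lambda>(m, p). (m, un_Simplex p, \<lambda>_. 0)) q"
    then obtain m \<sigma> l \<tau> where "p = (m, Simplex \<sigma>)" "q = (l, Simplex \<tau>)" using * by blast
    with eq show "p = q" by simp
  qed
  then show "|SIGMA m : (UNIV :: nat set). Smp (Rlz SS (Dom (generator \<nu>))) m| \<le>o
      |UNIV :: (nat \<times> nat list \<times> (nat => real)) set|"
    using card_of_ordLeq by blast
  fix X Z :: "'u element sset" assume X: "X \<in> Obj SS" and "Z \<in> range sset_classifier"
  then obtain m where Z: "Z = sset_classifier m" by blast
  have i: "RlzMap SS (generator \<nu>) \<in> Mor SS" "Dom (RlzMap SS (generator \<nu>)) = Rlz SS (Dom (generator \<nu>))"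
    using g(3) by (auto simp: Hom_def)
  show "extends SS Z (Tuple SS (Pr1 SS X (Rlz SS (Dom (generator \<nu>))))
      (RlzMap SS (generator \<nu>) \<cdot>\<^bsub>SS\<^esub> Pr2 SS X (Rlz SS (Dom (generator \<nu>)))))"
    unfolding Z using X g(1,4) i by (intro sset_extends_classifier) (auto simp: inj_on_def)
qed

end

context inaccessible_universe
begin

section \<open>Compactly generated spaces\<close>

definition test_space :: "'z topology => bool" where
  "test_space L \<longleftrightarrow> small TYPE('u) (topspace L) \<and> compact_space L \<and> Hausdorff_space L"

text \<open>Test spaces on other types may be used as well, since a copy of them has points in the universe.\<close>

lemma k_open_test:
  fixes L :: "'z topology" and X :: "'u element topology"
  assumes W: "k_open X W" and L: "test_space L" and u: "continuous_map L X u"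
  shows "openin L {z \<in> topspace L. u z \<in> W}"
proof -
  have sm: "small TYPE('u) (topspace L)" and cp: "compact_space L" and hd: "Hausdorff_space L"
    using L by (auto simp: test_space_def)
  obtain c :: "'z => 'u" where c: "inj_on c (topspace L)" using small_embedding[OF sm] .
  define e :: "'z => 'u element" where "e = (\<lambda>z. Atom (c z))"
  define d where "d = inv_into (topspace L) e"
  have e: "inj_on e (topspace L)" using c by (auto simp: e_def inj_on_def)
  have de: "d (e z) = z" if "z \<in> topspace L" for z using that e by (simp add: d_def)
  define M where "M = pullback_topology (e ` topspace L) d L"
  have tM: "topspace M = e ` topspace L" by (auto simp: M_def topspace_pullback_topology de)
  have ce: "continuous_map L M e"
    unfolding M_def
    by (rule continuous_map_pullback') (auto intro: continuous_map_eq[OF continuous_map_id] simp: de)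
  have cd: "continuous_map M L d"
    unfolding M_def using continuous_map_pullback[OF continuous_map_id] by (simp add: o_def id_def)
  have "compact_space M"
    using image_compactin[OF cp[unfolded compact_space_def] ce] by (simp add: compact_space_def tM)
  moreover have "Hausdorff_space M"
    by (rule Hausdorff_space_injective_preimage[OF hd cd]) (auto simp: tM inj_on_def de)
  moreover have "small TYPE('u) (topspace M)" unfolding tM using sm by (rule small_image)
  moreover have "continuous_map M X (u \<circ> d)" by (rule continuous_map_compose[OF cd u])
  ultimately have "openin M {z \<in> topspace M. (u \<circ> d) z \<in> W}" using W unfolding k_open_def by blast
  then have "openin L {z \<in> topspace L. e z \<in> {z \<in> topspace M. (u \<circ> d) z \<in> W}}"
    using ce unfolding continuous_map_def by blast
  moreover have "{z \<in> topspace L. e z \<in> {z \<in> topspace M. (u \<circ> d) z \<in> W}} = {z \<in> topspace L. u z \<in> W}"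
    by (auto simp: tM de dest: inj_onD[OF e])
  ultimately show ?thesis by simp
qed

lemma k_openI:
  fixes X :: "'u element topology"
  assumes "W \<subseteq> topspace X"
    and "\<And>(L :: 'u element topology) u. test_space L ==> continuous_map L X u ==> openin L {z \<in> topspace L. u z \<in> W}"
  shows "k_open X W"
  using assms unfolding k_open_def test_space_def by blast

lemma open_k_open: "openin (X :: 'u element topology) W ==> k_open X W"
  unfolding k_open_def using openin_subset by (auto simp: continuous_map_def)

lemma topspace_kify [simp]: "topspace (kify X) = topspace (X :: 'u element topology)"
proof (rule antisym)
  show "topspace (kify X) \<subseteq> topspace X"
  proof -
    have "openin (kify X) (topspace (kify X))" by (rule openin_topspace)
    then show ?thesis unfolding openin_kify k_open_def by blast
  qed
  show "topspace X \<subseteq> topspace (kify X)"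
    by (rule openin_subset) (simp add: openin_kify open_k_open)
qed

lemma kify_to: "continuous_map (kify X) (X :: 'u element topology) (\<lambda>x. x)"
  by (auto simp: continuous_map_def openin_kify open_k_open openin_subset Int_absorb1 Collect_conj_eq)

lemma test_into_kify:
  fixes L :: "'z topology" and X :: "'u element topology"
  assumes "test_space L" "continuous_map L X u"
  shows "continuous_map L (kify X) u"
  unfolding continuous_map_def openin_kify topspace_kify
  using assms(2) k_open_test[OF _ assms] by (auto simp: continuous_map_def)

lemma kify_generated: "compactly_generated (kify (X :: 'u element topology))"
  unfolding compactly_generated_def openin_kify
proof (intro allI impI)
  fix W assume W: "k_open (kify X) W"
  show "k_open X W"
  proof (rule k_openI)
    show "W \<subseteq> topspace X" using W by (simp add: k_open_def)
    show "openin L {z \<in> topspace L. u z \<in> W}" if "test_space L" "continuous_map L X u"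
      for L :: "'u element topology" and u
      using k_open_test[OF W that(1) test_into_kify[OF that]] .
  qed
qed

lemma generated_continuous:
  fixes A :: "'u element topology"
  assumes A: "compactly_generated A" and f: "f ` topspace A \<subseteq> topspace X"
    and test: "\<And>(L :: 'u element topology) u. test_space L ==> continuous_map L A u ==> continuous_map L X (\<lambda>z. f (u z))"
  shows "continuous_map A X f"
  unfolding continuous_map_def
proof (intro conjI allI impI)
  show "f \<in> topspace A \<rightarrow> topspace X" using f by blast
  fix V assume V: "openin X V"
  have "k_open A {x \<in> topspace A. f x \<in> V}"
  proof (rule k_openI)
    fix L :: "'u element topology" and u assume L: "test_space L" and u: "continuous_map L A u"
    have "{z \<in> topspace L. u z \<in> {x \<in> topspace A. f x \<in> V}} = {z \<in> topspace L. f (u z) \<in> V}"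
      using u by (auto simp: continuous_map_def)
    then show "openin L {z \<in> topspace L. u z \<in> {x \<in> topspace A. f x \<in> V}}"
      using openin_continuous_map_preimage[OF test[OF L u] V] by simp
  qed auto
  then show "openin A {x \<in> topspace A. f x \<in> V}" using A unfolding compactly_generated_def by blast
qed

lemma into_kify:
  fixes A X :: "'u element topology"
  assumes A: "compactly_generated A" and f: "continuous_map A X f"
  shows "continuous_map A (kify X) f"
proof (rule generated_continuous[OF A])
  show "f ` topspace A \<subseteq> topspace (kify X)" using f by (auto simp: continuous_map_def)
  show "continuous_map L (kify X) (\<lambda>z. f (u z))" if "test_space L" "continuous_map L A u"
    for L :: "'u element topology" and u
    using test_into_kify[OF that(1) continuous_map_compose[OF that(2) f]] by (simp add: o_def)
qed

lemma test_generated: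
  fixes X :: "'u element topology"
  assumes X: "test_space X" shows "compactly_generated X"
  unfolding compactly_generated_def
proof (intro allI impI)
  fix W assume W: "k_open X W"
  then have "{z \<in> topspace X. z \<in> W} = W" by (auto simp: k_open_def)
  then show "openin X W" using k_open_test[OF W X continuous_map_id[unfolded id_def]] by simp
qed

lemma discrete_generated: "compactly_generated (discrete_topology (U :: 'u element set))"
  unfolding compactly_generated_def k_open_def by simp

definition box :: "'u element topology => 'u element topology => 'u element topology" where
  "box X Y = pullback_topology {Pair x y | x y. True} (\<lambda>p. (pfst p, psnd p)) (prod_topology X Y)"

lemma top_product_kify: "top_product (X :: 'u element topology) Y = kify (box X Y)"
  by (simp add: top_product_def box_def)

lemma topspace_box: "topspace (box X Y) = {Pair x y | x y. x \<in> topspace X \<and> y \<in> topspace Y}"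
  by (auto simp: box_def topspace_pullback_topology)

lemma topspace_top_product [simp]: "topspace (top_product (X :: 'u element topology) Y) = {Pair x y | x y. x \<in> topspace X \<and> y \<in> topspace Y}"
  by (simp add: top_product_kify topspace_box)

lemma box_proj: "continuous_map (box X Y) X pfst" "continuous_map (box X Y) Y psnd"
  unfolding box_def
  using continuous_map_pullback[OF continuous_map_fst, of _ "\<lambda>p. (pfst p, psnd p)" X Y]
    continuous_map_pullback[OF continuous_map_snd, of _ "\<lambda>p. (pfst p, psnd p)" X Y]
  by (auto simp: o_def)

lemma product_proj: "continuous_map (top_product X Y) (X :: 'u element topology) pfst" "continuous_map (top_product X Y) (Y :: 'u element topology) psnd"
  using continuous_map_compose[OF kify_to box_proj(1)] continuous_map_compose[OF kify_to box_proj(2)]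
  by (auto simp: o_def top_product_kify)

lemma into_box: "continuous_map A X f ==> continuous_map A Y g ==> continuous_map A (box X Y) (\<lambda>a. Pair (f a) (g a))"
  unfolding box_def by (rule continuous_map_pullback') (auto simp: o_def intro: continuous_map_pairedI)

lemma into_product: "compactly_generated (A :: 'u element topology) ==> continuous_map A (X :: 'u element topology) f ==> continuous_map A Y g ==>
    continuous_map A (top_product X Y) (\<lambda>a. Pair (f a) (g a))"
  using into_kify[OF _ into_box[of A X f Y g]] by (simp only: top_product_kify)

lemma test_into_product: "test_space L ==> continuous_map L (X :: 'u element topology) f ==> continuous_map L Y g ==>
    continuous_map L (top_product X Y) (\<lambda>a. Pair (f a) (g a))"
  using test_into_kify[OF _ into_box[of L X f Y g]] by (simp only: top_product_kify)

lemma test_closed_subspace: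
  assumes L: "test_space L" and F: "closedin L F"
  shows "test_space (subtopology L F)" "topspace (subtopology L F) = F"
proof -
  have F': "F \<subseteq> topspace L" using F by (rule closedin_subset)
  show "topspace (subtopology L F) = F" using F' by auto
  show "test_space (subtopology L F)"
    using L F F' by (auto simp: test_space_def Hausdorff_space_subtopology compact_space_subtopology
        closedin_compact_space Int_absorb1 intro: small_subset[of "TYPE('u)" "topspace L"])
qed

lemma test_prod:
  assumes "test_space L" "test_space M"
  shows "test_space (prod_topology L M)"
  using assms small_Times[OF inaccessible_u]
  by (auto simp: test_space_def compact_space_prod_topology Hausdorff_space_prod_topology)

abbreviation TT :: "('u element topology, 'u element => 'u element) spaces" where
  "TT \<equiv> CGTop"

lemma top_obj: "X \<in> Obj TT \<longleftrightarrow> compactly_generated X \<and> small TYPE('u) (topspace X)"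
  by (simp add: CGTop_def)

lemma top_mor: "f \<in> Mor TT \<longleftrightarrow> Dom f \<in> Obj TT \<and> Cod f \<in> Obj TT \<and>
    continuous_map (Dom f) (Cod f) (Fn f) \<and> Fn f \<in> extensional (topspace (Dom f))"
  by (cases f) (auto simp: CGTop_def)

lemma restrict_continuous: "continuous_map X Y f ==> continuous_map X Y (restrict f (topspace X))"
  by (rule continuous_map_eq) auto

lemma top_Arrow_mor:
  assumes "X \<in> Obj TT" "Y \<in> Obj TT" "continuous_map X Y f"
  shows "Arrow X (\<lambda>x\<in>topspace X. f x) Y \<in> Mor TT"
  using assms restrict_continuous by (auto simp: top_mor)

lemma top_product_obj: "X \<in> Obj TT ==> Y \<in> Obj TT ==> top_product X Y \<in> Obj TT"
proof -
  assume "X \<in> Obj TT" "Y \<in> Obj TT"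
  moreover have "topspace (top_product X Y) = (\<lambda>(x, y). Pair x y) ` (topspace X \<times> topspace Y)" by auto
  ultimately have "small TYPE('u) (topspace (top_product X Y))"
    unfolding top_obj by (simp only: small_image small_Times[OF inaccessible_u])
  then show ?thesis unfolding top_obj using kify_generated by (simp only: top_product_kify simp_thms)
qed

lemma discrete_obj: "discrete_topology {x :: 'u element} \<in> Obj TT"
  using small_singleton[OF inaccessible_u] by (simp add: top_obj discrete_generated)

lemma constant_continuous: "y \<in> topspace Y ==> continuous_map X Y (\<lambda>_. y)"
  by (simp add: continuous_map_const)

sublocale top: concrete_spaces TT "\<lambda>X m. topspace X" "\<lambda>X n \<theta> x. x" "\<lambda>f m. Fn f"
proof
  show "inaccessible TYPE('u)" by (rule inaccessible_u)
  fix X Y :: "'u element topology"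
  assume X: "X \<in> Obj TT"
  then have Xc: "compactly_generated X" by (simp add: top_obj)
  show "x \<in> topspace X ==> x \<in> topspace X" for x .
  show "small TYPE('u) (topspace X)" using X by (simp add: top_obj)
  have "Arrow X (\<lambda>x\<in>topspace X. x) X \<in> Mor TT"
    by (rule top_Arrow_mor[OF X X]) (rule continuous_map_id[unfolded id_def])
  then show "Ident TT X \<in> Mor TT" by (simp add: CGTop_def)
  have "Arrow X (\<lambda>x\<in>topspace X. Simplex [0]) (discrete_topology {Simplex [0]}) \<in> Mor TT"
    by (rule top_Arrow_mor[OF X discrete_obj]) (rule constant_continuous, simp)
  then show "Bang TT X \<in> Mor TT" by (simp add: CGTop_def)
  {
    assume Y: "Y \<in> Obj TT"
    note XY = top_product_obj[OF X Y]
    then show "Prod TT X Y \<in> Obj TT" by (simp add: CGTop_def)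
    show "Pr1 TT X Y \<in> Mor TT"
      using top_Arrow_mor[OF XY X product_proj(1)] by (simp add: CGTop_def)
    show "Pr2 TT X Y \<in> Mor TT"
      using top_Arrow_mor[OF XY Y product_proj(2)] by (simp add: CGTop_def)
  }
  fix y assume y: "y \<in> topspace X"
  let ?D = "discrete_topology {Simplex [0] :: 'u element}"
  have "Arrow ?D (\<lambda>x\<in>topspace ?D. y) X \<in> Mor TT"
    by (rule top_Arrow_mor[OF discrete_obj X constant_continuous[OF y]])
  then show "\<exists>u \<in> Hom TT (One TT) X. \<forall>m. \<forall>s \<in> topspace (One TT). Fn u s = y"
    by (intro bexI[of _ "Arrow ?D (\<lambda>x\<in>topspace ?D. y) X"]) (auto simp: Hom_def CGTop_def)
next
  fix f g :: "('u element topology, 'u element => 'u element) arrow"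
  assume f: "f \<in> Mor TT"
  show "Dom f \<in> Obj TT \<and> Cod f \<in> Obj TT" using f top_mor by blast
  show "x \<in> topspace (Dom f) ==> Fn f x \<in> topspace (Cod f)" for x using f by (auto simp: top_mor continuous_map_def)
  assume g: "g \<in> Mor TT"
  {
    assume "Dom f = Dom g" "Cod f = Cod g" "\<And>(m :: nat) x. x \<in> topspace (Dom f) ==> Fn f x = Fn g x"
    moreover have "Fn f = Fn g"
      by (rule extensionalityI[of _ "topspace (Dom f)"]) (use f g calculation in \<open>auto simp: top_mor\<close>)
    ultimately show "f = g" by (metis arrow.collapse)
  }
  {
    assume "Cod f = Dom g"
    then have "Arrow (Dom f) (\<lambda>x\<in>topspace (Dom f). Fn g (Fn f x)) (Cod g) \<in> Mor TT"
      using f g continuous_map_compose[of "Dom f" "Cod f" "Fn f" "Cod g" "Fn g"]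
      by (intro top_Arrow_mor) (auto simp: top_mor o_def)
    then show "g \<cdot>\<^bsub>TT\<^esub> f \<in> Mor TT" by (simp add: CGTop_def)
  }
  {
    assume "Dom f = Dom g"
    then have "Arrow (Dom f) (\<lambda>x\<in>topspace (Dom f). Pair (Fn f x) (Fn g x)) (top_product (Cod f) (Cod g)) \<in> Mor TT"
      using f g top_product_obj
      by (intro top_Arrow_mor into_product) (auto simp: top_mor top_obj[of "Dom g"])
    then show "Tuple TT f g \<in> Mor TT" by (simp add: CGTop_def)
  }
next
  show "One TT \<in> Obj TT" using discrete_obj by (simp add: CGTop_def)
  show "\<exists>s. topspace (One TT) = {s}" by (simp add: CGTop_def)
qed (auto simp: CGTop_def)

lemma top_hm: "top.hm X Y \<phi> \<longleftrightarrow> X \<in> Obj TT \<and> Y \<in> Obj TT \<and> continuous_map X Y (\<phi> 0) \<and>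
    (\<forall>m. \<forall>x \<in> topspace X. \<phi> m x = \<phi> 0 x)"
proof
  assume "top.hm X Y \<phi>"
  then obtain f where f: "f \<in> Mor TT" "Dom f = X" "Cod f = Y" "\<And>m x. x \<in> topspace X ==> Fn f x = \<phi> m x"
    by (auto simp: top.hm_def Hom_def)
  have "continuous_map X Y (Fn f)" using f(1-3) by (simp add: top_mor)
  then have "continuous_map X Y (\<phi> 0)" by (rule continuous_map_eq) (rule f(4))
  moreover have "\<phi> m x = \<phi> 0 x" if "x \<in> topspace X" for m x
    using f(4)[OF that, of m] f(4)[OF that, of 0] by simp
  ultimately show "X \<in> Obj TT \<and> Y \<in> Obj TT \<and> continuous_map X Y (\<phi> 0) \<and>
    (\<forall>m. \<forall>x \<in> topspace X. \<phi> m x = \<phi> 0 x)" using f(1-3) top_mor by blast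
next
  assume *: "X \<in> Obj TT \<and> Y \<in> Obj TT \<and> continuous_map X Y (\<phi> 0) \<and>
    (\<forall>m. \<forall>x \<in> topspace X. \<phi> m x = \<phi> 0 x)"
  let ?f = "Arrow X (\<lambda>x\<in>topspace X. \<phi> 0 x) Y"
  have "?f \<in> Mor TT" by (rule top_Arrow_mor) (use * in blast)+
  then have "?f \<in> Hom TT X Y" by (simp add: Hom_def)
  moreover have "Fn ?f x = \<phi> m x" if x: "x \<in> topspace X" for m x
  proof -
    have "Fn ?f x = \<phi> 0 x" using x by simp
    also have "\<dots> = \<phi> m x" using * x by metis
    finally show ?thesis .
  qed
  ultimately show "top.hm X Y \<phi>" unfolding top.hm_def by blast
qed


section \<open>Mapping spaces\<close>

definition map_set :: "'u element topology => 'u element topology => ('u element => 'u element) set" where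
  "map_set B X = {f \<in> extensional (topspace B). continuous_map B X f}"

definition map_code :: "'u element topology => 'u element topology => ('u element => 'u element) => 'u element" where
  "map_code B X f = Atom ((SOME c. inj_on c (map_set B X)) f)"

definition map_decode where
  "map_decode B X = inv_into (map_set B X) (map_code B X)"

text \<open>The compact-open topology, with compact test spaces over \<open>B\<close> in place of compact subsets.\<close>

definition sub_basic :: "'u element topology => 'u element topology => 'u element topology =>
    ('u element => 'u element) => 'u element set => ('u element => 'u element) set" where
  "sub_basic B X K h V = {f \<in> map_set B X. \<forall>k \<in> topspace K. f (h k) \<in> V}"

definition compact_open :: "'u element topology => 'u element topology => ('u element => 'u element) topology" where
  "compact_open B X = topology_generated_by (insert (map_set B X)
     {sub_basic B X K h V | K h V. test_space K \<and> continuous_map K B h \<and> openin X V})"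

definition top_exp :: "'u element topology => 'u element topology => 'u element topology" where
  "top_exp B X = kify (pullback_topology (map_code B X ` map_set B X) (map_decode B X) (compact_open B X))"

context
  fixes B X assumes B: "B \<in> Obj TT" and X: "X \<in> Obj TT"
begin

lemma small_map_set: "small TYPE('u) (map_set B X)"
proof (rule small_subset)
  show "small TYPE('u) (topspace B \<rightarrow>\<^sub>E topspace X)"
    using B X by (intro small_PiE[OF inaccessible_u]) (auto simp: top_obj)
  show "map_set B X \<subseteq> topspace B \<rightarrow>\<^sub>E topspace X"
    by (auto simp: map_set_def continuous_map_def PiE_def)
qed

lemma map_code_inj: "inj_on (map_code B X) (map_set B X)"
proof -
  have "\<exists>c :: _ => 'u. inj_on c (map_set B X)" using small_embedding[OF small_map_set] by blast
  then have "inj_on (SOME c :: _ => 'u. inj_on c (map_set B X)) (map_set B X)" by (rule someI_ex)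
  then show ?thesis by (simp add: map_code_def inj_on_def)
qed

lemma map_decode_code [simp]: "f \<in> map_set B X ==> map_decode B X (map_code B X f) = f"
  unfolding map_decode_def by (rule inv_into_f_f[OF map_code_inj])

lemma topspace_compact_open [simp]: "topspace (compact_open B X) = map_set B X"
  by (auto simp: compact_open_def sub_basic_def)

lemma topspace_top_exp: "topspace (top_exp B X) = map_code B X ` map_set B X"
  by (auto simp: top_exp_def topspace_pullback_topology)

lemma decode_continuous: "continuous_map (top_exp B X) (compact_open B X) (map_decode B X)"
  using continuous_map_compose[OF kify_to continuous_map_pullback[OF continuous_map_id]]
  by (simp add: top_exp_def o_def id_def)

lemma top_exp_obj: "top_exp B X \<in> Obj TT"
  unfolding top_obj using kify_generated small_image[OF small_map_set] by (simp add: topspace_top_exp) (simp add: top_exp_def)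

text \<open>
  Along a test map to \<open>X\<^sup>B \<times> B\<close> the evaluation is continuous, since a compact Hausdorff space is regular: every
  point of it has a closed, hence compact, neighbourhood that is mapped to a given open subset of \<open>X\<close>.
\<close>

lemma eval_continuous: "continuous_map (top_product (top_exp B X) B) X (\<lambda>p. map_decode B X (pfst p) (psnd p))"
proof (rule generated_continuous)
  show "compactly_generated (top_product (top_exp B X) B)"
    using top_product_obj[OF top_exp_obj B] by (simp add: top_obj)
  show "(\<lambda>p. map_decode B X (pfst p) (psnd p)) ` topspace (top_product (top_exp B X) B) \<subseteq> topspace X"
    by (auto simp: topspace_top_exp map_set_def continuous_map_def)
  fix L :: "'u element topology" and u assume L: "test_space L" and u: "continuous_map L (top_product (top_exp B X) B) u"
  define a where "a = (\<lambda>z. map_decode B X (pfst (u z)))"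
  define b where "b = (\<lambda>z. psnd (u z))"
  have a: "continuous_map L (compact_open B X) a"
    using continuous_map_compose[OF continuous_map_compose[OF u product_proj(1)] decode_continuous]
    by (simp add: a_def o_def)
  have b: "continuous_map L B b" using continuous_map_compose[OF u product_proj(2)] by (simp add: b_def o_def)
  have am: "a z \<in> map_set B X" if "z \<in> topspace L" for z using a that by (auto simp: continuous_map_def)
  have bm: "b z \<in> topspace B" if "z \<in> topspace L" for z using b that by (auto simp: continuous_map_def)
  have "continuous_map L X (\<lambda>z. a z (b z))"
    unfolding continuous_map_def
  proof (intro conjI allI impI)
    show "(\<lambda>z. a z (b z)) \<in> topspace L \<rightarrow> topspace X"
      using am bm by (auto simp: map_set_def continuous_map_def)
    fix V assume V: "openin X V"
    have "\<exists>T. openin L T \<and> z \<in> T \<and> T \<subseteq> {z \<in> topspace L. a z (b z) \<in> V}"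
      if z: "z \<in> topspace L" "a z (b z) \<in> V" for z
    proof -
      have "continuous_map L X (\<lambda>y. a z (b y))"
        using continuous_map_compose[OF b, of X "a z"] am[OF z(1)] by (simp add: map_set_def o_def)
      then have O: "openin L {y \<in> topspace L. a z (b y) \<in> V}"
        using V by (rule openin_continuous_map_preimage)
      have "regular_space L" using L compact_Hausdorff_imp_regular_space unfolding test_space_def by blast
      then have "neighbourhood_base_of (closedin L) L" by (simp add: neighbourhood_base_of_closedin)
      moreover have "z \<in> {y \<in> topspace L. a z (b y) \<in> V}" using z by blast
      ultimately have "\<exists>U F. openin L U \<and> closedin L F \<and> z \<in> U \<and> U \<subseteq> F \<and>
          F \<subseteq> {y \<in> topspace L. a z (b y) \<in> V}"
        using O unfolding neighbourhood_base_of by (elim allE impE) (rule conjI)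
      then obtain U F where U: "openin L U" and F: "closedin L F" and UF: "z \<in> U" "U \<subseteq> F"
        and FO: "F \<subseteq> {y \<in> topspace L. a z (b y) \<in> V}"
        by (elim exE conjE)
      note K = test_closed_subspace[OF L F]
      have h: "continuous_map (subtopology L F) B b" using b by (rule continuous_map_from_subtopology)
      let ?N = "sub_basic B X (subtopology L F) b V"
      have "openin (compact_open B X) ?N"
        unfolding compact_open_def using K(1) h V by (intro topology_generated_by_Basis) blast
      then have P: "openin L {y \<in> topspace L. a y \<in> ?N}" using a by (rule openin_continuous_map_preimage[rotated])
      have "z \<in> {y \<in> topspace L. a y \<in> ?N}" using z(1) am[OF z(1)] FO K(2) by (auto simp: sub_basic_def)
      moreover have "{y \<in> topspace L. a y \<in> ?N} \<inter> U \<subseteq> {z \<in> topspace L. a z (b z) \<in> V}"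
        using UF K(2) by (auto simp: sub_basic_def)
      ultimately show ?thesis using openin_Int[OF P U] UF(1) by blast
    qed
    then show "openin L {z \<in> topspace L. a z (b z) \<in> V}"
      by (subst openin_subopen) blast
  qed
  then show "continuous_map L X (\<lambda>z. map_decode B X (pfst (u z)) (psnd (u z)))" by (simp only: a_def b_def)
qed

text \<open>
  The preimage of a subbasic open set under the transpose is the complement of the projection of a closed
  set along a compact space, and such projections are closed maps.
\<close>

lemma transpose_continuous:
  assumes A: "A \<in> Obj TT" and \<beta>: "continuous_map (top_product A B) X \<beta>"
  shows "a \<in> topspace A ==> (\<lambda>b\<in>topspace B. \<beta> (Pair a b)) \<in> map_set B X"
    and "continuous_map A (top_exp B X) (\<lambda>a. map_code B X (\<lambda>b\<in>topspace B. \<beta> (Pair a b)))"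
proof -
  let ?\<psi> = "\<lambda>a. (\<lambda>b\<in>topspace B. \<beta> (Pair a b))"
  show \<psi>: "?\<psi> a \<in> map_set B X" if a: "a \<in> topspace A" for a
  proof -
    have "continuous_map B (top_product A B) (\<lambda>b. Pair a b)"
      using B by (intro into_product constant_continuous a continuous_map_id[unfolded id_def]) (simp add: top_obj)
    from restrict_continuous[OF continuous_map_compose[OF this \<beta>]]
    show ?thesis by (simp add: map_set_def o_def)
  qed
  have "continuous_map A (compact_open B X) ?\<psi>"
  proof (rule generated_continuous)
    show "compactly_generated A" using A by (simp add: top_obj)
    show "?\<psi> ` topspace A \<subseteq> topspace (compact_open B X)" using \<psi> by auto
    fix L :: "'u element topology" and u assume L: "test_space L" and u: "continuous_map L A u"
    have um: "u z \<in> topspace A" if "z \<in> topspace L" for z using u that by (auto simp: continuous_map_def)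
    show "continuous_map L (compact_open B X) (\<lambda>z. ?\<psi> (u z))"
      unfolding compact_open_def continuous_on_generated_topo_iff
    proof (intro conjI allI impI)
      show "(\<lambda>z. ?\<psi> (u z)) ` topspace L \<subseteq> \<Union> (insert (map_set B X)
          {sub_basic B X K h V | K h V. test_space K \<and> continuous_map K B h \<and> openin X V})"
        using \<psi> um by blast
      fix N assume "N \<in> insert (map_set B X)
          {sub_basic B X K h V | K h V. test_space K \<and> continuous_map K B h \<and> openin X V}"
      then consider "N = map_set B X" | K h V where "N = sub_basic B X K h V" "test_space K" "continuous_map K B h" "openin X V"
        by blast
      then show "openin L ((\<lambda>z. ?\<psi> (u z)) -` N \<inter> topspace L)"
      proof cases
        case 1
        then have "(\<lambda>z. ?\<psi> (u z)) -` N \<inter> topspace L = topspace L" using \<psi> um by auto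
        then show ?thesis by simp
      next
        case (2 K h V)
        have hm: "h k \<in> topspace B" if "k \<in> topspace K" for k using 2(3) that by (auto simp: continuous_map_def)
        have "continuous_map (prod_topology L K) (top_product A B) (\<lambda>p. Pair (u (fst p)) (h (snd p)))"
          using continuous_map_compose[OF continuous_map_fst u] continuous_map_compose[OF continuous_map_snd 2(3)]
          by (intro test_into_product test_prod L 2) (auto simp: o_def)
        from continuous_map_compose[OF this \<beta>]
        have c: "continuous_map (prod_topology L K) X (\<lambda>p. \<beta> (Pair (u (fst p)) (h (snd p))))" by (simp add: o_def)
        let ?C = "topspace (prod_topology L K) - {p \<in> topspace (prod_topology L K). \<beta> (Pair (u (fst p)) (h (snd p))) \<in> V}"
        have "closedin (prod_topology L K) ?C"
          using closedin_diff[OF closedin_topspace openin_continuous_map_preimage[OF c 2(4)]] .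
        then have "closedin L (fst ` ?C)"
          using closed_map_fst[of K L] 2(2) unfolding closed_map_def test_space_def by blast
        then have "openin L (topspace L - fst ` ?C)" by (intro openin_diff) auto
        moreover have "(\<lambda>z. ?\<psi> (u z)) -` N \<inter> topspace L = topspace L - fst ` ?C"
        proof (intro equalityI subsetI)
          fix z assume "z \<in> (\<lambda>z. ?\<psi> (u z)) -` N \<inter> topspace L"
          then have z: "z \<in> topspace L" "?\<psi> (u z) \<in> N" by auto
          then have "\<beta> (Pair (u z) (h k)) \<in> V" if "k \<in> topspace K" for k
            using that hm[OF that] by (auto simp: 2(1) sub_basic_def)
          then show "z \<in> topspace L - fst ` ?C" using z(1) by auto
        next
          fix z assume "z \<in> topspace L - fst ` ?C"
          then have z: "z \<in> topspace L" "z \<notin> fst ` ?C" by auto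
          have "\<beta> (Pair (u z) (h k)) \<in> V" if k: "k \<in> topspace K" for k
          proof (rule ccontr)
            assume "\<beta> (Pair (u z) (h k)) \<notin> V"
            then have "(z, k) \<in> ?C" using z(1) k by simp
            then have "fst (z, k) \<in> fst ` ?C" by (rule imageI)
            then show False using z(2) by simp
          qed
          then have "?\<psi> (u z) \<in> N" using \<psi>[OF um[OF z(1)]] hm by (simp add: 2(1) sub_basic_def)
          then show "z \<in> (\<lambda>z. ?\<psi> (u z)) -` N \<inter> topspace L" using z(1) by blast
        qed
        ultimately show ?thesis by simp
      qed
    qed
  qed
  then have "continuous_map A (pullback_topology (map_code B X ` map_set B X) (map_decode B X) (compact_open B X))
      (\<lambda>a. map_code B X (?\<psi> a))"
    using \<psi> by (intro continuous_map_pullback') (auto intro: continuous_map_eq simp: o_def)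
  then show "continuous_map A (top_exp B X) (\<lambda>a. map_code B X (?\<psi> a))"
    using A unfolding top_exp_def by (intro into_kify) (simp_all add: top_obj)
qed

end

end


section \<open>Realizations of subcomplexes of a simplex\<close>

abbreviation Rn :: "(nat => real) topology" where "Rn \<equiv> powertop_real UNIV"

abbreviation simplex_space :: "nat => (nat => real) topology" where
  "simplex_space m \<equiv> subtopology Rn (standard_simplex m)"

text \<open>The barycentric coordinates with respect to the vertices of the ambient simplex.\<close>

definition position :: "nat \<times> nat list \<times> (nat => real) => nat => real" where
  "position = (\<lambda>(m, \<sigma>, t). push \<sigma> t)"

lemma position_simp [simp]: "position (m, \<sigma>, t) = push \<sigma> t"
  by (simp add: position_def)

lemma push_comp:
  assumes "set \<theta> \<subseteq> {..<length \<sigma>}"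
  shows "push (map ((!) \<sigma>) \<theta>) t = push \<sigma> (push \<theta> t)"
proof
  fix i
  let ?S = "{j. j < length \<theta> \<and> \<sigma> ! (\<theta> ! j) = i}" and ?T = "{k. k < length \<sigma> \<and> \<sigma> ! k = i}"
  have "(\<lambda>j. \<theta> ! j) ` ?S \<subseteq> ?T" using assms nth_mem by fastforce
  then have "(\<Sum>k\<in>?T. sum t {j \<in> ?S. \<theta> ! j = k}) = sum t ?S" by (intro sum.group) auto
  moreover have "(\<Sum>k\<in>?T. sum t {j \<in> ?S. \<theta> ! j = k}) = (\<Sum>k\<in>?T. push \<theta> t k)"
    unfolding push_def by (intro sum.cong) (auto intro!: arg_cong[where f="sum t"])
  moreover have "{j. j < length (map ((!) \<sigma>) \<theta>) \<and> map ((!) \<sigma>) \<theta> ! j = i} = ?S" by auto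
  ultimately show "push (map ((!) \<sigma>) \<theta>) t i = push \<sigma> (push \<theta> t) i" unfolding push_def by simp
qed

lemma push_simplex:
  assumes \<theta>: "\<theta> \<in> operators m n" and t: "t \<in> standard_simplex m"
  shows "push \<theta> t \<in> standard_simplex n"
proof -
  have l: "length \<theta> = Suc m" and s: "set \<theta> \<subseteq> {..n}" using \<theta> by (auto simp: operators_def)
  have t0: "0 \<le> t i" and ts: "(\<Sum>i<Suc m. t i) = 1" for i
    using t by (auto simp: standard_simplex_def lessThan_Suc_atMost)
  have p0: "0 \<le> push \<theta> t i" for i unfolding push_def by (intro sum_nonneg t0)
  have p1: "push \<theta> t i \<le> 1" for i
    unfolding push_def ts[symmetric] l by (rule sum_mono2) (auto simp: t0)
  have pz: "push \<theta> t i = 0" if "i > n" for i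
  proof -
    have "{j. j < length \<theta> \<and> \<theta> ! j = i} = {}" using s that nth_mem by fastforce
    then show ?thesis unfolding push_def by (simp only: sum.empty)
  qed
  have "\<theta> ! j \<le> n" if "j < Suc m" for j
  proof -
    have "\<theta> ! j \<in> set \<theta>" by (rule nth_mem) (use l that in simp)
    then show ?thesis using s by blast
  qed
  then have "(\<lambda>j. \<theta> ! j) ` {..<Suc m} \<subseteq> {..n}" by auto
  then have "(\<Sum>i\<in>{..n}. sum t {j \<in> {..<Suc m}. \<theta> ! j = i}) = sum t {..<Suc m}"
    by (intro sum.group) auto
  moreover have "{j \<in> {..<Suc m}. \<theta> ! j = i} = {j. j < length \<theta> \<and> \<theta> ! j = i}" for i using l by auto
  ultimately have "(\<Sum>i\<le>n. push \<theta> t i) = 1" unfolding push_def ts by simp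
  then show ?thesis using p0 p1 pz by (simp add: standard_simplex_def)
qed

lemma push_distinct:
  assumes "distinct F"
  shows "j < length F ==> push F u (F ! j) = u j" and "i \<notin> set F ==> push F u i = 0"
proof -
  assume "j < length F"
  then have "{k. k < length F \<and> F ! k = F ! j} = {j}" using assms by (auto simp: nth_eq_iff_index_eq)
  then show "push F u (F ! j) = u j" unfolding push_def by simp
next
  assume "i \<notin> set F"
  then have "{k. k < length F \<and> F ! k = i} = {}" by (auto simp: nth_mem)
  then show "push F u i = 0" unfolding push_def by (simp only: sum.empty)
qed

lemma operator_factors:
  assumes \<sigma>: "\<sigma> \<in> operators l n" and F: "F \<in> operators r n" "distinct F" and sub: "set \<sigma> \<subseteq> set F"
  obtains \<rho> where "\<rho> \<in> operators l r" "\<sigma> = map ((!) F) \<rho>"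
proof -
  define g where "g = (\<lambda>x. SOME k. k < length F \<and> F ! k = x)"
  have g: "g x < length F \<and> F ! g x = x" if "x \<in> set F" for x
    unfolding g_def by (rule someI_ex) (use that in \<open>auto simp: in_set_conv_nth\<close>)
  have mono: "g x \<le> g y" if x: "x \<in> set F" and y: "y \<in> set F" and "x \<le> y" for x y
  proof (rule ccontr)
    assume "\<not> g x \<le> g y"
    then have "F ! g y \<le> F ! g x" using g[OF x] F(1) by (intro sorted_nth_mono) (auto simp: operators_def)
    then have "x = y" using g[OF x] g[OF y] \<open>x \<le> y\<close> by simp
    then show False using \<open>\<not> g x \<le> g y\<close> by simp
  qed
  have "sorted (map g \<sigma>)"
    unfolding sorted_iff_nth_mono
  proof (intro allI impI)
    fix i j assume ij: "i \<le> j" "j < length (map g \<sigma>)"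
    then have "\<sigma> ! i \<le> \<sigma> ! j" using \<sigma> by (intro sorted_nth_mono) (auto simp: operators_def)
    moreover have "\<sigma> ! i \<in> set F" "\<sigma> ! j \<in> set F" using ij sub nth_mem[of i \<sigma>] nth_mem[of j \<sigma>] by auto
    ultimately show "map g \<sigma> ! i \<le> map g \<sigma> ! j" using mono ij by simp
  qed
  moreover have "set (map g \<sigma>) \<subseteq> {..r}" using g sub F(1) by (force simp: operators_def less_Suc_eq_le)
  ultimately have "map g \<sigma> \<in> operators l r" using \<sigma> by (simp add: operators_def)
  moreover have "\<sigma> = map ((!) F) (map g \<sigma>)" using g sub by (auto intro!: nth_equalityI simp: subset_iff)
  ultimately show ?thesis using that by blast
qed

lemma sorted_list_operator:
  assumes "A \<subseteq> {..n}" "A \<noteq> {}"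
  obtains F r where "F \<in> operators r n" "distinct F" "set F = A" "r \<le> n"
proof -
  have fin: "finite A" using assms(1) finite_subset by blast
  have "card A \<noteq> 0" using fin assms(2) by simp
  then obtain r where r: "card A = Suc r" using not0_implies_Suc by blast
  have "card A \<le> card {..n}" by (rule card_mono) (use assms in auto)
  then have "r \<le> n" using r by simp
  moreover have "sorted_list_of_set A \<in> operators r n" using fin r assms(1) by (simp add: operators_def)
  ultimately show ?thesis using that[of "sorted_list_of_set A" r] fin by simp
qed

locale subcomplex =
  fixes n :: nat and Q :: "nat set => bool"
  assumes antitone: "A \<subseteq> B ==> Q B ==> Q A"
begin

definition K :: "nat list sset" where "K = subsimplex n (\<lambda>\<sigma>. Q (set \<sigma>))"

lemma Smp_K: "\<sigma> \<in> Smp K m \<longleftrightarrow> \<sigma> \<in> operators m n \<and> Q (set \<sigma>)"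
  by (simp add: K_def subsimplex_def)

lemma real_points_K: "(m, \<sigma>, t) \<in> real_points K \<longleftrightarrow> \<sigma> \<in> operators m n \<and> Q (set \<sigma>) \<and> t \<in> standard_simplex m"
  by (simp add: real_points_def Smp_K)

lemma glue_K:
  assumes "\<theta> \<in> operators m k" "\<sigma> \<in> operators k n" "Q (set \<sigma>)" "t \<in> standard_simplex m"
  shows "((m, map ((!) \<sigma>) \<theta>, t), (k, \<sigma>, push \<theta> t)) \<in> real_glue K"
proof -
  have "Op K k \<theta> \<sigma> = map ((!) \<sigma>) \<theta>" using assms by (auto simp: K_def subsimplex_def)
  then show ?thesis using assms Smp_K unfolding real_glue_def by force
qed

lemma glue_position: "(p, q) \<in> real_glue K ==> position p = position q"
proof -
  assume "(p, q) \<in> real_glue K"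
  then obtain m k \<theta> \<sigma> t where *: "p = (m, Op K k \<theta> \<sigma>, t)" "q = (k, \<sigma>, push \<theta> t)" "\<theta> \<in> operators m k" "\<sigma> \<in> Smp K k"
    unfolding real_glue_def by blast
  have "Op K k \<theta> \<sigma> = map ((!) \<sigma>) \<theta>" using * Smp_K by (auto simp: K_def subsimplex_def)
  moreover have "set \<theta> \<subseteq> {..<length \<sigma>}" using * Smp_K by (auto simp: operators_def)
  ultimately show ?thesis using * push_comp by simp
qed

lemma linked_position: "(p, q) \<in> (real_glue K \<union> (real_glue K)\<inverse>)\<^sup>* ==> position p = position q"
proof (induction rule: rtrancl_induct)
  case (step q r)
  then have "position q = position r" using glue_position[of q r] glue_position[of r q] by auto
  then show ?case using step by simp
qed simp

text \<open>
  Every point is linked to one in the open simplex of its support: discard the vanishing coordinates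
  (one face operator), then collapse repeated vertices (one degeneracy).
\<close>

lemma linked_canonical:
  assumes p: "(m, \<sigma>, t) \<in> real_points K"
  obtains r F u where "((m, \<sigma>, t), (r, F, u)) \<in> (real_glue K \<union> (real_glue K)\<inverse>)\<^sup>*"
    "F \<in> operators r n" "distinct F" "set F = {i. push \<sigma> t i \<noteq> 0}" "r \<le> n" "Q (set F)" "u \<in> standard_simplex r"
proof -
  have \<sigma>: "\<sigma> \<in> operators m n" and Q: "Q (set \<sigma>)" and t: "t \<in> standard_simplex m"
    using p by (auto simp: real_points_K)
  have l: "length \<sigma> = Suc m" using \<sigma> by (simp add: operators_def)
  have t0: "0 \<le> t i" "t i \<le> 1" and tz: "i > m ==> t i = 0" and ts: "(\<Sum>i\<le>m. t i) = 1" for i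
    using t by (auto simp: standard_simplex_def)
  let ?A = "{j. j \<le> m \<and> t j \<noteq> 0}"
  have "?A \<noteq> {}"
  proof
    assume "?A = {}"
    then have "(\<Sum>i\<le>m. t i) = 0" by (intro sum.neutral) auto
    then show False using ts by simp
  qed
  then obtain J k where J: "J \<in> operators k m" "distinct J" "set J = ?A"
    using sorted_list_operator[of ?A m] by blast
  have lJ: "length J = Suc k" using J(1) by (simp add: operators_def)
  define t1 where "t1 = (\<lambda>j. if j \<le> k then t (J ! j) else 0)"
  have push_t1: "push J t1 = t"
  proof
    fix i
    show "push J t1 i = t i"
    proof (cases "i \<in> set J")
      case True
      then obtain j where "j < length J" "J ! j = i" by (auto simp: in_set_conv_nth)
      then show ?thesis using push_distinct(1)[OF J(2), of j t1] lJ by (simp add: t1_def)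
    next
      case False
      then have "t i = 0" using J(3) tz[of i] by (cases "i \<le> m") auto
      then show ?thesis using push_distinct(2)[OF J(2) False] by simp
    qed
  qed
  have "(\<Sum>j\<le>k. t1 j) = (\<Sum>j<length J. t (J ! j))"
    by (intro sum.cong) (auto simp: lJ t1_def)
  also have "\<dots> = sum_list (map t J)" by (simp add: sum_list_sum_nth atLeast0LessThan)
  also have "\<dots> = sum t (set J)" by (rule sum_list_distinct_conv_sum_set[OF J(2)])
  also have "\<dots> = (\<Sum>i\<le>m. t i)" unfolding J(3) by (rule sum.mono_neutral_left) auto
  finally have t1: "t1 \<in> standard_simplex k" using ts t0 by (simp add: standard_simplex_def t1_def)
  define \<tau> where "\<tau> = map ((!) \<sigma>) J"
  have \<tau>: "\<tau> \<in> operators k n" unfolding \<tau>_def by (rule operator_comp[OF J(1) \<sigma>])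
  have step1: "((k, \<tau>, t1), (m, \<sigma>, t)) \<in> real_glue K"
    using glue_K[OF J(1) \<sigma> Q t1] by (simp add: push_t1 \<tau>_def)
  have sub: "set \<tau> \<subseteq> set \<sigma>" unfolding \<tau>_def using J(1) l by (auto simp: operators_def)
  have supp: "{i. push \<sigma> t i \<noteq> 0} = set \<tau>"
  proof -
    have "push \<sigma> t i = 0 \<longleftrightarrow> i \<notin> set \<tau>" for i
    proof -
      have "push \<sigma> t i = 0 \<longleftrightarrow> (\<forall>j. j < length \<sigma> \<and> \<sigma> ! j = i \<longrightarrow> t j = 0)"
        unfolding push_def by (subst sum_nonneg_eq_0_iff) (auto simp: t0)
      also have "\<dots> \<longleftrightarrow> i \<notin> set \<tau>" unfolding \<tau>_def using J(3) l by (auto simp: less_Suc_eq_le)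
      finally show ?thesis .
    qed
    then show ?thesis by auto
  qed
  have "set \<tau> \<subseteq> {..n}" "set \<tau> \<noteq> {}" using \<tau> by (auto simp: operators_def)
  then obtain F r where F: "F \<in> operators r n" "distinct F" "set F = set \<tau>" "r \<le> n"
    using sorted_list_operator by blast
  obtain \<rho> where \<rho>: "\<rho> \<in> operators k r" "\<tau> = map ((!) F) \<rho>"
    using operator_factors[OF \<tau> F(1,2)] F(3) by blast
  have QF: "Q (set F)" using antitone[OF sub Q] F(3) by simp
  have step2: "((k, \<tau>, t1), (r, F, push \<rho> t1)) \<in> real_glue K"
    using glue_K[OF \<rho>(1) F(1) QF t1] \<rho>(2) by simp
  have "((m, \<sigma>, t), (r, F, push \<rho> t1)) \<in> (real_glue K \<union> (real_glue K)\<inverse>)\<^sup>*"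
    by (rule rtrancl_trans[OF r_into_rtrancl r_into_rtrancl, of _ "(k, \<tau>, t1)"]) (use step1 step2 in auto)
  then show ?thesis
    by (rule that) (use F QF supp push_simplex[OF \<rho>(1) t1] in auto)
qed

lemma distinct_determined:
  assumes F: "F \<in> operators r n" "distinct F" "F' \<in> operators r' n" "distinct F'" "set F = set F'"
    and u: "u \<in> standard_simplex r" "u' \<in> standard_simplex r'" "push F u = push F' u'"
  shows "(r, F, u) = (r', F', u')"
proof -
  have FF: "F = F'" using F by (intro sorted_distinct_set_unique) (auto simp: operators_def)
  then have r: "r = r'" using F(1,3) by (auto simp: operators_def)
  have "u j = u' j" for j
  proof (cases "j \<le> r")
    case True
    then have "j < length F" using F(1) by (simp add: operators_def)
    then show ?thesis using push_distinct(1)[OF F(2), of j u] push_distinct(1)[OF F(2), of j u'] u(3) FF by simp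
  qed (use u r in \<open>auto simp: standard_simplex_def\<close>)
  then show ?thesis using FF r by auto
qed

text \<open>
  Points in the same position have the same support, hence the same canonical form: on the open simplex
  of the support the position determines the coordinates.
\<close>

lemma real_eq_iff:
  assumes p: "p \<in> real_points K" and q: "q \<in> real_points K"
  shows "(p, q) \<in> real_eq K \<longleftrightarrow> position p = position q"
proof
  assume "(p, q) \<in> real_eq K"
  then show "position p = position q" unfolding real_eq_def by (intro linked_position) auto
next
  assume eq: "position p = position q"
  let ?R = "real_glue K \<union> (real_glue K)\<inverse>"
  obtain m \<sigma> t where p': "p = (m, \<sigma>, t)" by (cases p)
  obtain m' \<sigma>' t' where q': "q = (m', \<sigma>', t')" by (cases q)
  obtain r F u where 1: "(p, (r, F, u)) \<in> ?R\<^sup>*" "F \<in> operators r n" "distinct F"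
    "set F = {i. push \<sigma> t i \<noteq> 0}" "u \<in> standard_simplex r"
    using linked_canonical[OF p[unfolded p']] unfolding p' by metis
  obtain r' F' u' where 2: "(q, (r', F', u')) \<in> ?R\<^sup>*" "F' \<in> operators r' n" "distinct F'"
    "set F' = {i. push \<sigma>' t' i \<noteq> 0}" "u' \<in> standard_simplex r'"
    using linked_canonical[OF q[unfolded q']] unfolding q' by metis
  have "push F u = push F' u'" using linked_position[OF 1(1)] linked_position[OF 2(1)] eq by simp
  then have "(r, F, u) = (r', F', u')"
    using 1 2 eq by (intro distinct_determined) (auto simp: p' q')
  moreover have "sym (?R\<^sup>*)" by (intro sym_rtrancl) (auto simp: sym_def)
  ultimately have "((r, F, u), q) \<in> ?R\<^sup>*" using symD[of "?R\<^sup>*", OF _ 2(1)] by simp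
  with 1(1) have "(p, q) \<in> ?R\<^sup>*" by (rule rtrancl_trans)
  then show "(p, q) \<in> real_eq K" using p q by (simp add: real_eq_def)
qed

definition fiber :: "(nat => real) => (nat \<times> nat list \<times> (nat => real)) set" where
  "fiber s = {q \<in> real_points K. position q = s}"

definition body :: "(nat => real) set" where
  "body = position ` real_points K"

lemma real_class: "p \<in> real_points K ==> real_eq K `` {p} = fiber (position p)"
proof -
  assume p: "p \<in> real_points K"
  have "q \<in> real_eq K `` {p} \<longleftrightarrow> q \<in> fiber (position p)" for q
    using real_eq_iff[OF p, of q] by (auto simp: fiber_def real_eq_def)
  then show ?thesis by blast
qed

lemma points_eq: "real_points K // real_eq K = fiber ` body"
  by (auto simp: quotient_def body_def real_class)

lemma fiber_nonempty: "s \<in> body ==> \<exists>p. p \<in> fiber s"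
  unfolding body_def fiber_def by blast

lemma fiber_inj: "s \<in> body ==> fiber s = fiber s' ==> s = s'"
  using fiber_nonempty[of s] by (auto simp: fiber_def)

lemma topspace_realization: "topspace (realization K) = fiber ` body"
proof (rule antisym)
  have "openin (realization K) (topspace (realization K))" by (rule openin_topspace)
  then show "topspace (realization K) \<subseteq> fiber ` body"
    unfolding openin_realization points_eq by blast
  have "openin (realization K) (fiber ` body)"
    unfolding openin_realization points_eq
  proof (intro conjI allI ballI subset_refl)
    fix m \<sigma> assume "\<sigma> \<in> Smp K m"
    then have "{t \<in> standard_simplex m. real_eq K `` {(m, \<sigma>, t)} \<in> fiber ` body} = topspace (simplex_space m)"
      by (auto simp: points_eq[symmetric] real_points_def intro!: quotientI)
    then show "openin (simplex_space m) {t \<in> standard_simplex m. real_eq K `` {(m, \<sigma>, t)} \<in> fiber ` body}"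
      by (simp only: openin_topspace)
  qed
  then show "fiber ` body \<subseteq> topspace (realization K)" by (rule openin_subset)
qed

lemma class_continuous:
  assumes \<sigma>: "\<sigma> \<in> Smp K m"
  shows "continuous_map (simplex_space m) (realization K) (\<lambda>t. fiber (push \<sigma> t))"
  unfolding continuous_map_def
proof (intro conjI allI impI)
  have c: "real_eq K `` {(m, \<sigma>, t)} = fiber (push \<sigma> t)" if "t \<in> standard_simplex m" for t
    using real_class[of "(m, \<sigma>, t)"] \<sigma> that by (simp add: real_points_def)
  show "(\<lambda>t. fiber (push \<sigma> t)) \<in> topspace (simplex_space m) \<rightarrow> topspace (realization K)"
    using \<sigma> by (force simp: topspace_realization body_def real_points_def)
  fix W assume "openin (realization K) W"
  then have "openin (simplex_space m) {t \<in> standard_simplex m. real_eq K `` {(m, \<sigma>, t)} \<in> W}"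
    using \<sigma> unfolding openin_realization by blast
  moreover have "{t \<in> standard_simplex m. real_eq K `` {(m, \<sigma>, t)} \<in> W} =
      {t \<in> topspace (simplex_space m). fiber (push \<sigma> t) \<in> W}"
    using c by auto
  ultimately show "openin (simplex_space m) {t \<in> topspace (simplex_space m). fiber (push \<sigma> t) \<in> W}" by simp
qed

lemma from_realization:
  assumes "\<And>m \<sigma>. \<sigma> \<in> Smp K m ==> continuous_map (simplex_space m) Y (\<lambda>t. f (fiber (push \<sigma> t)))"
  shows "continuous_map (realization K) Y f"
  unfolding continuous_map_def
proof (intro conjI allI impI)
  show "f \<in> topspace (realization K) \<rightarrow> topspace Y"
    using assms by (force simp: topspace_realization body_def real_points_def continuous_map_def)
  fix V assume V: "openin Y V"
  show "openin (realization K) {c \<in> topspace (realization K). f c \<in> V}"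
    unfolding openin_realization points_eq topspace_realization
  proof (intro conjI allI ballI)
    fix m \<sigma> assume \<sigma>: "\<sigma> \<in> Smp K m"
    have c: "real_eq K `` {(m, \<sigma>, t)} = fiber (push \<sigma> t)" "push \<sigma> t \<in> body" if "t \<in> standard_simplex m" for t
      using real_class[of "(m, \<sigma>, t)"] \<sigma> that by (force simp: real_points_def body_def)+
    have "{t \<in> standard_simplex m. real_eq K `` {(m, \<sigma>, t)} \<in> {c \<in> fiber ` body. f c \<in> V}} =
        {t \<in> topspace (simplex_space m). f (fiber (push \<sigma> t)) \<in> V}"
      using c by auto
    then show "openin (simplex_space m)
        {t \<in> standard_simplex m. real_eq K `` {(m, \<sigma>, t)} \<in> {c \<in> fiber ` body. f c \<in> V}}"
      using openin_continuous_map_preimage[OF assms[OF \<sigma>] V] by simp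
  qed blast
qed

lemma push_continuous: "continuous_map (simplex_space m) Rn (push \<sigma>)"
proof -
  have "continuous_map (simplex_space m) euclideanreal (\<lambda>t. push \<sigma> t i)" for i
    unfolding push_def
    by (intro continuous_map_sum continuous_map_from_subtopology continuous_map_product_projection) auto
  then show ?thesis by (simp add: continuous_map_componentwise_UNIV)
qed

text \<open>
  The position is a continuous injection into a Hausdorff space.
\<close>

lemma realization_Hausdorff: "Hausdorff_space (realization K)"
proof -
  define h where "h = (\<lambda>c. position (SOME p. p \<in> c))"
  have h: "h (fiber s) = s" if s: "s \<in> body" for s
  proof -
    have "(SOME p. p \<in> fiber s) \<in> fiber s" using fiber_nonempty[OF s] by (rule someI_ex)
    then show ?thesis by (simp add: h_def fiber_def)
  qed
  have "continuous_map (realization K) Rn h"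
  proof (rule from_realization)
    fix m \<sigma> assume \<sigma>: "\<sigma> \<in> Smp K m"
    have "h (fiber (push \<sigma> t)) = push \<sigma> t" if "t \<in> topspace (simplex_space m)" for t
      by (rule h) (use \<sigma> that in \<open>force simp: body_def real_points_def\<close>)
    then show "continuous_map (simplex_space m) Rn (\<lambda>t. h (fiber (push \<sigma> t)))"
      by (intro continuous_map_eq[OF push_continuous]) simp
  qed
  moreover have "inj_on h (topspace (realization K))"
    by (rule inj_onI) (auto simp: topspace_realization h)
  moreover have "Hausdorff_space Rn"
    by (simp add: Hausdorff_space_product_topology Hausdorff_space_euclidean)
  ultimately show ?thesis using Hausdorff_space_injective_preimage[of Rn "realization K" h] by fast
qed

text \<open>
  The simplices without repeated vertices already cover the realization, and there are finitely many of them.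
\<close>

lemma realization_compact: "compact_space (realization K)"
proof -
  let ?E = "\<lambda>F. (\<lambda>t. fiber (push F t)) ` standard_simplex (length F - 1)"
  let ?T = "{F. set F \<subseteq> {..n} \<and> length F \<le> Suc n \<and> length F > 0 \<and> F \<in> Smp K (length F - 1)}"
  have "?T \<subseteq> {F. set F \<subseteq> {..n} \<and> length F \<le> Suc n}" by blast
  then have "finite ?T" using finite_lists_length_le[of "{..n}" "Suc n"] finite_subset by blast
  moreover have "compactin (realization K) (?E F)" if "F \<in> ?T" for F
  proof (rule image_compactin[of "simplex_space (length F - 1)"])
    show "compactin (simplex_space (length F - 1)) (standard_simplex (length F - 1))"
      by (simp add: compactin_subtopology compactin_standard_simplex)
    show "continuous_map (simplex_space (length F - 1)) (realization K) (\<lambda>t. fiber (push F t))"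
      using that by (intro class_continuous) blast
  qed
  ultimately have "compactin (realization K) (\<Union>(?E ` ?T))" by (intro compactin_Union) auto
  moreover have "\<Union>(?E ` ?T) = topspace (realization K)"
  proof (rule antisym)
    show "\<Union>(?E ` ?T) \<subseteq> topspace (realization K)"
      using \<open>compactin (realization K) (\<Union>(?E ` ?T))\<close> by (rule compactin_subset_topspace)
    show "topspace (realization K) \<subseteq> \<Union>(?E ` ?T)"
    proof
      fix c assume "c \<in> topspace (realization K)"
      then obtain m \<sigma> t where p: "(m, \<sigma>, t) \<in> real_points K" and c: "c = fiber (push \<sigma> t)"
        by (force simp: topspace_realization body_def)
      obtain r F u where F: "((m, \<sigma>, t), (r, F, u)) \<in> (real_glue K \<union> (real_glue K)\<inverse>)\<^sup>*"
        "F \<in> operators r n" "r \<le> n" "Q (set F)" "u \<in> standard_simplex r"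
        using linked_canonical[OF p] by metis
      have "push \<sigma> t = push F u" using linked_position[OF F(1)] by simp
      moreover have r: "length F - 1 = r" using F(2) by (simp add: operators_def)
      ultimately have "c \<in> ?E F" using F(5) unfolding c by (simp add: image_iff) metis
      moreover have "F \<in> ?T" using F(2-4) r by (simp add: Smp_K) (auto simp: operators_def)
      ultimately show "c \<in> \<Union>(?E ` ?T)" by (rule_tac UnionI[of "?E F"]) (rule imageI)
    qed
  qed
  ultimately show ?thesis by (simp add: compact_space_def)
qed

end

text \<open>
  The map of realizations induced by an inclusion of subcomplexes preserves positions.
\<close>

lemma realization_inclusion:
  fixes n :: nat
  assumes "subcomplex Q" "subcomplex Q'" and QQ: "\<And>A. Q A ==> Q' A"
  defines "K \<equiv> subcomplex.K n Q" and "L \<equiv> subcomplex.K n Q'"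
  shows "s \<in> subcomplex.body n Q ==> s \<in> subcomplex.body n Q'"
    and "s \<in> subcomplex.body n Q ==>
      realization_map (inclusion K L) (subcomplex.fiber n Q s) = subcomplex.fiber n Q' s"
    and "continuous_map (realization K) (realization L) (realization_map (inclusion K L))"
proof -
  interpret K: subcomplex n Q by (rule assms)
  interpret L: subcomplex n Q' by (rule assms)
  have sub: "p \<in> real_points K.K ==> p \<in> real_points L.K" for p
    by (cases p) (auto simp: K.real_points_K L.real_points_K QQ)
  show b: "s \<in> L.body" if "s \<in> K.body" for s using that sub by (auto simp: K.body_def L.body_def)
  show f: "realization_map (inclusion K L) (K.fiber s) = L.fiber s" if s: "s \<in> K.body" for s
  proof -
    have "(\<lambda>(m, x, t). (m, Fn (inclusion K L) m x, t)) ` K.fiber s = (\<lambda>p. p) ` K.fiber s"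
      by (rule image_cong) (auto simp: K.fiber_def inclusion_def K_def real_points_def)
    then have "realization_map (inclusion K L) (K.fiber s) = real_eq L.K `` K.fiber s"
      by (simp add: realization_map_def inclusion_def L_def)
    also have "\<dots> = (\<Union>p \<in> K.fiber s. real_eq L.K `` {p})" by blast
    also have "\<dots> = (\<Union>p \<in> K.fiber s. L.fiber s)"
      by (rule SUP_cong) (auto simp: K.fiber_def L.real_class sub)
    also have "\<dots> = L.fiber s" using K.fiber_nonempty[OF s] by blast
    finally show ?thesis .
  qed
  show "continuous_map (realization K) (realization L) (realization_map (inclusion K L))"
    unfolding K_def
  proof (rule K.from_realization)
    fix m \<sigma> assume \<sigma>: "\<sigma> \<in> Smp K.K m"
    then have \<sigma>': "\<sigma> \<in> Smp L.K m" by (simp add: K.Smp_K L.Smp_K QQ)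
    have "L.fiber (push \<sigma> t) = realization_map (inclusion K.K L) (K.fiber (push \<sigma> t))"
      if "t \<in> topspace (simplex_space m)" for t
      by (rule f[unfolded K_def, symmetric]) (use \<sigma> that in \<open>force simp: K.body_def real_points_def\<close>)
    then show "continuous_map (simplex_space m) (realization L) (\<lambda>t. realization_map (inclusion K.K L) (K.fiber (push \<sigma> t)))"
      unfolding L_def by (intro continuous_map_eq[OF L.class_continuous[OF \<sigma>']]) (simp add: L_def)
  qed
qed

context inaccessible_universe
begin

section \<open>Realizations as compactly generated spaces\<close>

text \<open>
  The realization of a simplicial set has equivalence classes as points; they are turned into elements here.
\<close>

definition renamed :: "(nat \<times> nat list \<times> (nat => real)) set topology => 'u element topology" where
  "renamed R = pullback_topology (range Point) un_Point R"

lemma topspace_renamed: "topspace (renamed R) = Point ` topspace R"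
  unfolding renamed_def topspace_pullback_topology
proof (intro equalityI subsetI)
  fix p assume p: "p \<in> un_Point -` topspace R \<inter> range Point"
  then obtain c where "p = Point c" by blast
  with p show "p \<in> Point ` topspace R" by simp
next
  fix p assume "p \<in> Point ` topspace R"
  then obtain c where "c \<in> topspace R" "p = Point c" by blast
  then show "p \<in> un_Point -` topspace R \<inter> range Point" by simp
qed

lemma from_renamed: "continuous_map (renamed R) R un_Point"
  unfolding renamed_def using continuous_map_pullback[OF continuous_map_id] by (simp add: o_def id_def)

lemma into_renamed: "continuous_map A R g ==> continuous_map A (renamed R) (\<lambda>a. Point (g a))"
  unfolding renamed_def by (rule continuous_map_pullback') (auto simp: o_def)

lemma renamed_test:
  assumes "compact_space R" "Hausdorff_space R" "small TYPE('u) (topspace R)"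
  shows "test_space (renamed R)"
  unfolding test_space_def
proof (intro conjI)
  show "small TYPE('u) (topspace (renamed R))" unfolding topspace_renamed using assms(3) by (rule small_image)
  have "compactin (renamed R) ((\<lambda>a. Point a) ` topspace R)"
    by (rule image_compactin[OF _ into_renamed[OF continuous_map_id[unfolded id_def]]])
      (use assms(1) in \<open>simp add: compact_space_def\<close>)
  then show "compact_space (renamed R)" by (simp add: compact_space_def topspace_renamed)
  show "Hausdorff_space (renamed R)"
    by (rule Hausdorff_space_injective_preimage[OF assms(2) from_renamed])
      (auto simp: topspace_renamed inj_on_def)
qed

lemma (in subcomplex) fibers_indexed:
  "topspace (realization K) \<subseteq> (\<lambda>(m :: nat, x :: nat list, s). fiber s) ` UNIV"
  by (force simp: topspace_realization)

lemma realization_test: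
  assumes "subcomplex Q"
  shows "test_space (top_realization (subcomplex.K n Q) :: 'u element topology)"
proof -
  interpret subcomplex n Q by (rule assms)
  have "small TYPE('u) (topspace (realization K))"
    by (rule small_subset[of "TYPE('u)", OF small_image[OF small_simplex_points[OF inaccessible_u]] fibers_indexed])
  then show ?thesis
    using renamed_test[OF realization_compact realization_Hausdorff] by (simp add: top_realization_def renamed_def)
qed

lemma top_rlz:
  "Rlz TT K = renamed (realization K)"
  "RlzMap TT f = Arrow (renamed (realization (Dom f)))
     (\<lambda>p\<in>topspace (renamed (realization (Dom f))). Point (realization_map f (un_Point p)))
     (renamed (realization (Cod f)))"
  by (simp_all only: CGTop_def top_realization_def renamed_def spaces.select_convs)

lemma top_prod: "Prod TT X Y = top_product X Y"
  by (simp only: CGTop_def spaces.select_convs)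

lemma top_generator:
  assumes \<nu>: "\<nu> \<in> inclusions"
  defines "RK \<equiv> Rlz TT (Dom (generator \<nu>))" and "RL \<equiv> Rlz TT (Cod (generator \<nu>))"
  shows "test_space RK" and "test_space RL" and "topspace RL \<noteq> {}"
    and "RlzMap TT (generator \<nu>) \<in> Hom TT RK RL"
    and "inj_on (Fn (RlzMap TT (generator \<nu>))) (topspace RK)"
    and "|SIGMA m : (UNIV :: nat set). topspace RK| \<le>o |UNIV :: (nat \<times> nat list \<times> (nat => real)) set|"
proof -
  obtain n Q where g: "generator \<nu> = inclusion (subsimplex n (\<lambda>\<sigma>. Q (set \<sigma>))) (Delta n)"
    and Q: "\<And>A B. A \<subseteq> B ==> Q B ==> Q A"
    using generator_cases[OF \<nu>] by metis
  let ?Q = "\<lambda>_ :: nat set. True"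
  have sQ: "subcomplex Q" by unfold_locales (rule Q)
  have sT: "subcomplex ?Q" by unfold_locales
  interpret K: subcomplex n Q by (rule sQ)
  interpret L: subcomplex n ?Q by (rule sT)
  have g': "generator \<nu> = inclusion K.K L.K" by (simp add: g K.K_def L.K_def Delta_def)
  have RK: "RK = renamed (realization K.K)" and RL: "RL = renamed (realization L.K)"
    unfolding RK_def RL_def g' top_rlz inclusion_def arrow.sel by (rule refl)+
  show tK: "test_space RK" using realization_test[OF sQ] by (simp add: RK top_realization_def renamed_def)
  show tL: "test_space RL" using realization_test[OF sT] by (simp add: RL top_realization_def renamed_def)
  have oK: "RK \<in> Obj TT" "RL \<in> Obj TT"
    using tK tL test_generated unfolding top_obj test_space_def by blast+
  have "(0, [0], \<lambda>i. if i = 0 then 1 else 0) \<in> real_points L.K"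
    by (simp add: L.real_points_K operators_def)
  then have "topspace (realization L.K) \<noteq> {}" unfolding L.topspace_realization L.body_def by blast
  then show "topspace RL \<noteq> {}" by (simp add: RL topspace_renamed)
  let ?i = "realization_map (inclusion K.K L.K)"
  note inc = realization_inclusion[OF sQ sT TrueI]
  have map: "RlzMap TT (generator \<nu>) = Arrow RK (\<lambda>p\<in>topspace RK. Point (?i (un_Point p))) RL"
    unfolding g' top_rlz RK RL by (simp only: inclusion_def arrow.sel)
  have "continuous_map RK RL (\<lambda>p. Point (?i (un_Point p)))"
    unfolding RK RL
    by (rule into_renamed) (use continuous_map_compose[OF from_renamed inc(3)] in \<open>simp add: o_def\<close>)
  then have "RlzMap TT (generator \<nu>) \<in> Mor TT" unfolding map by (rule top_Arrow_mor[OF oK])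
  then show "RlzMap TT (generator \<nu>) \<in> Hom TT RK RL" by (simp add: Hom_def map)
  show "inj_on (Fn (RlzMap TT (generator \<nu>))) (topspace RK)"
  proof (rule inj_onI)
    fix p q assume p: "p \<in> topspace RK" and q: "q \<in> topspace RK"
      and eq: "Fn (RlzMap TT (generator \<nu>)) p = Fn (RlzMap TT (generator \<nu>)) q"
    obtain s t where s: "s \<in> K.body" "p = Point (K.fiber s)" and t: "t \<in> K.body" "q = Point (K.fiber t)"
      using p q by (auto simp: RK topspace_renamed K.topspace_realization)
    have "L.fiber s = L.fiber t" using eq p q by (simp add: map s t inc(2))
    then have "s = t" by (rule L.fiber_inj[OF inc(1)[OF s(1)]])
    then show "p = q" using s t by simp
  qed
  have "(SIGMA m : (UNIV :: nat set). topspace RK) \<subseteq>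
      (\<lambda>(m, x :: nat list, s). (m, Point (K.fiber s))) ` UNIV"
  proof
    fix q assume "q \<in> (SIGMA m : (UNIV :: nat set). topspace RK)"
    then obtain m s where "q = (m, Point (K.fiber s))"
      by (auto simp: RK topspace_renamed K.topspace_realization)
    then have "q = (\<lambda>(m, x :: nat list, s). (m, Point (K.fiber s))) (m, [], s)" by simp
    then show "q \<in> (\<lambda>(m, x :: nat list, s). (m, Point (K.fiber s))) ` UNIV" by (rule range_eqI)
  qed
  then show "|SIGMA m : (UNIV :: nat set). topspace RK| \<le>o |UNIV :: (nat \<times> nat list \<times> (nat => real)) set|"
    by (rule surj_imp_ordLeq)
qed


section \<open>The indiscrete and the Sierpinski space\<close>

abbreviation off :: "'u element" where "off \<equiv> Simplex [0]"
abbreviation on :: "'u element" where "on \<equiv> Simplex [1]"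

definition blunt :: "'u element topology" where
  "blunt = kify (topology_generated_by {{on, off}})"

definition sierpinski :: "'u element topology" where
  "sierpinski = kify (topology_generated_by {{on}, {on, off}})"

lemma topspace_blunt [simp]: "topspace blunt = {on, off}"
  by (simp add: blunt_def)

lemma topspace_sierpinski [simp]: "topspace sierpinski = {on, off}"
  by (auto simp: sierpinski_def)

lemma two_point_obj: "blunt \<in> Obj TT" "sierpinski \<in> Obj TT"
proof -
  have "small TYPE('u) {on, off}" by (rule small_countable[OF inaccessible_u]) simp
  then show "blunt \<in> Obj TT" "sierpinski \<in> Obj TT"
    unfolding top_obj topspace_blunt topspace_sierpinski
    by (simp_all only: blunt_def sierpinski_def kify_generated simp_thms)
qed

lemma into_blunt:
  assumes "X \<in> Obj TT" "\<And>x. x \<in> topspace X ==> f x \<in> {on, off}"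
  shows "continuous_map X blunt f"
  unfolding blunt_def
proof (rule into_kify)
  show "compactly_generated X" using assms(1) by (simp add: top_obj)
  have "f -` {on, off} \<inter> topspace X = topspace X" using assms(2) by blast
  then show "continuous_map X (topology_generated_by {{on, off}}) f"
    using assms(2) unfolding continuous_on_generated_topo_iff by (simp add: image_subset_iff)
qed

lemma into_sierpinski:
  assumes X: "X \<in> Obj TT" and U: "openin X U"
  shows "continuous_map X sierpinski (\<lambda>x. if x \<in> U then on else off)"
  unfolding sierpinski_def
proof (rule into_kify)
  show "compactly_generated X" using X by (simp add: top_obj)
  let ?f = "\<lambda>x. if x \<in> U then on else off"
  have 1: "?f -` {on} \<inter> topspace X = U" using openin_subset[OF U] by auto
  have 2: "?f -` {on, off} \<inter> topspace X = topspace X" by auto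
  have 3: "?f ` topspace X \<subseteq> \<Union> {{on}, {on, off}}" by auto
  show "continuous_map X (topology_generated_by {{on}, {on, off}}) ?f"
    unfolding continuous_on_generated_topo_iff
  proof (intro conjI allI impI)
    fix V assume "V \<in> {{on}, {on, off}}"
    then have "?f -` V \<inter> topspace X = U \<or> ?f -` V \<inter> topspace X = topspace X" using 1 2 by blast
    then show "openin X (?f -` V \<inter> topspace X)" using U openin_topspace[of X] by metis
  qed (rule 3)
qed

lemma open_on: "openin sierpinski {on}"
  unfolding sierpinski_def openin_kify
  by (rule open_k_open) (rule topology_generated_by_Basis, simp)

lemma sierpinski_open:
  assumes "continuous_map X sierpinski v"
  shows "openin X {x \<in> topspace X. v x = on}"
  using openin_continuous_map_preimage[OF assms open_on] by simp

lemma top_homI: "f \<in> Mor TT ==> Dom f = X ==> Cod f = Y ==> f \<in> Hom TT X Y"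
  by (simp add: Hom_def)

lemma top_ext:
  assumes "f \<in> Hom TT X Y" "g \<in> Hom TT X Y" "\<And>x. x \<in> topspace X ==> Fn f x = Fn g x"
  shows "f = g"
  by (rule top.ap_ext) (use assms in \<open>auto simp: Hom_def\<close>)

text \<open>
  Maps to the indiscrete space are arbitrary functions.
\<close>

lemma blunt_extends:
  assumes f: "f \<in> Mor TT" and inj: "inj_on (Fn f) (topspace (Dom f))"
  shows "extends TT blunt f"
  unfolding extends_def
proof
  fix v assume v: "v \<in> Hom TT (Dom f) blunt"
  have F: "Dom f \<in> Obj TT" "Cod f \<in> Obj TT" using f top_mor by blast+
  have vc: "Fn v x \<in> {on, off}" if "x \<in> topspace (Dom f)" for x
    using v that top.ap_pts[of v x] by (auto simp: Hom_def)
  let ?w = "\<lambda>y. if \<exists>x \<in> topspace (Dom f). Fn f x = y \<and> Fn v x = on then on else off"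
  define w where "w = Arrow (Cod f) (\<lambda>y\<in>topspace (Cod f). ?w y) blunt"
  have w: "w \<in> Mor TT" unfolding w_def
    by (rule top_Arrow_mor[OF F(2) two_point_obj(1) into_blunt[OF F(2)]]) simp
  have "w \<cdot>\<^bsub>TT\<^esub> f = v"
  proof (rule top_ext)
    show "w \<cdot>\<^bsub>TT\<^esub> f \<in> Hom TT (Dom f) blunt" using w f by (intro top_homI) (simp_all add: w_def)
    fix x assume x: "x \<in> topspace (Dom f)"
    have "Fn (w \<cdot>\<^bsub>TT\<^esub> f) x = ?w (Fn f x)" using w f x top.ap_pts[OF f x] by (simp add: w_def)
    also have "(\<exists>x' \<in> topspace (Dom f). Fn f x' = Fn f x \<and> Fn v x' = on) \<longleftrightarrow> Fn v x = on"
    proof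
      assume "\<exists>x' \<in> topspace (Dom f). Fn f x' = Fn f x \<and> Fn v x' = on"
      then obtain x' where x': "x' \<in> topspace (Dom f)" "Fn f x' = Fn f x" "Fn v x' = on" by blast
      have "x' = x" by (rule inj_onD[OF inj x'(2,1) x])
      then show "Fn v x = on" using x'(3) by simp
    qed (use x in blast)
    also have "(if Fn v x = on then on else off) = Fn v x" using vc[OF x] by auto
    finally show "Fn (w \<cdot>\<^bsub>TT\<^esub> f) x = Fn v x" .
  qed (rule v)
  then show "\<exists>w \<in> Hom TT (Cod f) blunt. w \<cdot>\<^bsub>TT\<^esub> f = v" using w by (auto simp: Hom_def w_def)
qed

text \<open>
  A map to the Sierpinski space is an open subset.  The image under \<open>f\<close> of its complement is closed, and the
  complement of this image is an open subset that restricts to the given one.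
\<close>

lemma sierpinski_extends:
  assumes f: "f \<in> Mor TT" and inj: "inj_on (Fn f) (topspace (Dom f))"
    and closed: "\<And>C. closedin (Dom f) C ==> closedin (Cod f) (Fn f ` C)"
  shows "extends TT sierpinski f"
  unfolding extends_def
proof
  fix v assume v: "v \<in> Hom TT (Dom f) sierpinski"
  have F: "Dom f \<in> Obj TT" "Cod f \<in> Obj TT" using f top_mor by blast+
  have vc: "Fn v x \<in> {on, off}" if "x \<in> topspace (Dom f)" for x
    using v that top.ap_pts[of v x] by (auto simp: Hom_def)
  have "continuous_map (Dom f) sierpinski (Fn v)" using v by (auto simp: Hom_def top_mor)
  then have "openin (Dom f) {x \<in> topspace (Dom f). Fn v x = on}" by (rule sierpinski_open)
  then have "closedin (Dom f) (topspace (Dom f) - {x \<in> topspace (Dom f). Fn v x = on})"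
    by (rule closedin_diff[OF closedin_topspace])
  from closed[OF this]
  have "openin (Cod f) (topspace (Cod f) - Fn f ` (topspace (Dom f) - {x \<in> topspace (Dom f). Fn v x = on}))"
    (is "openin _ ?U") by (rule openin_diff[OF openin_topspace])
  then have c: "continuous_map (Cod f) sierpinski (\<lambda>y. if y \<in> ?U then on else off)"
    by (rule into_sierpinski[OF F(2)])
  define w where "w = Arrow (Cod f) (\<lambda>y\<in>topspace (Cod f). if y \<in> ?U then on else off) sierpinski"
  have w: "w \<in> Mor TT" unfolding w_def by (rule top_Arrow_mor[OF F(2) two_point_obj(2) c])
  have "w \<cdot>\<^bsub>TT\<^esub> f = v"
  proof (rule top_ext)
    show "w \<cdot>\<^bsub>TT\<^esub> f \<in> Hom TT (Dom f) sierpinski" using w f by (intro top_homI) (simp_all add: w_def)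
    fix x assume x: "x \<in> topspace (Dom f)"
    note y = top.ap_pts[OF f x]
    have "Fn (w \<cdot>\<^bsub>TT\<^esub> f) x = (if Fn f x \<in> ?U then on else off)"
      using w f x y by (simp add: w_def del: Diff_iff)
    moreover have "Fn f x \<in> ?U \<longleftrightarrow> Fn v x = on"
    proof
      assume U: "Fn f x \<in> ?U"
      show "Fn v x = on"
      proof (rule ccontr)
        assume "Fn v x \<noteq> on"
        then have "x \<in> topspace (Dom f) - {x \<in> topspace (Dom f). Fn v x = on}" using x by simp
        then have "Fn f x \<in> Fn f ` (topspace (Dom f) - {x \<in> topspace (Dom f). Fn v x = on})" by (rule imageI)
        then show False using U by (rule_tac DiffD2)
      qed
    next
      assume on: "Fn v x = on"
      have "Fn f x \<notin> Fn f ` (topspace (Dom f) - {x \<in> topspace (Dom f). Fn v x = on})"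
      proof
        assume "Fn f x \<in> Fn f ` (topspace (Dom f) - {x \<in> topspace (Dom f). Fn v x = on})"
        then obtain x' where x': "Fn f x = Fn f x'" "x' \<in> topspace (Dom f)" "Fn v x' \<noteq> on" by blast
        have "x = x'" by (rule inj_onD[OF inj x'(1) x x'(2)])
        then show False using on x'(3) by simp
      qed
      then show "Fn f x \<in> ?U" by (rule DiffI[OF y])
    qed
    ultimately show "Fn (w \<cdot>\<^bsub>TT\<^esub> f) x = Fn v x" using vc[OF x] by auto
  qed (rule v)
  then show "\<exists>w \<in> Hom TT (Cod f) sierpinski. w \<cdot>\<^bsub>TT\<^esub> f = v" using w by (auto simp: Hom_def w_def)
qed

text \<open>
  The product of a space with a closed embedding of compact Hausdorff spaces is a closed embedding:
  a test map into the larger product pulls the smaller one back to a closed subspace of the test space,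
  on which it lifts.
\<close>

lemma product_closed:
  assumes X: "X \<in> Obj TT" and K: "test_space K" and L: "test_space L"
    and i: "continuous_map K L i" and inj: "inj_on i (topspace K)"
    and C: "closedin (top_product X K) C"
  shows "closedin (top_product X L) ((\<lambda>p. Pair (pfst p) (i (psnd p))) ` C)" (is "closedin _ (?f ` C)")
proof -
  have Lo: "L \<in> Obj TT" using L test_generated unfolding top_obj test_space_def by blast
  have g: "compactly_generated (top_product X L)" using top_product_obj[OF X Lo] by (simp add: top_obj)
  have Csub: "C \<subseteq> topspace (top_product X K)" using C by (rule closedin_subset)
  have im: "i k \<in> topspace L" if "k \<in> topspace K" for k using i that by (auto simp: continuous_map_def)
  have sub: "?f ` C \<subseteq> topspace (top_product X L)" using Csub im by auto
  have ci: "closedin L (i ` A)" if "closedin K A" for A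
  proof -
    have "compactin K A" using K that by (auto simp: test_space_def intro: closedin_compact_space)
    then have "compactin L (i ` A)" using i by (rule image_compactin)
    then show ?thesis using L by (auto simp: test_space_def intro: compactin_imp_closedin)
  qed
  have "k_open (top_product X L) (topspace (top_product X L) - ?f ` C)"
  proof (rule k_openI)
    fix M :: "'u element topology" and u assume M: "test_space M" and u: "continuous_map M (top_product X L) u"
    define a where "a = (\<lambda>z. pfst (u z))"
    define b where "b = (\<lambda>z. psnd (u z))"
    have a: "continuous_map M X a" using continuous_map_compose[OF u product_proj(1)] by (simp add: a_def o_def)
    have b: "continuous_map M L b" using continuous_map_compose[OF u product_proj(2)] by (simp add: b_def o_def)
    have uab: "u z = Pair (a z) (b z)" "u z \<in> topspace (top_product X L)" if "z \<in> topspace M" for z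
    proof -
      show "u z \<in> topspace (top_product X L)" using u that by (auto simp: continuous_map_def)
      then show "u z = Pair (a z) (b z)" by (auto simp: a_def b_def)
    qed
    define F where "F = {z \<in> topspace M. b z \<in> i ` topspace K}"
    have F: "closedin M F"
      unfolding F_def by (rule closedin_continuous_map_preimage[OF b ci[OF closedin_topspace]])
    note MF = test_closed_subspace[OF M F]
    define j where "j = (\<lambda>z. inv_into (topspace K) i (b z))"
    have j: "j z \<in> topspace K" "i (j z) = b z" if "z \<in> F" for z
      using that by (auto simp: F_def j_def inv_into_into f_inv_into_f)
    have "continuous_map (subtopology M F) K j"
      unfolding continuous_map_closedin MF(2)
    proof (intro conjI allI impI)
      show "j \<in> F \<rightarrow> topspace K" using j by blast
      fix A assume A: "closedin K A"
      have "{z \<in> F. j z \<in> A} = {z \<in> topspace (subtopology M F). b z \<in> i ` A}"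
        unfolding MF(2)
      proof (rule Collect_cong, rule conj_cong[OF refl])
        fix z assume z: "z \<in> F"
        show "j z \<in> A \<longleftrightarrow> b z \<in> i ` A"
        proof
          assume "j z \<in> A"
          then have "i (j z) \<in> i ` A" by (rule imageI)
          then show "b z \<in> i ` A" using j(2)[OF z] by simp
        next
          assume "b z \<in> i ` A"
          then obtain k where k: "b z = i k" "k \<in> A" by blast
          have "j z = k"
            by (rule inj_onD[OF inj _ j(1)[OF z]]) (use k j(2)[OF z] closedin_subset[OF A] in auto)
          then show "j z \<in> A" using k(2) by simp
        qed
      qed
      moreover have "continuous_map (subtopology M F) L b" using b by (rule continuous_map_from_subtopology)
      then have "closedin (subtopology M F) {z \<in> topspace (subtopology M F). b z \<in> i ` A}"
        using ci[OF A] by (rule closedin_continuous_map_preimage)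
      ultimately show "closedin (subtopology M F) {z \<in> F. j z \<in> A}" by (simp only:)
    qed
    then have "continuous_map (subtopology M F) (top_product X K) (\<lambda>z. Pair (a z) (j z))"
      by (intro test_into_product[OF MF(1)] continuous_map_from_subtopology[OF a])
    from closedin_continuous_map_preimage[OF this C]
    have "closedin M {z \<in> F. Pair (a z) (j z) \<in> C}"
      unfolding MF(2) using closedin_trans_full F by blast
    moreover have "{z \<in> F. Pair (a z) (j z) \<in> C} = {z \<in> topspace M. u z \<in> ?f ` C}"
    proof (intro equalityI subsetI)
      fix z assume "z \<in> {z \<in> F. Pair (a z) (j z) \<in> C}"
      then have z: "z \<in> F" "Pair (a z) (j z) \<in> C" by auto
      then have "z \<in> topspace M" by (simp add: F_def)
      moreover have "u z = ?f (Pair (a z) (j z))" using uab(1)[OF \<open>z \<in> topspace M\<close>] j(2)[OF z(1)] by simp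
      ultimately show "z \<in> {z \<in> topspace M. u z \<in> ?f ` C}" using z(2) by blast
    next
      fix z assume "z \<in> {z \<in> topspace M. u z \<in> ?f ` C}"
      then obtain p where z: "z \<in> topspace M" and p: "p \<in> C" "u z = ?f p" by blast
      obtain x k where pk: "p = Pair x k" "k \<in> topspace K" using p(1) Csub by auto
      have ab: "a z = x" "b z = i k" using p(2) by (auto simp: a_def b_def pk)
      then have zF: "z \<in> F" using z pk(2) by (auto simp: F_def)
      have "j z = k" using j[OF zF] ab(2) pk(2) inj by (auto dest: inj_onD)
      then show "z \<in> {z \<in> F. Pair (a z) (j z) \<in> C}" using zF p(1) pk(1) ab(1) by simp
    qed
    ultimately have "closedin M {z \<in> topspace M. u z \<in> ?f ` C}" by simp
    then have "openin M (topspace M - {z \<in> topspace M. u z \<in> ?f ` C})"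
      by (rule openin_diff[OF openin_topspace])
    moreover have "topspace M - {z \<in> topspace M. u z \<in> ?f ` C} =
        {z \<in> topspace M. u z \<in> topspace (top_product X L) - ?f ` C}" using uab(2) by blast
    ultimately show "openin M {z \<in> topspace M. u z \<in> topspace (top_product X L) - ?f ` C}" by simp
  qed blast
  then have "openin (top_product X L) (topspace (top_product X L) - ?f ` C)"
    using g unfolding compactly_generated_def by blast
  then show ?thesis using sub by (simp add: closedin_def)
qed


section \<open>Compactly generated spaces as a model\<close>

text \<open>
  A family of subsets that is closed under the trivial operators is constant, so its value at 0 is all of it.
\<close>

definition top_sub :: "'u element topology => (nat => 'u element set) => 'u element topology" where
  "top_sub X A = kify (subtopology X (A 0))"

lemma top_closed_sub:
  assumes "top.closed_sub X A" shows "A m = A 0" "A 0 \<subseteq> topspace X"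
proof -
  have "A n \<subseteq> A m" for m n
  proof
    fix x assume x: "x \<in> A n"
    have "replicate (Suc m) 0 \<in> operators m n" by (auto simp: operators_def)
    then show "x \<in> A m" using x assms unfolding top.closed_sub_def by blast
  qed
  then show "A m = A 0" by blast
  show "A 0 \<subseteq> topspace X" using assms unfolding top.closed_sub_def by blast
qed

lemma top_classify:
  assumes X: "X \<in> Obj TT"
  shows "\<exists>\<phi>. top.hm X blunt \<phi> \<and> (\<forall>x \<in> topspace X. \<phi> m x = on \<longleftrightarrow> x \<in> P)"
proof (intro exI conjI)
  show "top.hm X blunt (\<lambda>m x. if x \<in> P then on else off)"
    unfolding top_hm using X two_point_obj(1) into_blunt[OF X] by simp
qed simp

sublocale top: space_model TT "\<lambda>X m. topspace X" "\<lambda>X n \<theta> x. x" "\<lambda>f m. Fn f" top_exp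
  "\<lambda>B X m w b. map_decode B X w b" top_sub "\<lambda>\<nu>. discrete_topology {Simplex \<nu>}" "\<lambda>m. blunt" "\<lambda>m w. w = on"
  "{blunt, sierpinski}" generator inclusions
proof
  fix X B :: "'u element topology" assume B: "B \<in> Obj TT" and X: "X \<in> Obj TT"
  show E: "top_exp B X \<in> Obj TT" by (rule top_exp_obj[OF B X])
  show "top.hm (Prod TT (top_exp B X) B) X (\<lambda>m p. map_decode B X (pfst p) (psnd p))"
    unfolding top_hm top_prod using top_product_obj[OF E B] X eval_continuous[OF B X] by blast
  show "w = w'" if w: "w \<in> topspace (top_exp B X)" "w' \<in> topspace (top_exp B X)"
    and e: "\<And>l \<theta> b. \<theta> \<in> operators l m ==> b \<in> topspace B ==> map_decode B X w b = map_decode B X w' b" for w w' m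
  proof -
    obtain f f' where f: "f \<in> map_set B X" "w = map_code B X f" and f': "f' \<in> map_set B X" "w' = map_code B X f'"
      using w unfolding topspace_top_exp[OF B X] by blast
    have "f b = f' b" if "b \<in> topspace B" for b
      using e[OF operator_id that] unfolding f(2) f'(2) map_decode_code[OF B X f(1)] map_decode_code[OF B X f'(1)] .
    then have "f = f'" by (intro extensionalityI[of f "topspace B"]) (use f f' in \<open>auto simp: map_set_def\<close>)
    then show "w = w'" using f f' by simp
  qed
next
  fix V B X :: "'u element topology" and \<beta>
  assume V: "V \<in> Obj TT" and B: "B \<in> Obj TT" and X: "X \<in> Obj TT"
    and \<beta>: "top.hm (Prod TT V B) X (\<lambda>m p. \<beta> m (pfst p) (psnd p))"
  note P = top_prod
  have c: "continuous_map (top_product V B) X (\<lambda>p. \<beta> 0 (pfst p) (psnd p))" using \<beta> unfolding top_hm P by blast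
  have \<beta>0: "\<beta> m a b = \<beta> 0 a b" if "a \<in> topspace V" "b \<in> topspace B" for m a b
  proof -
    have "Pair a b \<in> topspace (top_product V B)" using that by simp
    then have "\<beta> m (pfst (Pair a b)) (psnd (Pair a b)) = \<beta> 0 (pfst (Pair a b)) (psnd (Pair a b))"
      using \<beta> unfolding top_hm P by blast
    then show ?thesis by simp
  qed
  note t = transpose_continuous[OF B X V c]
  show "\<exists>\<psi>. top.hm V (top_exp B X) \<psi> \<and>
      (\<forall>m. \<forall>a\<in>topspace V. \<forall>b\<in>topspace B. map_decode B X (\<psi> m a) b = \<beta> m a b)"
  proof (intro exI conjI allI ballI)
    show "top.hm V (top_exp B X) (\<lambda>m a. map_code B X (\<lambda>b\<in>topspace B. \<beta> 0 (pfst (Pair a b)) (psnd (Pair a b))))"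
      unfolding top_hm using V top_exp_obj[OF B X] t(2) by blast
    show "map_decode B X (map_code B X (\<lambda>b\<in>topspace B. \<beta> 0 (pfst (Pair a b)) (psnd (Pair a b)))) b = \<beta> m a b"
      if "a \<in> topspace V" "b \<in> topspace B" for m a b
      using map_decode_code[OF B X t(1)[OF that(1)]] that(2) \<beta>0[OF that, of m] by simp
  qed
next
  fix X :: "'u element topology" and A assume X: "X \<in> Obj TT" and A: "top.closed_sub X A"
  note A0 = top_closed_sub[OF A]
  have ts: "topspace (top_sub X A) = A 0" using A0(2) by (auto simp: top_sub_def)
  have "small TYPE('u) (A 0)" using X A0(2) small_subset[of "TYPE('u)" "topspace X" "A 0"] by (simp add: top_obj)
  then show obj: "top_sub X A \<in> Obj TT" unfolding top_obj ts by (simp only: top_sub_def kify_generated simp_thms)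
  show "topspace (top_sub X A) = A m" for m unfolding ts by (rule A0(1)[symmetric])
  have "continuous_map (top_sub X A) X (\<lambda>x. x)"
    unfolding top_sub_def by (rule continuous_map_into_fulltopology[OF kify_to])
  then show "top.hm (top_sub X A) X (\<lambda>m x. x)" unfolding top_hm using obj X by simp
  fix W \<phi> assume \<phi>: "top.hm W X \<phi>" and img: "\<And>m w. w \<in> topspace W ==> \<phi> m w \<in> A m"
  have W: "W \<in> Obj TT" "continuous_map W X (\<phi> 0)" "\<And>m x. x \<in> topspace W ==> \<phi> m x = \<phi> 0 x"
    using \<phi> unfolding top_hm by blast+
  have "continuous_map W (subtopology X (A 0)) (\<phi> 0)"
    unfolding continuous_map_in_subtopology using W(2) img by blast
  then have "continuous_map W (top_sub X A) (\<phi> 0)"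
    unfolding top_sub_def using W(1) by (intro into_kify) (simp_all add: top_obj)
  then show "top.hm W (top_sub X A) \<phi>" unfolding top_hm using W obj by blast
next
  fix \<nu>
  show "discrete_topology {Simplex \<nu> :: 'u element} \<in> Obj TT" by (rule discrete_obj)
  show "topspace (discrete_topology {Simplex \<nu> :: 'u element}) = {Simplex \<nu>}" by simp
next
  show "blunt \<in> Obj TT" by (rule two_point_obj)
  show "\<exists>\<phi>. top.hm X blunt \<phi> \<and> (\<forall>x\<in>topspace X. \<phi> m x = on \<longleftrightarrow> x \<in> P)"
    if "X \<in> Obj TT" for X m P using top_classify[OF that] .
  show "\<phi> l x = \<psi> l x" if h: "top.hm X blunt \<phi>" "top.hm X blunt \<psi>"
    and e: "\<And>x. x \<in> topspace X ==> \<phi> m x = on \<longleftrightarrow> \<psi> m x = on" and x: "x \<in> topspace X" for X m \<phi> \<psi> x l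
  proof -
    have "\<phi> l x = \<phi> m x" "\<psi> l x = \<psi> m x" using h x unfolding top_hm by metis+
    moreover have "\<phi> m x \<in> {on, off}" "\<psi> m x \<in> {on, off}"
      using top.hm_pts[OF h(1) x, of m] top.hm_pts[OF h(2) x, of m] by simp_all
    ultimately show ?thesis using e[OF x] by auto
  qed
  show "Z \<in> {blunt, sierpinski} ==> Z \<in> Obj TT" for Z using two_point_obj by blast
next
  fix f :: "('u element topology, 'u element => 'u element) arrow"
  assume f: "f \<in> Mor TT" and ext: "\<And>Z. Z \<in> {blunt, sierpinski} ==> extends TT Z f"
  have F: "Dom f \<in> Obj TT" "Cod f \<in> Obj TT" using f top_mor by blast+
  have extend: "\<exists>w. continuous_map (Cod f) Z w \<and> (\<forall>x \<in> topspace (Dom f). w (Fn f x) = v x)"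
    if Z: "Z \<in> {blunt, sierpinski}" and v: "continuous_map (Dom f) Z v" for Z v
  proof -
    have Zo: "Z \<in> Obj TT" using Z two_point_obj by blast
    let ?v = "Arrow (Dom f) (restrict v (topspace (Dom f))) Z"
    have "?v \<in> Hom TT (Dom f) Z" using top_Arrow_mor[OF F(1) Zo v] by (simp add: Hom_def)
    then obtain w where w: "w \<in> Hom TT (Cod f) Z" "w \<cdot>\<^bsub>TT\<^esub> f = ?v"
      using ext[OF Z] unfolding extends_def by blast
    have w': "w \<in> Mor TT" "Dom w = Cod f" "Cod w = Z" using w(1) by (auto simp: Hom_def)
    have "Fn w (Fn f x) = v x" if "x \<in> topspace (Dom f)" for x
      using arg_cong[OF w(2), of "\<lambda>h. Fn h x"] that w'(2) by simp
    moreover have "continuous_map (Cod f) Z (Fn w)" using w' by (simp add: top_mor)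
    ultimately show ?thesis by blast
  qed
  show inj: "inj_on (Fn f) (topspace (Dom f))"
  proof (rule inj_onI)
    fix x y assume x: "x \<in> topspace (Dom f)" and y: "y \<in> topspace (Dom f)" and eq: "Fn f x = Fn f y"
    let ?v = "\<lambda>z. if z = x then on else off"
    have "continuous_map (Dom f) blunt ?v" by (rule into_blunt[OF F(1)]) simp
    then obtain w where "\<forall>z \<in> topspace (Dom f). w (Fn f z) = ?v z" using extend by blast
    then have "?v x = ?v y" using x y eq by metis
    then show "x = y" by (simp split: if_splits)
  qed
  fix h :: "('u element topology, 'u element => 'u element) arrow"
  assume h: "h \<in> Mor TT" and hf: "Cod h = Cod f"
    and img: "\<And>m x. x \<in> topspace (Dom h) ==> Fn h x \<in> Fn f ` topspace (Dom f)"
  have H: "Dom h \<in> Obj TT" "continuous_map (Dom h) (Cod f) (Fn h)" using h hf by (auto simp: top_mor)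
  let ?k = "\<lambda>x. inv_into (topspace (Dom f)) (Fn f) (Fn h x)"
  have k: "?k x \<in> topspace (Dom f)" "Fn f (?k x) = Fn h x" if "x \<in> topspace (Dom h)" for x
    using img[OF that] by (simp_all add: inv_into_into f_inv_into_f)
  have "continuous_map (Dom h) (Dom f) ?k"
    unfolding continuous_map_def
  proof (intro conjI allI impI)
    show "?k \<in> topspace (Dom h) \<rightarrow> topspace (Dom f)" using k(1) by blast
    fix U assume U: "openin (Dom f) U"
    then obtain w where w: "continuous_map (Cod f) sierpinski w"
      "\<forall>x \<in> topspace (Dom f). w (Fn f x) = (if x \<in> U then on else off)"
      using extend[OF _ into_sierpinski[OF F(1) U]] by blast
    have "openin (Dom h) {x \<in> topspace (Dom h). (w \<circ> Fn h) x = on}"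
      by (rule sierpinski_open[OF continuous_map_compose[OF H(2) w(1)]])
    moreover have "(w \<circ> Fn h) x = on \<longleftrightarrow> ?k x \<in> U" if "x \<in> topspace (Dom h)" for x
      using bspec[OF w(2) k(1)[OF that]] k(2)[OF that] by (simp split: if_splits)
    then have "{x \<in> topspace (Dom h). (w \<circ> Fn h) x = on} = {x \<in> topspace (Dom h). ?k x \<in> U}" by blast
    ultimately show "openin (Dom h) {x \<in> topspace (Dom h). ?k x \<in> U}" by (simp only:)
  qed
  then have K: "Arrow (Dom h) (\<lambda>x\<in>topspace (Dom h). ?k x) (Dom f) \<in> Mor TT" (is "?K \<in> _")
    by (rule top_Arrow_mor[OF H(1) F(1)])
  have "f \<cdot>\<^bsub>TT\<^esub> ?K = h"
  proof (rule top_ext)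
    show "f \<cdot>\<^bsub>TT\<^esub> ?K \<in> Hom TT (Dom h) (Cod f)" using K f by (intro top_homI) simp_all
    show "h \<in> Hom TT (Dom h) (Cod f)" using h hf by (intro top_homI) simp_all
    fix x assume x: "x \<in> topspace (Dom h)"
    show "Fn (f \<cdot>\<^bsub>TT\<^esub> ?K) x = Fn h x" using x k(2)[OF x] by simp
  qed
  moreover have "?K \<in> Hom TT (Dom h) (Dom f)" using K by (intro top_homI) simp_all
  ultimately show "\<exists>k\<in>Hom TT (Dom h) (Dom f). f \<cdot>\<^bsub>TT\<^esub> k = h" by blast
next
  fix \<nu> assume \<nu>: "\<nu> \<in> inclusions"
  let ?K = "Rlz TT (Dom (generator \<nu>))" and ?L = "Rlz TT (Cod (generator \<nu>))" and ?i = "RlzMap TT (generator \<nu>)"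
  note g = top_generator[OF \<nu>]
  show "?i \<in> Hom TT ?K ?L" by (rule g)
  show "topspace ?L \<noteq> {}" by (rule g)
  show "|SIGMA m : (UNIV :: nat set). topspace ?K| \<le>o |UNIV :: (nat \<times> nat list \<times> (nat => real)) set|"
    by (rule g)
  fix X Z :: "'u element topology" assume X: "X \<in> Obj TT" and Z: "Z \<in> {blunt, sierpinski}"
  have i: "?i \<in> Mor TT" "Dom ?i = ?K" "Cod ?i = ?L" "continuous_map ?K ?L (Fn ?i)"
    using g(4) by (auto simp: Hom_def top_mor)
  have K: "?K \<in> Obj TT" using i(1,2) top_mor by metis
  let ?f = "Tuple TT (Pr1 TT X ?K) (?i \<cdot>\<^bsub>TT\<^esub> Pr2 TT X ?K)"
  have ip: "?i \<cdot>\<^bsub>TT\<^esub> Pr2 TT X ?K \<in> Mor TT"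
    by (rule top.cmp_S(1)[OF top.pr2_S(1)[OF X K] i(1)]) (simp add: i(2))
  have f: "?f \<in> Mor TT" by (rule top.tuple_S(1)[OF top.pr1_S(1)[OF X K] ip]) simp
  have df: "Dom ?f = top_product X ?K" "Cod ?f = top_product X ?L" by (simp_all add: top_prod i(3))
  have ff: "Fn ?f p = Pair (pfst p) (Fn ?i (psnd p))" if p: "p \<in> topspace (top_product X ?K)" for p
  proof -
    obtain x k where xk: "p = Pair x k" "x \<in> topspace X" "k \<in> topspace ?K" using p unfolding topspace_top_product by blast
    then show ?thesis by simp
  qed
  have inj: "inj_on (Fn ?f) (topspace (Dom ?f))"
  proof (rule inj_onI)
    fix p q assume p: "p \<in> topspace (Dom ?f)" and q: "q \<in> topspace (Dom ?f)" and eq: "Fn ?f p = Fn ?f q"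
    obtain x k where p': "p = Pair x k" "k \<in> topspace ?K" using p unfolding df by auto
    obtain y l where q': "q = Pair y l" "l \<in> topspace ?K" using q unfolding df by auto
    have "x = y" "Fn ?i k = Fn ?i l" using eq p q unfolding df by (simp_all add: ff p' q')
    then show "p = q" using inj_onD[OF g(5) _ p'(2) q'(2)] p' q' by simp
  qed
  have closed: "closedin (Cod ?f) (Fn ?f ` C)" if C: "closedin (Dom ?f) C" for C
  proof -
    have "Fn ?f ` C = (\<lambda>p. Pair (pfst p) (Fn ?i (psnd p))) ` C"
      using closedin_subset[OF C] unfolding df by (intro image_cong refl ff) blast
    then show ?thesis using product_closed[OF X g(1,2) i(4) g(5) C[unfolded df]] unfolding df by simp
  qed
  show "extends TT Z ?f"
    using Z blunt_extends[OF f inj] sierpinski_extends[OF f inj closed] by blast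
qed

end

lemma I_maps_generators:
  "I_maps S D = {tensor_map S D T (generator \<nu>) | T \<nu>. orbit S D T \<and> \<nu> \<in> {[n] | n. True}}"
proof -
  have "generator [n] = inclusion (boundary n) (Delta n)" for n by (simp add: generator_def)
  then show ?thesis unfolding I_maps_def by (auto; metis)
qed

lemma J_maps_generators:
  "J_maps S D = {tensor_map S D T (generator \<nu>) | T \<nu>. orbit S D T \<and> \<nu> \<in> {[n, k] | n k. k \<le> n \<and> 1 \<le> n}}"
proof -
  have "generator [n, k] = inclusion (horn n k) (Delta n)" for n k by (simp add: generator_def)
  then show ?thesis unfolding J_maps_def by (auto; metis)
qed

theorem theorem3p5:
  fixes D :: "('d, 'u element sset, nat \<Rightarrow> 'u element \<Rightarrow> 'u element) enriched"
    and E :: "('e, 'u element topology, 'u element \<Rightarrow> 'u element) enriched"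
  assumes "inaccessible TYPE('u)"
  shows "(enriched_category SSet D \<and> small TYPE('u) (Ob D) \<longrightarrow>
            instrumented TYPE('u) (Diagrams SSet D) (I_maps SSet D) \<and>
            instrumented TYPE('u) (Diagrams SSet D) (J_maps SSet D)) \<and>
         (enriched_category CGTop E \<and> small TYPE('u) (Ob E) \<longrightarrow>
            instrumented TYPE('u) (Diagrams CGTop E) (I_maps CGTop E) \<and>
            instrumented TYPE('u) (Diagrams CGTop E) (J_maps CGTop E))"
proof (intro conjI impI)
  interpret inaccessible_universe "TYPE('u)" by unfold_locales (rule assms)
  let ?I = "{[n] | n :: nat. True}" and ?J = "{[n, k] | n k :: nat. k \<le> n \<and> 1 \<le> n}"
  have sub: "?I \<subseteq> inclusions" "?J \<subseteq> inclusions" by (auto simp: inclusions_def)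
  {
    assume D: "enriched_category SSet D \<and> small TYPE('u) (Ob D)"
    interpret model_diagrams SSet Smp Op Fn sset_exp sset_eval sset_sub sset_tag sset_classifier sset_true
      "range sset_classifier" generator inclusions D
      by unfold_locales (use D in auto)
    show "instrumented TYPE('u) (Diagrams SSet D) (I_maps SSet D)"
      unfolding I_maps_generators by (rule instrumented_tensor_maps[OF sub(1)])
    show "instrumented TYPE('u) (Diagrams SSet D) (J_maps SSet D)"
      unfolding J_maps_generators by (rule instrumented_tensor_maps[OF sub(2)])
  }
  {
    assume E: "enriched_category CGTop E \<and> small TYPE('u) (Ob E)"
    interpret model_diagrams CGTop "\<lambda>X m. topspace X" "\<lambda>X n \<theta> x. x" "\<lambda>f m. Fn f" top_exp
      "\<lambda>B X m w b. map_decode B X w b" top_sub "\<lambda>\<nu>. discrete_topology {Simplex \<nu>}" "\<lambda>m. blunt" "\<lambda>m w. w = on"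
      "{blunt, sierpinski}" generator inclusions E
      by unfold_locales (use E in auto)
    show "instrumented TYPE('u) (Diagrams CGTop E) (I_maps CGTop E)"
      unfolding I_maps_generators by (rule instrumented_tensor_maps[OF sub(1)])
    show "instrumented TYPE('u) (Diagrams CGTop E) (J_maps CGTop E)"
      unfolding J_maps_generators by (rule instrumented_tensor_maps[OF sub(2)])
  }
qed

end
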